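(* Let $\delta$ be a divisorial semidegree on $\mathbb{C}[x,y]$ with $\delta(x)>0$, let $g_0,\ldots,g_{n+1}$ be the corresponding key forms, let $\alpha(\delta)$ be the skewness of $\delta$, and let $d_\delta:=\max\{\delta(x),\delta(y)\}$. Consider the identity $$( * )\qquad \alpha(\delta)=\inf\left\{\frac{\delta(f)}{d_\delta\deg(f)}: f \text{ is a non-constant polynomial in } \mathbb{C}[x,y]\right\}.$$ Then $( * )$ holds if and only if one of the following is true: (1) $\delta(g_{n+1})\ge 0$; (2) $\delta(g_{n+1})<0$ and $g_k\in\mathbb{C}[x,y]$ for all $k$, $0\le k\le n+1$. Here condition (2) may be replaced by (2$'$) $\delta(g_{n+1})<0$ and $g_{n+1}\in\mathbb{C}[x,y]$. Moreover, the "$\inf$" in the right-hand side of $( * )$ can be replaced by "$\min$" (i.e. $( * )$ holds and the infimum is attained) if and only if $g_{n+1}\in\mathbb{C}[x,y]$, if and only if $g_k\in\mathbb{C}[x,y]$ for all $k$, $0\le k\le n+1$; in this case the minimum is achieved with $f=g_{n+1}$.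
   Context: A discrete valuation on $\mathbb{C}(x,y)$ is a map $\nu:\mathbb{C}(x,y)\setminus\{0\}\to\mathbb{Z}$ with $\nu(f+g)\ge\min\{\nu(f),\nu(g)\}$ and $\nu(fg)=\nu(f)+\nu(g)$. Embed $\mathbb{C}^2$ (with polynomial coordinates $(x,y)$) into $\mathbb{P}^2$ by $(x,y)\mapsto[1:x:y]$, and let $L:=\mathbb{P}^2\setminus\mathbb{C}^2$ be the line at infinity. The valuation $\nu$ is *divisorial* if there are a normal algebraic surface $Y_\nu$, a birational map $\sigma:Y_\nu\to\mathbb{P}^2$ and an (irreducible) curve $C_\nu$ on $Y_\nu$ such that for all non-zero $f\in\mathbb{C}[x,y]$, $\nu(f)$ is the order of vanishing of $\sigma^*(f)$ along $C_\nu$. The center of $\nu$ on $\mathbb{P}^2$ is $\sigma(C_\nu)$; $\nu$ is *centered at infinity* if its center is contained in $L$; equivalently, $\nu(f)<0$ for some non-zero $f\in\mathbb{C}[x,y]$. A *divisorial semidegree* is a map $\delta:\mathbb{C}(x,y)\setminus\{0\}\to\mathbb{Z}$ such that $-\delta$ is a divisorial discrete valuation; a divisorial semidegree on $\mathbb{C}[x,y]$ is one for which $-\delta$ is in addition centered at infinity. $\deg$ is the usual degree in $(x,y)$-coordinates. *Skewness* (in the sense of Favre–Jonsson, extended to semidegrees). $\alpha(\delta)$ is the skewness of the normalized valuation $\nu:=-\delta/d_\delta$ (so that $\min\{\nu(x),\nu(y)\}=-1$). Explicitly: if $\delta=\deg$ then $\alpha(\delta)=1$. Otherwise the center of $\nu$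 on $\mathbb{P}^2$ is a point $p\in L$; a local equation $u$ of $L$ at $p$ satisfies $\nu(u)=1$, and $$\alpha(\delta)=1-\sup_{\varphi}\frac{\nu(\varphi)}{(\varphi\cdot L)_p},$$ where $\varphi$ ranges over irreducible elements of the completed local ring $\widehat{\mathcal{O}}_{\mathbb{P}^2,p}$ in its maximal ideal that are not associate to $u$, $\nu$ is extended by continuity, and $(\varphi\cdot L)_p=\dim_{\mathbb{C}}\widehat{\mathcal{O}}_{\mathbb{P}^2,p}/(\varphi,u)$ is the local intersection multiplicity. *Key forms.* Let $\delta$ be a divisorial semidegree on $\mathbb{C}[x,y]$ with $\delta(x)>0$. A finite sequence $g_0,g_1,\ldots,g_{n+1}\in\mathbb{C}[x,x^{-1},y]$ is the sequence of key forms of $\delta$ if the following hold (there is a unique such sequence): (P0) $g_0=x$, $g_1=y$. (P1) Let $\omega_j:=\delta(g_j)$, $0\le j\le n+1$. Then $\omega_{j+1}<\alpha_j\omega_j=\sum_{i=0}^{j-1}\beta_{j,i}\omega_i$ for $1\le j\le n$, where $\alpha_j=\min\{\alpha\in\mathbb{Z}_{>0}:\alpha\omega_j\in\mathbb{Z}\omega_0+\cdots+\mathbb{Z}\omega_{j-1}\}$ for $1\le j\le n$, and the $\beta_{j,i}$ are integers with $0\le\beta_{j,i}<\alpha_i$ for $1\le i<j\le n$ (the $\beta_{j,0}$ are allowed to be negative). (P2) For $1\le j\le n$ there is $\theta_j\in\mathbb{C}^*$ such that $g_{j+1}=g_j^{\alpha_j}-\theta_j\,g_0^{\beta_{j,0}}\cdots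 g_{j-1}^{\beta_{j,j-1}}$. (P3) Let $y_1,\ldots,y_{n+1}$ be indeterminates and let $\omega$ be the weighted degree on $B:=\mathbb{C}[x,x^{-1},y_1,\ldots,y_{n+1}]$ with weight $\omega_0$ for $x$ and $\omega_j$ for $y_j$, $1\le j\le n+1$ (the value of $\omega$ on an element is the maximum weight of its monomials). Then for every non-zero $g\in\mathbb{C}[x,x^{-1},y]$, $\delta(g)=\min\{\omega(G):G\in B,\ G(x,g_1,\ldots,g_{n+1})=g\}$.
   Formalization: When n = 0 and δ(x) < δ(y) (e.g. the weighted degree with weights 2 and 3), g_{n+1} = y never attains the infimum, so in that case alone the last clause states that the minimum is achieved with f = g_0 = x instead of f = g_{n+1}. *)

theory Defs
  imports
    Complex_Main
    "HOL-Library.Extended_Real"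
    "HOL-Library.Poly_Mapping"
    "HOL-Computational_Algebra.Computational_Algebra"
begin

section \<open>Polynomials and rational functions in two variables\<close>

text \<open>C[x,y] is modelled as C[x][y]: the inner variable is x, the outer variable is y.\<close>

type_synonym poly2 = "complex poly poly"
type_synonym ratfun = "complex poly poly fract"

definition cst :: "complex \<Rightarrow> ratfun" where
  "cst c = to_fract [:[:c:]:]"

definition X :: ratfun where
  "X = to_fract [:[:0, 1:]:]"

definition Y :: ratfun where
  "Y = to_fract [:0, 1:]"

definition polys :: "ratfun set" where
  "polys = range (to_fract :: poly2 \<Rightarrow> ratfun)"

text \<open>The subring C[x,1/x,y] of C(x,y).\<close>

definition laurent_polys :: "ratfun set" where
  "laurent_polys = {h. \<exists>m::nat. X ^ m * h \<in> polys}"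

text \<open>The degree in (x,y); only meaningful for nonzero arguments.\<close>

definition total_degree :: "poly2 \<Rightarrow> nat" where
  "total_degree f = Max {i + j | i j. coeff (coeff f j) i \<noteq> 0}"

definition nonconstant_polys :: "poly2 set" where
  "nonconstant_polys = - range (\<lambda>c. [:[:c:]:])"

text \<open>The substitution F(s,t).\<close>

definition subst2 :: "poly2 \<Rightarrow> ratfun \<Rightarrow> ratfun \<Rightarrow> ratfun" where
  "subst2 F s t = (\<Sum>j\<le>degree F. \<Sum>i\<le>degree (coeff F j). cst (coeff (coeff F j) i) * s ^ i * t ^ j)"


section \<open>Normal surfaces birational to the plane and orders of vanishing\<close>

text \<open>
  A birational map from a surface to the projective plane identifies the function field of the
  surface with C(x,y). The order of vanishing along an irreducible curve C can be computed on any
  affine open subset of the surface that meets C. Hence a normal surface, a birational map to the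
  plane and an irreducible curve on the surface are given by the coordinate ring A of such an
  affine open subset, embedded into C(x,y) by the birational map, together with the height one
  prime ideal P of C.
\<close>

inductive_set generated_algebra :: "ratfun set \<Rightarrow> ratfun set" for S where
  const: "cst c \<in> generated_algebra S"
| gen: "s \<in> S \<Longrightarrow> s \<in> generated_algebra S"
| add: "a \<in> generated_algebra S \<Longrightarrow> b \<in> generated_algebra S \<Longrightarrow> a + b \<in> generated_algebra S"
| mult: "a \<in> generated_algebra S \<Longrightarrow> b \<in> generated_algebra S \<Longrightarrow> a * b \<in> generated_algebra S"

definition normal_affine_model :: "ratfun set \<Rightarrow> bool" where
  "normal_affine_model A \<longleftrightarrow>
     (\<exists>S. finite S \<and> A = generated_algebra S) \<and>
     (\<forall>z. \<exists>a\<in>A. \<exists>b\<in>A. b \<noteq> 0 \<and> z = a / b) \<and>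
     (\<forall>z. (\<exists>p. lead_coeff p = 1 \<and> (\<forall>i. coeff p i \<in> A) \<and> poly p z = 0) \<longrightarrow> z \<in> A)"

definition prime_ideal_of :: "ratfun set \<Rightarrow> ratfun set \<Rightarrow> bool" where
  "prime_ideal_of A P \<longleftrightarrow>
     P \<subseteq> A \<and> 0 \<in> P \<and> 1 \<notin> P \<and>
     (\<forall>a\<in>P. \<forall>b\<in>P. a + b \<in> P) \<and>
     (\<forall>a\<in>A. \<forall>b\<in>P. a * b \<in> P) \<and>
     (\<forall>a\<in>A. \<forall>b\<in>A. a * b \<in> P \<longrightarrow> a \<in> P \<or> b \<in> P)"

definition height_one_prime :: "ratfun set \<Rightarrow> ratfun set \<Rightarrow> bool" where
  "height_one_prime A P \<longleftrightarrow>
     prime_ideal_of A P \<and> P \<noteq> {0} \<and>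
     (\<forall>Q. prime_ideal_of A Q \<and> Q \<subseteq> P \<longrightarrow> Q = {0} \<or> Q = P)"

definition localization_at :: "ratfun set \<Rightarrow> ratfun set \<Rightarrow> ratfun set" where
  "localization_at A P = {a / s | a s. a \<in> A \<and> s \<in> A - P}"

definition uniformizer_at :: "ratfun set \<Rightarrow> ratfun set \<Rightarrow> ratfun \<Rightarrow> bool" where
  "uniformizer_at A P t \<longleftrightarrow>
     {a / s | a s. a \<in> P \<and> s \<in> A - P} = {t * h | h. h \<in> localization_at A P}"

text \<open>
  If A is normal and P has height one, then the localization of A at P is a discrete valuation
  ring, and the order of vanishing of a nonzero f along the curve of P is the exponent of a
  uniformizer in f.
\<close>

definition has_vanishing_order :: "ratfun set \<Rightarrow> ratfun set \<Rightarrow> ratfun \<Rightarrow> int \<Rightarrow> bool" where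
  "has_vanishing_order A P f k \<longleftrightarrow>
     (\<exists>t w. uniformizer_at A P t \<and> w \<noteq> 0 \<and>
            w \<in> localization_at A P \<and> inverse w \<in> localization_at A P \<and> f = t powi k * w)"


section \<open>Divisorial valuations and semidegrees\<close>

text \<open>Valuations and semidegrees are total functions; their value at 0 is irrelevant.\<close>

definition discrete_valuation :: "(ratfun \<Rightarrow> int) \<Rightarrow> bool" where
  "discrete_valuation \<nu> \<longleftrightarrow>
     (\<forall>f g. f \<noteq> 0 \<and> g \<noteq> 0 \<and> f + g \<noteq> 0 \<longrightarrow> \<nu> (f + g) \<ge> min (\<nu> f) (\<nu> g)) \<and>
     (\<forall>f g. f \<noteq> 0 \<and> g \<noteq> 0 \<longrightarrow> \<nu> (f * g) = \<nu> f + \<nu> g)"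

definition divisorial_valuation :: "(ratfun \<Rightarrow> int) \<Rightarrow> bool" where
  "divisorial_valuation \<nu> \<longleftrightarrow>
     discrete_valuation \<nu> \<and>
     (\<exists>A P. normal_affine_model A \<and> height_one_prime A P \<and>
            (\<forall>f::poly2. f \<noteq> 0 \<longrightarrow> has_vanishing_order A P (to_fract f) (\<nu> (to_fract f))))"

text \<open>
  The closed points of the projective plane: Finite_Point a b is [1:a:b], Infinite_Point c is
  [0:1:c], and Vertical_Point is [0:0:1].
\<close>

datatype proj_plane = Finite_Point complex complex | Infinite_Point complex | Vertical_Point

definition line_at_infinity :: "proj_plane set" where
  "line_at_infinity = range Infinite_Point \<union> {Vertical_Point}"

text \<open>
  Affine coordinates centered at a point, in the standard charts of the projective plane. At the
  points of the line at infinity, the first coordinate is a local equation of this line.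
\<close>

fun local_coords :: "proj_plane \<Rightarrow> ratfun \<times> ratfun" where
  "local_coords (Finite_Point a b) = (X - cst a, Y - cst b)"
| "local_coords (Infinite_Point c) = (1 / X, Y / X - cst c)"
| "local_coords Vertical_Point = (1 / Y, X / Y)"

definition local_ring :: "proj_plane \<Rightarrow> ratfun set" where
  "local_ring p =
     {subst2 F (fst (local_coords p)) (snd (local_coords p)) /
      subst2 G (fst (local_coords p)) (snd (local_coords p)) | F G. coeff (coeff G 0) 0 \<noteq> 0}"

text \<open>
  The center of a divisorial valuation is the image of its curve. A closed point p lies on it iff
  the functions regular at p are regular at the generic point of the curve.
\<close>

definition center :: "(ratfun \<Rightarrow> int) \<Rightarrow> proj_plane set" where
  "center \<nu> = {p. \<forall>f\<in>local_ring p. f \<noteq> 0 \<longrightarrow> \<nu> f \<ge> 0}"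

definition divisorial_semidegree_on_polys :: "(ratfun \<Rightarrow> int) \<Rightarrow> bool" where
  "divisorial_semidegree_on_polys \<delta> \<longleftrightarrow>
     divisorial_valuation (\<lambda>h. - \<delta> h) \<and> center (\<lambda>h. - \<delta> h) \<subseteq> line_at_infinity"

definition dmax :: "(ratfun \<Rightarrow> int) \<Rightarrow> int" where
  "dmax \<delta> = max (\<delta> X) (\<delta> Y)"


section \<open>Skewness\<close>

text \<open>
  The completed local ring of the plane at p is the ring of formal power series in the local
  coordinates u, v at p: the coefficient of u^i v^j in \<phi> is \<phi> $ j $ i.
\<close>

type_synonym completed_ring = "complex fps fps"

definition u_coord :: completed_ring where
  "u_coord = fps_const fps_X"

definition jet :: "proj_plane \<Rightarrow> nat \<Rightarrow> completed_ring \<Rightarrow> ratfun" where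
  "jet p N \<phi> = (\<Sum>(i, j)\<in>{(i, j). i + j < N}.
     cst (\<phi> $ j $ i) * fst (local_coords p) ^ i * snd (local_coords p) ^ j)"

text \<open>The normalized valuation \<open>-\<delta>/d\<^sub>\<delta>\<close> and its extension by continuity to the completed ring.\<close>

definition normalized_val :: "(ratfun \<Rightarrow> int) \<Rightarrow> ratfun \<Rightarrow> ereal" where
  "normalized_val \<delta> h =
     (if h = 0 then \<infinity> else ereal (- real_of_int (\<delta> h) / real_of_int (dmax \<delta>)))"

definition completed_val :: "(ratfun \<Rightarrow> int) \<Rightarrow> proj_plane \<Rightarrow> completed_ring \<Rightarrow> ereal" where
  "completed_val \<delta> p \<phi> = lim (\<lambda>N. normalized_val \<delta> (jet p N \<phi>))"

text \<open>B is finite and its image in the quotient by I is a basis over C.\<close>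

definition finite_basis_mod :: "completed_ring set \<Rightarrow> completed_ring set \<Rightarrow> bool" where
  "finite_basis_mod I B \<longleftrightarrow> finite B \<and>
     (\<forall>f. \<exists>!c::completed_ring \<Rightarrow> complex.
        (\<forall>b. b \<notin> B \<longrightarrow> c b = 0) \<and> f - (\<Sum>b\<in>B. fps_const (fps_const (c b)) * b) \<in> I)"

definition intersection_with_L :: "completed_ring \<Rightarrow> nat" where
  "intersection_with_L \<phi> =
     (THE m. \<exists>B. card B = m \<and> finite_basis_mod {a * \<phi> + b * u_coord | a b. True} B)"

definition skewness_branches :: "completed_ring set" where
  "skewness_branches =
     {\<phi>. irreducible \<phi> \<and> \<phi> $ 0 $ 0 = 0 \<and> \<not> (\<phi> dvd u_coord \<and> u_coord dvd \<phi>)}"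

definition is_degree :: "(ratfun \<Rightarrow> int) \<Rightarrow> bool" where
  "is_degree \<delta> \<longleftrightarrow> (\<forall>f::poly2. f \<noteq> 0 \<longrightarrow> \<delta> (to_fract f) = int (total_degree f))"

definition skewness :: "(ratfun \<Rightarrow> int) \<Rightarrow> ereal" where
  "skewness \<delta> =
     (if is_degree \<delta> then 1
      else let p = (THE p. center (\<lambda>h. - \<delta> h) = {p}) in
        1 - (SUP \<phi>\<in>skewness_branches.
               completed_val \<delta> p \<phi> / ereal (real (intersection_with_L \<phi>))))"


section \<open>Key forms\<close>

definition key_alpha :: "(nat \<Rightarrow> int) \<Rightarrow> nat \<Rightarrow> nat" where
  "key_alpha \<omega> j =
     (LEAST a. a > 0 \<and> (\<exists>m::nat \<Rightarrow> int. int a * \<omega> j = (\<Sum>i<j. m i * \<omega> i)))"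

text \<open>
  Elements of C[x,1/x,y_1,...,y_(n+1)] map exponent vectors to coefficients; index 0 stands for x
  and index j for y_j.
\<close>

definition mixed_laurent :: "nat \<Rightarrow> ((nat \<Rightarrow>\<^sub>0 int) \<Rightarrow>\<^sub>0 complex) set" where
  "mixed_laurent n =
     {G. \<forall>e\<in>Poly_Mapping.keys G. (\<forall>j\<ge>1. Poly_Mapping.lookup e j \<ge> 0) \<and> (\<forall>j>n+1. Poly_Mapping.lookup e j = 0)}"

definition weighted_degree :: "(nat \<Rightarrow> int) \<Rightarrow> nat \<Rightarrow> ((nat \<Rightarrow>\<^sub>0 int) \<Rightarrow>\<^sub>0 complex) \<Rightarrow> int" where
  "weighted_degree \<omega> n G = Max ((\<lambda>e. \<Sum>j\<le>n+1. Poly_Mapping.lookup e j * \<omega> j) ` Poly_Mapping.keys G)"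

definition eval_at :: "(nat \<Rightarrow> ratfun) \<Rightarrow> nat \<Rightarrow> ((nat \<Rightarrow>\<^sub>0 int) \<Rightarrow>\<^sub>0 complex) \<Rightarrow> ratfun" where
  "eval_at g n G = (\<Sum>e\<in>Poly_Mapping.keys G. cst (Poly_Mapping.lookup G e) * (\<Prod>j\<le>n+1. g j powi Poly_Mapping.lookup e j))"

definition key_forms :: "(ratfun \<Rightarrow> int) \<Rightarrow> nat \<Rightarrow> (nat \<Rightarrow> ratfun) \<Rightarrow> bool" where
  "key_forms \<delta> n g \<longleftrightarrow>
     (let \<omega> = (\<lambda>j. \<delta> (g j)); \<alpha> = key_alpha \<omega> in
       (\<forall>j\<le>n+1. g j \<in> laurent_polys) \<and>
       g 0 = X \<and> g 1 = Y \<and>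
       (\<exists>(\<beta> :: nat \<Rightarrow> nat \<Rightarrow> int) (\<theta> :: nat \<Rightarrow> complex). \<forall>j\<in>{1..n}.
          \<omega> (j + 1) < int (\<alpha> j) * \<omega> j \<and>
          int (\<alpha> j) * \<omega> j = (\<Sum>i<j. \<beta> j i * \<omega> i) \<and>
          (\<forall>i. 1 \<le> i \<and> i < j \<longrightarrow> 0 \<le> \<beta> j i \<and> \<beta> j i < int (\<alpha> i)) \<and>
          \<theta> j \<noteq> 0 \<and>
          g (j + 1) = g j ^ \<alpha> j - cst (\<theta> j) * (\<Prod>i<j. g i powi \<beta> j i)) \<and>
       (\<forall>h\<in>laurent_polys. h \<noteq> 0 \<longrightarrow>
          (\<exists>G\<in>mixed_laurent n. eval_at g n G = h \<and> weighted_degree \<omega> n G = \<delta> h) \<and>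
          (\<forall>G\<in>mixed_laurent n. eval_at g n G = h \<longrightarrow> \<delta> h \<le> weighted_degree \<omega> n G)))"


section \<open>The identity for the skewness\<close>

definition slope :: "(ratfun \<Rightarrow> int) \<Rightarrow> poly2 \<Rightarrow> ereal" where
  "slope \<delta> f =
     ereal (real_of_int (\<delta> (to_fract f)) / (real_of_int (dmax \<delta>) * real (total_degree f)))"

definition skewness_is_inf :: "(ratfun \<Rightarrow> int) \<Rightarrow> bool" where
  "skewness_is_inf \<delta> \<longleftrightarrow> skewness \<delta> = (INF f\<in>nonconstant_polys. slope \<delta> f)"

definition inf_attained_at :: "(ratfun \<Rightarrow> int) \<Rightarrow> ratfun \<Rightarrow> bool" where
  "inf_attained_at \<delta> h \<longleftrightarrow>
     (\<exists>f\<in>nonconstant_polys. to_fract f = h \<and> slope \<delta> f = (INF f'\<in>nonconstant_polys. slope \<delta> f'))"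

definition skewness_is_min :: "(ratfun \<Rightarrow> int) \<Rightarrow> bool" where
  "skewness_is_min \<delta> \<longleftrightarrow> skewness_is_inf \<delta> \<and> (\<exists>h. inf_attained_at \<delta> h)"

text \<open>
  If n = 0 and \<open>\<delta>(x) < \<delta>(y)\<close> (for example, if \<open>\<delta>\<close> is the weighted degree with weights 2 and 3),
  then the last key form is y, and the following fact shows that it does not attain the infimum.
  In this case the infimum is attained at \<open>g\<^sub>0 = x\<close> instead.
\<close>

lemma not_inf_attained_at_Y:
  assumes "0 < \<delta> X" "\<delta> X < \<delta> Y"
  shows "\<not> inf_attained_at \<delta> Y"
proof
  assume "inf_attained_at \<delta> Y"
  then obtain f where f: "to_fract f = Y"
      "slope \<delta> f = (INF f'\<in>nonconstant_polys. slope \<delta> f')"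
    by (auto simp: inf_attained_at_def)
  have fY: "f = [:0, 1:]"
    using f(1) by (simp add: Y_def)
  have degY: "total_degree [:0, 1:] = 1"
  proof -
    have "coeff (coeff ([:0, 1:] :: poly2) j) i \<noteq> 0 \<longleftrightarrow> j = 1 \<and> i = 0" for i j
      by (cases j; cases "j - 1"; cases i) auto
    then have "{i + j | i j. coeff (coeff ([:0, 1:] :: poly2) j) i \<noteq> 0} = {1}"
      by auto
    then show ?thesis by (simp add: total_degree_def)
  qed
  have degX: "total_degree [:[:0, 1:]:] = 1"
  proof -
    have "coeff (coeff ([:[:0, 1:]:] :: poly2) j) i \<noteq> 0 \<longleftrightarrow> j = 0 \<and> i = 1" for i j
      by (cases i; cases "i - 1"; cases j) auto
    then have "{i + j | i j. coeff (coeff ([:[:0, 1:]:] :: poly2) j) i \<noteq> 0} = {1}"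
      by auto
    then show ?thesis by (simp add: total_degree_def)
  qed
  have "slope \<delta> f = 1"
    using assms by (simp add: slope_def fY degY dmax_def one_ereal_def flip: Y_def)
  moreover have "slope \<delta> [:[:0, 1:]:] < 1"
    using assms by (simp add: slope_def degX dmax_def one_ereal_def flip: X_def)
  moreover have "[:[:0, 1:]:] \<in> nonconstant_polys"
    by (auto simp: nonconstant_polys_def)
  then have "(INF f'\<in>nonconstant_polys. slope \<delta> f') \<le> slope \<delta> [:[:0, 1:]:]"
    by (rule INF_lower)
  ultimately show False
    using f(2) by simp
qed

end

theory Submission
  imports Defs "HOL-Computational_Algebra.Field_as_Ring" "Jordan_Normal_Form.Char_Poly"
begin

hide_const (open) Module.smult

text \<open>
  In local coordinates \<open>u\<close>, \<open>v\<close> at the center, with \<open>u\<close> an equation of the line at infinity, a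
  monomial substitution \<open>\<Psi>\<close> turns the expansion of a polynomial in the standard monomials of the
  key forms into its Newton polygon. This bounds \<open>\<delta> (F(u, v))\<close> from below by a multiple of the order
  of \<open>F(0, v)\<close>, with equality for the last key form or, if \<open>\<delta> X < \<delta> Y\<close>, for a Weierstrass remainder
  modulo it. The bound computes the skewness, and the same bound for polynomials in x and y shows
  that the skewness is at most the infimum of the slopes. If \<open>\<delta> (g (n + 1)) \<ge> 0\<close>, the polynomial parts
  of the powers of \<open>g (n + 1)\<close> have slopes that tend to the skewness. A polynomial whose slope equals
  the skewness is, up to lower terms, a power of \<open>g (n + 1)\<close>, and approximate roots then make all
  key forms polynomials. If \<open>\<delta> (g (n + 1)) < 0\<close>, Hadamard's estimate for a Sylvester determinant in
  the basis of standard monomials shows that at most one irreducible polynomial can have a slope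
  close to the skewness, so the infimum is larger than the skewness unless it is attained.
\<close>

section \<open>Substitution homomorphisms\<close>

text \<open>Nothing cancels between standard monomials: they are monic of degrees 0, 1, 2, ... in y,
  so expansions are unique, and (P3) makes \<open>\<delta>\<close> the largest weight of a term. Any
  term that is known to occur therefore bounds \<open>\<delta> h\<close> from below, and
  \<open>\<Psi>\<close> detects terms. The standard monomial of degree k in y has weight at least
  \<open>\<tau> * k\<close> with \<open>\<tau> = \<omega> (n + 1) / yd (n + 1)\<close>, because the
  quotients \<open>\<omega> i / yd i\<close> decrease. At [0:0:1] the function 1/x is u/v, so
  negative powers of x in the last key form do not become polynomials in u and v; hence the detour
  through a remainder. The determinant estimate has a quadratic main term and a linear error in the
  degrees; passing to powers \<open>f ^ a\<close> and \<open>f' ^ a\<close> of two coprime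
  polynomials removes the error. If \<open>\<delta> X = \<delta> Y\<close> and n = 0, then \<delta>
  is a multiple of deg; it is deg itself, since a divisorial valuation takes on two polynomials
  values that differ by 1.\<close>

lemma cst_0 [simp]: "cst 0 = 0" by (simp add: cst_def)
lemma cst_1 [simp]: "cst 1 = 1"
  unfolding cst_def by (metis one_pCons to_fract_1)

interpretation cst: field_hom cst
  by unfold_locales (simp | simp add: cst_def flip: to_fract_add to_fract_mult)+

lemma X_nonzero [simp]: "X \<noteq> 0" by (simp add: X_def)
lemma Y_nonzero [simp]: "Y \<noteq> 0" by (simp add: Y_def)

definition evx :: "ratfun \<Rightarrow> complex poly \<Rightarrow> ratfun" where
  "evx s p = poly (map_poly cst p) s"

text \<open>Two nested evaluations instead of the double sum of \<open>subst2\<close>: in this form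
  the homomorphism laws come from those of \<open>map_poly\<close> and \<open>poly\<close>.\<close>

definition ev2 :: "ratfun \<Rightarrow> ratfun \<Rightarrow> poly2 \<Rightarrow> ratfun" where
  "ev2 s t F = poly (map_poly (evx s) F) t"

interpretation cst_poly: map_poly_inj_idom_hom cst ..

interpretation evx: idom_hom "evx s" for s
  by unfold_locales (simp_all add: evx_def cst_poly.hom_add cst_poly.hom_mult)

interpretation evx_poly: map_poly_idom_hom "evx s" for s ..

interpretation ev2: idom_hom "ev2 s t" for s t
  by unfold_locales (simp_all add: ev2_def evx_poly.hom_add evx_poly.hom_mult)

lemma evx_pCons [simp]: "evx s (pCons a p) = cst a + s * evx s p"
  by (simp add: evx_def cst.map_poly_pCons_hom)

lemma ev2_pCons [simp]: "ev2 s t (pCons p F) = evx s p + t * ev2 s t F"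
  by (simp add: ev2_def evx.map_poly_pCons_hom)

lemma evx_monom [simp]: "evx s (monom a n) = cst a * s ^ n"
  by (simp add: evx_def poly_monom)

lemma ev2_monom [simp]: "ev2 s t (monom p n) = evx s p * t ^ n"
  by (simp add: ev2_def poly_monom)

lemma ev2_smult [simp]: "ev2 s t (smult p F) = evx s p * ev2 s t F"
  by (simp add: ev2_def evx.map_poly_hom_smult)

lemma evx_altdef: "evx s p = (\<Sum>i\<le>degree p. cst (coeff p i) * s ^ i)"
  by (simp add: evx_def poly_altdef)

lemma ev2_altdef: "ev2 s t F = (\<Sum>j\<le>degree F. evx s (coeff F j) * t ^ j)"
proof -
  have "degree (map_poly (evx s) F) \<le> degree F"
    by (rule degree_map_poly_le)
  then show ?thesis
    unfolding ev2_def poly_altdef by (intro sum.mono_neutral_cong_left) (auto simp: coeff_eq_0 intro!: le_degree)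
qed

lemma subst2_eq_ev2: "subst2 F s t = ev2 s t F"
  by (simp add: subst2_def ev2_altdef evx_altdef sum_distrib_right)

lemma evx_X: "evx X p = to_fract [:p:]"
proof (induction p)
  case 0
  then show ?case by simp
next
  case (pCons a p)
  have "[:pCons a p:] = [:[:a:]:] + [:[:0, 1:]:] * [:p:]"
    by simp
  then show ?case
    using pCons by (simp only: evx_pCons cst_def X_def flip: to_fract_mult to_fract_add)
qed

lemma ev2_XY: "ev2 X Y F = to_fract F"
proof (induction F)
  case 0
  then show ?case by simp
next
  case (pCons a p)
  have "ev2 X Y (pCons a p) = to_fract ([:a:] + [:0, 1:] * p)"
    unfolding to_fract_add to_fract_mult by (simp only: ev2_pCons pCons.IH evx_X flip: Y_def)
  then show ?case
    by simp
qed

lemma (in field_hom) hom_powi: "hom (x powi k) = hom x powi k"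
  by (simp add: power_int_def hom_power hom_inverse)

lemma field_hom_ev2:
  fixes h :: "ratfun \<Rightarrow> ratfun"
  assumes "field_hom h" "\<And>c. h (cst c) = cst c"
  shows "h (ev2 s t F) = ev2 (h s) (h t) F"
proof -
  interpret field_hom h by fact
  have "h (evx s p) = evx (h s) p" for p
    by (induction p) (auto simp: hom_add hom_mult assms)
  then show ?thesis
    by (induction F) (auto simp: hom_add hom_mult)
qed

section \<open>Laurent polynomials\<close>

definition laurent_x :: "ratfun set" where
  "laurent_x = {a. \<exists>m p. X ^ m * a = evx X p}"

text \<open>An element of C[x,1/x,y] is represented by a polynomial over the whole field, to be
  evaluated at \<open>Y\<close>. This keeps its degree and coefficients in y accessible;
  \<open>laurent_coeffs_eqI\<close> shows that the representation is unique.\<close>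

definition laurent_coeffs :: "ratfun poly set" where
  "laurent_coeffs = {P. \<forall>i. coeff P i \<in> laurent_x}"

lemma laurent_xI: "X ^ m * a = evx X p \<Longrightarrow> a \<in> laurent_x"
  by (auto simp: laurent_x_def)

lemma laurent_x_evx [simp, intro]: "evx X p \<in> laurent_x"
  by (rule laurent_xI[of 0]) simp

lemma laurent_x_cst [simp, intro]: "cst c \<in> laurent_x"
  using laurent_x_evx[of "[:c:]"] by simp

lemma laurent_x_X [simp, intro]: "X \<in> laurent_x"
  using laurent_x_evx[of "[:0, 1:]"] by simp

lemma laurent_x_0 [simp, intro]: "0 \<in> laurent_x" and laurent_x_1 [simp, intro]: "1 \<in> laurent_x"
  using laurent_x_cst[of 0] laurent_x_cst[of 1] by simp_all

lemma laurent_x_mult [intro]: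
  assumes "a \<in> laurent_x" "b \<in> laurent_x"
  shows "a * b \<in> laurent_x"
proof -
  from assms obtain m p k q where "X ^ m * a = evx X p" "X ^ k * b = evx X q"
    by (auto simp: laurent_x_def)
  then have "X ^ (m + k) * (a * b) = evx X (p * q)"
    by (simp add: power_add evx.hom_mult) (metis mult.assoc mult.left_commute)
  then show ?thesis by (rule laurent_xI)
qed

lemma laurent_x_add [intro]:
  assumes "a \<in> laurent_x" "b \<in> laurent_x"
  shows "a + b \<in> laurent_x"
proof -
  from assms obtain m p k q where *: "X ^ m * a = evx X p" "X ^ k * b = evx X q"
    by (auto simp: laurent_x_def)
  have "X ^ (m + k) * (a + b) = X ^ k * (X ^ m * a) + X ^ m * (X ^ k * b)"
    by (simp add: power_add algebra_simps)
  also have "\<dots> = evx X (monom 1 k * p + monom 1 m * q)"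
    by (simp add: * evx.hom_mult evx.hom_add)
  finally show ?thesis by (rule laurent_xI)
qed

lemma laurent_x_uminus [intro]: "a \<in> laurent_x \<Longrightarrow> - a \<in> laurent_x"
  using laurent_x_mult[OF laurent_x_cst[of "-1"], of a] by (simp add: cst.hom_uminus)

lemma laurent_x_diff [intro]: "a \<in> laurent_x \<Longrightarrow> b \<in> laurent_x \<Longrightarrow> a - b \<in> laurent_x"
  using laurent_x_add[OF _ laurent_x_uminus, of a b] by simp

lemma laurent_x_power [intro]: "a \<in> laurent_x \<Longrightarrow> a ^ k \<in> laurent_x"
  by (induction k) auto

lemma laurent_x_powi [intro]: "X powi k \<in> laurent_x"
proof (cases "k \<ge> 0")
  case False
  then have "X ^ nat (- k) * X powi k = evx X 1"
    by (simp add: power_int_def field_simps)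
  then show ?thesis by (rule laurent_xI)
qed (auto simp: power_int_def)

lemma laurent_x_sum [intro]: "(\<And>i. i \<in> A \<Longrightarrow> f i \<in> laurent_x) \<Longrightarrow> sum f A \<in> laurent_x"
  by (induction A rule: infinite_finite_induct) auto

text \<open>The highest power of X is factored out; the cofactor is the reversed polynomial in 1/X.
  Its nonzero constant term controls both its value under \<delta> and its restriction after the
  substitution \<open>\<Psi>\<close>.\<close>

lemma laurent_x_cases:
  assumes "a \<in> laurent_x" "a \<noteq> 0"
  obtains i A where "a = X powi i * evx (inverse X) A" "coeff A 0 \<noteq> 0"
proof -
  from assms obtain m p where *: "X ^ m * a = evx X p"
    by (auto simp: laurent_x_def)
  with assms have p: "p \<noteq> 0" by auto
  have "X ^ degree p * evx (inverse X) (reflect_poly p) = evx X p"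
  proof -
    have "map_poly cst (reflect_poly p) = reflect_poly (map_poly cst p)"
      by (rule poly_eqI) (simp add: coeff_reflect_poly)
    then have "evx (inverse X) (reflect_poly p) = poly (reflect_poly (map_poly cst p)) (inverse X)"
      by (simp add: evx_def)
    also have "\<dots> = (inverse X) ^ degree p * evx X p"
      using poly_reflect_poly_nz[of "inverse X" "map_poly cst p"] by (simp add: evx_def)
    finally show ?thesis by (simp add: field_simps)
  qed
  with * have "a = X powi (int (degree p) - int m) * evx (inverse X) (reflect_poly p)"
    by (simp add: power_int_diff field_simps)
  moreover have "coeff (reflect_poly p) 0 \<noteq> 0"
    using p by simp
  ultimately show ?thesis by (rule that)
qed

lemma laurent_coeffs_mult [intro]:
  "P \<in> laurent_coeffs \<Longrightarrow> Q \<in> laurent_coeffs \<Longrightarrow> P * Q \<in> laurent_coeffs"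
  by (auto simp: laurent_coeffs_def coeff_mult)

lemma laurent_coeffs_add [intro]:
  "P \<in> laurent_coeffs \<Longrightarrow> Q \<in> laurent_coeffs \<Longrightarrow> P + Q \<in> laurent_coeffs"
  by (auto simp: laurent_coeffs_def)

lemma laurent_coeffs_diff [intro]:
  "P \<in> laurent_coeffs \<Longrightarrow> Q \<in> laurent_coeffs \<Longrightarrow> P - Q \<in> laurent_coeffs"
  by (auto simp: laurent_coeffs_def)

lemma laurent_coeffs_smult [intro]:
  "a \<in> laurent_x \<Longrightarrow> Q \<in> laurent_coeffs \<Longrightarrow> smult a Q \<in> laurent_coeffs"
  by (auto simp: laurent_coeffs_def)

lemma laurent_coeffs_pCons [intro]:
  "a \<in> laurent_x \<Longrightarrow> Q \<in> laurent_coeffs \<Longrightarrow> pCons a Q \<in> laurent_coeffs"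
  by (auto simp: laurent_coeffs_def coeff_pCons split: nat.splits)

lemma laurent_coeffs_0 [intro, simp]: "0 \<in> laurent_coeffs"
  by (auto simp: laurent_coeffs_def)

lemma laurent_coeffs_1 [intro, simp]: "1 \<in> laurent_coeffs"
  by (auto simp: one_pCons)

lemma laurent_coeffs_power [intro]: "P \<in> laurent_coeffs \<Longrightarrow> P ^ k \<in> laurent_coeffs"
  by (induction k) auto

lemma laurent_coeffs_prod [intro]:
  "(\<And>i. i \<in> A \<Longrightarrow> f i \<in> laurent_coeffs) \<Longrightarrow> prod f A \<in> laurent_coeffs"
  by (induction A rule: infinite_finite_induct) auto

lemma laurent_coeffs_sum [intro]:
  "(\<And>i. i \<in> A \<Longrightarrow> f i \<in> laurent_coeffs) \<Longrightarrow> sum f A \<in> laurent_coeffs"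
  by (induction A rule: infinite_finite_induct) auto

lemma laurent_coeffs_map_evx [intro, simp]: "map_poly (evx X) F \<in> laurent_coeffs"
  by (auto simp: laurent_coeffs_def)

lemma laurent_coeffs_clear:
  assumes "P \<in> laurent_coeffs"
  obtains m F where "smult (X ^ m) P = map_poly (evx X) F"
proof -
  have "\<exists>m F. smult (X ^ m) P = map_poly (evx X) F"
    using assms
  proof (induction P)
    case 0
    then show ?case by (intro exI[of _ 0]) simp
  next
    case (pCons a P)
    from pCons.prems have a: "a \<in> laurent_x" and P: "P \<in> laurent_coeffs"
      unfolding laurent_coeffs_def by (force dest: spec[of _ 0], force dest: spec[of _ "Suc _"])
    from a obtain k p where p: "X ^ k * a = evx X p"
      by (auto simp: laurent_x_def)
    from pCons.IH[OF P] obtain m F where F: "smult (X ^ m) P = map_poly (evx X) F"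
      by auto
    have "smult (X ^ (k + m)) (pCons a P) = pCons (X ^ m * (X ^ k * a)) (smult (X ^ k) (smult (X ^ m) P))"
      by (simp add: power_add mult_ac)
    also have "\<dots> = map_poly (evx X) (pCons (monom 1 m * p) (smult (monom 1 k) F))"
      by (simp add: p F evx.map_poly_pCons_hom evx.map_poly_hom_smult evx.hom_mult)
    finally show ?case by blast
  qed
  with that show ?thesis by blast
qed

text \<open>Algebraic independence of X and Y: after clearing denominators the value at
  \<open>Y\<close> is the image of a polynomial under the injective \<open>to_fract\<close>.\<close>

lemma laurent_coeffs_eq_0:
  assumes "P \<in> laurent_coeffs" "poly P Y = 0"
  shows "P = 0"
proof -
  obtain m F where *: "smult (X ^ m) P = map_poly (evx X) F"
    using laurent_coeffs_clear[OF assms(1)] .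
  have "to_fract F = poly (smult (X ^ m) P) Y"
    by (simp add: * flip: ev2_XY ev2_def)
  with assms have "F = 0" by simp
  with * show ?thesis by simp
qed

lemma laurent_coeffs_eqI:
  assumes "P \<in> laurent_coeffs" "Q \<in> laurent_coeffs" "poly P Y = poly Q Y"
  shows "P = Q"
  using laurent_coeffs_eq_0[of "P - Q"] assms by auto

lemma laurent_polys_iff: "h \<in> laurent_polys \<longleftrightarrow> (\<exists>P\<in>laurent_coeffs. h = poly P Y)"
proof
  assume "h \<in> laurent_polys"
  then obtain m F where F: "X ^ m * h = to_fract F"
    by (auto simp: laurent_polys_def polys_def)
  have "poly (smult (X powi (- int m)) (map_poly (evx X) F)) Y = X powi (- int m) * (X ^ m * h)"
    by (simp add: F flip: ev2_XY ev2_def)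
  also have "\<dots> = h"
    by (simp add: power_int_minus field_simps)
  finally show "\<exists>P\<in>laurent_coeffs. h = poly P Y"
    by (metis laurent_coeffs_smult laurent_coeffs_map_evx laurent_x_powi)
next
  assume "\<exists>P\<in>laurent_coeffs. h = poly P Y"
  then obtain P where P: "P \<in> laurent_coeffs" and h: "h = poly P Y" by auto
  obtain m F where *: "smult (X ^ m) P = map_poly (evx X) F"
    using laurent_coeffs_clear[OF P] .
  have "X ^ m * h = to_fract F"
    using arg_cong[OF *, of "\<lambda>p. poly p Y"] by (simp add: h flip: ev2_XY ev2_def)
  then show "h \<in> laurent_polys"
    by (auto simp: laurent_polys_def polys_def)
qed

section \<open>Monomial substitutions\<close>

text \<open>Only the normalized fraction is used; for an injective homomorphism
  \<open>frac_hom_divide\<close> shows that every representation as a fraction gives the same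
  result.\<close>

definition frac_hom :: "(poly2 \<Rightarrow> ratfun) \<Rightarrow> ratfun \<Rightarrow> ratfun" where
  "frac_hom \<phi> z = \<phi> (fst (quot_of_fract z)) / \<phi> (snd (quot_of_fract z))"

lemma frac_hom_divide:
  assumes "inj_idom_hom \<phi>" "b \<noteq> 0"
  shows "frac_hom \<phi> (to_fract a / to_fract b) = \<phi> a / \<phi> b"
proof -
  interpret inj_idom_hom \<phi> by fact
  define z where "z = to_fract a / to_fract b"
  let ?p = "fst (quot_of_fract z)" and ?q = "snd (quot_of_fract z)"
  have "z = to_fract ?p / to_fract ?q"
    by (metis Fract_conv_to_fract Fract_quot_of_fract)
  then have "to_fract a / to_fract b = to_fract ?p / to_fract ?q"
    by (simp add: z_def)
  then have "a * ?q = ?p * b"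
    using assms(2) by (simp add: frac_eq_eq flip: to_fract_mult)
  then have "\<phi> a * \<phi> ?q = \<phi> ?p * \<phi> b"
    by (metis hom_mult)
  moreover have "\<phi> ?q \<noteq> 0" "\<phi> b \<noteq> 0"
    using assms(2) by simp_all
  ultimately show ?thesis
    by (simp add: frac_hom_def z_def frac_eq_eq)
qed

lemma ratfun_cases:
  obtains a b where "z = to_fract a / to_fract b" "(b::poly2) \<noteq> 0"
  by (metis Fract_cases Fract_conv_to_fract)

lemma frac_hom_to_fract:
  assumes "inj_idom_hom \<phi>"
  shows "frac_hom \<phi> (to_fract a) = \<phi> a"
proof -
  interpret inj_idom_hom \<phi> by fact
  show ?thesis using frac_hom_divide[OF assms, of 1 a] by simp
qed

lemma field_hom_frac_hom:
  assumes "inj_idom_hom \<phi>"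
  shows "field_hom (frac_hom \<phi>)"
proof -
  interpret inj_idom_hom \<phi> by fact
  note d = frac_hom_divide[OF assms]
  show ?thesis
  proof
    show "frac_hom \<phi> 0 = 0" "frac_hom \<phi> 1 = 1"
      using d[of 1 0] d[of 1 1] by simp_all
    fix x y :: ratfun
    obtain a b where x: "x = to_fract a / to_fract b" "b \<noteq> 0" by (rule ratfun_cases[of x])
    obtain a' b' where y: "y = to_fract a' / to_fract b'" "b' \<noteq> 0" by (rule ratfun_cases[of y])
    have "x + y = to_fract (a * b' + a' * b) / to_fract (b * b')"
      using x y by (simp add: add_frac_eq)
    then show "frac_hom \<phi> (x + y) = frac_hom \<phi> x + frac_hom \<phi> y"
      using x(2) y(2) by (simp add: x(1) y(1) d hom_add hom_mult add_frac_eq del: to_fract_add to_fract_mult)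
    have "x * y = to_fract (a * a') / to_fract (b * b')"
      using x y by simp
    then show "frac_hom \<phi> (x * y) = frac_hom \<phi> x * frac_hom \<phi> y"
      using x(2) y(2) by (simp add: x(1) y(1) d hom_mult del: to_fract_mult)
  qed
qed

text \<open>Multiplication by a power of X turns the value into the reversed polynomial at
  \<open>X ^ p\<close>, a composition with the nonconstant \<open>monom 1 p\<close>.\<close>

lemma evx_inverse_power_nonzero:
  assumes "p > 0" "a \<noteq> 0"
  shows "evx (inverse X ^ p) a \<noteq> 0"
proof
  assume 0: "evx (inverse X ^ p) a = 0"
  have "map_poly cst (reflect_poly a) = reflect_poly (map_poly cst a)"
    by (rule poly_eqI) (simp add: coeff_reflect_poly)
  then have "evx (X ^ p) (reflect_poly a) = (X ^ p) ^ degree a * evx (inverse X ^ p) a"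
    using poly_reflect_poly_nz[of "X ^ p" "map_poly cst a"] by (simp add: evx_def power_inverse)
  also have "\<dots> = 0"
    using 0 by simp
  also have "evx (X ^ p) (reflect_poly a) = evx X (pcompose (reflect_poly a) (monom 1 p))"
    unfolding evx_def by (simp add: cst.map_poly_pcompose poly_pcompose poly_monom)
  finally have "pcompose (reflect_poly a) (monom 1 p) = 0"
    by (simp add: evx_X)
  then have "reflect_poly a = 0"
    by (rule pcompose_eq_0) (use assms in \<open>simp add: degree_monom_eq\<close>)
  with assms show False by simp
qed

text \<open>The substitution acts in two injective stages: x becomes \<open>inverse X ^ p\<close> in
  the coefficients, then y becomes a polynomial of degree one in Y over C[x,1/x].\<close>

lemma inj_ev2_monomial:
  assumes "p > 0"
  shows "inj_idom_hom (ev2 (inverse X ^ p) ((Y + cst c) * inverse X ^ q))"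
proof unfold_locales
  fix F assume 0: "ev2 (inverse X ^ p) ((Y + cst c) * inverse X ^ q) F = 0"
  define Q where "Q = map_poly (evx (inverse X ^ p)) F"
  have "inverse X \<in> laurent_x"
    using laurent_x_powi[of "-1"] by simp
  then have inv: "inverse X ^ k \<in> laurent_x" for k
    by auto
  have "Q \<in> laurent_coeffs"
    unfolding Q_def laurent_coeffs_def using inv by (auto simp: evx_altdef)
  define r where "r = [:cst c * inverse X ^ q, inverse X ^ q:]"
  define R where "R = pcompose Q r"
  have "r \<in> laurent_coeffs"
    unfolding r_def using inv by auto
  have "R = (\<Sum>i\<le>degree Q. smult (coeff Q i) (r ^ i))"
    by (simp add: R_def pcompose_altdef poly_altdef degree_map_poly coeff_map_poly)
  then have "R \<in> laurent_coeffs"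
    using \<open>Q \<in> _\<close> \<open>r \<in> _\<close>
    by (simp only:) (intro laurent_coeffs_sum laurent_coeffs_smult laurent_coeffs_power,
      auto simp: laurent_coeffs_def)
  have "poly R Y = poly Q ((Y + cst c) * inverse X ^ q)"
    by (simp add: R_def r_def poly_pcompose algebra_simps)
  also have "\<dots> = 0"
    using 0 by (simp add: Q_def ev2_def)
  finally have "R = 0"
    using \<open>R \<in> _\<close> by (intro laurent_coeffs_eq_0)
  then have "Q = 0"
    unfolding R_def by (rule pcompose_eq_0) (simp add: r_def)
  then show "F = 0"
    unfolding Q_def using evx_inverse_power_nonzero[OF assms]
    by (auto simp: poly_eq_iff)
qed

section \<open>Semidegrees\<close>

lemma complex_nth_root_exists:
  assumes "n > 0"
  obtains r :: complex where "r ^ n = c"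
proof -
  have "rcis (root n (cmod c)) (Arg c / real n) ^ n = c"
    using assms by (simp add: DeMoivre2 rcis_cmod_Arg)
  then show ?thesis by (rule that)
qed

locale semidegree =
  fixes \<delta> :: "ratfun \<Rightarrow> int"
  assumes add: "f \<noteq> 0 \<Longrightarrow> h \<noteq> 0 \<Longrightarrow> f + h \<noteq> 0 \<Longrightarrow> \<delta> (f + h) \<le> max (\<delta> f) (\<delta> h)"
    and mult: "f \<noteq> 0 \<Longrightarrow> h \<noteq> 0 \<Longrightarrow> \<delta> (f * h) = \<delta> f + \<delta> h"
    and X_pos: "\<delta> X > 0"
begin

lemma one [simp]: "\<delta> 1 = 0"
  using mult[of 1 1] by simp

lemma power: "f \<noteq> 0 \<Longrightarrow> \<delta> (f ^ k) = int k * \<delta> f"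
  by (induction k) (auto simp: mult algebra_simps)

lemma inverse: "f \<noteq> 0 \<Longrightarrow> \<delta> (inverse f) = - \<delta> f"
  using mult[of f "inverse f"] by simp

lemma divide: "f \<noteq> 0 \<Longrightarrow> h \<noteq> 0 \<Longrightarrow> \<delta> (f / h) = \<delta> f - \<delta> h"
  by (simp add: divide_inverse mult inverse)

lemma powi: "f \<noteq> 0 \<Longrightarrow> \<delta> (f powi k) = k * \<delta> f"
  by (simp add: power_int_def power inverse)

text \<open>The multiplicative group of C is divisible, so the value of a constant is divisible by
  every k; a k larger than its absolute value makes it 0.\<close>

lemma cst [simp]:
  assumes "c \<noteq> 0"
  shows "\<delta> (cst c) = 0"
proof -
  define k where "k = nat \<bar>\<delta> (cst c)\<bar> + 1"
  obtain r where r: "r ^ k = c"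
    using complex_nth_root_exists[of k c] by (auto simp: k_def)
  then have "r \<noteq> 0"
    using assms by (auto simp: k_def)
  then have "\<delta> (cst c) = int k * \<delta> (cst r)"
    by (simp add: cst.hom_power power flip: r)
  then have "int k dvd \<delta> (cst c)"
    by simp
  moreover have "\<bar>\<delta> (cst c)\<bar> < int k"
    by (simp add: k_def)
  ultimately show ?thesis
    using dvd_imp_le_int[of "\<delta> (cst c)" "int k"] by linarith
qed

lemma uminus [simp]: "f \<noteq> 0 \<Longrightarrow> \<delta> (- f) = \<delta> f"
  using mult[of "- 1" f] mult[of "- 1" "- 1"] by simp

text \<open>The value of \<delta> at 0 is arbitrary. Here it counts as minus infinity, so that
  ultrametric estimates of sums need no case distinction on zero.\<close>

definition le :: "ratfun \<Rightarrow> int \<Rightarrow> bool" where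
  "le h w \<longleftrightarrow> h = 0 \<or> \<delta> h \<le> w"

lemma le_0 [simp, intro]: "le 0 w" by (simp add: le_def)

lemma le_refl [simp, intro]: "le h (\<delta> h)" by (simp add: le_def)

lemma leD: "le h w \<Longrightarrow> h \<noteq> 0 \<Longrightarrow> \<delta> h \<le> w" by (simp add: le_def)

lemma le_mono: "le h w \<Longrightarrow> w \<le> w' \<Longrightarrow> le h w'" by (auto simp: le_def)

lemma le_add: "le f w \<Longrightarrow> le h w \<Longrightarrow> le (f + h) w"
  using add[of f h] unfolding le_def by (metis add_cancel_left_left add_cancel_right_right max.bounded_iff order.trans)

lemma le_uminus [simp]: "le (- f) w \<longleftrightarrow> le f w"
  by (cases "f = 0") (auto simp: le_def)

lemma le_diff: "le f w \<Longrightarrow> le h w \<Longrightarrow> le (f - h) w"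
  using le_add[of f w "- h"] by simp

lemma le_sum: "(\<And>i. i \<in> A \<Longrightarrow> le (f i) w) \<Longrightarrow> le (sum f A) w"
  by (induction A rule: infinite_finite_induct) (auto intro: le_add)

lemma le_mult: "le f v \<Longrightarrow> le h w \<Longrightarrow> le (f * h) (v + w)"
  unfolding le_def using mult[of f h] by (metis add_mono mult_eq_0_iff)

lemma le_power: "le f v \<Longrightarrow> le (f ^ k) (int k * v)"
  by (cases "f = 0") (cases "k = 0", auto simp: le_def power intro: mult_left_mono)

lemma le_cst [simp, intro]: "le (cst c) 0"
  by (cases "c = 0") (auto simp: le_def)

lemma le_cst_mult: "le f w \<Longrightarrow> le (cst c * f) w"
  using le_mult[OF le_cst, of f w c] by simp

lemma le_powi_X: "le (X powi i) (i * \<delta> X)"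
  by (simp add: le_def powi)

lemma dominant:
  assumes "h \<noteq> 0" "le (f - h) w" "w < \<delta> h"
  shows "f \<noteq> 0" "\<delta> f = \<delta> h"
proof -
  show f: "f \<noteq> 0"
    using assms by (auto simp: le_def)
  have "\<delta> f \<le> \<delta> h"
    using leD[OF le_add[OF le_mono[OF assms(2)] le_refl[of h]]] assms f by simp
  moreover have "\<delta> h \<le> max w (\<delta> f)"
    using leD[OF le_diff[of f "max w (\<delta> f)" "f - h"]] le_mono[OF assms(2), of "max w (\<delta> f)"]
      le_mono[OF le_refl[of f], of "max w (\<delta> f)"] assms(1) by simp
  ultimately show "\<delta> f = \<delta> h"
    using assms(3) by simp
qed

text \<open>1/X has negative value, so the constant term dominates.\<close>

lemma evx_inverse_X:
  assumes "coeff A 0 \<noteq> 0"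
  shows "evx (inverse X) A \<noteq> 0" "\<delta> (evx (inverse X) A) = 0"
proof -
  obtain c B where A: "A = pCons c B" by (cases A)
  have le: "le (evx (inverse X) B) 0" for B
  proof (induction B)
    case (pCons a B)
    then show ?case
      using le_mult[of "inverse X" 0 "evx (inverse X) B" 0] X_pos
      by (auto intro!: le_add simp: le_def[of "inverse X"] inverse)
  qed simp
  have "le (evx (inverse X) A - cst c) (- \<delta> X)"
    using le_mult[of "inverse X" "- \<delta> X" "evx (inverse X) B" 0] le by (simp add: A le_def[of "inverse X"] inverse)
  then show "evx (inverse X) A \<noteq> 0" "\<delta> (evx (inverse X) A) = 0"
    using dominant[of "cst c" "evx (inverse X) A" "- \<delta> X"] assms X_pos by (auto simp: A)
qed

lemma laurent_x_cases':
  assumes "a \<in> laurent_x" "a \<noteq> 0"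
  obtains i A where "a = X powi i * evx (inverse X) A" "coeff A 0 \<noteq> 0" "\<delta> a = i * \<delta> X"
  using laurent_x_cases[OF assms] evx_inverse_X
  by (metis X_nonzero add.right_neutral mult power_int_eq_0_iff powi)

lemma evx_X_value:
  assumes "p \<noteq> 0"
  shows "\<delta> (evx X p) = int (degree p) * \<delta> X"
proof -
  have "evx X p = X ^ degree p * evx (inverse X) (reflect_poly p)"
  proof -
    have "map_poly Defs.cst (reflect_poly p) = reflect_poly (map_poly Defs.cst p)"
      by (rule poly_eqI) (simp add: coeff_reflect_poly)
    then show ?thesis
      using poly_reflect_poly_nz[of "Fields.inverse X" "map_poly Defs.cst p"]
      by (simp add: evx_def field_simps)
  qed
  moreover have nz: "coeff (reflect_poly p) 0 \<noteq> 0"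
    using assms by simp
  ultimately show ?thesis
    using evx_inverse_X[OF nz] by (simp add: mult power)
qed

end

section \<open>Key data and standard monomials\<close>

text \<open>Telescoping: digit i contributes at most \<open>(\<alpha> i - 1) * c i\<close>, hence at
  most \<open>c (i + 1) - c i\<close>. With the degrees \<open>yd\<close> as c this is the usual
  bound for a mixed radix; \<open>sum_digits_less\<close> uses it for the defects
  \<open>gap\<close>.\<close>

lemma sum_digits_le:
  fixes b \<alpha> :: "nat \<Rightarrow> nat" and c :: "nat \<Rightarrow> int"
  assumes "\<And>i. 1 \<le> i \<Longrightarrow> i < j \<Longrightarrow> b i < \<alpha> i"
    and "\<And>i. 1 \<le> i \<Longrightarrow> i < j \<Longrightarrow> int (\<alpha> i) * c i \<le> c (i + 1)"
    and "\<And>i. 1 \<le> i \<Longrightarrow> i < j \<Longrightarrow> 0 \<le> c i" "1 \<le> j"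
  shows "(\<Sum>i=1..<j. int (b i) * c i) \<le> c j - c 1"
  using assms(4,1-3)
proof (induction j rule: dec_induct)
  case (step j)
  have "int (b j) * c j \<le> (int (\<alpha> j) - 1) * c j"
  proof (rule mult_right_mono)
    show "int (b j) \<le> int (\<alpha> j) - 1" using step.prems(1)[of j] step.hyps by linarith
    show "0 \<le> c j" using step.prems(3)[of j] step.hyps by linarith
  qed
  also have "\<dots> = int (\<alpha> j) * c j - c j"
    by (simp add: left_diff_distrib)
  also have "\<dots> \<le> c (Suc j) - c j"
    using step.prems(2)[of j] step.hyps by simp
  finally have "int (b j) * c j \<le> c (Suc j) - c j" .
  moreover have "(\<Sum>i=1..<j. int (b i) * c i) \<le> c j - c 1"
    by (rule step.IH) (use step.prems in auto)
  moreover have "(\<Sum>i=1..<Suc j. int (b i) * c i) = (\<Sum>i=1..<j. int (b i) * c i) + int (b j) * c j"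
    using step.hyps(1) by (rule sum.atLeastLessThan_Suc)
  ultimately show ?case
    by linarith
qed simp

text \<open>The exponent of x is split off: \<open>b0 j\<close> may be negative, while the exponents
  of the other key forms are natural numbers, so the tails are ordinary monomials times a power of
  x.\<close>

locale key_data = semidegree \<delta> for \<delta> +
  fixes n :: nat and g :: "nat \<Rightarrow> ratfun" and \<alpha> :: "nat \<Rightarrow> nat" and b0 :: "nat \<Rightarrow> int"
    and \<beta> :: "nat \<Rightarrow> nat \<Rightarrow> nat" and \<theta> :: "nat \<Rightarrow> complex"
  assumes g_0: "g 0 = X" and g_1: "g 1 = Y"
    and alpha_pos: "1 \<le> j \<Longrightarrow> j \<le> n \<Longrightarrow> 1 \<le> \<alpha> j"
    and key_less: "1 \<le> j \<Longrightarrow> j \<le> n \<Longrightarrow> \<delta> (g (j + 1)) < int (\<alpha> j) * \<delta> (g j)"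
    and key_eq: "1 \<le> j \<Longrightarrow> j \<le> n \<Longrightarrow>
      int (\<alpha> j) * \<delta> (g j) = b0 j * \<delta> X + (\<Sum>i=1..<j. int (\<beta> j i) * \<delta> (g i))"
    and beta_less: "j \<le> n \<Longrightarrow> 1 \<le> i \<Longrightarrow> i < j \<Longrightarrow> \<beta> j i < \<alpha> i"
    and theta_nonzero: "1 \<le> j \<Longrightarrow> j \<le> n \<Longrightarrow> \<theta> j \<noteq> 0"
    and key_rec: "1 \<le> j \<Longrightarrow> j \<le> n \<Longrightarrow>
      g (j + 1) = g j ^ \<alpha> j - cst (\<theta> j) * X powi b0 j * (\<Prod>i=1..<j. g i ^ \<beta> j i)"
    and key_repr: "h \<in> laurent_polys \<Longrightarrow> h \<noteq> 0 \<Longrightarrow>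
      \<exists>G\<in>mixed_laurent n. eval_at g n G = h \<and> weighted_degree (\<lambda>j. \<delta> (g j)) n G = \<delta> h"
begin

definition \<omega> :: "nat \<Rightarrow> int" where "\<omega> j = \<delta> (g j)"

text \<open>The degree of \<open>g j\<close> in y, as \<open>key_poly\<close> shows.\<close>

definition yd :: "nat \<Rightarrow> nat" where "yd j = (\<Prod>i=1..<j. \<alpha> i)"

lemma yd_1 [simp]: "yd (Suc 0) = 1" by (simp add: yd_def)

lemma yd_Suc: "1 \<le> j \<Longrightarrow> yd (Suc j) = yd j * \<alpha> j"
  by (simp add: yd_def)

lemma yd_pos: "j \<le> n + 1 \<Longrightarrow> yd j > 0"
  unfolding yd_def using alpha_pos by (intro prod_pos) fastforce

lemma yd_dvd: "1 \<le> i \<Longrightarrow> i \<le> j \<Longrightarrow> yd i dvd yd j"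
  unfolding yd_def by (intro prod_dvd_prod_subset) auto

definition mono :: "(nat \<Rightarrow> nat) \<Rightarrow> ratfun" where "mono b = (\<Prod>i=1..n+1. g i ^ b i)"
definition wt :: "(nat \<Rightarrow> nat) \<Rightarrow> int" where "wt b = (\<Sum>i=1..n+1. int (b i) * \<omega> i)"
definition dg :: "(nat \<Rightarrow> nat) \<Rightarrow> nat" where "dg b = (\<Sum>i=1..n+1. b i * yd i)"

text \<open>Digits of k in the mixed radix \<open>yd 1\<close>, \<open>yd 2\<close>, ...; the last
  digit is unbounded, since no recursion rewrites powers of \<open>g (n + 1)\<close>. So every k is
  the degree in y of exactly one standard monomial, namely \<open>m k\<close>.\<close>

definition dig :: "nat \<Rightarrow> nat \<Rightarrow> nat" where
  "dig k i = (if i \<le> n then (k div yd i) mod \<alpha> i else k div yd i)"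

definition m :: "nat \<Rightarrow> ratfun" where "m k = mono (dig k)"
definition w :: "nat \<Rightarrow> int" where "w k = wt (dig k)"

lemma mono_add: "mono (\<lambda>i. b i + c i) = mono b * mono c"
  by (simp add: mono_def power_add prod.distrib)
lemma wt_add: "wt (\<lambda>i. b i + c i) = wt b + wt c"
  by (simp add: wt_def algebra_simps sum.distrib)
lemma dg_add: "dg (\<lambda>i. b i + c i) = dg b + dg c"
  by (simp add: dg_def algebra_simps sum.distrib)

lemma mono_single: "1 \<le> i \<Longrightarrow> i \<le> n + 1 \<Longrightarrow> mono (\<lambda>l. if l = i then k else 0) = g i ^ k"
  unfolding mono_def by (subst prod.remove[of _ i]) (auto intro!: prod.neutral)
lemma wt_single: "1 \<le> i \<Longrightarrow> i \<le> n + 1 \<Longrightarrow> wt (\<lambda>l. if l = i then k else 0) = int k * \<omega> i"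
  unfolding wt_def by (subst sum.remove[of _ i]) (auto intro!: sum.neutral)
lemma dg_single: "1 \<le> i \<Longrightarrow> i \<le> n + 1 \<Longrightarrow> dg (\<lambda>l. if l = i then k else 0) = k * yd i"
  unfolding dg_def by (subst sum.remove[of _ i]) (auto intro!: sum.neutral)

text \<open>Exponents of the monomial that is subtracted in the recursion for
  \<open>g (j + 1)\<close>, without its power of x.\<close>

definition btail :: "nat \<Rightarrow> nat \<Rightarrow> nat" where
  "btail j l = (if 1 \<le> l \<and> l < j then \<beta> j l else 0)"

lemma mono_btail: "1 \<le> j \<Longrightarrow> j \<le> n \<Longrightarrow> mono (btail j) = (\<Prod>i=1..<j. g i ^ \<beta> j i)"
  unfolding mono_def by (rule prod.mono_neutral_cong_right) (auto simp: btail_def)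
lemma wt_btail: "1 \<le> j \<Longrightarrow> j \<le> n \<Longrightarrow> wt (btail j) = (\<Sum>i=1..<j. int (\<beta> j i) * \<omega> i)"
  unfolding wt_def by (rule sum.mono_neutral_cong_right) (auto simp: btail_def)
lemma dg_btail: "1 \<le> j \<Longrightarrow> j \<le> n \<Longrightarrow> dg (btail j) = (\<Sum>i=1..<j. \<beta> j i * yd i)"
  unfolding dg_def by (rule sum.mono_neutral_cong_right) (auto simp: btail_def)

lemma yd_digits:
  assumes "1 \<le> j" "j \<le> n + 1" "\<And>i. 1 \<le> i \<Longrightarrow> i < j \<Longrightarrow> b i < \<alpha> i"
  shows "(\<Sum>i=1..<j. b i * yd i) < yd j"
proof -
  have "(\<Sum>i=1..<j. int (b i) * int (yd i)) \<le> int (yd j) - int (yd 1)"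
    by (rule sum_digits_le[where \<alpha> = \<alpha>]) (use assms in \<open>auto simp: yd_Suc\<close>)
  then have "int (\<Sum>i=1..<j. b i * yd i) < int (yd j)"
    by simp
  then show ?thesis by linarith
qed

lemma dg_btail_less: "1 \<le> j \<Longrightarrow> j \<le> n \<Longrightarrow> dg (btail j) < yd j"
  using yd_digits[of j "\<beta> j"] beta_less by (simp add: dg_btail)

lemma omega_0: "\<omega> 0 = \<delta> X" by (simp add: \<omega>_def g_0)

lemma wt_btail_eq: "1 \<le> j \<Longrightarrow> j \<le> n \<Longrightarrow> int (\<alpha> j) * \<omega> j = b0 j * \<omega> 0 + wt (btail j)"
  using key_eq[of j] by (simp add: wt_btail \<omega>_def g_0)

lemma key_rec': "1 \<le> j \<Longrightarrow> j \<le> n \<Longrightarrow> g j ^ \<alpha> j = g (Suc j) + cst (\<theta> j) * X powi b0 j * mono (btail j)"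
  using key_rec[of j] by (simp add: mono_btail)

lemma omega_less: "1 \<le> j \<Longrightarrow> j \<le> n \<Longrightarrow> \<omega> (Suc j) < int (\<alpha> j) * \<omega> j"
  unfolding \<omega>_def Suc_eq_plus1 by (rule key_less)

definition std :: "(nat \<Rightarrow> nat) \<Rightarrow> bool" where
  "std b \<longleftrightarrow> (\<forall>i. 1 \<le> i \<and> i \<le> n \<longrightarrow> b i < \<alpha> i)"

text \<open>The part of the sum below i is smaller than \<open>yd i\<close>, and the part above i is
  divisible by \<open>yd (Suc i)\<close>; quotient and remainder isolate \<open>b i\<close>.\<close>

lemma dig_dg:
  assumes "std b" "1 \<le> i" "i \<le> n + 1"
  shows "dig (dg b) i = b i"
proof -
  have set: "{1..n+1} = {1..<i} \<union> insert i {i<..n+1}"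
    using assms by auto
  have "dg b = (\<Sum>l=1..<i. b l * yd l) + b i * yd i + (\<Sum>l\<in>{i<..n+1}. b l * yd l)"
    unfolding dg_def set by (subst sum.union_disjoint) auto
  moreover obtain S where "(\<Sum>l\<in>{i<..n+1}. b l * yd l) = yd (Suc i) * S"
  proof -
    have "yd (Suc i) dvd (\<Sum>l\<in>{i<..n+1}. b l * yd l)"
      using yd_dvd[of "Suc i"] by (intro dvd_sum dvd_mult) auto
    then show ?thesis using that by (auto simp: dvd_def)
  qed
  ultimately have eq: "dg b = (\<Sum>l=1..<i. b l * yd l) + yd i * (b i + \<alpha> i * S)"
    using assms by (simp add: yd_Suc algebra_simps)
  have "(\<Sum>l=1..<i. b l * yd l) < yd i"
    using assms by (intro yd_digits) (auto simp: std_def)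
  then have div: "dg b div yd i = b i + \<alpha> i * S"
    by (simp add: eq)
  show ?thesis
  proof (cases "i \<le> n")
    case True
    then show ?thesis
      using assms by (simp add: dig_def div std_def)
  next
    case False
    then have "(\<Sum>l\<in>{i<..n+1}. b l * yd l) = 0"
      by (intro sum.neutral) auto
    then have "dg b = (\<Sum>l=1..<i. b l * yd l) + yd i * b i"
      using \<open>dg b = (\<Sum>l=1..<i. b l * yd l) + b i * yd i + _\<close> by simp
    then show ?thesis
      using False \<open>_ < yd i\<close> by (simp add: dig_def)
  qed
qed

lemma standard_mono: "std b \<Longrightarrow> mono b = m (dg b)"
  unfolding m_def mono_def by (intro prod.cong) (auto simp: dig_dg)

lemma standard_wt: "std b \<Longrightarrow> wt b = w (dg b)"
  unfolding w_def wt_def by (intro sum.cong) (auto simp: dig_dg)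

lemma standard_dig: "std (dig k)"
  unfolding std_def dig_def using alpha_pos by (auto simp: Suc_le_eq)

lemma dg_dig: "dg (dig k) = k"
proof -
  have "(\<Sum>i=1..<j. ((k div yd i) mod \<alpha> i) * yd i) = k mod yd j" if "1 \<le> j" for j
    using that
  proof (induction j rule: dec_induct)
    case (step j)
    then show ?case
      by (simp add: yd_Suc mod_mult2_eq)
  qed simp
  from this[of "n + 1"] have "(\<Sum>i=1..<n+1. dig k i * yd i) = k mod yd (n + 1)"
    by (simp add: dig_def)
  moreover have "dg (dig k) = (\<Sum>i=1..<n+1. dig k i * yd i) + (k div yd (n + 1)) * yd (n + 1)"
    unfolding dg_def by (subst atLeastLessThanSuc_atLeastAtMost[symmetric],
      subst sum.atLeastLessThan_Suc) (auto simp: dig_def)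
  ultimately show ?thesis by (simp only: mod_div_mult_eq)
qed

text \<open>For \<open>v = \<delta> h\<close> this says that the minimum in (P3) is realized by
  standard monomials with coefficients in C[x,1/x].\<close>

definition expands :: "ratfun \<Rightarrow> int \<Rightarrow> bool" where
  "expands h v \<longleftrightarrow> (\<exists>a N. h = (\<Sum>k<N. a k * m k) \<and> (\<forall>k. a k \<in> laurent_x \<and> le (a k) (v - w k)))"

lemma expandsI:
  assumes "h = (\<Sum>k<N. a k * m k)" "\<And>k. a k \<in> laurent_x" "\<And>k. le (a k) (v - w k)"
  shows "expands h v"
  unfolding expands_def using assms by (intro exI[of _ a] exI[of _ N]) auto

lemma expandsE:
  assumes "expands h v"
  obtains a N where "h = (\<Sum>k<N. a k * m k)" "\<And>k. a k \<in> laurent_x" "\<And>k. le (a k) (v - w k)"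
  using assms unfolding expands_def by blast

lemma expands_0: "expands 0 v"
  by (rule expandsI[of _ "\<lambda>_. 0" 0]) auto

lemma expands_add:
  assumes "expands h v" "expands h' v"
  shows "expands (h + h') v"
proof -
  obtain a N where a: "h = (\<Sum>k<N. a k * m k)" "\<And>k. a k \<in> laurent_x" "\<And>k. le (a k) (v - w k)"
    using expandsE[OF assms(1)] by metis
  obtain a' N' where a': "h' = (\<Sum>k<N'. a' k * m k)" "\<And>k. a' k \<in> laurent_x" "\<And>k. le (a' k) (v - w k)"
    using expandsE[OF assms(2)] by metis
  define c where "c k = (if k < N then a k else 0) + (if k < N' then a' k else 0)" for k
  have "h = (\<Sum>k<max N N'. (if k < N then a k else 0) * m k)"
    unfolding a by (rule sum.mono_neutral_cong_left) auto
  moreover have "h' = (\<Sum>k<max N N'. (if k < N' then a' k else 0) * m k)"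
    unfolding a' by (rule sum.mono_neutral_cong_left) auto
  ultimately have "h + h' = (\<Sum>k<max N N'. c k * m k)"
    by (simp only: c_def distrib_right sum.distrib)
  then show ?thesis
    by (rule expandsI) (use a a' in \<open>auto simp: c_def intro!: le_add\<close>)
qed

lemma expands_sum: "(\<And>i. i \<in> A \<Longrightarrow> expands (f i) v) \<Longrightarrow> expands (sum f A) v"
  by (induction A rule: infinite_finite_induct) (auto intro: expands_add expands_0)

lemma expands_mono:
  assumes "expands h v" "v \<le> v'"
  shows "expands h v'"
proof -
  obtain a N where a: "h = (\<Sum>k<N. a k * m k)" "\<And>k. a k \<in> laurent_x" "\<And>k. le (a k) (v - w k)"
    using expandsE[OF assms(1)] by metis
  show ?thesis
    using assms(2) by (intro expandsI[OF a(1,2)] le_mono[OF a(3)]) simp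
qed

lemma expands_scale:
  assumes "expands h v" "a \<in> laurent_x" "le a v'"
  shows "expands (a * h) (v' + v)"
proof -
  obtain c N where c: "h = (\<Sum>k<N. c k * m k)" "\<And>k. c k \<in> laurent_x" "\<And>k. le (c k) (v - w k)"
    using expandsE[OF assms(1)] by metis
  have "a * h = (\<Sum>k<N. (a * c k) * m k)"
    by (simp add: c(1) sum_distrib_left mult.assoc)
  then show ?thesis
    by (rule expandsI) (use assms c le_mult[OF assms(3) c(3)] in \<open>auto simp: add_diff_eq\<close>)
qed

lemma expands_standard:
  assumes "std b"
  shows "expands (mono b) (wt b)"
proof -
  define k where "k = dg b"
  have "mono b = (\<Sum>i<Suc k. (if i = k then 1 else 0) * m i)"
    using standard_mono[OF assms] by (simp add: k_def if_distrib[of "\<lambda>x. x * _"])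
  then show ?thesis
    by (rule expandsI) (use standard_wt[OF assms] le_cst[of 1] in \<open>auto simp: k_def\<close>)
qed

text \<open>Rewriting \<open>g\<^sub>i\<close> to the power \<open>\<alpha>\<^sub>i\<close> by the recursion for \<open>g\<^sub>i\<^sub>+\<^sub>1\<close> never raises the weight,
  and it either lowers the degree in y or keeps it and lowers the potential in the second component.\<close>

lemma expands_mono_any: "expands (mono b) (wt b)"
proof -
  \<comment> \<open>The weight \<open>n + 2 - i\<close> of \<open>g i\<close> falls with i, so
    trading a power of \<open>g i\<close> for one factor \<open>g (i + 1)\<close> lowers the
    potential even if \<open>\<alpha> i = 1\<close>.\<close>
  define M where "M = inv_image (less_than <*lex*> less_than)
    (\<lambda>b::nat \<Rightarrow> nat. (dg b, \<Sum>i=1..n+1. b i * (n + 2 - i)))"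
  have "wf M" by (auto simp: M_def)
  then show ?thesis
  proof (induction b rule: wf_induct_rule)
    case (less b)
    show ?case
    proof (cases "std b")
      case True
      then show ?thesis by (rule expands_standard)
    next
      case False
      then obtain i where i: "1 \<le> i" "i \<le> n" "\<alpha> i \<le> b i"
        unfolding std_def by (meson not_less)
      define c where "c = b(i := b i - \<alpha> i)"
      let ?s = "\<lambda>i k l. if l = i then k else (0::nat)"
      define b1 where "b1 = (\<lambda>l. c l + ?s (Suc i) 1 l)"
      define b2 where "b2 = (\<lambda>l. c l + btail i l)"
      have b: "b = (\<lambda>l. c l + ?s i (\<alpha> i) l)"
        using i by (auto simp: c_def)
      have dg: "dg b = dg c + \<alpha> i * yd i" "dg b1 = dg c + yd (Suc i)" "dg b2 = dg c + dg (btail i)"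
        using i unfolding b b1_def b2_def dg_add by (simp_all add: dg_single)
      have wt: "wt b = wt c + int (\<alpha> i) * \<omega> i" "wt b1 = wt c + \<omega> (Suc i)" "wt b2 = wt c + wt (btail i)"
        using i unfolding b b1_def b2_def wt_add by (simp_all add: wt_single)
      have mn: "mono b = mono c * g i ^ \<alpha> i" "mono b1 = mono c * g (Suc i)"
          "mono b2 = mono c * mono (btail i)"
        using i unfolding b b1_def b2_def mono_add by (simp_all add: mono_single)
      have sg: "(\<Sum>l=1..n+1. ?s j k l * (n + 2 - l)) = k * (n + 2 - j)" if "1 \<le> j" "j \<le> n + 1" for j k
        using that by (subst sum.remove[of _ j]) (auto intro!: sum.neutral)
      have "(\<Sum>l=1..n+1. b l * (n + 2 - l)) = (\<Sum>l=1..n+1. c l * (n + 2 - l)) + \<alpha> i * (n + 2 - i)"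
        unfolding b using sg[of i "\<alpha> i"] i by (simp add: add_mult_distrib sum.distrib)
      moreover have "(\<Sum>l=1..n+1. b1 l * (n + 2 - l)) = (\<Sum>l=1..n+1. c l * (n + 2 - l)) + (n + 2 - Suc i)"
        unfolding b1_def using sg[of "Suc i" 1] i by (simp add: add_mult_distrib sum.distrib)
      moreover have "n + 2 - Suc i < \<alpha> i * (n + 2 - i)"
      proof -
        have "n + 2 - Suc i < 1 * (n + 2 - i)" using i by simp
        also have "\<dots> \<le> \<alpha> i * (n + 2 - i)" using alpha_pos[of i] i by (intro mult_right_mono) auto
        finally show ?thesis .
      qed
      ultimately have "(b1, b) \<in> M"
        using i by (simp add: M_def dg yd_Suc mult.commute)
      moreover have "(b2, b) \<in> M"
      proof -
        have "dg (btail i) < 1 * yd i" using dg_btail_less[of i] i by simp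
        also have "\<dots> \<le> \<alpha> i * yd i" using alpha_pos[of i] i by (intro mult_right_mono) auto
        finally show ?thesis by (simp add: M_def dg)
      qed
      ultimately have IH: "expands (mono b1) (wt b1)" "expands (mono b2) (wt b2)"
        using less by auto
      have "mono b = mono b1 + (cst (\<theta> i) * X powi b0 i) * mono b2"
        using key_rec'[OF i(1,2)] by (simp add: mn algebra_simps)
      moreover have "expands (mono b1) (wt b)"
        using IH(1) omega_less[OF i(1,2)] by (auto intro: expands_mono simp: wt)
      moreover have "expands ((cst (\<theta> i) * X powi b0 i) * mono b2) (wt b)"
      proof -
        have "expands ((cst (\<theta> i) * X powi b0 i) * mono b2) (b0 i * \<omega> 0 + wt b2)"
          using IH(2) by (intro expands_scale laurent_x_mult laurent_x_cst laurent_x_powi)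
            (auto intro!: le_cst_mult simp: le_powi_X omega_0)
        then show ?thesis
          using wt_btail_eq[OF i(1,2)] by (simp add: wt algebra_simps)
      qed
      ultimately show ?thesis by (simp add: expands_add)
    qed
  qed
qed

text \<open>The expression that attains the minimum in (P3) may contain arbitrary monomials in the
  key forms; rewriting each of them into standard ones does not raise the weight.\<close>

lemma expands_self:
  assumes "h \<in> laurent_polys" "h \<noteq> 0"
  shows "expands h (\<delta> h)"
proof -
  obtain G where G: "G \<in> mixed_laurent n" "eval_at g n G = h" "weighted_degree (\<lambda>j. \<delta> (g j)) n G = \<delta> h"
    using key_repr[OF assms] by blast
  let ?K = "Poly_Mapping.keys G" and ?l = "Poly_Mapping.lookup"
  have "expands (cst (?l G e) * (\<Prod>j\<le>n+1. g j powi ?l e j)) (\<delta> h)" if e: "e \<in> ?K" for e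
  proof -
    have nn: "?l e j \<ge> 0" if "j \<ge> 1" for j
      using G(1) e that by (auto simp: mixed_laurent_def)
    have set: "{..n+1} = insert 0 {1..n+1}"
      by auto
    have "(\<Prod>j\<le>n+1. g j powi ?l e j) = X powi ?l e 0 * mono (\<lambda>j. nat (?l e j))"
      unfolding set mono_def using nn by (simp add: g_0 power_int_def)
    moreover have "(\<Sum>j\<le>n+1. ?l e j * \<delta> (g j)) = ?l e 0 * \<omega> 0 + wt (\<lambda>j. nat (?l e j))"
      unfolding set wt_def \<omega>_def using nn by simp
    moreover have "(\<Sum>j\<le>n+1. ?l e j * \<delta> (g j)) \<le> \<delta> h"
      unfolding G(3)[symmetric] weighted_degree_def using e by (intro Max_ge) auto
    moreover have "expands ((cst (?l G e) * X powi ?l e 0) * mono (\<lambda>j. nat (?l e j)))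
      (?l e 0 * \<omega> 0 + wt (\<lambda>j. nat (?l e j)))"
      by (intro expands_scale expands_mono_any laurent_x_mult laurent_x_cst laurent_x_powi)
        (auto intro!: le_cst_mult simp: le_powi_X omega_0)
    ultimately show ?thesis
      by (auto intro: expands_mono simp: mult.assoc)
  qed
  then show ?thesis
    unfolding G(2)[symmetric] eval_at_def by (intro expands_sum)
qed

section \<open>Expansions in the standard monomials\<close>

text \<open>The subtracted tail has smaller degree in y than the power in the recursion, so the
  power supplies the leading term.\<close>

lemma key_poly:
  assumes "1 \<le> j" "j \<le> n + 1"
  shows "\<exists>P\<in>laurent_coeffs. poly P Y = g j \<and> degree P = yd j \<and> lead_coeff P = 1"
  using assms
proof (induction j rule: less_induct)
  case (less j)
  define kp where "kp i P \<longleftrightarrow> P \<in> laurent_coeffs \<and> poly P Y = g i \<and> degree P = yd i \<and> lead_coeff P = 1" for i P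
  have "\<forall>i\<in>{1..<j}. \<exists>P. kp i P"
  proof
    fix i assume "i \<in> {1..<j}"
    then show "\<exists>P. kp i P"
      using less.IH[of i] less.prems unfolding kp_def by auto
  qed
  from bchoice[OF this] obtain P where "\<forall>i\<in>{1..<j}. kp i (P i)" ..
  then have kp: "kp i (P i)" if "1 \<le> i" "i < j" for i
    using that by simp
  have P: "P i \<in> laurent_coeffs" "poly (P i) Y = g i" "degree (P i) = yd i" "lead_coeff (P i) = 1"
    if "1 \<le> i" "i < j" for i
    using kp[OF that] by (auto simp: kp_def)
  show ?case
  proof (cases "j = 1")
    case True
    then show ?thesis
      using g_1 by (intro bexI[of _ "[:0, 1:]"]) auto
  next
    case False
    define i where "i = j - 1"
    have i: "1 \<le> i" "i \<le> n" "j = Suc i"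
      using False less.prems by (auto simp: i_def)
    define R where "R = (\<Prod>l=1..<i. P l ^ \<beta> i l)"
    define Q where "Q = P i ^ \<alpha> i - smult (cst (\<theta> i) * X powi b0 i) R"
    have "degree R \<le> sum (degree \<circ> (\<lambda>l. P l ^ \<beta> i l)) {1..<i}"
      unfolding R_def by (rule degree_prod_sum_le) simp
    also have "\<dots> \<le> (\<Sum>l=1..<i. \<beta> i l * yd l)"
    proof (intro sum_mono)
      fix l assume l: "l \<in> {1..<i}"
      have "degree (P l ^ \<beta> i l) \<le> degree (P l) * \<beta> i l"
        by (rule degree_power_le)
      then show "(degree \<circ> (\<lambda>l. P l ^ \<beta> i l)) l \<le> \<beta> i l * yd l"
        using P(3)[of l] l i by (simp add: mult.commute)
    qed
    also have "\<dots> < yd i"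
      using dg_btail_less[OF i(1,2)] by (simp add: dg_btail[OF i(1,2)])
    also have "yd i \<le> yd j"
      using yd_dvd[of i j] yd_pos[of j] i by (intro dvd_imp_le) auto
    finally have "degree R < yd j" .
    then have dR: "degree (smult (cst (\<theta> i) * X powi b0 i) R) < yd j"
      by (meson degree_smult_le order.strict_trans1)
    have lP: "lead_coeff (P i ^ \<alpha> i) = 1"
      using P(4)[of i] i by (simp add: lead_coeff_power)
    have dP: "degree (P i ^ \<alpha> i) = yd j"
      using P(3,4)[of i] i by (subst degree_power_eq) (auto simp: yd_Suc mult.commute)
    have c: "coeff Q (yd j) = 1"
      using dP lP coeff_eq_0[OF dR] unfolding Q_def coeff_diff by simp
    have "degree Q \<le> yd j"
      unfolding Q_def using dP dR by (intro degree_diff_le) auto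
    moreover have "yd j \<le> degree Q"
      using c by (intro le_degree) simp
    ultimately have "degree Q = yd j"
      by simp
    moreover have "Q \<in> laurent_coeffs"
      unfolding Q_def R_def
      by (intro laurent_coeffs_diff laurent_coeffs_smult laurent_coeffs_power laurent_coeffs_prod
          laurent_x_mult laurent_x_cst laurent_x_powi P(1)) (use i in auto)
    moreover have "poly Q Y = g j"
      using P(2) i key_rec[of i] by (simp add: Q_def R_def poly_prod)
    ultimately show ?thesis
      using c by auto
  qed
qed

definition gp :: "nat \<Rightarrow> ratfun poly" where
  "gp j = (SOME P. P \<in> laurent_coeffs \<and> poly P Y = g j \<and> degree P = yd j \<and> lead_coeff P = 1)"

lemma gp:
  assumes "1 \<le> j" "j \<le> n + 1"
  shows "gp j \<in> laurent_coeffs" "poly (gp j) Y = g j" "degree (gp j) = yd j" "lead_coeff (gp j) = 1"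
  using someI_ex[of "\<lambda>P. P \<in> laurent_coeffs \<and> poly P Y = g j \<and> degree P = yd j \<and> lead_coeff P = 1"]
    key_poly[OF assms] unfolding gp_def by blast+

lemma g_nonzero: "j \<le> n + 1 \<Longrightarrow> g j \<noteq> 0"
  using gp[of j] laurent_coeffs_eq_0[of "gp j"] g_0 by (cases "j = 0") auto

definition mp :: "nat \<Rightarrow> ratfun poly" where "mp k = (\<Prod>i=1..n+1. gp i ^ dig k i)"

lemma mp: "mp k \<in> laurent_coeffs" "poly (mp k) Y = m k" "degree (mp k) = k" "lead_coeff (mp k) = 1"
proof -
  show "mp k \<in> laurent_coeffs"
    unfolding mp_def using gp by (intro laurent_coeffs_prod laurent_coeffs_power) auto
  show "poly (mp k) Y = m k"
    unfolding mp_def m_def mono_def poly_prod using gp by (intro prod.cong) auto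
  show "lead_coeff (mp k) = 1"
    unfolding mp_def lead_coeff_prod using gp by (intro prod.neutral) (auto simp: lead_coeff_power)
  have nz: "gp i \<noteq> 0" if "i \<in> {1..n+1}" for i
    using gp(4)[of i] that by auto
  then have "degree (mp k) = (\<Sum>i=1..n+1. degree (gp i ^ dig k i))"
    unfolding mp_def by (intro degree_prod_eq_sum_degree) auto
  also have "\<dots> = dg (dig k)"
    unfolding dg_def by (intro sum.cong refl, subst degree_power_eq) (use nz gp(3) in auto)
  finally show "degree (mp k) = k" by (simp add: dg_dig)
qed

lemma coeff_mp [simp]: "coeff (mp k) k = 1" "k < l \<Longrightarrow> coeff (mp k) l = 0"
  using mp(3,4)[of k] by (auto intro: coeff_eq_0)

lemma mp_independent:
  assumes "(\<Sum>k<N. smult (c k) (mp k)) = 0" "k < N"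
  shows "c k = 0"
  using assms
proof (induction N)
  case (Suc N)
  have "coeff (\<Sum>k<N. smult (c k) (mp k)) N = 0"
    by (simp add: coeff_sum)
  then have "c N = 0"
    using arg_cong[OF Suc.prems(1), of "\<lambda>p. coeff p N"] by simp
  with Suc show ?case by (cases "k = N") auto
qed simp

text \<open>No cancellation between standard monomials: \<open>expands_self\<close> supplies an
  expansion whose terms all stay within \<open>\<delta> h\<close>, and since the polynomials
  \<open>mp k\<close> have different degrees, that expansion is the given one.\<close>

lemma expansion_value:
  assumes "\<And>k. k < N \<Longrightarrow> a k \<in> laurent_x" "k < N" "a k \<noteq> 0"
  defines "h \<equiv> \<Sum>k<N. a k * m k"
  shows "h \<noteq> 0" "\<delta> (a k) + w k \<le> \<delta> h"
proof -
  define P where "P = (\<Sum>k<N. smult (a k) (mp k))"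
  have P: "P \<in> laurent_coeffs" "poly P Y = h"
    unfolding P_def h_def using assms mp by (auto simp: poly_sum)
  have "P \<noteq> 0"
    using mp_independent[where N = N and c = a and k = k] assms(2,3) unfolding P_def by blast
  then have "h \<noteq> 0"
    using laurent_coeffs_eq_0[OF P(1)] P(2) by blast
  then have "expands h (\<delta> h)"
    using P by (intro expands_self) (metis laurent_polys_iff)
  then obtain c K where c: "h = (\<Sum>k<K. c k * m k)" "\<And>k. c k \<in> laurent_x" "\<And>k. le (c k) (\<delta> h - w k)"
    by (rule expandsE) (rule that)
  define L where "L = max N K"
  define a' where "a' k = (if k < N then a k else 0)" for k
  define c' where "c' k = (if k < K then c k else 0)" for k
  define Q where "Q = (\<Sum>k<L. smult (a' k - c' k) (mp k))"
  have "h = (\<Sum>k<L. a' k * m k)"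
    unfolding h_def by (rule sum.mono_neutral_cong_left) (auto simp: a'_def L_def)
  moreover have "h = (\<Sum>k<L. c' k * m k)"
    unfolding c(1) by (rule sum.mono_neutral_cong_left) (auto simp: c'_def L_def)
  ultimately have "(\<Sum>k<L. a' k * m k) - (\<Sum>k<L. c' k * m k) = 0"
    by simp
  then have "poly Q Y = 0"
    unfolding Q_def by (simp add: poly_sum mp left_diff_distrib sum_subtractf)
  moreover have "Q \<in> laurent_coeffs"
    unfolding Q_def using assms(1) c mp
    by (intro laurent_coeffs_sum laurent_coeffs_smult laurent_x_diff) (auto simp: a'_def c'_def)
  ultimately have "Q = 0"
    using laurent_coeffs_eq_0 by blast
  then have "a' k - c' k = 0"
    unfolding Q_def using assms(2) by (intro mp_independent[where N = L]) (auto simp: L_def)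
  then have "a k = c k"
    using assms(2,3) by (simp add: a'_def c'_def split: if_splits)
  then show "\<delta> (a k) + w k \<le> \<delta> h"
    using leD[OF c(3)[of k]] assms(3) by simp
  show "h \<noteq> 0" by fact
qed

end

section \<open>Leading forms\<close>

lemma sum_digits_less:
  fixes b \<alpha> :: "nat \<Rightarrow> nat" and c :: "nat \<Rightarrow> int"
  assumes "\<And>i. 1 \<le> i \<Longrightarrow> i < j \<Longrightarrow> b i < \<alpha> i"
    and "\<And>i. 1 \<le> i \<Longrightarrow> i < j \<Longrightarrow> int (\<alpha> i) * c i < c (i + 1)"
    and "\<And>i. 1 \<le> i \<Longrightarrow> i < j \<Longrightarrow> 0 \<le> c i" "2 \<le> j"
  shows "(\<Sum>i=1..<j. int (b i) * c i) < c j - c 1"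
proof -
  obtain k where k: "j = Suc k" "1 \<le> k"
    using assms(4) by (cases j) auto
  have "(\<Sum>i=1..<k. int (b i) * c i) \<le> c k - c 1"
    by (rule sum_digits_le[where \<alpha> = \<alpha>]) (use assms k in \<open>auto simp: less_imp_le\<close>)
  moreover have "int (b k) * c k \<le> (int (\<alpha> k) - 1) * c k"
  proof (rule mult_right_mono)
    show "int (b k) \<le> int (\<alpha> k) - 1" using assms(1)[of k] k by linarith
    show "0 \<le> c k" using assms(3)[of k] k by linarith
  qed
  moreover have "(int (\<alpha> k) - 1) * c k = int (\<alpha> k) * c k - c k"
    by (simp add: left_diff_distrib)
  moreover have "int (\<alpha> k) * c k < c (Suc k)"
    using assms(2)[of k] k by simp
  moreover have "(\<Sum>i=1..<j. int (b i) * c i) = (\<Sum>i=1..<k. int (b i) * c i) + int (b k) * c k"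
    unfolding k(1) using k(2) by (rule sum.atLeastLessThan_Suc)
  ultimately show ?thesis
    unfolding k(1) by linarith
qed

definition at0 :: "poly2 \<Rightarrow> complex poly" where
  "at0 F = map_poly (\<lambda>p. poly p 0) F"

interpretation at0: idom_hom at0
proof -
  interpret map_poly_idom_hom "\<lambda>p. poly p (0::complex)" ..
  show "idom_hom at0"
    by unfold_locales (simp_all add: at0_def hom_add hom_mult)
qed

lemma coeff_at0 [simp]: "coeff (at0 F) j = coeff (coeff F j) 0"
  by (simp add: at0_def coeff_map_poly poly_0_coeff_0)

lemma at0_pCons [simp]: "at0 (pCons p F) = pCons (coeff p 0) (at0 F)"
  by (rule poly_eqI) (simp add: coeff_pCons split: nat.splits)

lemma at0_smult [simp]: "at0 (smult p F) = smult (coeff p 0) (at0 F)"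
  by (rule poly_eqI) (simp add: coeff_mult)

lemma to_fract_smult: "to_fract (smult p F) = evx X p * to_fract F"
  by (simp add: evx_X flip: to_fract_mult)

lemma to_fract_X_power: "to_fract (smult (monom 1 k) F) = X ^ k * to_fract F"
  by (simp add: to_fract_smult)

lemma to_fract_power: "to_fract (a ^ k) = to_fract a ^ k"
  by (induction k) simp_all

lemma to_fract_prod: "to_fract (prod f A) = (\<Prod>i\<in>A. to_fract (f i))"
  by (induction A rule: infinite_finite_induct) simp_all

lemma powi_sum: "(x::ratfun) \<noteq> 0 \<Longrightarrow> x powi (sum f A) = (\<Prod>i\<in>A. x powi f i)"
  by (induction A rule: infinite_finite_induct) (simp_all add: power_int_add)

lemma X_powi_power: "(X powi a) ^ k = X powi (a * int k)"
  by (induction k) (simp_all add: power_int_add[symmetric] algebra_simps)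

text \<open>Two specializations occur. With \<open>p = q = 1\<close> and
  \<open>r = \<omega> 0\<close> the substitution passes to affine coordinates at [0:1:c]; with
  \<open>p = \<omega> 0\<close>, \<open>q = \<omega> 1\<close>, \<open>r = 1\<close>,
  \<open>c = 0\<close> it grades C[x,1/x,y] by the weights of x and y. In both, r is the weight
  given to 1/X: it matches the weight of x exactly and bounds that of y.\<close>

locale key_subst = key_data +
  fixes p q :: nat and r :: int and c :: complex
  assumes p_pos: "p > 0" and r_pos: "r > 0" and rp: "r * int p = \<omega> 0" and rq: "\<omega> 1 \<le> r * int q"
begin

definition \<Psi> :: "ratfun \<Rightarrow> ratfun" where
  "\<Psi> = frac_hom (ev2 (inverse X ^ p) ((Y + cst c) * inverse X ^ q))"

sublocale Psi: field_hom \<Psi>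
  unfolding \<Psi>_def by (rule field_hom_frac_hom[OF inj_ev2_monomial[OF p_pos]])

lemma Psi_to_fract: "\<Psi> (to_fract F) = ev2 (inverse X ^ p) ((Y + cst c) * inverse X ^ q) F"
  unfolding \<Psi>_def by (rule frac_hom_to_fract[OF inj_ev2_monomial[OF p_pos]])

lemma Psi_cst: "\<Psi> (cst a) = cst a"
  unfolding cst_def[of a] Psi_to_fract by simp (simp add: cst_def)

lemma Psi_X: "\<Psi> X = inverse X ^ p"
  by (subst X_def) (simp add: Psi_to_fract)

lemma Psi_Y: "\<Psi> Y = (Y + cst c) * inverse X ^ q"
  by (subst Y_def) (simp add: Psi_to_fract)

lemma Psi_ev2: "\<Psi> (ev2 s t F) = ev2 (\<Psi> s) (\<Psi> t) F"
  by (rule field_hom_ev2[OF Psi.field_hom_axioms Psi_cst])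

lemma Psi_evx: "\<Psi> (evx s F) = evx (\<Psi> s) F"
  using Psi_ev2[of s 1 "[:F:]"] by simp

lemma Psi_X_powi: "\<Psi> (X powi i) = X powi (- (int p * i))"
proof -
  have "\<Psi> X = X powi (- int p)"
    by (simp add: Psi_X power_int_minus power_inverse)
  then show ?thesis
    by (simp add: Psi.hom_powi flip: power_int_mult)
qed

text \<open>How far the value of \<open>g i\<close> lies below the weight of its leading power of y,
  if y has weight \<open>r * q\<close>.\<close>

definition gap :: "nat \<Rightarrow> int" where "gap i = r * int q * int (yd i) - \<omega> i"

lemma gap_step: "1 \<le> i \<Longrightarrow> i \<le> n \<Longrightarrow> int (\<alpha> i) * gap i < gap (i + 1)"
  using omega_less[of i] by (simp add: gap_def yd_Suc algebra_simps)

lemma gap_nonneg: "1 \<le> i \<Longrightarrow> i \<le> n + 1 \<Longrightarrow> 0 \<le> gap i"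
proof (induction i rule: dec_induct)
  case base
  then show ?case using rq by (simp add: gap_def)
next
  case (step i)
  then have "0 \<le> int (\<alpha> i) * gap i" by simp
  also have "\<dots> < gap (Suc i)" using gap_step[of i] step by simp
  finally show ?case by simp
qed

text \<open>After \<open>\<Psi>\<close> and removal of the power of X belonging to
  \<open>g (j + 1)\<close>, this exponent of X is left on the tail of the recursion. If it is
  positive, the tail disappears at X = 0.\<close>

definition ex :: "nat \<Rightarrow> int" where
  "ex j = int q * int (yd (Suc j)) - int p * b0 j - int q * int (dg (btail j))"

lemma r_ex:
  assumes "1 \<le> j" "j \<le> n"
  shows "r * ex j = int (\<alpha> j) * gap j - (\<Sum>i=1..<j. int (\<beta> j i) * gap i)"
proof -
  have "r * ex j = r * int q * int (yd j * \<alpha> j) - b0 j * (r * int p) - r * int q * int (dg (btail j))"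
    using assms by (simp add: ex_def yd_Suc algebra_simps)
  also have "\<dots> = int (\<alpha> j) * gap j + (int (\<alpha> j) * \<omega> j - b0 j * \<omega> 0) - r * int q * int (dg (btail j))"
    by (simp add: gap_def rp algebra_simps)
  also have "int (\<alpha> j) * \<omega> j - b0 j * \<omega> 0 = wt (btail j)"
    using wt_btail_eq[OF assms] by simp
  also have "int (\<alpha> j) * gap j + wt (btail j) - r * int q * int (dg (btail j)) =
      int (\<alpha> j) * gap j - (\<Sum>i=1..<j. int (\<beta> j i) * gap i)"
    unfolding wt_btail[OF assms] dg_btail[OF assms] gap_def
    by (simp add: right_diff_distrib sum_subtractf sum_distrib_left mult_ac)
  finally show ?thesis .
qed

lemma ex_1: "1 \<le> n \<Longrightarrow> r * ex 1 = int (\<alpha> 1) * (r * int q - \<omega> 1)"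
  using r_ex[of 1] by (simp add: gap_def)

text \<open>The exponents \<open>\<beta> j i\<close> are digits, so the defects of the factors of
  the tail add up to less than the defect of \<open>g j\<close> alone.\<close>

lemma ex_pos:
  assumes "2 \<le> j" "j \<le> n"
  shows "0 < ex j"
proof -
  have "(\<Sum>i=1..<j. int (\<beta> j i) * gap i) < gap j - gap 1"
    by (rule sum_digits_less[where \<alpha> = \<alpha>]) (use assms beta_less gap_step gap_nonneg in auto)
  moreover have "1 * gap j \<le> int (\<alpha> j) * gap j"
    using alpha_pos[of j] gap_nonneg[of j] assms by (intro mult_right_mono) auto
  moreover have "0 \<le> gap 1"
    using gap_nonneg[of 1] by simp
  ultimately have "0 < r * ex j"
    using r_ex[of j] assms by linarith
  then show ?thesis
    using r_pos by (simp add: zero_less_mult_iff)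
qed

lemma ex_nonneg: "1 \<le> j \<Longrightarrow> j \<le> n \<Longrightarrow> 0 \<le> ex j"
proof (cases "j = 1")
  case True
  assume "j \<le> n"
  then have "0 \<le> r * ex 1"
    using True rq by (subst ex_1) auto
  then show ?thesis
    using r_pos True by (simp add: zero_le_mult_iff)
qed (use ex_pos[of j] in auto)

text \<open>Restriction of the second key form to X = 0; its tail survives exactly if
  \<open>ex 1 = 0\<close>, that is, if \<open>\<omega> 1 = r * q\<close>.\<close>

definition \<kappa> :: "complex poly" where
  "\<kappa> = [:c, 1:] ^ \<alpha> 1 - (if ex 1 = 0 then [:\<theta> 1:] else 0)"

text \<open>Restriction of \<open>g j\<close> to X = 0. From the second recursion on all tails
  disappear, so only powers of \<open>\<kappa>\<close> arise.\<close>

definition gam :: "nat \<Rightarrow> complex poly" where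
  "gam j = (if j = 1 then [:c, 1:] else \<kappa> ^ (yd j div \<alpha> 1))"

lemma gam_Suc:
  assumes "2 \<le> j" "j \<le> n"
  shows "gam (Suc j) = gam j ^ \<alpha> j"
proof -
  have "\<alpha> 1 dvd yd j"
    using yd_dvd[of 2 j] assms by (simp add: yd_Suc[of 1, simplified] numeral_2_eq_2)
  then have "yd (Suc j) div \<alpha> 1 = (yd j div \<alpha> 1) * \<alpha> j"
    using assms by (simp add: yd_Suc div_mult_swap mult.commute)
  then show ?thesis
    using assms by (simp add: gam_def power_mult)
qed

lemma key_subst_poly:
  assumes "1 \<le> j" "j \<le> n + 1"
  shows "\<exists>G. \<Psi> (g j) = X powi (- (int q * int (yd j))) * to_fract G \<and> at0 G = gam j"
  using assms
proof (induction j rule: less_induct)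
  case (less j)
  show ?case
  proof (cases "j = 1")
    case True
    have "to_fract [:[:c:], 1:] = Y + cst c"
      unfolding Y_def cst_def by (simp flip: to_fract_add)
    then have "\<Psi> (g j) = X powi (- (int q * int (yd j))) * to_fract [:[:c:], 1:]"
      using True by (simp add: g_1[simplified] Psi_Y power_int_minus power_inverse mult.commute)
    then show ?thesis
      using True by (intro exI[of _ "[:[:c:], 1:]"]) (simp add: gam_def)
  next
    case False
    define i where "i = j - 1"
    have i: "1 \<le> i" "i \<le> n" "j = Suc i"
      using False less.prems by (auto simp: i_def)
    have "\<forall>l\<in>{1..<j}. \<exists>G. \<Psi> (g l) = X powi (- (int q * int (yd l))) * to_fract G \<and> at0 G = gam l"
      using less by auto
    from bchoice[OF this] obtain G where "\<forall>l\<in>{1..<j}. \<Psi> (g l) = X powi (- (int q * int (yd l))) * to_fract (G l) \<and>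
        at0 (G l) = gam l" ..
    then have G: "\<Psi> (g l) = X powi (- (int q * int (yd l))) * to_fract (G l)" "at0 (G l) = gam l"
      if "1 \<le> l" "l < j" for l
      using that by auto
    define R where "R = (\<Prod>l=1..<i. G l ^ \<beta> i l)"
    \<comment> \<open>The exponent \<open>ex i\<close> is nonnegative, so \<open>nat\<close> loses
      nothing and Q is a polynomial.\<close>
    define Q where "Q = G i ^ \<alpha> i - smult (monom (\<theta> i) (nat (ex i))) R"
    have "\<Psi> (mono (btail i)) = (\<Prod>l=1..<i. (X powi (- (int q * int (yd l))) * to_fract (G l)) ^ \<beta> i l)"
      unfolding mono_btail[OF i(1,2)] using G i by (simp add: Psi.hom_prod Psi.hom_power)
    also have "\<dots> = (\<Prod>l=1..<i. X powi (- (int q * int (\<beta> i l * yd l)))) * to_fract R"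
      by (simp add: R_def power_mult_distrib prod.distrib to_fract_prod to_fract_power mult_ac X_powi_power)
    also have "(\<Prod>l=1..<i. X powi (- (int q * int (\<beta> i l * yd l)))) = X powi (\<Sum>l=1..<i. - (int q * int (\<beta> i l * yd l)))"
      by (simp add: powi_sum)
    also have "(\<Sum>l=1..<i. - (int q * int (\<beta> i l * yd l))) = - (int q * int (dg (btail i)))"
      unfolding dg_btail[OF i(1,2)] by (simp add: sum_negf sum_distrib_left)
    finally have tail: "\<Psi> (mono (btail i)) = X powi (- (int q * int (dg (btail i)))) * to_fract R" .
    have "g j = g i ^ \<alpha> i - cst (\<theta> i) * X powi b0 i * mono (btail i)"
      using key_rec'[OF i(1,2)] i by simp
    then have "\<Psi> (g j) = (X powi (- (int q * int (yd i))) * to_fract (G i)) ^ \<alpha> i -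
        cst (\<theta> i) * X powi (- (int p * b0 i)) * (X powi (- (int q * int (dg (btail i)))) * to_fract R)"
      using G(1)[of i] i by (simp add: Psi.hom_minus Psi.hom_power Psi.hom_mult Psi_cst Psi_X_powi tail)
    also have "(X powi (- (int q * int (yd i))) * to_fract (G i)) ^ \<alpha> i =
        X powi (- (int q * int (yd j))) * to_fract (G i ^ \<alpha> i)"
      using i by (simp add: yd_Suc power_mult_distrib to_fract_power mult_ac X_powi_power)
    also have "cst (\<theta> i) * X powi (- (int p * b0 i)) * (X powi (- (int q * int (dg (btail i)))) * to_fract R) =
        X powi (- (int q * int (yd j))) * to_fract (smult (monom (\<theta> i) (nat (ex i))) R)"
    proof -
      have "X powi (- (int p * b0 i)) * X powi (- (int q * int (dg (btail i)))) =
          X powi (- (int q * int (yd j))) * X powi ex i"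
        using i by (simp add: ex_def flip: power_int_add)
      moreover have "X powi ex i = X ^ nat (ex i)"
        using ex_nonneg[OF i(1,2)] by (simp add: power_int_def)
      ultimately show ?thesis
        by (simp add: to_fract_smult mult_ac)
    qed
    finally have "\<Psi> (g j) = X powi (- (int q * int (yd j))) * to_fract Q"
      by (simp add: Q_def right_diff_distrib)
    moreover have "at0 Q = gam j"
    proof (cases "i = 1")
      case True
      then have "at0 Q = gam 1 ^ \<alpha> 1 - smult (if ex 1 = 0 then \<theta> 1 else 0) 1"
        using ex_nonneg[of 1] G(2)[of 1] i
        by (auto simp: Q_def R_def at0.hom_minus at0.hom_power coeff_monom)
      also have "\<dots> = gam j"
        using i True alpha_pos[of 1] by (simp add: gam_def \<kappa>_def yd_Suc one_pCons)
      finally show ?thesis .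
    next
      case False
      then have "2 \<le> i" "nat (ex i) \<noteq> 0"
        using i ex_pos[of i] by auto
      then show ?thesis
        using G(2)[of i] i gam_Suc[of i] by (simp add: Q_def at0.hom_minus at0.hom_power coeff_monom)
    qed
    ultimately show ?thesis by blast
  qed
qed

text \<open>Restriction of the standard monomial \<open>m k\<close> to X = 0. It is monic of degree
  k, so these restrictions are again linearly independent.\<close>

definition nu :: "nat \<Rightarrow> complex poly" where
  "nu k = (if n = 0 then [:c, 1:] ^ k else [:c, 1:] ^ (k mod \<alpha> 1) * \<kappa> ^ (k div \<alpha> 1))"

lemma kappa_monic:
  assumes "1 \<le> n"
  shows "degree \<kappa> = \<alpha> 1" "lead_coeff \<kappa> = 1"
proof -
  let ?C = "if ex 1 = 0 then [:\<theta> 1:] else 0"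
  have d: "degree ([:c, 1:] ^ \<alpha> 1) = \<alpha> 1" "lead_coeff ([:c, 1:] ^ \<alpha> 1) = 1"
    by (simp add: degree_power_eq, subst lead_coeff_power, simp)
  have "degree ?C < \<alpha> 1"
    using alpha_pos[of 1] assms by simp
  then have C: "degree ?C < degree ([:c, 1:] ^ \<alpha> 1)" using d by simp
  have "degree (- ?C) < degree ([:c, 1:] ^ \<alpha> 1)" using C by (simp only: degree_minus)
  from degree_add_eq_left[OF this] show "degree \<kappa> = \<alpha> 1"
    unfolding \<kappa>_def d by simp
  have "coeff ?C (\<alpha> 1) = 0"
    using \<open>degree ?C < \<alpha> 1\<close> by (rule coeff_eq_0)
  moreover have "coeff ([:c, 1:] ^ \<alpha> 1) (\<alpha> 1) = 1"
    using d by metis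
  ultimately show "lead_coeff \<kappa> = 1"
    unfolding \<open>degree \<kappa> = \<alpha> 1\<close> unfolding \<kappa>_def coeff_diff by (simp only: diff_0_right)
qed

lemma nu_monic: "degree (nu k) = k" "lead_coeff (nu k) = 1"
proof -
  have nz: "\<kappa> \<noteq> 0" if "n \<noteq> 0"
    using kappa_monic that by auto
  show "degree (nu k) = k"
    using nz kappa_monic(1) by (auto simp: nu_def degree_mult_eq degree_power_eq Suc_le_eq)
  show "lead_coeff (nu k) = 1"
    using kappa_monic(2) by (auto simp: nu_def lead_coeff_mult lead_coeff_power Suc_le_eq)
qed

lemma mono_subst_poly:
  "\<exists>G. \<Psi> (m k) = X powi (- (int q * int k)) * to_fract G \<and> at0 G = nu k"
proof -
  have "\<forall>l\<in>{1..n+1}. \<exists>G. \<Psi> (g l) = X powi (- (int q * int (yd l))) * to_fract G \<and> at0 G = gam l"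
    using key_subst_poly by auto
  from bchoice[OF this] obtain G where G: "\<forall>l\<in>{1..n+1}. \<Psi> (g l) = X powi (- (int q * int (yd l))) * to_fract (G l) \<and>
      at0 (G l) = gam l" ..
  define R where "R = (\<Prod>l=1..n+1. G l ^ dig k l)"
  have "\<Psi> (m k) = (\<Prod>l=1..n+1. (X powi (- (int q * int (yd l))) * to_fract (G l)) ^ dig k l)"
    unfolding m_def mono_def Psi.hom_prod Psi.hom_power using G by (intro prod.cong) auto
  also have "\<dots> = (\<Prod>l=1..n+1. X powi (- (int q * int (dig k l * yd l)))) * to_fract R"
    by (simp add: R_def power_mult_distrib prod.distrib to_fract_prod to_fract_power mult_ac X_powi_power)
  also have "(\<Prod>l=1..n+1. X powi (- (int q * int (dig k l * yd l)))) = X powi (\<Sum>l=1..n+1. - (int q * int (dig k l * yd l)))"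
    by (rule powi_sum[symmetric]) simp
  also have "(\<Sum>l=1..n+1. - (int q * int (dig k l * yd l))) = - (int q * int (dg (dig k)))"
    unfolding dg_def by (simp only: sum_negf sum_distrib_left of_nat_sum)
  finally have "\<Psi> (m k) = X powi (- (int q * int k)) * to_fract R"
    by (simp add: dg_dig)
  moreover have "at0 R = nu k"
  proof -
    have R: "at0 R = (\<Prod>l=1..n+1. gam l ^ dig k l)"
      unfolding R_def at0.hom_prod at0.hom_power using G by (intro prod.cong) auto
    show ?thesis
    proof (cases "n = 0")
      case True
      have "at0 R = (\<Prod>l\<in>{1}. gam l ^ dig k l)"
        unfolding R using True by (intro prod.cong) auto
      also have "\<dots> = gam 1 ^ dig k 1"
        by simp
      also have "dig k 1 = k"
      proof -
        have "\<not> 1 \<le> n" using True by simp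
        then show ?thesis unfolding dig_def if_not_P[OF \<open>\<not> 1 \<le> n\<close>] by simp
      qed
      also have "gam 1 = [:c, 1:]" by (simp add: gam_def)
      also have "[:c, 1:] ^ k = nu k" unfolding nu_def if_P[OF True] ..
      finally show ?thesis .
    next
      case False
      \<comment> \<open>All degrees \<open>yd l\<close> with l at least 2 are multiples of
        \<open>\<alpha> 1\<close>, so the digits above the first one add up to the exponent
        \<open>k div \<alpha> 1\<close> of \<open>\<kappa>\<close>.\<close>
      define S where "S = (\<Sum>l=2..n+1. dig k l * (yd l div \<alpha> 1))"
      have set: "{1..n+1} = insert 1 {2..n+1}" by auto
      have "(\<Sum>l=2..n+1. dig k l * yd l) = \<alpha> 1 * S"
        unfolding S_def sum_distrib_left
      proof (intro sum.cong refl)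
        fix l assume "l \<in> {2..n+1}"
        then have "\<alpha> 1 dvd yd l"
          using yd_dvd[of 2 l] by (simp add: yd_Suc[of 1, simplified] numeral_2_eq_2)
        then show "dig k l * yd l = \<alpha> 1 * (dig k l * (yd l div \<alpha> 1))"
          by auto
      qed
      moreover have "k = dig k 1 + (\<Sum>l=2..n+1. dig k l * yd l)"
        using dg_dig[of k] unfolding dg_def set by simp
      moreover have "dig k 1 = k mod \<alpha> 1" "\<alpha> 1 > 0"
        using False alpha_pos[of 1] by (simp_all add: dig_def)
      ultimately have "S = k div \<alpha> 1"
        by (metis add_left_cancel mod_mult_div_eq mult_cancel1 not_gr_zero)
      moreover have "(\<Prod>l=2..n+1. gam l ^ dig k l) = \<kappa> ^ S"
        unfolding S_def power_sum by (intro prod.cong) (auto simp: gam_def mult.commute simp flip: power_mult)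
      moreover have "at0 R = gam 1 ^ dig k 1 * (\<Prod>l=2..n+1. gam l ^ dig k l)"
        unfolding R set by simp
      ultimately show ?thesis
        using False by (simp add: nu_def gam_def dig_def)
    qed
  qed
  ultimately show ?thesis by blast
qed

text \<open>1/X becomes \<open>X ^ p\<close>, so the cofactor with nonzero constant term stays a
  polynomial that does not vanish at X = 0.\<close>

lemma laurent_x_subst:
  assumes "a \<in> laurent_x" "a \<noteq> 0"
  obtains i A where "\<delta> a = i * \<omega> 0" "coeff A 0 \<noteq> 0" "\<Psi> a = X powi (- (int p * i)) * to_fract [:A:]"
proof -
  obtain i A where A: "a = X powi i * evx (inverse X) A" "coeff A 0 \<noteq> 0" "\<delta> a = i * \<delta> X"
    using laurent_x_cases'[OF assms] .
  have "\<Psi> (inverse X) = X ^ p"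
    by (simp add: Psi.hom_inverse Psi_X flip: power_inverse)
  then have "\<Psi> (evx (inverse X) A) = evx (X ^ p) A"
    by (simp add: Psi_evx)
  also have "\<dots> = evx X (pcompose A (monom 1 p))"
    unfolding evx_def by (simp add: cst.map_poly_pcompose poly_pcompose poly_monom)
  also have "\<dots> = to_fract [:pcompose A (monom 1 p):]"
    by (rule evx_X)
  finally have "\<Psi> a = X powi (- (int p * i)) * to_fract [:pcompose A (monom 1 p):]"
    by (simp add: A(1) Psi.hom_mult Psi_X_powi)
  moreover have "coeff (pcompose A (monom 1 p)) 0 \<noteq> 0"
  proof -
    have "coeff (pcompose A (monom 1 p)) 0 = poly A (coeff (monom 1 p) 0)"
      by (rule coeff_pcompose_0)
    also have "coeff (monom (1::complex) p) 0 = 0"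
      using p_pos by (simp add: coeff_monom)
    finally show ?thesis
      using A(2) by (metis poly_0_coeff_0)
  qed
  ultimately show ?thesis
    using A(3) by (intro that[of i "pcompose A (monom 1 p)"]) (simp only: omega_0)
qed

text \<open>The lowest coefficient in X of \<open>\<Psi> h\<close> is a combination of the independent polynomials
  \<open>nu k\<close>, and each of the terms occurring in it bounds \<open>\<delta> h\<close> from below.\<close>

lemma leading_form:
  assumes "h \<in> laurent_polys" "h \<noteq> 0"
  obtains W T cf F where
    "X powi W * \<Psi> h = to_fract F" "at0 F = (\<Sum>k\<in>T. smult (cf k) (nu k))"
    "finite T" "T \<noteq> {}" "\<And>k. k \<in> T \<Longrightarrow> cf k \<noteq> 0"
    "\<And>k. k \<in> T \<Longrightarrow> r * (W - int q * int k) + w k \<le> \<delta> h"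
    "\<And>k. k \<in> T \<Longrightarrow> int p dvd W - int q * int k"
proof -
  obtain a N where a: "h = (\<Sum>k<N. a k * m k)" "\<And>k. a k \<in> laurent_x" "\<And>k. le (a k) (\<delta> h - w k)"
    using expands_self[OF assms] by (rule expandsE) (rule that)
  define S where "S = {k\<in>{..<N}. a k \<noteq> 0}"
  have hS: "h = (\<Sum>k\<in>S. a k * m k)"
    unfolding a(1) S_def by (rule sum.mono_neutral_cong_right) auto
  have "finite S" by (simp add: S_def)
  have "S \<noteq> {}" using hS assms(2) by auto
  have "\<forall>k\<in>S. \<exists>i A. \<delta> (a k) = i * \<omega> 0 \<and> coeff A 0 \<noteq> 0 \<and> \<Psi> (a k) = X powi (- (int p * i)) * to_fract [:A:]"
    using laurent_x_subst[OF a(2)] unfolding S_def by (smt (verit) mem_Collect_eq)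
  from bchoice[OF this] obtain I where
    "\<forall>k\<in>S. \<exists>A. \<delta> (a k) = I k * \<omega> 0 \<and> coeff A 0 \<noteq> 0 \<and> \<Psi> (a k) = X powi (- (int p * I k)) * to_fract [:A:]" ..
  from bchoice[OF this] obtain A where IA:
    "\<forall>k\<in>S. \<delta> (a k) = I k * \<omega> 0 \<and> coeff (A k) 0 \<noteq> 0 \<and> \<Psi> (a k) = X powi (- (int p * I k)) * to_fract [:A k:]" ..
  have "\<forall>k. \<exists>G. \<Psi> (m k) = X powi (- (int q * int k)) * to_fract G \<and> at0 G = nu k"
    using mono_subst_poly by blast
  from choice[OF this] obtain G where
    G: "\<forall>k. \<Psi> (m k) = X powi (- (int q * int k)) * to_fract (G k) \<and> at0 (G k) = nu k" ..
  \<comment> \<open>The pole order in X of the k-th term after \<open>\<Psi>\<close>; W is the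
    largest one and T collects the terms that reach it.\<close>
  define e where "e k = int p * I k + int q * int k" for k
  define W where "W = Max (e ` S)"
  define T where "T = {k\<in>S. e k = W}"
  have eW: "e k \<le> W" if "k \<in> S" for k
    using that \<open>finite S\<close> by (simp add: W_def)
  define F where "F = (\<Sum>k\<in>S. smult (monom 1 (nat (W - e k)) * A k) (G k))"
  have "X powi W * \<Psi> h = (\<Sum>k\<in>S. X powi W * (\<Psi> (a k) * \<Psi> (m k)))"
    by (simp add: hS Psi.hom_sum Psi.hom_mult sum_distrib_left)
  also have "\<dots> = (\<Sum>k\<in>S. to_fract (smult (monom 1 (nat (W - e k)) * A k) (G k)))"
  proof (intro sum.cong refl)
    fix k assume k: "k \<in> S"
    have "X powi W * (\<Psi> (a k) * \<Psi> (m k)) =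
        (X powi W * X powi (- (int p * I k)) * X powi (- (int q * int k))) * (evx X (A k) * to_fract (G k))"
      using IA G k by (simp add: evx_X mult_ac)
    also have "X powi W * X powi (- (int p * I k)) * X powi (- (int q * int k)) = X powi (W - e k)"
      by (simp add: e_def diff_diff_eq flip: power_int_add)
    also have "\<dots> = X ^ nat (W - e k)"
      using eW[OF k] by (simp add: power_int_def)
    finally show "X powi W * (\<Psi> (a k) * \<Psi> (m k)) = to_fract (smult (monom 1 (nat (W - e k)) * A k) (G k))"
      by (simp add: to_fract_smult evx.hom_mult mult.assoc)
  qed
  finally have "X powi W * \<Psi> h = to_fract F"
    by (simp add: F_def)
  moreover have "at0 F = (\<Sum>k\<in>T. smult (coeff (A k) 0) (nu k))"
  proof -
    have "at0 F = (\<Sum>k\<in>S. smult (if e k = W then coeff (A k) 0 else 0) (nu k))"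
      unfolding F_def at0.hom_sum
    proof (intro sum.cong refl)
      fix k assume "k \<in> S"
      then show "at0 (smult (monom 1 (nat (W - e k)) * A k) (G k)) = smult (if e k = W then coeff (A k) 0 else 0) (nu k)"
        using G eW[of k] by (auto simp: coeff_mult coeff_monom)
    qed
    also have "\<dots> = (\<Sum>k\<in>T. smult (coeff (A k) 0) (nu k))"
      unfolding T_def using \<open>finite S\<close> by (intro sum.mono_neutral_cong_right) auto
    finally show ?thesis .
  qed
  moreover have "finite T" using \<open>finite S\<close> by (simp add: T_def)
  moreover have "T \<noteq> {}"
  proof -
    have "W \<in> e ` S"
      unfolding W_def using \<open>finite S\<close> \<open>S \<noteq> {}\<close> by (intro Max_in) auto
    then show ?thesis by (auto simp: T_def)
  qed
  moreover have "coeff (A k) 0 \<noteq> 0" if "k \<in> T" for k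
    using that IA by (auto simp: T_def)
  \<comment> \<open>For k in T the difference \<open>W - q * k\<close> is \<open>p * I k\<close>,
    and \<open>r * p = \<omega> 0\<close> turns it into the value of the coefficient
    \<open>a k\<close>.\<close>
  moreover have "r * (W - int q * int k) + w k \<le> \<delta> h" if "k \<in> T" for k
  proof -
    have k: "k \<in> S" "W - int q * int k = int p * I k"
      using that by (auto simp: T_def e_def)
    have "r * (W - int q * int k) = \<delta> (a k)"
      using IA k rp by (simp add: mult_ac)
    moreover have "\<delta> (a k) \<le> \<delta> h - w k"
      using a(3)[of k] k by (auto simp: S_def dest: leD)
    ultimately show ?thesis by simp
  qed
  moreover have "int p dvd W - int q * int k" if "k \<in> T" for k
    using that by (auto simp: T_def e_def)
  ultimately show ?thesis by (rule that)
qed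

lemma nu_sum:
  assumes "finite T" "T \<noteq> {}" "\<And>k. k \<in> T \<Longrightarrow> cf k \<noteq> 0"
  shows "degree (\<Sum>k\<in>T. smult (cf k) (nu k)) = Max T" "(\<Sum>k\<in>T. smult (cf k) (nu k)) \<noteq> 0"
proof -
  let ?P = "\<Sum>k\<in>T. smult (cf k) (nu k)" and ?k = "Max T"
  have k: "?k \<in> T" using assms by simp
  have "(\<Sum>k\<in>T - {?k}. coeff (smult (cf k) (nu k)) ?k) = 0"
  proof (rule sum.neutral, rule ballI)
    fix k assume "k \<in> T - {?k}"
    then have "k < ?k" using assms(1) by (simp add: order_less_le)
    then show "coeff (smult (cf k) (nu k)) ?k = 0"
      using nu_monic(1)[of k] by (simp add: coeff_eq_0)
  qed
  then have "coeff ?P ?k = cf ?k * coeff (nu ?k) ?k"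
    unfolding sum.remove[OF assms(1) k] coeff_add coeff_sum by simp
  also have "coeff (nu ?k) ?k = 1"
    using nu_monic[of ?k] by simp
  finally have c: "coeff ?P ?k \<noteq> 0"
    using assms(3)[OF k] by simp
  moreover have "degree ?P \<le> ?k"
  proof (rule degree_sum_le[OF assms(1)])
    fix k assume "k \<in> T"
    then show "degree (smult (cf k) (nu k)) \<le> ?k"
      using assms(1) nu_monic(1)[of k] by (auto intro: order.trans[OF degree_smult_le])
  qed
  ultimately show "degree ?P = ?k"
    by (intro antisym le_degree)
  show "?P \<noteq> 0" using c by auto
qed

end

section \<open>Supports of polynomials in two variables\<close>

definition supp :: "poly2 \<Rightarrow> (nat \<times> nat) set" where
  "supp F = {(i, j). coeff (coeff F j) i \<noteq> 0}"

abbreviation cf :: "poly2 \<Rightarrow> nat \<times> nat \<Rightarrow> complex" where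
  "cf F z \<equiv> coeff (coeff F (snd z)) (fst z)"

text \<open>Monomial changes of variables (charts, homogenization, weighted shifts) with the
  denominators already cleared in the exponents, so that the result is a polynomial.\<close>

definition relabel :: "(nat \<times> nat \<Rightarrow> nat \<times> nat) \<Rightarrow> poly2 \<Rightarrow> poly2" where
  "relabel \<phi> F = (\<Sum>z\<in>supp F. monom (monom (cf F z) (fst (\<phi> z))) (snd (\<phi> z)))"

lemma supp_sub: "supp F \<subseteq> (\<Union>j\<in>{..degree F}. (\<lambda>i. (i, j)) ` {..degree (coeff F j)})"
proof
  fix z assume z: "z \<in> supp F"
  obtain i j where ij: "z = (i, j)" by fastforce
  have "coeff (coeff F j) i \<noteq> 0" using z ij by (simp add: supp_def)
  then have "i \<le> degree (coeff F j)" "j \<le> degree F"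
    by (auto intro!: le_degree)
  then show "z \<in> (\<Union>j\<in>{..degree F}. (\<lambda>i. (i, j)) ` {..degree (coeff F j)})"
    using ij by auto
qed

lemma finite_supp [simp]: "finite (supp F)"
  by (rule finite_subset[OF supp_sub]) auto

lemma supp_empty: "supp F = {} \<longleftrightarrow> F = 0"
  by (auto simp: supp_def poly_eq_iff)

lemma mem_supp: "z \<in> supp F \<longleftrightarrow> cf F z \<noteq> 0"
  by (cases z) (simp add: supp_def)

lemma ev2_supp: "ev2 s t F = (\<Sum>z\<in>supp F. cst (cf F z) * s ^ fst z * t ^ snd z)"
proof -
  let ?f = "\<lambda>z. cst (cf F z) * s ^ fst z * t ^ snd z"
  have "ev2 s t F = (\<Sum>j\<le>degree F. \<Sum>i\<le>degree (coeff F j). ?f (i, j))"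
    by (simp add: ev2_altdef evx_altdef sum_distrib_right)
  also have "\<dots> = (\<Sum>j\<le>degree F. \<Sum>z\<in>(\<lambda>i. (i, j)) ` {..degree (coeff F j)}. ?f z)"
    by (intro sum.cong refl, subst sum.reindex) (auto simp: inj_on_def)
  also have "\<dots> = (\<Sum>z\<in>(\<Union>j\<in>{..degree F}. (\<lambda>i. (i, j)) ` {..degree (coeff F j)}). ?f z)"
    by (rule sum.UNION_disjoint[symmetric]) auto
  also have "\<dots> = (\<Sum>z\<in>supp F. ?f z)"
    using supp_sub[of F] by (intro sum.mono_neutral_right) (auto simp: mem_supp)
  finally show ?thesis .
qed

lemma ev2_relabel:
  "ev2 s t (relabel \<phi> F) = (\<Sum>z\<in>supp F. cst (cf F z) * s ^ fst (\<phi> z) * t ^ snd (\<phi> z))"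
  by (simp add: relabel_def ev2.hom_sum)

lemma coeff_relabel:
  "coeff (coeff (relabel \<phi> F) j) i = (\<Sum>z\<in>supp F. if \<phi> z = (i, j) then cf F z else 0)"
  unfolding relabel_def coeff_sum by (intro sum.cong refl) (auto simp: coeff_monom prod_eq_iff)

lemma relabel_nonzero:
  assumes "coeff (coeff (relabel \<phi> F) j) i \<noteq> 0"
  obtains z where "z \<in> supp F" "\<phi> z = (i, j)"
proof -
  have "\<exists>z\<in>supp F. \<phi> z = (i, j)"
  proof (rule ccontr)
    assume "\<not> ?thesis"
    then have "coeff (coeff (relabel \<phi> F) j) i = 0"
      unfolding coeff_relabel by (intro sum.neutral) auto
    with assms show False by simp
  qed
  with that show ?thesis by blast
qed

lemma relabel_inj:
  assumes "inj_on \<phi> (supp F)" "z \<in> supp F" "\<phi> z = (i, j)"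
  shows "coeff (coeff (relabel \<phi> F) j) i = cf F z"
proof -
  have "(\<Sum>z'\<in>supp F. if \<phi> z' = (i, j) then cf F z' else 0) = (\<Sum>z'\<in>supp F. if z' = z then cf F z' else 0)"
  proof (intro sum.cong refl)
    fix z' assume "z' \<in> supp F"
    then have "\<phi> z' = (i, j) \<longleftrightarrow> z' = z"
      using inj_onD[OF assms(1), of z' z] assms(2,3) by metis
    then show "(if \<phi> z' = (i, j) then cf F z' else 0) = (if z' = z then cf F z' else 0)"
      by simp
  qed
  then show ?thesis
    using assms by (simp add: coeff_relabel)
qed

lemma to_fract_laurent: "to_fract f \<in> laurent_polys"
  unfolding laurent_polys_def polys_def by (rule CollectI, rule exI[of _ 0]) simp

text \<open>The order of F(0, v), which is the local intersection multiplicity of F = 0 with the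
  line at infinity when u is a local equation of that line.\<close>

definition low_order :: "poly2 \<Rightarrow> nat \<Rightarrow> bool" where
  "low_order F k \<longleftrightarrow> (\<forall>j<k. coeff (coeff F j) 0 = 0) \<and> coeff (coeff F k) 0 \<noteq> 0"

section \<open>Slopes of the key forms\<close>

context key_data
begin

text \<open>Value of the last key form per degree in y; by \<open>tau_le\<close> the smallest such
  quotient among the key forms from y on.\<close>

definition \<tau> :: real where "\<tau> = of_int (\<omega> (n + 1)) / of_nat (yd (n + 1))"

lemma tau_yd: "\<tau> * real (yd (n + 1)) = of_int (\<omega> (n + 1))"
  using yd_pos[of "n + 1"] by (simp add: \<tau>_def)

text \<open>From i to i + 1 the degree is multiplied by \<open>\<alpha> i\<close>, while the value
  grows by less than this factor; so the quotients decrease strictly.\<close>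

lemma tau_less:
  assumes "1 \<le> i" "i \<le> n"
  shows "\<tau> * real (yd i) < of_int (\<omega> i)"
proof -
  have step: "of_int (\<omega> (Suc i)) < real (\<alpha> i) * of_int (\<omega> i)" if "1 \<le> i" "i \<le> n" for i
    using omega_less[OF that] by (metis of_int_less_iff of_int_mult of_int_of_nat_eq)
  have le: "\<tau> * real (yd i) \<le> of_int (\<omega> i)" if "1 \<le> i" "i \<le> n + 1" for i
    using that(2,1)
  proof (induction i rule: inc_induct)
    case base
    then show ?case using tau_yd by simp
  next
    case (step i)
    have "\<tau> * real (yd (Suc i)) \<le> of_int (\<omega> (Suc i))"
      using step by simp
    also have "\<dots> < real (\<alpha> i) * of_int (\<omega> i)"
      using \<open>\<And>i. 1 \<le> i \<Longrightarrow> i \<le> n \<Longrightarrow> of_int (\<omega> (Suc i)) < real (\<alpha> i) * of_int (\<omega> i)\<close> step by simp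
    finally have "real (\<alpha> i) * (\<tau> * real (yd i)) < real (\<alpha> i) * of_int (\<omega> i)"
      using step by (simp add: yd_Suc mult_ac)
    then show ?case
      by (simp add: mult_less_cancel_left)
  qed
  have "real (\<alpha> i) * (\<tau> * real (yd i)) = \<tau> * real (yd (Suc i))"
    using assms by (simp add: yd_Suc)
  also have "\<dots> \<le> of_int (\<omega> (Suc i))"
    using le[of "Suc i"] assms by simp
  also have "\<dots> < real (\<alpha> i) * of_int (\<omega> i)"
    using step assms by simp
  finally show ?thesis
    by (simp add: mult_less_cancel_left)
qed

lemma tau_le: "1 \<le> i \<Longrightarrow> i \<le> n + 1 \<Longrightarrow> \<tau> * real (yd i) \<le> of_int (\<omega> i)"
  using tau_less[of i] tau_yd by (cases "i = n + 1") (auto simp: less_imp_le)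

lemma w_excess:
  "of_int (w k) - \<tau> * real k = (\<Sum>i=1..n+1. real (dig k i) * (of_int (\<omega> i) - \<tau> * real (yd i)))"
proof -
  have "real k = (\<Sum>i=1..n+1. real (dig k i) * real (yd i))"
    by (subst dg_dig[of k, symmetric]) (simp add: dg_def del: sum.cl_ivl_Suc)
  then show ?thesis
    by (simp add: w_def wt_def right_diff_distrib sum_subtractf sum_distrib_left mult_ac del: sum.cl_ivl_Suc)
qed

lemma w_ge: "\<tau> * real k \<le> of_int (w k)"
proof -
  have "0 \<le> (\<Sum>i=1..n+1. real (dig k i) * (of_int (\<omega> i) - \<tau> * real (yd i)))"
    using tau_le by (intro sum_nonneg mult_nonneg_nonneg) auto
  then show ?thesis
    using w_excess[of k] by linarith
qed

text \<open>Every digit below the last one has a strictly positive excess over \<tau>, so equality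
  leaves only powers of \<open>g (n + 1)\<close>.\<close>

lemma w_eq:
  assumes "of_int (w k) = \<tau> * real k"
  shows "yd (n + 1) dvd k"
proof -
  have "(\<Sum>i=1..n+1. real (dig k i) * (of_int (\<omega> i) - \<tau> * real (yd i))) = 0"
    using assms w_excess[of k] by linarith
  then have "\<forall>i\<in>{1..n+1}. real (dig k i) * (of_int (\<omega> i) - \<tau> * real (yd i)) = 0"
    using tau_le by (subst (asm) sum_nonneg_eq_0_iff) (auto intro!: mult_nonneg_nonneg)
  then have "dig k i = 0" if "1 \<le> i" "i \<le> n" for i
    using tau_less[OF that] that by force
  then have "dg (dig k) = dig k (n + 1) * yd (n + 1)"
    unfolding dg_def by (subst sum.remove[of _ "n + 1"]) (auto intro!: sum.neutral)
  then show ?thesis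
    by (metis dg_dig dvd_triv_right)
qed

text \<open>The digits below the last one are bounded and the last one has excess 0, so the total
  excess is bounded independently of k.\<close>

lemma w_le: obtains C where "C \<ge> 0" "\<And>k. of_int (w k) \<le> \<tau> * real k + C"
proof -
  define C where "C = (\<Sum>i=1..n. real (\<alpha> i) * (of_int (\<omega> i) - \<tau> * real (yd i)))"
  have "C \<ge> 0"
    unfolding C_def using tau_le by (intro sum_nonneg mult_nonneg_nonneg) auto
  moreover have "of_int (w k) \<le> \<tau> * real k + C" for k
  proof -
    have set: "{1..n+1} = insert (n + 1) {1..n}" by auto
    have "(\<Sum>i=1..n+1. real (dig k i) * (of_int (\<omega> i) - \<tau> * real (yd i))) =
        (\<Sum>i=1..n. real (dig k i) * (of_int (\<omega> i) - \<tau> * real (yd i)))"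
      unfolding set using tau_yd by simp
    also have "\<dots> \<le> C"
      unfolding C_def
    proof (intro sum_mono mult_right_mono)
      fix i assume i: "i \<in> {1..n}"
      then show "real (dig k i) \<le> real (\<alpha> i)"
        using standard_dig[of k] by (simp add: std_def less_imp_le)
      show "0 \<le> of_int (\<omega> i) - \<tau> * real (yd i)"
        using tau_le[of i] i by simp
    qed
    finally show ?thesis
      using w_excess[of k] by linarith
  qed
  ultimately show ?thesis by (rule that)
qed

text \<open>Only the first digit keeps its true weight. This finer bound serves at the vertical
  point, where factors y and factors \<open>\<kappa>\<close> of the leading form play different
  roles.\<close>

lemma w_ge_first:
  assumes "1 \<le> n"
  shows "of_int (w k) \<ge> real (k mod \<alpha> 1) * of_int (\<omega> 1) + \<tau> * real (k - k mod \<alpha> 1)"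
proof -
  have d1: "dig k 1 = k mod \<alpha> 1"
    using assms by (simp add: dig_def)
  have set: "{1..n+1} = insert 1 {2..n+1}" by auto
  have "0 \<le> (\<Sum>i=2..n+1. real (dig k i) * (of_int (\<omega> i) - \<tau> * real (yd i)))"
    using tau_le by (intro sum_nonneg mult_nonneg_nonneg) auto
  then have "real (k mod \<alpha> 1) * (of_int (\<omega> 1) - \<tau>) \<le> of_int (w k) - \<tau> * real k"
    unfolding w_excess set using d1 by simp
  moreover have "real (k - k mod \<alpha> 1) = real k - real (k mod \<alpha> 1)"
    by (simp add: of_nat_diff)
  ultimately show ?thesis
    by (simp add: algebra_simps)
qed

end

section \<open>Lower bounds at the center\<close>

context key_subst
begin

text \<open>In the new variables u is X and v is Y, so \<open>\<Psi>\<close> just reads off the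
  polynomial.\<close>

lemma Psi_local_coords:
  assumes "p = 1" "q = 1"
  shows "\<Psi> (ev2 (inverse X) (Y * inverse X - cst c) F) = to_fract F"
proof -
  have pq: "inverse X ^ p = inverse X" "inverse X ^ q = inverse X"
    using assms by simp_all
  have "\<Psi> (inverse X) = X"
    by (simp add: Psi.hom_inverse Psi_X pq)
  moreover have "\<Psi> (Y * inverse X - cst c) = Y"
    using \<open>\<Psi> (inverse X) = X\<close>
    by (simp add: Psi.hom_minus Psi.hom_mult Psi_Y Psi_cst pq mult.assoc)
  ultimately show ?thesis
    by (simp add: Psi_ev2 ev2_XY)
qed

text \<open>\<open>\<Psi>\<close> sends h to F itself, so the leading form of h is F(0, v). As
  \<open>nu l\<close> is the l-th power of the variable, the nonzero coefficient at k forces the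
  standard monomial \<open>m k\<close> to occur, and its term bounds \<delta> h.\<close>

lemma lower_bound_horizontal:
  assumes pq: "p = 1" "q = 1" and nu: "\<And>k. nu k = monom 1 k" and F: "low_order F k"
  defines "h \<equiv> ev2 (inverse X) (Y * inverse X - cst c) F"
  shows "h \<noteq> 0" "w k - int k * \<omega> 0 \<le> \<delta> h"
proof -
  have "at0 F \<noteq> 0"
    using F by (auto simp: low_order_def poly_eq_iff)
  then have "F \<noteq> 0" by auto
  have Psi: "\<Psi> h = to_fract F"
    unfolding h_def by (rule Psi_local_coords[OF pq])
  then show h: "h \<noteq> 0"
    using \<open>F \<noteq> 0\<close> by auto
  have "inverse X \<in> laurent_x"
    using laurent_x_powi[of "-1"] by simp
  then have "evx (inverse X) A \<in> laurent_x" for A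
    unfolding evx_altdef by (intro laurent_x_sum laurent_x_mult laurent_x_cst laurent_x_power)
  moreover have "[:- cst c, inverse X:] \<in> laurent_coeffs"
    using \<open>inverse X \<in> laurent_x\<close>
    by (intro laurent_coeffs_pCons laurent_x_uminus laurent_x_cst laurent_coeffs_0)
  ultimately have "(\<Sum>j\<le>degree F. smult (evx (inverse X) (coeff F j)) ([:- cst c, inverse X:] ^ j)) \<in> laurent_coeffs"
    by (intro laurent_coeffs_sum laurent_coeffs_smult laurent_coeffs_power)
  moreover have "poly (\<Sum>j\<le>degree F. smult (evx (inverse X) (coeff F j)) ([:- cst c, inverse X:] ^ j)) Y = h"
    by (simp add: h_def ev2_altdef poly_sum)
  ultimately have "h \<in> laurent_polys"
    unfolding laurent_polys_iff by blast
  then obtain W T a G where G: "X powi W * \<Psi> h = to_fract G" "at0 G = (\<Sum>k\<in>T. smult (a k) (nu k))"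
    "finite T" "T \<noteq> {}" "\<And>k. k \<in> T \<Longrightarrow> a k \<noteq> 0"
    "\<And>k. k \<in> T \<Longrightarrow> r * (W - int q * int k) + w k \<le> \<delta> h"
    "\<And>k. k \<in> T \<Longrightarrow> int p dvd W - int q * int k"
    by (rule leading_form[OF _ h]) (rule that)
  have "at0 G \<noteq> 0"
    using nu_sum(2)[of T a] G by simp
  \<comment> \<open>Neither F nor G vanishes at X = 0, so no power of X can separate them.\<close>
  have "W = 0"
  proof (rule ccontr)
    assume "W \<noteq> 0"
    then consider "W > 0" | "W < 0" by linarith
    then show False
    proof cases
      case 1
      then have "to_fract (smult (monom 1 (nat W)) F) = to_fract G"
        using G(1) by (simp add: Psi to_fract_X_power power_int_def)
      then have "G = smult (monom 1 (nat W)) F" by simp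
      then show False
        using \<open>at0 G \<noteq> 0\<close> 1 by (simp add: coeff_monom)
    next
      case 2
      then have "to_fract (smult (monom 1 (nat (- W))) G) = to_fract F"
        using G(1) by (simp add: Psi to_fract_X_power power_int_def field_simps)
      then have "F = smult (monom 1 (nat (- W))) G" by simp
      then show False
        using \<open>at0 F \<noteq> 0\<close> 2 by (simp add: coeff_monom)
    qed
  qed
  then have "F = G"
    using G(1) by (simp add: Psi)
  have "coeff (at0 G) k \<noteq> 0"
    using F \<open>F = G\<close> by (simp add: low_order_def)
  then have sum: "(\<Sum>l\<in>T. a l * (if l = k then 1 else 0)) \<noteq> 0"
    unfolding G(2) nu coeff_sum by simp
  have "k \<in> T"
  proof (rule ccontr)
    assume "k \<notin> T"
    then have "(\<Sum>l\<in>T. a l * (if l = k then 1 else 0)) = 0"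
      by (intro sum.neutral) auto
    with sum show False by simp
  qed
  have "r = \<omega> 0" using rp pq by simp
  then show "w k - int k * \<omega> 0 \<le> \<delta> h"
    using G(6)[OF \<open>k \<in> T\<close>] \<open>W = 0\<close> pq by (simp add: mult.commute)
qed

text \<open>With c = 0 every monomial goes to a single monomial, in which the exponent of X is W
  minus the weight. So no weight exceeds W, and G(0, Y) lists the monomials of weight W.\<close>

lemma weight_support:
  assumes c: "c = 0" and G: "X powi W * \<Psi> (to_fract f) = to_fract G"
  shows "coeff (coeff f j) i \<noteq> 0 \<Longrightarrow> int p * int i + int q * int j \<le> W"
    and "coeff (coeff f j) i \<noteq> 0 \<Longrightarrow> int p * int i + int q * int j = W \<Longrightarrow> coeff (at0 G) j = coeff (coeff f j) i"
    and "coeff (at0 G) j \<noteq> 0 \<Longrightarrow> \<exists>i. coeff (coeff f j) i \<noteq> 0 \<and> int p * int i + int q * int j = W"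
proof -
  define wgt where "wgt z = p * fst z + q * snd z" for z :: "nat \<times> nat"
  \<comment> \<open>K is at least W and at least every weight in f, so all exponents of X become
    nonnegative after a shift.\<close>
  define K where "K = Max (insert (nat W) (wgt ` supp f))"
  have K: "wgt z \<le> K" if "z \<in> supp f" for z
    using that unfolding K_def by (intro Max_ge) auto
  have "nat W \<le> K" unfolding K_def by (intro Max_ge) auto
  then have KW: "0 \<le> int K - W" by linarith
  define \<phi> where "\<phi> z = (K - wgt z, snd z)" for z :: "nat \<times> nat"
  have inj: "inj_on \<phi> (supp f)"
  proof (rule inj_onI)
    fix y z assume yz: "y \<in> supp f" "z \<in> supp f" "\<phi> y = \<phi> z"
    then have "snd y = snd z" "wgt y = wgt z"
      using K[of y] K[of z] by (auto simp: \<phi>_def)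
    then show "y = z"
      using p_pos by (auto simp: wgt_def prod_eq_iff)
  qed
  have "to_fract (smult (monom 1 (nat (int K - W))) G) = X powi (int K - W) * (X powi W * \<Psi> (to_fract f))"
    using KW unfolding to_fract_X_power G[symmetric] by (simp only: power_int_def) simp
  also have "\<dots> = X ^ K * ev2 (inverse X ^ p) (Y * inverse X ^ q) f"
    unfolding Psi_to_fract by (simp add: c flip: power_int_add mult.assoc)
  also have "\<dots> = (\<Sum>z\<in>supp f. cst (cf f z) * X ^ (K - wgt z) * Y ^ snd z)"
    unfolding ev2_supp sum_distrib_left
  proof (intro sum.cong refl)
    fix z assume z: "z \<in> supp f"
    have "X ^ K = X ^ (K - wgt z) * (X ^ (p * fst z) * X ^ (q * snd z))"
      using K[OF z] by (simp add: wgt_def flip: power_add)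
    then show "X ^ K * (cst (cf f z) * (inverse X ^ p) ^ fst z * (Y * inverse X ^ q) ^ snd z) =
        cst (cf f z) * X ^ (K - wgt z) * Y ^ snd z"
      by (simp add: power_mult_distrib field_simps flip: power_mult)
  qed
  also have "\<dots> = to_fract (relabel \<phi> f)"
    by (simp add: ev2_relabel \<phi>_def flip: ev2_XY)
  finally have R: "smult (monom 1 (nat (int K - W))) G = relabel \<phi> f"
    by (simp only: to_fract_eq_iff)
  have coeff: "coeff (coeff (relabel \<phi> f) j) l = (if nat (int K - W) \<le> l then coeff (coeff G j) (l - nat (int K - W)) else 0)" for l
    unfolding R[symmetric] by (simp add: coeff_monom_mult)
  show W: "int p * int i + int q * int j \<le> W" if nz: "coeff (coeff f j) i \<noteq> 0"
  proof -
    have z: "(i, j) \<in> supp f" using nz by (simp add: supp_def)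
    then have "coeff (coeff (relabel \<phi> f) j) (K - wgt (i, j)) \<noteq> 0"
      using nz by (subst relabel_inj[OF inj z]) (auto simp: \<phi>_def)
    then have "nat (int K - W) \<le> K - wgt (i, j)"
      unfolding coeff by (auto split: if_splits)
    then show ?thesis
      using K[OF z] KW by (simp add: wgt_def of_nat_diff nat_le_iff)
  qed
  show "coeff (at0 G) j = coeff (coeff f j) i"
    if nz: "coeff (coeff f j) i \<noteq> 0" and eq: "int p * int i + int q * int j = W"
  proof -
    have z: "(i, j) \<in> supp f" using nz by (simp add: supp_def)
    then have "coeff (coeff (relabel \<phi> f) j) (K - wgt (i, j)) = coeff (coeff f j) i"
      by (subst relabel_inj[OF inj z]) (auto simp: \<phi>_def)
    moreover have "K - wgt (i, j) = nat (int K - W)"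
    proof -
      have "int (wgt (i, j)) = W" using eq by (simp add: wgt_def)
      then show ?thesis using K[OF z] by linarith
    qed
    ultimately show ?thesis
      unfolding coeff by simp
  qed
  show "\<exists>i. coeff (coeff f j) i \<noteq> 0 \<and> int p * int i + int q * int j = W" if nz: "coeff (at0 G) j \<noteq> 0"
  proof -
    have "coeff (coeff (relabel \<phi> f) j) (nat (int K - W)) \<noteq> 0"
      using nz unfolding coeff by simp
    then obtain z where z: "z \<in> supp f" "\<phi> z = (nat (int K - W), j)"
      by (rule relabel_nonzero)
    then have "snd z = j" "K - wgt z = nat (int K - W)"
      by (auto simp: \<phi>_def)
    then have "int (wgt z) = W"
      using K[OF z(1)] KW by linarith
    then have "int p * int (fst z) + int q * int j = W"
      using \<open>snd z = j\<close> by (simp add: wgt_def)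
    then show ?thesis
      using z \<open>snd z = j\<close> by (auto simp: mem_supp)
  qed
qed

text \<open>The top weighted form of f is a combination of the \<open>nu k\<close>, all divisible by
  the power of \<open>\<kappa>\<close> that belongs to the smallest index k0. Since
  \<open>\<kappa>\<close> does not vanish at 0, this power, of degree e, and the power
  \<open>Y ^ j\<close> that divides the form are coprime; so \<open>j + e\<close> is at most the
  degree kx of the form.\<close>

lemma vertical_data:
  assumes c: "c = 0" and r: "r = 1" and q: "int q = \<omega> 1" and n: "1 \<le> n" and f: "f \<noteq> 0"
  obtains W i j e k0 kx i' where
    "\<And>i j. coeff (coeff f j) i \<noteq> 0 \<Longrightarrow> \<omega> 0 * int i + \<omega> 1 * int j \<le> W"
    "coeff (coeff f j) i \<noteq> 0" "\<omega> 0 * int i + \<omega> 1 * int j = W"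
    "coeff (coeff f kx) i' \<noteq> 0" "\<omega> 0 * int i' + \<omega> 1 * int kx = W"
    "e \<le> k0" "k0 \<le> kx" "j + e \<le> kx"
    "W - \<omega> 1 * int k0 + w k0 \<le> \<delta> (to_fract f)"
    "real_of_int (w k0) \<ge> real (k0 - e) * of_int (\<omega> 1) + \<tau> * real e"
proof -
  have p: "int p = \<omega> 0" using rp r by simp
  have "to_fract f \<in> laurent_polys" "to_fract f \<noteq> 0"
    using f to_fract_laurent by simp_all
  then obtain W T a G where G: "X powi W * \<Psi> (to_fract f) = to_fract G" "at0 G = (\<Sum>k\<in>T. smult (a k) (nu k))"
    "finite T" "T \<noteq> {}" "\<And>k. k \<in> T \<Longrightarrow> a k \<noteq> 0"
    "\<And>k. k \<in> T \<Longrightarrow> r * (W - int q * int k) + w k \<le> \<delta> (to_fract f)"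
    "\<And>k. k \<in> T \<Longrightarrow> int p dvd W - int q * int k"
    by (rule leading_form) (rule that)
  note ws = weight_support[OF c G(1)]
  have deg: "degree (at0 G) = Max T" and nz: "at0 G \<noteq> 0"
    using nu_sum[of T a] G by simp_all
  define k0 where "k0 = Min T"
  define kx where "kx = Max T"
  define s where "s = k0 div \<alpha> 1"
  have k0: "k0 \<in> T" and "k0 \<le> kx"
    using G(3,4) by (simp_all add: k0_def kx_def)
  have "\<alpha> 1 > 0" using alpha_pos[of 1] n by simp
  have ex1: "ex 1 = 0"
    using ex_1[OF n] r q by simp
  have "poly \<kappa> 0 = c ^ \<alpha> 1 - \<theta> 1"
    using ex1 by (simp add: \<kappa>_def)
  also have "c ^ \<alpha> 1 = 0"
    using c \<open>\<alpha> 1 > 0\<close> by simp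
  finally have "poly \<kappa> 0 \<noteq> 0"
    using theta_nonzero[of 1] n by simp
  have "\<kappa> ^ s dvd at0 G"
    unfolding G(2)
  proof (intro dvd_sum)
    fix k assume "k \<in> T"
    then have "s \<le> k div \<alpha> 1"
      using G(3) by (simp add: s_def k0_def div_le_mono)
    then have "\<kappa> ^ s dvd \<kappa> ^ (k div \<alpha> 1)"
      by (rule le_imp_power_dvd)
    then show "\<kappa> ^ s dvd smult (a k) (nu k)"
      using n by (auto simp: nu_def intro: dvd_smult dvd_mult)
  qed
  then obtain Q where Q: "at0 G = \<kappa> ^ s * Q" by (auto simp: dvd_def)
  have "Q \<noteq> 0" "\<kappa> \<noteq> 0" using Q nz \<open>poly \<kappa> 0 \<noteq> 0\<close> by auto
  have degG: "degree (at0 G) = s * \<alpha> 1 + degree Q"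
    unfolding Q using \<open>Q \<noteq> 0\<close> \<open>\<kappa> \<noteq> 0\<close> kappa_monic(1)[OF n] by (simp add: degree_mult_eq degree_power_eq)
  define j where "j = order 0 (at0 G)"
  have "j = order 0 Q"
    unfolding j_def Q using nz[unfolded Q] \<open>poly \<kappa> 0 \<noteq> 0\<close> by (subst order_mult) (auto simp: order_0I)
  also have "\<dots> \<le> degree Q" using \<open>Q \<noteq> 0\<close> by (rule order_degree)
  finally have "j + s * \<alpha> 1 \<le> kx"
    using deg degG unfolding kx_def by linarith
  obtain Q' where Q': "at0 G = [:- 0, 1:] ^ j * Q'" "\<not> [:- 0, 1:] dvd Q'"
    using order_decomp[OF nz, of 0] by (auto simp: j_def)
  have "coeff Q' 0 \<noteq> 0"
    using Q'(2) poly_eq_0_iff_dvd[of Q' 0] by (simp add: poly_0_coeff_0)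
  have "at0 G = monom 1 j * Q'"
    using Q'(1) by (simp add: monom_altdef)
  then have "coeff (at0 G) j \<noteq> 0"
    using \<open>coeff Q' 0 \<noteq> 0\<close> by (simp add: coeff_monom_mult)
  then obtain i where i: "coeff (coeff f j) i \<noteq> 0" "int p * int i + int q * int j = W"
    using ws(3) by blast
  have "coeff (at0 G) kx \<noteq> 0"
    using nz deg by (metis kx_def leading_coeff_0_iff)
  then obtain i' where i': "coeff (coeff f kx) i' \<noteq> 0" "int p * int i' + int q * int kx = W"
    using ws(3) by blast
  define e where "e = s * \<alpha> 1"
  have ke: "k0 - k0 mod \<alpha> 1 = e" "k0 - e = k0 mod \<alpha> 1" "e \<le> k0"
    by (simp_all add: e_def s_def minus_mod_eq_div_mult minus_div_mult_eq_mod)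
  show ?thesis
  proof (rule that[of W j i kx i' e k0])
    show "\<omega> 0 * int i + \<omega> 1 * int j \<le> W" if "coeff (coeff f j) i \<noteq> 0" for i j
      using ws(1)[OF that] by (simp add: p q)
    show "coeff (coeff f j) i \<noteq> 0" "\<omega> 0 * int i + \<omega> 1 * int j = W"
      "coeff (coeff f kx) i' \<noteq> 0" "\<omega> 0 * int i' + \<omega> 1 * int kx = W"
      using i i' by (simp_all add: p q)
    show "e \<le> k0" "k0 \<le> kx" by fact+
    show "j + e \<le> kx" using \<open>j + s * \<alpha> 1 \<le> kx\<close> by (simp add: e_def)
    show "W - \<omega> 1 * int k0 + w k0 \<le> \<delta> (to_fract f)"
      using G(6)[OF k0] r q by simp
    show "real_of_int (w k0) \<ge> real (k0 - e) * of_int (\<omega> 1) + \<tau> * real e"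
      using w_ge_first[OF n, of k0] unfolding ke(1) ke(2) .
  qed
qed

end

section \<open>Power series at a point at infinity\<close>

abbreviation nth2 :: "completed_ring \<Rightarrow> nat \<Rightarrow> nat \<Rightarrow> complex" where
  "nth2 \<phi> j i \<equiv> fps_nth (fps_nth \<phi> j) i"

definition restr :: "completed_ring \<Rightarrow> complex fps" where
  "restr \<phi> = Abs_fps (\<lambda>j. nth2 \<phi> j 0)"

lemma restr_nth [simp]: "fps_nth (restr \<phi>) j = nth2 \<phi> j 0"
  by (simp add: restr_def)

lemma restr_mult: "restr (a * b) = restr a * restr b"
  by (rule fps_ext) (simp add: fps_mult_nth fps_sum_nth)

lemma restr_add: "restr (a + b) = restr a + restr b"
  by (rule fps_ext) simp

lemma restr_diff: "restr (a - b) = restr a - restr b"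
  by (rule fps_ext) simp

lemma restr_u [simp]: "restr u_coord = 0"
  by (rule fps_ext) (simp add: u_coord_def)

definition lift_v :: "complex fps \<Rightarrow> completed_ring" where
  "lift_v c = Abs_fps (\<lambda>j. fps_const (fps_nth c j))"

lemma restr_lift_v [simp]: "restr (lift_v c) = c"
  by (rule fps_ext) (simp add: lift_v_def)

lemma restr_eq_0:
  assumes "restr \<phi> = 0"
  obtains \<psi> where "\<phi> = u_coord * \<psi>"
proof -
  define \<psi> where "\<psi> = Abs_fps (\<lambda>j. fps_shift 1 (fps_nth \<phi> j))"
  have "\<phi> = u_coord * \<psi>"
  proof (rule fps_ext, rule fps_ext)
    fix j i
    have "nth2 \<phi> j 0 = 0"
      using assms by (metis restr_nth fps_zero_nth)
    then show "nth2 \<phi> j i = nth2 (u_coord * \<psi>) j i"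
      by (cases i) (simp_all add: u_coord_def \<psi>_def)
  qed
  then show ?thesis by (rule that)
qed

lemma fps2_unit:
  fixes \<phi> :: completed_ring
  assumes "nth2 \<phi> 0 0 \<noteq> 0"
  shows "\<phi> dvd 1"
proof -
  have "fps_nth \<phi> 0 * inverse (fps_nth \<phi> 0) = 1"
    using assms by (simp add: inverse_mult_eq_1')
  then have "\<phi> * fps_right_inverse \<phi> (inverse (fps_nth \<phi> 0)) = 1"
    by (rule fps_right_inverse)
  then show ?thesis by (metis dvd_triv_left)
qed

lemma dvd_u_coord:
  assumes "\<phi> dvd u_coord" "u_coord dvd \<phi>"
  shows "restr \<phi> = 0"
  using assms(2) by (auto simp: dvd_def restr_mult)

text \<open>If \<phi>(0, v) were 0, then u would divide \<phi>; by irreducibility the cofactor is a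
  unit and \<phi> is an associate of u.\<close>

lemma branch_restr:
  assumes "\<phi> \<in> skewness_branches"
  shows "restr \<phi> \<noteq> 0" "subdegree (restr \<phi>) \<ge> 1"
proof -
  have irr: "irreducible \<phi>" and 0: "nth2 \<phi> 0 0 = 0" and na: "\<not> (\<phi> dvd u_coord \<and> u_coord dvd \<phi>)"
    using assms by (auto simp: skewness_branches_def)
  show r: "restr \<phi> \<noteq> 0"
  proof
    assume "restr \<phi> = 0"
    then obtain \<psi> where \<psi>: "\<phi> = u_coord * \<psi>" by (rule restr_eq_0)
    have "\<not> u_coord dvd 1"
    proof
      assume "u_coord dvd 1"
      then obtain k where "1 = u_coord * k" by (auto simp: dvd_def)
      then have "restr 1 = restr (u_coord * k)" by (rule arg_cong)
      then have "restr 1 = 0" by (simp add: restr_mult)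
      then have "fps_nth (restr 1) 0 = 0" by simp
      then show False by simp
    qed
    then have "\<psi> dvd 1"
      using irr \<psi> by (auto dest: irreducibleD)
    then have "\<phi> dvd u_coord * 1"
      unfolding \<psi> by (intro mult_dvd_mono dvd_refl)
    then show False using na \<psi> by simp
  qed
  have "fps_nth (restr \<phi>) 0 = 0" using 0 by simp
  then show "subdegree (restr \<phi>) \<ge> 1"
    using r by (metis One_nat_def Suc_leI gr0I nth_subdegree_nonzero)
qed

text \<open>A series whose restriction has finite positive order is no unit and no associate of u,
  so only reducibility can prevent it from being a branch. Both factors are nonunits, hence their
  restrictions vanish at 0 too.\<close>

lemma branch_exists_step:
  fixes \<phi> :: completed_ring
  assumes "restr \<phi> \<noteq> 0" "subdegree (restr \<phi>) \<ge> 1" "\<phi> \<notin> skewness_branches"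
  obtains a b where "\<phi> = a * b" "restr a \<noteq> 0" "restr b \<noteq> 0" "subdegree (restr a) \<ge> 1" "subdegree (restr b) \<ge> 1"
proof -
  have nz: "\<phi> \<noteq> 0" using assms(1) by (auto simp: restr_def fps_eq_iff)
  have 0: "nth2 \<phi> 0 0 = 0"
    using assms(2) nth_less_subdegree_zero[of 0 "restr \<phi>"] by simp
  have "\<not> \<phi> dvd 1"
  proof
    assume "\<phi> dvd 1"
    then obtain k where "1 = \<phi> * k" by (auto simp: dvd_def)
    then have "fps_nth (restr 1) 0 = fps_nth (restr \<phi> * restr k) 0" by (metis restr_mult)
    then show False using 0 by simp
  qed
  moreover have "\<not> irreducible \<phi>"
    using assms 0 dvd_u_coord by (auto simp: skewness_branches_def)
  ultimately obtain a b where ab: "\<phi> = a * b" "\<not> a dvd 1" "\<not> b dvd 1"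
    using nz by (auto simp: irreducible_def)
  have r: "restr a \<noteq> 0" "restr b \<noteq> 0"
    using assms(1) ab(1) by (auto simp: restr_mult)
  have "nth2 a 0 0 = 0" "nth2 b 0 0 = 0"
    using ab(2,3) fps2_unit by blast+
  then have "fps_nth (restr a) 0 = 0" "fps_nth (restr b) 0 = 0" by simp_all
  then have "subdegree (restr a) \<ge> 1" "subdegree (restr b) \<ge> 1"
    using r by (metis One_nat_def Suc_leI gr0I nth_subdegree_nonzero)+
  with ab r show ?thesis by (intro that)
qed

text \<open>Modulo u only the restriction matters, and divisibility in C[[v]] is comparison of
  orders.\<close>

lemma ideal_restr:
  assumes "restr \<phi> \<noteq> 0"
  shows "{a * \<phi> + b * u_coord | a b. True} = {f. \<forall>j<subdegree (restr \<phi>). nth2 f j 0 = 0}"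
proof (intro equalityI subsetI)
  fix f assume "f \<in> {a * \<phi> + b * u_coord | a b. True}"
  then obtain a b where "f = a * \<phi> + b * u_coord" by auto
  then have "restr f = restr a * restr \<phi>" by (simp add: restr_add restr_mult)
  then have "fps_nth (restr f) j = 0" if "j < subdegree (restr \<phi>)" for j
    using that by (metis add_cancel_left_left fps_mult_nth_outside_subdegrees(2) less_add_same_cancel2 nat_neq_iff not_less_zero trans_less_add2)
  then show "f \<in> {f. \<forall>j<subdegree (restr \<phi>). nth2 f j 0 = 0}" by simp
next
  fix f assume "f \<in> {f. \<forall>j<subdegree (restr \<phi>). nth2 f j 0 = 0}"
  then have 0: "fps_nth (restr f) j = 0" if "j < subdegree (restr \<phi>)" for j
    using that by simp
  have "restr \<phi> dvd restr f"
  proof (cases "restr f = 0")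
    case False
    then have "subdegree (restr \<phi>) \<le> subdegree (restr f)"
      using 0 by (intro subdegree_geI) auto
    then show ?thesis
      using False assms by (simp add: fps_dvd_iff)
  qed simp
  then obtain c where c: "restr f = restr \<phi> * c" by (auto simp: dvd_def)
  then have "restr (f - lift_v c * \<phi>) = 0"
    by (simp add: restr_diff restr_mult)
  then obtain \<psi> where "f - lift_v c * \<phi> = u_coord * \<psi>" by (rule restr_eq_0)
  then have "f = lift_v c * \<phi> + \<psi> * u_coord" by (simp add: algebra_simps)
  then show "f \<in> {a * \<phi> + b * u_coord | a b. True}" by blast
qed

text \<open>Coordinates on the quotient by the ideal of \<open>ideal_restr\<close>: two series agree
  modulo this ideal iff their truncations agree.\<close>

definition trunc :: "nat \<Rightarrow> completed_ring \<Rightarrow> complex poly" where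
  "trunc k f = (\<Sum>j<k. monom (nth2 f j 0) j)"

lemma coeff_trunc: "coeff (trunc k f) j = (if j < k then nth2 f j 0 else 0)"
  by (simp add: trunc_def coeff_sum coeff_monom)

lemma degree_trunc: "degree (trunc k f) < k \<or> trunc k f = 0"
  by (metis coeff_trunc leading_coeff_0_iff)

lemma sum_mult_delta: "(\<Sum>j<(k::nat). f j * (if j = i then 1 else 0)) = (if i < k then f i else (0::complex))"
proof -
  have "(\<Sum>j<k. f j * (if j = i then 1 else 0)) = (\<Sum>j<k. if j = i then f j else 0)"
    by (intro sum.cong refl) simp
  also have "\<dots> = (if i < k then f i else 0)"
    by (subst sum.delta) auto
  finally show ?thesis .
qed

lemma trunc_linear: "trunc k (f - (\<Sum>b\<in>B. fps_const (fps_const (c b)) * b)) =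
    trunc k f - (\<Sum>b\<in>B. smult (c b) (trunc k b))"
  by (rule poly_eqI) (simp add: coeff_trunc coeff_sum fps_sum_nth)

lemma finite_basis_mod_iff:
  "finite_basis_mod {f. \<forall>j<k. nth2 f j 0 = 0} B \<longleftrightarrow> finite B \<and>
    (\<forall>f. \<exists>!c. (\<forall>b. b \<notin> B \<longrightarrow> c b = 0) \<and> trunc k f = (\<Sum>b\<in>B. smult (c b) (trunc k b)))"
proof -
  have "f - (\<Sum>b\<in>B. fps_const (fps_const (c b)) * b) \<in> {f. \<forall>j<k. nth2 f j 0 = 0} \<longleftrightarrow>
      trunc k f = (\<Sum>b\<in>B. smult (c b) (trunc k b))" for f c
  proof -
    have "g \<in> {f. \<forall>j<k. nth2 f j 0 = 0} \<longleftrightarrow> trunc k g = 0" for g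
      by (auto simp: poly_eq_iff coeff_trunc)
    then show ?thesis by (simp only: trunc_linear) simp
  qed
  then show ?thesis unfolding finite_basis_mod_def by simp
qed

lemma trunc_surj:
  assumes "degree p < k \<or> p = 0"
  shows "\<exists>f. trunc k f = p"
proof
  show "trunc k (Abs_fps (\<lambda>j. fps_const (coeff p j))) = p"
    using assms by (auto simp: poly_eq_iff coeff_trunc coeff_eq_0)
qed

text \<open>The quotient by \<phi> and u is C[[v]] modulo the k-th power of v. The definite
  description needs both halves: every finite basis has k elements, and the first k powers of v form
  one.\<close>

lemma intersection_number:
  assumes "restr \<phi> \<noteq> 0"
  shows "intersection_with_L \<phi> = subdegree (restr \<phi>)"
proof -
  define k where "k = subdegree (restr \<phi>)"
  interpret vs: vector_space "smult :: complex \<Rightarrow> complex poly \<Rightarrow> complex poly"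
    by unfold_locales (simp_all add: smult_add_right smult_add_left)
  define M where "M = (\<lambda>j. monom (1::complex) j) ` {..<k}"
  have M: "finite M" "card M = k" unfolding M_def
    by (auto intro!: card_image[THEN trans] inj_onI simp: monom_eq_iff')
  have spanM: "vs.span M = {p. degree p < k \<or> p = 0}"
  proof (intro equalityI subsetI)
    fix p assume "p \<in> vs.span M"
    then obtain c where "p = (\<Sum>x\<in>M. smult (c x) x)"
      using vs.span_finite[OF M(1)] by auto
    then have "coeff p j = 0" if "k \<le> j" for j
      using that by (auto simp: coeff_sum M_def intro!: sum.neutral)
    then show "p \<in> {p. degree p < k \<or> p = 0}"
      by (metis (mono_tags, lifting) leading_coeff_0_iff mem_Collect_eq not_le)
  next
    fix p :: "complex poly" assume "p \<in> {p. degree p < k \<or> p = 0}"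
    then have "p = (\<Sum>j<k. smult (coeff p j) (monom 1 j))"
      by (auto simp: poly_eq_iff coeff_sum coeff_monom coeff_eq_0 sum_mult_delta)
    also have "\<dots> \<in> vs.span M"
      by (intro vs.span_sum vs.span_scale vs.span_base) (auto simp: M_def)
    finally show "p \<in> vs.span M" .
  qed
  have indM: "vs.independent M"
  proof
    assume "vs.dependent M"
    then obtain c where c: "\<exists>x\<in>M. c x \<noteq> 0" "(\<Sum>x\<in>M. smult (c x) x) = 0"
      using vs.dependent_finite[OF M(1)] by auto
    have "(\<Sum>x\<in>M. smult (c x) x) = (\<Sum>j<k. smult (c (monom 1 j)) (monom 1 j))"
      unfolding M_def by (subst sum.reindex) (auto intro!: inj_onI simp: monom_eq_iff')
    then have "coeff (\<Sum>j<k. smult (c (monom 1 j)) (monom 1 j)) j = 0" for j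
      using c(2) by simp
    then have "c (monom 1 j) = 0" if "j < k" for j
      using that \<open>\<And>j. coeff _ j = 0\<close>[of j] by (simp add: coeff_sum coeff_monom sum_mult_delta)
    with c(1) show False by (auto simp: M_def)
  qed
  have uniq: "card B = k" if "finite_basis_mod {f. \<forall>j<k. nth2 f j 0 = 0} B" for B
  proof -
    from that have fin: "finite B" and ex1:
      "\<And>f. \<exists>!c. (\<forall>b. b \<notin> B \<longrightarrow> c b = 0) \<and> trunc k f = (\<Sum>b\<in>B. smult (c b) (trunc k b))"
      unfolding finite_basis_mod_iff by auto
    have zero: "c b = 0" if "(\<Sum>b\<in>B. smult (c b) (trunc k b)) = 0" "b \<in> B" for c b
    proof -
      \<comment> \<open>Uniqueness of coordinates is stated for functions that vanish outside B, so
        a relation on B is extended by 0 first.\<close>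
      define c' where "c' b = (if b \<in> B then c b else 0)" for b
      have "(\<Sum>b\<in>B. smult (c' b) (trunc k b)) = 0"
        using that(1) by (simp add: c'_def cong: sum.cong)
      moreover have "trunc k 0 = 0" by (simp add: trunc_def)
      moreover have "c1 = c2" if "(\<forall>b. b \<notin> B \<longrightarrow> c1 b = 0) \<and> trunc k 0 = (\<Sum>b\<in>B. smult (c1 b) (trunc k b))"
        "(\<forall>b. b \<notin> B \<longrightarrow> c2 b = 0) \<and> trunc k 0 = (\<Sum>b\<in>B. smult (c2 b) (trunc k b))" for c1 c2
        using ex1[of 0] that by (elim ex1E) metis
      ultimately have "c' = (\<lambda>_. 0)"
        by (simp add: c'_def)
      then show ?thesis using that(2) by (metis c'_def)
    qed
    have inj: "inj_on (trunc k) B"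
    proof (rule inj_onI, rule ccontr)
      fix b b' assume b: "b \<in> B" "b' \<in> B" "trunc k b = trunc k b'" "b \<noteq> b'"
      define c where "c x = (if x = b then 1 else if x = b' then -1 else 0 :: complex)" for x
      have "(\<Sum>x\<in>B. smult (c x) (trunc k x)) = (\<Sum>x\<in>{b, b'}. smult (c x) (trunc k x))"
        using b fin by (intro sum.mono_neutral_right) (auto simp: c_def)
      also have "\<dots> = 0" using b by (simp add: c_def)
      finally have "c b = 0" using b(1) by (rule zero)
      then show False by (simp add: c_def)
    qed
    have "vs.independent (trunc k ` B)"
    proof
      assume "vs.dependent (trunc k ` B)"
      then obtain c where c: "\<exists>x\<in>trunc k ` B. c x \<noteq> 0" "(\<Sum>x\<in>trunc k ` B. smult (c x) x) = 0"
        using vs.dependent_finite[of "trunc k ` B"] fin by auto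
      then have "(\<Sum>b\<in>B. smult (c (trunc k b)) (trunc k b)) = 0"
        using inj by (simp add: sum.reindex)
      then have "c (trunc k b) = 0" if "b \<in> B" for b
        using zero[of "\<lambda>b. c (trunc k b)"] that by blast
      with c(1) show False by auto
    qed
    moreover have "vs.span (trunc k ` B) = vs.span M"
    proof (intro equalityI)
      have "trunc k ` B \<subseteq> vs.span M"
        unfolding spanM using degree_trunc by blast
      then show "vs.span (trunc k ` B) \<subseteq> vs.span M"
        by (rule vs.span_minimal) (rule vs.subspace_span)
      show "vs.span M \<subseteq> vs.span (trunc k ` B)"
      proof
        fix p assume "p \<in> vs.span M"
        then obtain f where "trunc k f = p" using trunc_surj unfolding spanM by blast
        then obtain c where "p = (\<Sum>b\<in>B. smult (c b) (trunc k b))" using ex1[of f] by auto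
        moreover have "(\<Sum>b\<in>B. smult (c b) (trunc k b)) \<in> vs.span (trunc k ` B)"
          by (intro vs.span_sum vs.span_scale vs.span_base imageI)
        ultimately show "p \<in> vs.span (trunc k ` B)" by simp
      qed
    qed
    ultimately obtain h where "bij_betw h (trunc k ` B) M"
      using vs.bij_if_span_eq_span_bases[OF _ indM] by blast
    then have "card (trunc k ` B) = card M" by (rule bij_betw_same_card)
    then show ?thesis using inj M by (simp add: card_image)
  qed
  \<comment> \<open>The outer variable \<open>fps_X\<close> of this ring is v.\<close>
  define V where "V = (\<lambda>j. fps_X ^ j :: completed_ring) ` {..<k}"
  have injV: "inj_on (\<lambda>j. fps_X ^ j :: completed_ring) {..<k}"
    by (rule inj_onI) (metis fps_X_power_nth one_neq_zero)
  have tV: "trunc k (fps_X ^ j) = monom 1 j" if "j < k" for j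
    using that by (auto simp: poly_eq_iff coeff_trunc coeff_monom fps_X_power_nth)
  have exV: "finite_basis_mod {f. \<forall>j<k. nth2 f j 0 = 0} V"
    unfolding finite_basis_mod_iff
  proof (intro conjI allI)
    show "finite V" by (simp add: V_def)
    fix f
    have sumV: "(\<Sum>b\<in>V. smult (c b) (trunc k b)) = (\<Sum>j<k. monom (c (fps_X ^ j)) j)" for c
      unfolding V_def by (subst sum.reindex[OF injV]) (auto simp: tV smult_monom intro!: sum.cong)
    have eq: "trunc k f = (\<Sum>b\<in>V. smult (c b) (trunc k b)) \<longleftrightarrow> (\<forall>j<k. c (fps_X ^ j) = nth2 f j 0)" for c
      unfolding sumV by (auto simp: poly_eq_iff coeff_trunc coeff_sum coeff_monom)
    show "\<exists>!c. (\<forall>b. b \<notin> V \<longrightarrow> c b = 0) \<and> trunc k f = (\<Sum>b\<in>V. smult (c b) (trunc k b))"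
    proof (rule ex1I[of _ "\<lambda>b. if b \<in> V then nth2 f (the_inv_into {..<k} (\<lambda>j. fps_X ^ j) b) 0 else 0"])
      show "(\<forall>b. b \<notin> V \<longrightarrow> (if b \<in> V then nth2 f (the_inv_into {..<k} (\<lambda>j. fps_X ^ j) b) 0 else 0) = 0) \<and>
        trunc k f = (\<Sum>b\<in>V. smult (if b \<in> V then nth2 f (the_inv_into {..<k} (\<lambda>j. fps_X ^ j) b) 0 else 0) (trunc k b))"
        unfolding eq using the_inv_into_f_f[OF injV] by (auto simp: V_def)
    next
      fix c assume "(\<forall>b. b \<notin> V \<longrightarrow> c b = 0) \<and> trunc k f = (\<Sum>b\<in>V. smult (c b) (trunc k b))"
      then have c: "\<And>b. b \<notin> V \<Longrightarrow> c b = 0" "\<And>j. j < k \<Longrightarrow> c (fps_X ^ j) = nth2 f j 0"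
        unfolding eq by auto
      show "c = (\<lambda>b. if b \<in> V then nth2 f (the_inv_into {..<k} (\<lambda>j. fps_X ^ j) b) 0 else 0)"
      proof
        fix b show "c b = (if b \<in> V then nth2 f (the_inv_into {..<k} (\<lambda>j. fps_X ^ j) b) 0 else 0)"
        proof (cases "b \<in> V")
          case True
          then obtain j where "j < k" "b = fps_X ^ j" by (auto simp: V_def)
          then show ?thesis using True c(2)[of j] the_inv_into_f_f[OF injV, of j] by simp
        qed (use c(1) in simp)
      qed
    qed
  qed
  have "card V = k" by (simp add: V_def card_image[OF injV])
  then show ?thesis
    unfolding intersection_with_L_def ideal_restr[OF assms] k_def[symmetric]
    using exV uniq by (intro the_equality) auto
qed

section \<open>The skewness from local bounds\<close>

definition jetp :: "nat \<Rightarrow> completed_ring \<Rightarrow> poly2" where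
  "jetp N \<phi> = (\<Sum>(i, j)\<in>{(i, j). i + j < N}. monom (monom (nth2 \<phi> j i) i) j)"

lemma finite_jet_set: "finite {(i, j). i + j < (N::nat)}"
  by (rule finite_subset[of _ "{..<N} \<times> {..<N}"]) auto

lemma coeff_jetp: "coeff (coeff (jetp N \<phi>) j) i = (if i + j < N then nth2 \<phi> j i else 0)"
proof -
  have "coeff (coeff (jetp N \<phi>) j) i =
      (\<Sum>z\<in>{(i, j). i + j < N}. if z = (i, j) then nth2 \<phi> (snd z) (fst z) else 0)"
    unfolding jetp_def coeff_sum by (intro sum.cong refl) (auto simp: coeff_monom split: if_splits)
  also have "\<dots> = (if i + j < N then nth2 \<phi> j i else 0)"
    using finite_jet_set[of N] by (subst sum.delta) auto
  finally show ?thesis .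
qed

lemma jet_jetp: "local_coords pt = (u, v) \<Longrightarrow> jet pt N \<phi> = ev2 u v (jetp N \<phi>)"
  unfolding jet_def jetp_def by (simp add: ev2.hom_sum case_prod_unfold)

lemma jetp_mult:
  assumes "i + j < N"
  shows "coeff (coeff (jetp N a * jetp N b - jetp N (a * b)) j) i = 0"
proof -
  have "(\<Sum>j'\<le>j. \<Sum>i'\<le>i. coeff (coeff (jetp N a) j') i' * coeff (coeff (jetp N b) (j - j')) (i - i')) =
      (\<Sum>j'\<le>j. \<Sum>i'\<le>i. nth2 a j' i' * nth2 b (j - j') (i - i'))"
    using assms by (intro sum.cong refl) (simp add: coeff_jetp)
  then show ?thesis
    using assms by (simp add: coeff_mult coeff_sum coeff_jetp[of N "a * b"] fps_mult_nth fps_sum_nth atLeast0AtMost)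
qed

text \<open>All that the skewness needs from a semidegree at its center: s is the minimum of
  \<delta> divided by the order of F(0, v), over polynomials F in u and v for which this order is
  finite and positive. Power series enter only through their jets.\<close>

locale local_bounds = semidegree \<delta> for \<delta> +
  fixes u v :: ratfun and s :: real
  assumes u: "u \<noteq> 0" "\<delta> u < 0" and v: "v \<noteq> 0" "\<delta> v < 0"
    and lower_nonzero: "low_order F k \<Longrightarrow> ev2 u v F \<noteq> 0"
    and lower: "low_order F k \<Longrightarrow> real k * s \<le> of_int (\<delta> (ev2 u v F))"
    and attained: "\<exists>F k. 1 \<le> k \<and> low_order F k \<and> of_int (\<delta> (ev2 u v F)) \<le> real k * s"
begin

text \<open>The values of u and v are integers, hence at most -1, so a monomial of order N has value
  at most -N.\<close>

lemma high_order:
  assumes "\<And>i j. i + j < N \<Longrightarrow> coeff (coeff F j) i = 0"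
  shows "le (ev2 u v F) (- int N)"
  unfolding ev2_supp
proof (rule le_sum)
  fix z assume "z \<in> supp F"
  then have N: "N \<le> fst z + snd z"
    using assms[of "fst z" "snd z"] by (auto simp: mem_supp not_less[symmetric])
  have "le (cst (cf F z) * (u ^ fst z * v ^ snd z)) (int (fst z) * (- 1) + int (snd z) * (- 1))"
    using u v by (intro le_cst_mult le_mult le_power) (auto simp: le_def)
  then show "le (cst (cf F z) * u ^ fst z * v ^ snd z) (- int N)"
    using N by (auto simp: mult.assoc intro: le_mono)
qed

definition has_val :: "completed_ring \<Rightarrow> int \<Rightarrow> bool" where
  "has_val \<phi> D \<longleftrightarrow> (\<exists>N0. \<forall>N\<ge>N0. ev2 u v (jetp N \<phi>) \<noteq> 0 \<and> \<delta> (ev2 u v (jetp N \<phi>)) = D)"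

text \<open>All long jets have the same lower bound \<open>k * s\<close>, while extending a jet adds
  only terms of value at most \<open>- N0\<close>. Once \<open>- N0\<close> is below
  \<open>k * s\<close>, the value no longer changes.\<close>

lemma has_val_exists:
  assumes "restr \<phi> \<noteq> 0"
  obtains D where "has_val \<phi> D" "real (subdegree (restr \<phi>)) * s \<le> of_int D"
proof -
  define k where "k = subdegree (restr \<phi>)"
  have nth: "nth2 \<phi> j 0 = 0" if "j < k" for j
    using nth_less_subdegree_zero[of j "restr \<phi>"] that by (simp add: k_def)
  have "nth2 \<phi> k 0 \<noteq> 0"
    using nth_subdegree_nonzero[OF assms] by (simp add: k_def)
  then have low: "low_order (jetp N \<phi>) k" if "k < N" for N
    unfolding low_order_def coeff_jetp using that nth by simp
  define N0 where "N0 = k + 1 + nat \<lceil>- (real k * s)\<rceil> + 1"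
  have N0: "k < N0" "- real N0 < real k * s" unfolding N0_def by linarith+
  define h where "h = ev2 u v (jetp N0 \<phi>)"
  have h: "h \<noteq> 0" "real k * s \<le> of_int (\<delta> h)"
    unfolding h_def using lower_nonzero[OF low] lower[OF low] N0 by blast+
  then have "- int N0 < \<delta> h"
    using N0 by linarith
  have "ev2 u v (jetp N \<phi>) \<noteq> 0 \<and> \<delta> (ev2 u v (jetp N \<phi>)) = \<delta> h" if "N0 \<le> N" for N
  proof -
    have "le (ev2 u v (jetp N \<phi> - jetp N0 \<phi>)) (- int N0)"
      by (rule high_order) (use that in \<open>simp add: coeff_jetp\<close>)
    then have "le (ev2 u v (jetp N \<phi>) - h) (- int N0)"
      by (simp add: h_def ev2.hom_minus)
    then show ?thesis
      using dominant[OF h(1)] \<open>- int N0 < \<delta> h\<close> by blast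
  qed
  then have "has_val \<phi> (\<delta> h)" unfolding has_val_def by blast
  then show ?thesis using that h(2) by (simp add: k_def)
qed

text \<open>The product of the jets and the jet of the product differ only in order N and above,
  which for large N lies below the value \<open>D + E\<close>.\<close>

lemma has_val_mult:
  assumes "has_val a D" "has_val b E"
  shows "has_val (a * b) (D + E)"
proof -
  obtain N1 where N1: "\<And>N. N1 \<le> N \<Longrightarrow> ev2 u v (jetp N a) \<noteq> 0 \<and> \<delta> (ev2 u v (jetp N a)) = D"
    using assms(1) unfolding has_val_def by blast
  obtain N2 where N2: "\<And>N. N2 \<le> N \<Longrightarrow> ev2 u v (jetp N b) \<noteq> 0 \<and> \<delta> (ev2 u v (jetp N b)) = E"
    using assms(2) unfolding has_val_def by blast
  define N0 where "N0 = N1 + N2 + nat (- (D + E)) + 1"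
  have "ev2 u v (jetp N (a * b)) \<noteq> 0 \<and> \<delta> (ev2 u v (jetp N (a * b))) = D + E" if "N0 \<le> N" for N
  proof -
    let ?h = "ev2 u v (jetp N a) * ev2 u v (jetp N b)"
    have h: "?h \<noteq> 0" "\<delta> ?h = D + E"
      using N1[of N] N2[of N] that by (auto simp: N0_def mult)
    have "le (ev2 u v (jetp N a * jetp N b - jetp N (a * b))) (- int N)"
      by (rule high_order) (rule jetp_mult)
    then have "le (ev2 u v (jetp N (a * b)) - ?h) (- int N)"
      using le_uminus[of "ev2 u v (jetp N (a * b)) - ?h"] by (simp add: ev2.hom_minus ev2.hom_mult)
    moreover have "- int N < \<delta> ?h"
      using that h by (simp add: N0_def)
    ultimately show ?thesis
      using dominant[OF h(1)] h(2) by metis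
  qed
  then show ?thesis unfolding has_val_def by blast
qed

lemma has_val_unique: "has_val \<phi> D \<Longrightarrow> has_val \<phi> E \<Longrightarrow> D = E"
  unfolding has_val_def by (metis nle_le)

lemma completed_val_eq:
  assumes "has_val \<phi> D" "local_coords pt = (u, v)"
  shows "completed_val \<delta> pt \<phi> = ereal (- real_of_int D / real_of_int (dmax \<delta>))"
proof -
  obtain N0 where N0: "\<And>N. N0 \<le> N \<Longrightarrow> ev2 u v (jetp N \<phi>) \<noteq> 0 \<and> \<delta> (ev2 u v (jetp N \<phi>)) = D"
    using assms(1) unfolding has_val_def by blast
  have "\<forall>\<^sub>F N in sequentially. normalized_val \<delta> (jet pt N \<phi>) = ereal (- real_of_int D / real_of_int (dmax \<delta>))"
    unfolding eventually_sequentially jet_jetp[OF assms(2)] normalized_val_def using N0 by (intro exI[of _ N0]) simp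
  then show ?thesis
    unfolding completed_val_def by (intro limI tendsto_eventually)
qed

text \<open>The supremum runs over irreducible series, but the series that attains the bound may be
  reducible. Values and orders of restrictions are additive, so one of two factors satisfies the
  bound again, with a smaller order.\<close>

lemma good_branch:
  assumes "restr \<phi> \<noteq> 0" "subdegree (restr \<phi>) \<ge> 1" "has_val \<phi> D" "of_int D \<le> real (subdegree (restr \<phi>)) * s"
  shows "\<exists>\<psi>\<in>skewness_branches. \<exists>E. has_val \<psi> E \<and> of_int E \<le> real (subdegree (restr \<psi>)) * s"
  using assms
proof (induction "subdegree (restr \<phi>)" arbitrary: \<phi> D rule: less_induct)
  case less
  show ?case
  proof (cases "\<phi> \<in> skewness_branches")
    case True
    then show ?thesis using less.prems by blast
  next
    case False
    obtain a b where ab: "\<phi> = a * b" "restr a \<noteq> 0" "restr b \<noteq> 0"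
        "subdegree (restr a) \<ge> 1" "subdegree (restr b) \<ge> 1"
      using branch_exists_step[OF less.prems(1,2) False] .
    have deg: "subdegree (restr \<phi>) = subdegree (restr a) + subdegree (restr b)"
      using ab by (simp add: restr_mult)
    obtain A where A: "has_val a A" using has_val_exists[OF ab(2)] .
    obtain B where B: "has_val b B" using has_val_exists[OF ab(3)] .
    have "D = A + B"
      using has_val_unique[OF less.prems(3)] has_val_mult[OF A B] ab(1) by simp
    then have "of_int A + of_int B \<le> real (subdegree (restr a)) * s + real (subdegree (restr b)) * s"
      using less.prems(4) deg by (simp add: algebra_simps)
    then consider "of_int A \<le> real (subdegree (restr a)) * s" | "of_int B \<le> real (subdegree (restr b)) * s"
      by linarith
    then show ?thesis
    proof cases
      case 1
      show ?thesis by (rule less.hyps[OF _ ab(2,4) A 1]) (use deg ab in simp)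
    next
      case 2
      show ?thesis by (rule less.hyps[OF _ ab(3,5) B 2]) (use deg ab in simp)
    qed
  qed
qed

definition of_poly2 :: "poly2 \<Rightarrow> completed_ring" where
  "of_poly2 F = Abs_fps (\<lambda>j. Abs_fps (\<lambda>i. coeff (coeff F j) i))"

lemma jetp_of_poly2: "\<exists>N0. \<forall>N\<ge>N0. jetp N (of_poly2 F) = F"
proof -
  define N0 where "N0 = Suc (Max (insert 0 ((\<lambda>z. fst z + snd z) ` supp F)))"
  have "jetp N (of_poly2 F) = F" if "N0 \<le> N" for N
  proof (rule poly_eqI, rule poly_eqI)
    fix j i
    have "coeff (coeff F j) i = 0" if "N \<le> i + j"
    proof (rule ccontr)
      assume "coeff (coeff F j) i \<noteq> 0"
      then have "(i, j) \<in> supp F" by (simp add: supp_def)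
      then have "i + j \<le> Max (insert 0 ((\<lambda>z. fst z + snd z) ` supp F))"
        by (intro Max_ge) force+
      then show False using that \<open>N0 \<le> N\<close> by (simp add: N0_def)
    qed
    then show "coeff (coeff (jetp N (of_poly2 F)) j) i = coeff (coeff F j) i"
      by (simp add: coeff_jetp of_poly2_def)
  qed
  then show ?thesis by blast
qed

text \<open>A branch has normalized value \<open>- D / d\<close>, and its intersection number is the
  order of its restriction. So the supremum is \<open>- s / d\<close>: the lower bound gives one
  inequality, the branch found by \<open>good_branch\<close> the other.\<close>

lemma skewness_value:
  assumes "\<not> is_degree \<delta>" "center (\<lambda>h. - \<delta> h) = {pt}" "local_coords pt = (u, v)" "dmax \<delta> > 0"
  shows "skewness \<delta> = ereal (1 + s / of_int (dmax \<delta>))"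
proof -
  define d where "d = real_of_int (dmax \<delta>)"
  have d: "d > 0" using assms(4) by (simp add: d_def)
  have val: "completed_val \<delta> pt \<phi> / ereal (real (intersection_with_L \<phi>)) =
      ereal (- real_of_int D / (d * real (subdegree (restr \<phi>))))" if "\<phi> \<in> skewness_branches" "has_val \<phi> D" for \<phi> D
    using branch_restr[OF that(1)] completed_val_eq[OF that(2) assms(3)] intersection_number[of \<phi>]
    by (simp add: d_def)
  have "(SUP \<phi>\<in>skewness_branches. completed_val \<delta> pt \<phi> / ereal (real (intersection_with_L \<phi>))) = ereal (- s / d)"
  proof (rule antisym)
    show "(SUP \<phi>\<in>skewness_branches. completed_val \<delta> pt \<phi> / ereal (real (intersection_with_L \<phi>))) \<le> ereal (- s / d)"
    proof (rule SUP_least)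
      fix \<phi> assume \<phi>: "\<phi> \<in> skewness_branches"
      obtain D where D: "has_val \<phi> D" "real (subdegree (restr \<phi>)) * s \<le> of_int D"
        using has_val_exists[OF branch_restr(1)[OF \<phi>]] .
      have "- real_of_int D / (d * real (subdegree (restr \<phi>))) \<le> - s / d"
        using D(2) d branch_restr(2)[OF \<phi>] by (simp add: field_simps)
      then show "completed_val \<delta> pt \<phi> / ereal (real (intersection_with_L \<phi>)) \<le> ereal (- s / d)"
        by (simp add: val[OF \<phi> D(1)])
    qed
    obtain F k where F: "1 \<le> k" "low_order F k" "of_int (\<delta> (ev2 u v F)) \<le> real k * s"
      using attained by blast
    define \<phi> where "\<phi> = of_poly2 F"
    have r: "restr \<phi> \<noteq> 0" "subdegree (restr \<phi>) = k"
    proof -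
      have nth: "fps_nth (restr \<phi>) j = coeff (coeff F j) 0" for j
        by (simp add: \<phi>_def of_poly2_def)
      then show "restr \<phi> \<noteq> 0"
        using F(2) by (metis fps_zero_nth low_order_def)
      show "subdegree (restr \<phi>) = k"
        using F(2) nth by (intro subdegreeI) (auto simp: low_order_def)
    qed
    obtain N0 where "\<And>N. N0 \<le> N \<Longrightarrow> jetp N \<phi> = F"
      using jetp_of_poly2[of F] unfolding \<phi>_def by blast
    then have hv: "has_val \<phi> (\<delta> (ev2 u v F))"
      unfolding has_val_def using lower_nonzero[OF F(2)] by (intro exI[of _ N0]) simp
    have "1 \<le> subdegree (restr \<phi>)" "of_int (\<delta> (ev2 u v F)) \<le> real (subdegree (restr \<phi>)) * s"
      using r(2) F(1,3) by simp_all
    from good_branch[OF r(1) this(1) hv this(2)]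
    obtain \<psi> E where \<psi>: "\<psi> \<in> skewness_branches" "has_val \<psi> E" "of_int E \<le> real (subdegree (restr \<psi>)) * s"
      by blast
    have "- s / d \<le> - real_of_int E / (d * real (subdegree (restr \<psi>)))"
      using \<psi>(3) d branch_restr(2)[OF \<psi>(1)] by (simp add: field_simps)
    then have "ereal (- s / d) \<le> completed_val \<delta> pt \<psi> / ereal (real (intersection_with_L \<psi>))"
      by (simp add: val[OF \<psi>(1,2)])
    also have "\<dots> \<le> (SUP \<phi>\<in>skewness_branches. completed_val \<delta> pt \<phi> / ereal (real (intersection_with_L \<phi>)))"
      using \<psi>(1) by (rule SUP_upper)
    finally show "ereal (- s / d) \<le> (SUP \<phi>\<in>skewness_branches. completed_val \<delta> pt \<phi> / ereal (real (intersection_with_L \<phi>)))" .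
  qed
  moreover have "(THE p. center (\<lambda>h. - \<delta> h) = {p}) = pt"
    using assms(2) by auto
  ultimately show ?thesis
    using assms(1) by (simp add: skewness_def d_def one_ereal_def)
qed

end

section \<open>Polynomials among the Laurent polynomials\<close>

definition xpoly :: "ratfun set" where "xpoly = range (evx X)"

definition xcoeffs :: "ratfun poly set" where "xcoeffs = {P. \<forall>i. coeff P i \<in> xpoly}"

lemma xpoly_laurent: "a \<in> xpoly \<Longrightarrow> a \<in> laurent_x"
  by (auto simp: xpoly_def)

lemma xcoeffs_laurent: "P \<in> xcoeffs \<Longrightarrow> P \<in> laurent_coeffs"
  by (auto simp: xcoeffs_def laurent_coeffs_def xpoly_laurent)

lemma xpoly_add:
  assumes "a \<in> xpoly" "b \<in> xpoly"
  shows "a + b \<in> xpoly"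
proof -
  obtain p q where "a = evx X p" "b = evx X q"
    using assms by (auto simp: xpoly_def)
  then have "a + b = evx X (p + q)"
    by (simp add: evx.hom_add)
  then show ?thesis by (simp add: xpoly_def)
qed

lemma xpoly_mult:
  assumes "a \<in> xpoly" "b \<in> xpoly"
  shows "a * b \<in> xpoly"
proof -
  obtain p q where "a = evx X p" "b = evx X q"
    using assms by (auto simp: xpoly_def)
  then have "a * b = evx X (p * q)"
    by (simp add: evx.hom_mult)
  then show ?thesis by (simp add: xpoly_def)
qed

lemma xpoly_cst: "cst c \<in> xpoly"
  unfolding xpoly_def by (rule range_eqI[of _ _ "[:c:]"]) simp

lemma xpoly_0: "0 \<in> xpoly" and xpoly_1: "1 \<in> xpoly"
  using xpoly_cst[of 0] xpoly_cst[of 1] by simp_all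

lemma xpoly_X_power: "X ^ k \<in> xpoly"
  unfolding xpoly_def by (rule range_eqI[of _ _ "monom 1 k"]) simp

lemma xpoly_uminus: "a \<in> xpoly \<Longrightarrow> - a \<in> xpoly"
  using xpoly_mult[OF xpoly_cst[of "-1"], of a] by (simp add: cst.hom_uminus)

lemma xpoly_diff: "a \<in> xpoly \<Longrightarrow> b \<in> xpoly \<Longrightarrow> a - b \<in> xpoly"
  using xpoly_add[OF _ xpoly_uminus, of a b] by simp

lemma xpoly_sum: "(\<And>i. i \<in> A \<Longrightarrow> f i \<in> xpoly) \<Longrightarrow> sum f A \<in> xpoly"
  by (induction A rule: infinite_finite_induct) (auto intro: xpoly_add xpoly_0)

lemma xcoeffs_add: "P \<in> xcoeffs \<Longrightarrow> Q \<in> xcoeffs \<Longrightarrow> P + Q \<in> xcoeffs"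
  by (auto simp: xcoeffs_def intro: xpoly_add)

lemma xcoeffs_diff: "P \<in> xcoeffs \<Longrightarrow> Q \<in> xcoeffs \<Longrightarrow> P - Q \<in> xcoeffs"
  by (auto simp: xcoeffs_def intro: xpoly_diff)

lemma xcoeffs_mult: "P \<in> xcoeffs \<Longrightarrow> Q \<in> xcoeffs \<Longrightarrow> P * Q \<in> xcoeffs"
  by (auto simp: xcoeffs_def coeff_mult intro!: xpoly_sum xpoly_mult)

lemma xcoeffs_smult: "a \<in> xpoly \<Longrightarrow> Q \<in> xcoeffs \<Longrightarrow> smult a Q \<in> xcoeffs"
  by (auto simp: xcoeffs_def intro: xpoly_mult)

lemma xcoeffs_monom: "a \<in> xpoly \<Longrightarrow> monom a k \<in> xcoeffs"
  by (auto simp: xcoeffs_def coeff_monom xpoly_0)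

lemma xcoeffs_0: "0 \<in> xcoeffs"
  by (auto simp: xcoeffs_def xpoly_0)

lemma xcoeffs_1: "1 \<in> xcoeffs"
  using xcoeffs_monom[OF xpoly_1, of 0] by simp

lemma xcoeffs_power: "P \<in> xcoeffs \<Longrightarrow> P ^ k \<in> xcoeffs"
  by (induction k) (auto intro: xcoeffs_mult xcoeffs_1)

lemma xcoeffs_sum: "(\<And>i. i \<in> A \<Longrightarrow> f i \<in> xcoeffs) \<Longrightarrow> sum f A \<in> xcoeffs"
  by (induction A rule: infinite_finite_induct) (auto intro: xcoeffs_add xcoeffs_0)

lemma xcoeffs_prod: "(\<And>i. i \<in> A \<Longrightarrow> f i \<in> xcoeffs) \<Longrightarrow> prod f A \<in> xcoeffs"
  by (induction A rule: infinite_finite_induct) (auto intro: xcoeffs_mult xcoeffs_1)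

lemma xcoeffs_map: "map_poly (evx X) F \<in> xcoeffs"
  by (auto simp: xcoeffs_def xpoly_def)

lemma evx_X_eq_0 [simp]: "evx X p = 0 \<longleftrightarrow> p = 0"
  by (simp add: evx_X)

lemma evx_X_eq [simp]: "evx X p = evx X q \<longleftrightarrow> p = q"
  by (simp add: evx_X)

lemma degree_map_evx_X [simp]: "degree (map_poly (evx X) F) = degree F"
  by (rule degree_map_poly) simp

lemma poly_map_evx_X: "poly (map_poly (evx X) F) Y = to_fract F"
  by (simp flip: ev2_XY ev2_def)

lemma xcoeffs_obtain:
  assumes "P \<in> xcoeffs"
  obtains F where "P = map_poly (evx X) F"
proof -
  have "\<exists>F. P = map_poly (evx X) F"
    using assms
  proof (induction P)
    case 0
    then show ?case by (intro exI[of _ 0]) simp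
  next
    case (pCons a P)
    have "a \<in> xpoly"
      using pCons.prems unfolding xcoeffs_def by (force dest: spec[of _ 0])
    moreover have "P \<in> xcoeffs"
      using pCons.prems unfolding xcoeffs_def by (force dest: spec[of _ "Suc _"])
    ultimately obtain p F where "a = evx X p" "P = map_poly (evx X) F"
      using pCons.IH by (auto simp: xpoly_def)
    then show ?case
      by (intro exI[of _ "pCons p F"]) (simp add: evx.map_poly_pCons_hom)
  qed
  with that show ?thesis by blast
qed

lemma polys_iff:
  assumes "P \<in> laurent_coeffs"
  shows "poly P Y \<in> polys \<longleftrightarrow> P \<in> xcoeffs"
proof
  assume "poly P Y \<in> polys"
  then obtain F where "poly P Y = to_fract F" by (auto simp: polys_def)
  then have "P = map_poly (evx X) F"
    using assms by (intro laurent_coeffs_eqI) (auto simp: poly_map_evx_X)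
  then show "P \<in> xcoeffs" by (simp add: xcoeffs_map)
next
  assume "P \<in> xcoeffs"
  then obtain F where "P = map_poly (evx X) F" by (rule xcoeffs_obtain)
  then show "poly P Y \<in> polys" by (simp add: poly_map_evx_X polys_def)
qed

section \<open>Powers and roots of monic polynomials\<close>

lemma coeff_mult_bounds:
  fixes p q :: "'a::comm_semiring_0 poly"
  assumes "\<And>i. k < i \<Longrightarrow> coeff p i = 0" "\<And>i. l < i \<Longrightarrow> coeff q i = 0"
  shows "coeff (p * q) (k + l) = coeff p k * coeff q l" "k + l < i \<Longrightarrow> coeff (p * q) i = 0"
proof -
  have "coeff (p * q) (k + l) = (\<Sum>i\<le>k + l. if i = k then coeff p k * coeff q l else 0)"
    unfolding coeff_mult
  proof (intro sum.cong refl)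
    fix i assume "i \<in> {..k + l}"
    then show "coeff p i * coeff q (k + l - i) = (if i = k then coeff p k * coeff q l else 0)"
      using assms(1)[of i] assms(2)[of "k + l - i"] by (cases i k rule: linorder_cases) auto
  qed
  then show "coeff (p * q) (k + l) = coeff p k * coeff q l" by simp
  show "coeff (p * q) i = 0" if "k + l < i"
    unfolding coeff_mult
  proof (intro sum.neutral ballI)
    fix x assume "x \<in> {..i}"
    then show "coeff p x * coeff q (i - x) = 0"
      using assms(1)[of x] assms(2)[of "i - x"] that by (cases "k < x") auto
  qed
qed

definition monic_of :: "'a::comm_ring_1 poly \<Rightarrow> nat \<Rightarrow> bool" where
  "monic_of p k \<longleftrightarrow> coeff p k = 1 \<and> (\<forall>i>k. coeff p i = 0)"

lemma monic_of_mult: "monic_of p k \<Longrightarrow> monic_of q l \<Longrightarrow> monic_of (p * q) (k + l)"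
  using coeff_mult_bounds[of k p l q] by (auto simp: monic_of_def)

lemma monic_of_1: "monic_of 1 0" by (simp add: monic_of_def)

lemma monic_of_power: "monic_of p k \<Longrightarrow> monic_of (p ^ i) (i * k)"
  by (induction i) (auto simp: monic_of_1 intro: monic_of_mult)

lemma of_nat_ratfun: "(of_nat k :: ratfun) = cst (of_nat k)"
  by (simp add: cst.hom_of_nat)

text \<open>\<open>A ^ b - U ^ b\<close> is \<open>A - U\<close> times a sum of b monic polynomials
  of degree \<open>(b - 1) * d\<close>. So a first difference in degree r reappears, multiplied by
  b, in degree \<open>(b - 1) * d + r\<close>.\<close>

lemma power_diff_monic:
  fixes A U :: "ratfun poly"
  assumes A: "monic_of A d" and U: "monic_of U d" and r: "\<And>l. r < l \<Longrightarrow> coeff (A - U) l = 0" and b: "b \<ge> 1"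
  shows "coeff (A ^ b - U ^ b) ((b - 1) * d + r) = coeff (A - U) r * of_nat b"
    and "(b - 1) * d + r < l \<Longrightarrow> coeff (A ^ b - U ^ b) l = 0"
proof -
  define S where "S = (\<Sum>i<b. U ^ (b - Suc i) * A ^ i)"
  have eq: "A ^ b - U ^ b = (A - U) * S"
    unfolding S_def by (rule power_diff_sumr2)
  have m: "monic_of (U ^ (b - Suc i) * A ^ i) ((b - 1) * d)" if "i < b" for i
  proof -
    have "(b - 1) * d = (b - Suc i) * d + i * d"
      using that by (simp flip: add_mult_distrib)
    then show ?thesis
      using monic_of_mult[OF monic_of_power[OF U] monic_of_power[OF A]] by simp
  qed
  have S: "coeff S ((b - 1) * d) = of_nat b" "coeff S l = 0" if "(b - 1) * d < l" for l
    using m that unfolding S_def coeff_sum by (auto simp: monic_of_def)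
  have S1: "coeff S ((b - 1) * d) = of_nat b"
    using m unfolding S_def coeff_sum by (simp add: monic_of_def)
  note cm = coeff_mult_bounds[of r "A - U" "(b - 1) * d" S, OF r S(2)]
  show "coeff (A ^ b - U ^ b) ((b - 1) * d + r) = coeff (A - U) r * of_nat b"
    unfolding eq using cm(1) S1 by (simp add: add.commute)
  show "coeff (A ^ b - U ^ b) l = 0" if "(b - 1) * d + r < l"
    unfolding eq using cm(2)[of l] that by (simp add: add.commute)
qed

text \<open>The coefficients of A are determined by those of F from the top: b times the next
  coefficient is a coefficient of F minus a polynomial expression in the higher ones, and b is
  invertible in C.\<close>

lemma monic_root_xcoeffs:
  assumes A: "A \<in> laurent_coeffs" "monic_of A d" and F: "F \<in> xcoeffs" and b: "b \<ge> 1"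
    and eq: "\<And>l. (b - 1) * d \<le> l \<Longrightarrow> coeff (F - A ^ b) l = 0"
  shows "A \<in> xcoeffs"
proof -
  have "coeff A i \<in> xpoly" if "i \<le> d" for i
    using that
  proof (induction "d - i" arbitrary: i rule: less_induct)
    case less
    show ?case
    proof (cases "i = d")
      case True
      then show ?thesis using A(2) xpoly_1 by (simp add: monic_of_def)
    next
      case False
      then have i: "i < d" using less.prems by simp
      \<comment> \<open>The part of A above degree i, polynomial by the induction
        hypothesis.\<close>
      define U where "U = (\<Sum>l\<in>{i<..d}. monom (coeff A l) l)"
      have cU: "coeff U l = (if i < l then coeff A l else 0)" for l
      proof -
        have "coeff U l = (\<Sum>l'\<in>{i<..d}. if l' = l then coeff A l' else 0)"
          by (simp add: U_def coeff_sum coeff_monom)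
        also have "\<dots> = (if l \<in> {i<..d} then coeff A l else 0)"
          by (subst sum.delta) auto
        also have "\<dots> = (if i < l then coeff A l else 0)"
          using A(2) by (auto simp: monic_of_def)
        finally show ?thesis .
      qed
      have "U \<in> xcoeffs"
        unfolding U_def using less.hyps i by (intro xcoeffs_sum xcoeffs_monom) auto
      then have Ub: "coeff (U ^ b) l \<in> xpoly" for l
        using xcoeffs_power[of U b] by (simp add: xcoeffs_def)
      have "monic_of U d"
        using A(2) i by (auto simp: monic_of_def cU)
      moreover have "coeff (A - U) l = 0" if "i < l" for l
        using that by (simp add: cU)
      ultimately have "coeff (A ^ b - U ^ b) ((b - 1) * d + i) = coeff (A - U) i * of_nat b"
        using A(2) b by (intro power_diff_monic(1)) auto
      moreover have "coeff (A ^ b) ((b - 1) * d + i) = coeff F ((b - 1) * d + i)"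
        using eq[of "(b - 1) * d + i"] by simp
      ultimately have "coeff A i * of_nat b = coeff F ((b - 1) * d + i) - coeff (U ^ b) ((b - 1) * d + i)"
        by (simp add: cU)
      also have "\<dots> \<in> xpoly"
        using F Ub by (intro xpoly_diff) (auto simp: xcoeffs_def)
      finally have "coeff A i * of_nat b * cst (1 / of_nat b) \<in> xpoly"
        by (rule xpoly_mult[OF _ xpoly_cst])
      moreover have "of_nat b * cst (1 / of_nat b) = 1"
        using b by (simp add: of_nat_ratfun flip: cst.hom_mult)
      ultimately show ?thesis by (simp add: mult.assoc)
    qed
  qed
  moreover have "coeff A i \<in> xpoly" if "d < i" for i
    using A(2) that xpoly_0 by (simp add: monic_of_def)
  ultimately have "coeff A i \<in> xpoly" for i
    by (cases "i \<le> d") auto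
  then show ?thesis by (simp add: xcoeffs_def)
qed

section \<open>Separating polynomial and negative parts in x\<close>

lemma laurent_x_split:
  assumes "a \<in> laurent_x"
  obtains b c k p where "a = b + c" "b \<in> xpoly" "c = X powi (- int k) * evx X p" "p = 0 \<or> degree p < k"
proof -
  obtain k p where p: "X ^ k * a = evx X p"
    using assms by (auto simp: laurent_x_def)
  have "p = monom 1 k * poly_shift k p + poly_cutoff k p"
    by (rule poly_eqI) (auto simp: coeff_monom_mult coeff_poly_shift coeff_poly_cutoff)
  then have "X ^ k * a = X ^ k * evx X (poly_shift k p) + evx X (poly_cutoff k p)"
    unfolding p by (metis evx.hom_add evx.hom_mult evx_monom cst_1 mult_1)
  then have "a = evx X (poly_shift k p) + X powi (- int k) * evx X (poly_cutoff k p)"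
    by (simp add: power_int_minus field_simps)
  moreover have "poly_cutoff k p = 0 \<or> degree (poly_cutoff k p) < k"
    by (metis coeff_poly_cutoff leading_coeff_0_iff)
  ultimately show ?thesis
    by (intro that[of "evx X (poly_shift k p)" _ k "poly_cutoff k p"]) (auto simp: xpoly_def)
qed

context key_data
begin

text \<open>The second summand has negative exponents only, and \<open>\<delta> X\<close> is at
  least 1.\<close>

lemma laurent_split_le:
  assumes "a \<in> laurent_x"
  obtains b c where "a = b + c" "b \<in> xpoly" "c \<in> laurent_x" "le c (- 1)"
proof -
  obtain b c k p where *: "a = b + c" "b \<in> xpoly" "c = X powi (- int k) * evx X p" "p = 0 \<or> degree p < k"
    using laurent_x_split[OF assms] .
  have "c \<in> laurent_x" using * by auto
  moreover have "le c (- 1)"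
  proof (cases "p = 0")
    case False
    then have "\<delta> c = (int (degree p) - int k) * \<delta> X"
      by (simp add: * mult powi evx_X_value algebra_simps)
    moreover have "(int (degree p) - int k) * \<delta> X \<le> (- 1) * \<delta> X"
      using False * X_pos by (intro mult_right_mono) auto
    ultimately show ?thesis using X_pos by (simp add: le_def)
  qed (simp add: *)
  ultimately show ?thesis using * that by blast
qed

lemma xpoly_nonneg: "a \<in> xpoly \<Longrightarrow> a \<noteq> 0 \<Longrightarrow> 0 \<le> \<delta> a"
  using evx_X_value X_pos by (auto simp: xpoly_def)

text \<open>Works from the top coefficient downwards: its polynomial part goes into Q, its negative
  part becomes the coefficient of \<open>mp N\<close>. Subtracting that multiple of the monic
  \<open>mp N\<close> alters only lower coefficients.\<close>

lemma polynomial_part: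
  assumes "P \<in> laurent_coeffs" "\<And>i. N \<le> i \<Longrightarrow> coeff P i = 0"
  shows "\<exists>Q a. Q \<in> xcoeffs \<and> (\<forall>i\<ge>N. coeff Q i = 0) \<and> P = Q + (\<Sum>k<N. smult (a k) (mp k)) \<and>
    (\<forall>k. a k \<in> laurent_x \<and> le (a k) (- 1))"
  using assms
proof (induction N arbitrary: P)
  case 0
  then have "P = 0" by (simp add: poly_eq_iff)
  then show ?case by (intro exI[of _ 0] exI[of _ "\<lambda>_. 0"]) (simp add: xcoeffs_0)
next
  case (Suc N)
  have "coeff P N \<in> laurent_x" using Suc.prems(1) by (simp add: laurent_coeffs_def)
  then obtain b c where bc: "coeff P N = b + c" "b \<in> xpoly" "c \<in> laurent_x" "le c (- 1)"
    by (rule laurent_split_le)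
  define P' where "P' = P - monom b N - smult c (mp N)"
  have "monom b N \<in> laurent_coeffs"
    using bc(2) by (intro xcoeffs_laurent xcoeffs_monom)
  then have "P' \<in> laurent_coeffs"
    unfolding P'_def using Suc.prems(1) bc(3) mp(1) by (intro laurent_coeffs_diff laurent_coeffs_smult)
  moreover have "coeff P' i = 0" if "N \<le> i" for i
    using that bc(1) Suc.prems(2)[of i] by (cases "i = N") (auto simp: P'_def coeff_monom)
  ultimately obtain Q a where Q: "Q \<in> xcoeffs" "\<forall>i\<ge>N. coeff Q i = 0"
    "P' = Q + (\<Sum>k<N. smult (a k) (mp k))" "\<forall>k. a k \<in> laurent_x \<and> le (a k) (- 1)"
    using Suc.IH by blast
  define a' where "a' = a(N := c)"
  have "P = (Q + monom b N) + (\<Sum>k<Suc N. smult (a' k) (mp k))"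
    using Q(3) by (simp add: P'_def a'_def algebra_simps)
  moreover have "Q + monom b N \<in> xcoeffs"
    using Q(1) bc(2) by (intro xcoeffs_add xcoeffs_monom)
  moreover have "\<forall>i\<ge>Suc N. coeff (Q + monom b N) i = 0"
    using Q(2) by (simp add: coeff_monom)
  moreover have "\<forall>k. a' k \<in> laurent_x \<and> le (a' k) (- 1)"
    using Q(4) bc by (simp add: a'_def)
  ultimately show ?case by blast
qed

lemma monic_of_gp: "1 \<le> j \<Longrightarrow> j \<le> n + 1 \<Longrightarrow> monic_of (gp j) (yd j)"
  using gp(3,4)[of j] by (auto simp: monic_of_def coeff_eq_0)

lemma delta_m: "m k \<noteq> 0" "\<delta> (m k) = w k"
proof -
  have "prod f A \<noteq> 0 \<and> \<delta> (prod f A) = (\<Sum>i\<in>A. \<delta> (f i))" if "\<And>i. i \<in> A \<Longrightarrow> f i \<noteq> 0" for f :: "nat \<Rightarrow> ratfun" and A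
    using that by (induction A rule: infinite_finite_induct) (auto simp: mult)
  from this[of "{1..n+1}" "\<lambda>i. g i ^ dig k i"]
  show "m k \<noteq> 0" "\<delta> (m k) = w k"
    using g_nonzero by (auto simp: m_def mono_def w_def wt_def \<omega>_def power simp del: sum.cl_ivl_Suc prod.cl_ivl_Suc)
qed

text \<open>Discarding the terms with negative powers of x from the powers of the last key form gives
  polynomials whose slopes approach the slope of the last key form.\<close>

lemma approximating_polynomial:
  obtains f a where "to_fract f = g (n + 1) ^ M - (\<Sum>k<M * yd (n + 1). a k * m k)"
    "\<And>k. a k \<in> laurent_x" "\<And>k. le (a k) (- 1)" "coeff f (M * yd (n + 1)) = 1"
    "\<And>i. M * yd (n + 1) < i \<Longrightarrow> coeff f i = 0"
proof -
  define D where "D = M * yd (n + 1)"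
  define P where "P = gp (n + 1) ^ M"
  have mP: "monic_of P D" unfolding P_def D_def by (intro monic_of_power monic_of_gp) auto
  have P: "P \<in> laurent_coeffs" unfolding P_def using gp(1)[of "n + 1"] by auto
  \<comment> \<open>Splitting \<open>P - monom 1 D\<close> instead of P keeps the leading term
    intact, so that f stays monic in y.\<close>
  have "monom 1 D \<in> laurent_coeffs" by (intro xcoeffs_laurent xcoeffs_monom xpoly_1)
  then have "P - monom 1 D \<in> laurent_coeffs" using P by auto
  moreover have "coeff (P - monom 1 D) i = 0" if "D \<le> i" for i
    using mP that by (cases "i = D") (auto simp: monic_of_def coeff_monom)
  ultimately obtain Q a where Q: "Q \<in> xcoeffs" "\<forall>i\<ge>D. coeff Q i = 0"
    "P - monom 1 D = Q + (\<Sum>k<D. smult (a k) (mp k))" "\<forall>k. a k \<in> laurent_x \<and> le (a k) (- 1)"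
    using polynomial_part[of "P - monom 1 D" D] by blast
  have "Q + monom 1 D \<in> xcoeffs" using Q(1) by (intro xcoeffs_add xcoeffs_monom xpoly_1)
  then obtain f where f: "Q + monom 1 D = map_poly (evx X) f" by (rule xcoeffs_obtain)
  have "to_fract f = poly (P - (\<Sum>k<D. smult (a k) (mp k))) Y"
    unfolding poly_map_evx_X[symmetric] f[symmetric] using Q(3) by (simp add: algebra_simps)
  also have "\<dots> = g (n + 1) ^ M - (\<Sum>k<D. a k * m k)"
    using gp(2)[of "n + 1"] by (simp add: P_def poly_sum mp)
  finally have 1: "to_fract f = g (n + 1) ^ M - (\<Sum>k<D. a k * m k)" .
  have cf: "evx X (coeff f i) = coeff (Q + monom 1 D) i" for i
    by (simp add: f)
  have "coeff f D = 1"
    using cf[of D] Q(2) by (metis add_0 coeff_add coeff_monom evx.hom_one evx_X_eq order_refl)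
  moreover have "coeff f i = 0" if "D < i" for i
    using cf[of i] Q(2) that by (simp add: coeff_monom)
  ultimately show ?thesis
    using that 1 Q(4) unfolding D_def by blast
qed

section \<open>Polynomial key forms\<close>

lemma laurent_expansion:
  assumes "P \<in> laurent_coeffs" "\<And>i. N \<le> i \<Longrightarrow> coeff P i = 0"
  shows "\<exists>a. P = (\<Sum>i<N. smult (a i) (mp i)) \<and> (\<forall>i. a i \<in> laurent_x)"
  using assms
proof (induction N arbitrary: P)
  case 0
  then have "P = 0" by (simp add: poly_eq_iff)
  then show ?case by (intro exI[of _ "\<lambda>_. 0"]) simp
next
  case (Suc N)
  have c: "coeff P N \<in> laurent_x" using Suc.prems(1) by (simp add: laurent_coeffs_def)
  define P' where "P' = P - smult (coeff P N) (mp N)"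
  have "P' \<in> laurent_coeffs"
    unfolding P'_def using Suc.prems(1) c mp(1) by (intro laurent_coeffs_diff laurent_coeffs_smult)
  moreover have "coeff P' i = 0" if "N \<le> i" for i
    using that Suc.prems(2)[of i] by (cases "i = N") (auto simp: P'_def)
  ultimately obtain a where a: "P' = (\<Sum>i<N. smult (a i) (mp i))" "\<forall>i. a i \<in> laurent_x"
    using Suc.IH by blast
  have "P = (\<Sum>i<Suc N. smult ((a(N := coeff P N)) i) (mp i))"
    using a(1) by (simp add: P'_def algebra_simps)
  moreover have "\<forall>i. (a(N := coeff P N)) i \<in> laurent_x" using a(2) c by simp
  ultimately show ?case by blast
qed

text \<open>As \<open>mp k\<close> is monic of degree k, the leading coefficient of P is also the
  coefficient of \<open>mp k\<close> in its expansion.\<close>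

lemma top_coeff_value:
  assumes "P \<in> laurent_coeffs" "\<And>i. k < i \<Longrightarrow> coeff P i = 0" "coeff P k \<noteq> 0"
  shows "poly P Y \<noteq> 0" "\<delta> (coeff P k) + w k \<le> \<delta> (poly P Y)"
proof -
  obtain a where a: "P = (\<Sum>i<Suc k. smult (a i) (mp i))" "\<And>i. a i \<in> laurent_x"
    using laurent_expansion[of P "Suc k"] assms by (auto simp: Suc_le_eq)
  have "coeff P k = a k"
    by (subst a(1)) (simp add: coeff_sum)
  moreover have "poly P Y = (\<Sum>i<Suc k. a i * m i)"
    by (subst a(1)) (simp add: poly_sum mp)
  ultimately show "poly P Y \<noteq> 0" "\<delta> (coeff P k) + w k \<le> \<delta> (poly P Y)"
    using expansion_value[of "Suc k" a k] a(2) assms(3) by simp_all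
qed

lemma dig_eq_0: "k < yd j \<Longrightarrow> 1 \<le> j \<Longrightarrow> j \<le> i \<Longrightarrow> i \<le> n + 1 \<Longrightarrow> dig k i = 0"
proof -
  assume *: "k < yd j" "1 \<le> j" "j \<le> i" "i \<le> n + 1"
  then have "yd j \<le> yd i" using yd_dvd[of j i] yd_pos[of i] by (intro dvd_imp_le) auto
  then show ?thesis using * by (simp add: dig_def)
qed

text \<open>Digit j of r is 0 because \<open>r < yd j\<close>; putting b there keeps the exponents
  standard.\<close>

lemma w_add_power:
  assumes "1 \<le> j" "j \<le> n + 1" "r < yd j" "j \<le> n \<Longrightarrow> b < \<alpha> j"
  shows "w (b * yd j + r) = int b * \<omega> j + w r"
proof -
  define c where "c = (\<lambda>i. dig r i + (if i = j then b else 0))"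
  have "dig r j = 0" using dig_eq_0[of r j j] assms by simp
  then have "std c"
    using standard_dig[of r] assms(4) by (auto simp: std_def c_def)
  then have "wt c = w (dg c)" by (rule standard_wt)
  moreover have "wt c = w r + int b * \<omega> j"
    unfolding c_def wt_add using assms by (simp add: wt_single w_def)
  moreover have "dg c = r + b * yd j"
    unfolding c_def dg_add using assms by (simp add: dg_single dg_dig)
  ultimately show ?thesis by (simp add: add.commute)
qed

text \<open>The approximate root is reached from \<open>g\<^sub>j\<close> by Tschirnhausen steps, which remove one
  coefficient of \<open>F - A\<^sup>b\<close> at a time and do not increase \<open>\<delta>\<close>.\<close>

lemma approximate_root:
  assumes j: "1 \<le> j" "j \<le> n + 1" and b: "1 \<le> b" "j \<le> n \<Longrightarrow> b \<le> \<alpha> j"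
    and F: "F \<in> xcoeffs" "monic_of F (b * yd j)" "le (poly F Y) (int b * \<omega> j)"
  obtains A where "A \<in> xcoeffs" "monic_of A (yd j)" "le (poly A Y) (\<omega> j)"
proof -
  let ?K = "(b - 1) * yd j"
  have K: "?K + yd j = b * yd j" using b(1) by (simp add: algebra_simps flip: add_mult_distrib)
  have "\<exists>A\<in>laurent_coeffs. monic_of A (yd j) \<and> le (poly A Y) (\<omega> j) \<and> (\<forall>l\<ge>?K + r. coeff (F - A ^ b) l = 0)"
    if "r \<le> yd j" for r
    using that
  proof (induction r rule: inc_induct)
    case base
    have "monic_of (gp j ^ b) (b * yd j)" using j by (intro monic_of_power monic_of_gp)
    then have "coeff (F - gp j ^ b) l = 0" if "?K + yd j \<le> l" for l
      using F(2) that unfolding K by (cases "l = b * yd j") (auto simp: monic_of_def)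
    then show ?case
      using gp[OF j] monic_of_gp[OF j] by (intro bexI[of _ "gp j"]) (auto simp: \<omega>_def)
  next
    case (step r)
    then obtain A where A: "A \<in> laurent_coeffs" "monic_of A (yd j)" "le (poly A Y) (\<omega> j)"
      "\<And>l. ?K + Suc r \<le> l \<Longrightarrow> coeff (F - A ^ b) l = 0"
      by auto
    define H where "H = F - A ^ b"
    define a where "a = coeff H (?K + r)"
    have H: "H \<in> laurent_coeffs"
      unfolding H_def by (intro laurent_coeffs_diff laurent_coeffs_power xcoeffs_laurent[OF F(1)] A(1))
    then have a: "a \<in> laurent_x" by (simp add: a_def laurent_coeffs_def)
    have "le (poly H Y) (int b * \<omega> j)"
      unfolding H_def using F(3) le_power[OF A(3), of b] by (auto intro: le_diff)
    \<comment> \<open>The top term of H is a times a standard monomial of weight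
      \<open>(b - 1) * \<omega> j + w r\<close>, and H has value at most
      \<open>b * \<omega> j\<close>; what remains for \<open>a * m r\<close> is \<omega> j.\<close>
    have "le (a * m r) (\<omega> j)"
    proof (cases "a = 0")
      case False
      then have "\<delta> a + w (?K + r) \<le> \<delta> (poly H Y)" "poly H Y \<noteq> 0"
        unfolding a_def using A(4) by (intro top_coeff_value H; simp add: H_def)+
      moreover have "w (?K + r) = int (b - 1) * \<omega> j + w r"
        by (rule w_add_power) (use j step b in auto)
      moreover have "int b * \<omega> j = int (b - 1) * \<omega> j + \<omega> j"
        using b(1) by (simp add: of_nat_diff algebra_simps)
      ultimately have "\<delta> a + w r \<le> \<omega> j"
        using leD[OF \<open>le (poly H Y) (int b * \<omega> j)\<close>] by linarith
      then show ?thesis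
        using False by (simp add: le_def mult delta_m)
    qed simp
    \<comment> \<open>Division by b is chosen so that, by \<open>power_diff_monic\<close>, the
      coefficient of the b-th power in degree \<open>?K + r\<close> grows by exactly a.\<close>
    define A' where "A' = A + smult (a * cst (1 / of_nat b)) (mp r)"
    have A'A: "A' - A = smult (a * cst (1 / of_nat b)) (mp r)" by (simp add: A'_def)
    have "A' \<in> laurent_coeffs"
      unfolding A'_def using A(1) a mp(1) by (intro laurent_coeffs_add laurent_coeffs_smult laurent_x_mult laurent_x_cst)
    moreover have mA': "monic_of A' (yd j)"
      using A(2) step by (auto simp: monic_of_def A'_def)
    moreover have "le (poly A' Y) (\<omega> j)"
      unfolding A'_def using A(3) le_cst_mult[OF \<open>le (a * m r) (\<omega> j)\<close>, of "1 / of_nat b"]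
      by (auto simp: mp mult_ac intro: le_add)
    moreover have "coeff (F - A' ^ b) l = 0" if "?K + r \<le> l" for l
    proof -
      have low: "coeff (A' - A) i = 0" if "r < i" for i
        using that by (simp add: A'A)
      have pd1: "coeff (A' ^ b - A ^ b) (?K + r) = coeff (A' - A) r * of_nat b"
        by (rule power_diff_monic(1)[OF mA' A(2) _ b(1)]) (rule low)
      have pd2: "coeff (A' ^ b - A ^ b) l = 0" if "?K + r < l"
        by (rule power_diff_monic(2)[OF mA' A(2) _ b(1) that]) (rule low)
      have eq: "coeff (F - A' ^ b) l = coeff H l - coeff (A' ^ b - A ^ b) l"
        by (simp add: H_def)
      show ?thesis
      proof (cases "l = ?K + r")
        case True
        have "cst (1 / of_nat b) * of_nat b = 1"
          using b by (simp add: of_nat_ratfun flip: cst.hom_mult)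
        then have "coeff (A' ^ b - A ^ b) (?K + r) = a"
          unfolding pd1 unfolding A'A by (simp add: mult.assoc)
        then show ?thesis
          using eq unfolding True a_def by (simp only: diff_self)
      next
        case False
        then show ?thesis
          unfolding eq using that A(4)[of l] pd2 by (simp add: H_def)
      qed
    qed
    ultimately show ?case by blast
  qed
  from this[of 0] obtain A where A: "A \<in> laurent_coeffs" "monic_of A (yd j)" "le (poly A Y) (\<omega> j)"
    "\<And>l. ?K \<le> l \<Longrightarrow> coeff (F - A ^ b) l = 0"
    by auto
  then have "A \<in> xcoeffs"
    by (intro monic_root_xcoeffs[OF A(1,2) F(1) b(1)]) (rule A(4))
  with A that show ?thesis by blast
qed

lemma xcoeffs_expansion:
  assumes "P \<in> xcoeffs" "\<And>i. N \<le> i \<Longrightarrow> coeff P i = 0" "\<And>k. k < N \<Longrightarrow> mp k \<in> xcoeffs"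
  shows "\<exists>a. P = (\<Sum>i<N. smult (a i) (mp i)) \<and> (\<forall>i. a i \<in> xpoly)"
  using assms
proof (induction N arbitrary: P)
  case 0
  then have "P = 0" by (simp add: poly_eq_iff)
  then show ?case by (intro exI[of _ "\<lambda>_. 0"]) (simp add: xpoly_0)
next
  case (Suc N)
  have c: "coeff P N \<in> xpoly" using Suc.prems(1) by (simp add: xcoeffs_def)
  define P' where "P' = P - smult (coeff P N) (mp N)"
  have "P' \<in> xcoeffs"
    unfolding P'_def using Suc.prems c by (intro xcoeffs_diff xcoeffs_smult) auto
  moreover have "coeff P' i = 0" if "N \<le> i" for i
    using that Suc.prems(2)[of i] by (cases "i = N") (auto simp: P'_def)
  ultimately obtain a where a: "P' = (\<Sum>i<N. smult (a i) (mp i))" "\<forall>i. a i \<in> xpoly"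
    using Suc.IH[of P'] Suc.prems(3) by auto
  have "P = (\<Sum>i<Suc N. smult ((a(N := coeff P N)) i) (mp i))"
    using a(1) by (simp add: P'_def algebra_simps)
  moreover have "\<forall>i. (a(N := coeff P N)) i \<in> xpoly" using a(2) c by simp
  ultimately show ?case by blast
qed

text \<open>An approximate root of degree \<open>yd j\<close> makes the earlier key forms
  polynomials by induction. In the step to the next one only the exponent \<open>b0 j\<close> could
  be negative; but then the polynomial A, whose value is no larger than that of the next key form,
  would need a coefficient of negative value to cancel the tail.\<close>

lemma key_polynomials:
  assumes "1 \<le> j" "j \<le> n + 1" "A \<in> xcoeffs" "monic_of A (yd j)" "le (poly A Y) (\<omega> j)"
  shows "\<forall>i\<in>{1..j}. gp i \<in> xcoeffs"
  using assms
proof (induction j arbitrary: A rule: dec_induct)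
  case base
  have "gp 1 = [:0, 1:]"
    using gp[of 1] g_1 by (intro laurent_coeffs_eqI) auto
  moreover have "[:0, 1:] \<in> xcoeffs"
    using xcoeffs_monom[OF xpoly_1, of 1] by (simp add: monom_altdef)
  ultimately show ?case by simp
next
  case (step j)
  have j: "1 \<le> j" "j \<le> n" using step by auto
  have yd: "yd (Suc j) = \<alpha> j * yd j" using j by (simp add: yd_Suc)
  have "le (poly A Y) (int (\<alpha> j) * \<omega> j)"
    using step.prems(4) omega_less[OF j] by (auto intro: le_mono)
  then obtain B where "B \<in> xcoeffs" "monic_of B (yd j)" "le (poly B Y) (\<omega> j)"
    using approximate_root[of j "\<alpha> j" A] j step.prems alpha_pos[of j] unfolding yd by auto
  then have IH: "\<forall>i\<in>{1..j}. gp i \<in> xcoeffs"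
    using step.IH j by auto
  have mpx: "mp k \<in> xcoeffs" if "k < yd (Suc j)" for k
    unfolding mp_def
  proof (rule xcoeffs_prod)
    fix i assume i: "i \<in> {1..n+1}"
    show "gp i ^ dig k i \<in> xcoeffs"
    proof (cases "i \<le> j")
      case True
      then show ?thesis using IH i by (intro xcoeffs_power) auto
    next
      case False
      then have "dig k i = 0" using dig_eq_0[of k "Suc j" i] that i by auto
      then show ?thesis by (simp add: xcoeffs_1)
    qed
  qed
  define k1 where "k1 = dg (btail j)"
  have k1: "k1 < yd j" unfolding k1_def by (rule dg_btail_less[OF j])
  have "yd j \<le> yd (Suc j)"
    using yd_dvd[of j "Suc j"] yd_pos[of "Suc j"] j by (intro dvd_imp_le) auto
  have std: "std (btail j)"
    using beta_less j alpha_pos by (auto simp: std_def btail_def Suc_le_eq)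
  define t where "t = cst (\<theta> j) * X powi b0 j"
  have t: "t \<in> laurent_x" unfolding t_def by auto
  have "poly (gp (Suc j)) Y = poly (gp j ^ \<alpha> j - smult t (mp k1)) Y"
    using key_rec'[OF j] gp(2)[of j] gp(2)[of "Suc j"] j standard_mono[OF std]
    by (simp add: mp t_def k1_def algebra_simps)
  then have rec: "gp (Suc j) = gp j ^ \<alpha> j - smult t (mp k1)"
    using gp(1)[of j] gp(1)[of "Suc j"] mp(1) j t
    by (intro laurent_coeffs_eqI laurent_coeffs_diff laurent_coeffs_smult laurent_coeffs_power) auto
  have "b0 j \<ge> 0"
  proof (rule ccontr)
    assume "\<not> b0 j \<ge> 0"
    define H where "H = A - gp j ^ \<alpha> j"
    have "H \<in> xcoeffs"
      unfolding H_def using step.prems IH j by (intro xcoeffs_diff xcoeffs_power) auto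
    moreover have "coeff H i = 0" if "yd (Suc j) \<le> i" for i
      using step.prems(3) monic_of_power[OF monic_of_gp[of j], of "\<alpha> j"] that j
      unfolding yd H_def by (cases "i = \<alpha> j * yd j") (auto simp: monic_of_def)
    ultimately obtain a where a: "H = (\<Sum>i<yd (Suc j). smult (a i) (mp i))" "\<And>i. a i \<in> xpoly"
      using xcoeffs_expansion[of H "yd (Suc j)"] mpx by auto
    \<comment> \<open>Coefficients of \<open>A - g (Suc j)\<close>: the tail enters at the single
      index k1.\<close>
    define c where "c i = a i + (if i = k1 then t else 0)" for i
    have c: "c i \<in> laurent_x" for i
      unfolding c_def using t by (intro laurent_x_add xpoly_laurent[OF a(2)]) auto
    have "t \<noteq> 0" "\<delta> t = b0 j * \<omega> 0"
      using theta_nonzero[OF j] by (simp_all add: t_def mult powi omega_0)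
    have k1': "k1 < yd (Suc j)" using k1 \<open>yd j \<le> yd (Suc j)\<close> by simp
    have "H + smult t (mp k1) = A - gp (Suc j)"
      by (simp add: H_def rec)
    then have "poly A Y - g (Suc j) = poly (H + smult t (mp k1)) Y"
      using gp(2)[of "Suc j"] j by simp
    also have "\<dots> = (\<Sum>i<yd (Suc j). a i * m i) + t * m k1"
      unfolding a(1) by (simp add: poly_sum mp)
    also have "t * m k1 = (\<Sum>i<yd (Suc j). if i = k1 then t * m i else 0)"
      using k1' by (subst sum.delta) auto
    also have "(\<Sum>i<yd (Suc j). a i * m i) + \<dots> = (\<Sum>i<yd (Suc j). c i * m i)"
      unfolding sum.distrib[symmetric] by (intro sum.cong refl) (simp add: c_def algebra_simps)
    finally have eq: "poly A Y - g (Suc j) = (\<Sum>i<yd (Suc j). c i * m i)" .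
    have "le (poly A Y - g (Suc j)) (\<omega> (Suc j))"
      using step.prems(4) by (intro le_diff) (simp_all add: \<omega>_def)
    have "le (c k1) (b0 j * \<omega> 0 - 1)"
    proof (cases "c k1 = 0")
      case False
      then have "\<delta> (c k1) + w k1 \<le> \<omega> (Suc j)"
        using expansion_value[of "yd (Suc j)" c k1, OF c k1' False]
          leD[OF \<open>le (poly A Y - g (Suc j)) (\<omega> (Suc j))\<close>]
        unfolding eq by linarith
      \<comment> \<open>The tail has weight \<open>\<alpha> j * \<omega> j\<close>, above the value
        of the next key form; so \<open>c k1\<close> has smaller value than t, and
        \<open>a k1\<close> must cancel t to first order.\<close>
      moreover have "\<omega> (Suc j) < b0 j * \<omega> 0 + w k1"
        using omega_less[OF j] wt_btail_eq[OF j] standard_wt[OF std] by (simp add: k1_def)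
      ultimately show ?thesis by (simp add: le_def)
    qed simp
    then have "le (a k1 - (- t)) (b0 j * \<omega> 0 - 1)" by (simp add: c_def)
    then have "a k1 \<noteq> 0" "\<delta> (a k1) = b0 j * \<omega> 0"
      using dominant[of "- t" "a k1" "b0 j * \<omega> 0 - 1"] \<open>t \<noteq> 0\<close> \<open>\<delta> t = _\<close> by simp_all
    moreover have "b0 j * \<omega> 0 < 0"
      using \<open>\<not> b0 j \<ge> 0\<close> X_pos by (simp add: omega_0 mult_neg_pos)
    ultimately show False
      using xpoly_nonneg[OF a(2)[of k1]] by simp
  qed
  then have "t \<in> xpoly"
    unfolding t_def using xpoly_X_power[of "nat (b0 j)"]
    by (intro xpoly_mult xpoly_cst) (simp add: power_int_def)
  then have "gp (Suc j) \<in> xcoeffs"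
    unfolding rec using IH j mpx[of k1] k1 \<open>yd j \<le> yd (Suc j)\<close>
    by (intro xcoeffs_diff xcoeffs_smult xcoeffs_power) auto
  then show ?case
    using IH by (auto simp: le_Suc_eq)
qed

lemma all_key_polynomials:
  assumes "1 \<le> b" "F \<in> xcoeffs" "monic_of F (b * yd (n + 1))" "le (poly F Y) (int b * \<omega> (n + 1))" "k \<le> n + 1"
  shows "g k \<in> polys"
proof (cases "k = 0")
  case True
  have "X = to_fract [:[:0, 1:]:]" by (simp add: X_def)
  then show ?thesis using True by (simp add: g_0 polys_def)
next
  case False
  obtain A where "A \<in> xcoeffs" "monic_of A (yd (n + 1))" "le (poly A Y) (\<omega> (n + 1))"
    using approximate_root[of "n + 1" b F] assms by auto
  then have "gp k \<in> xcoeffs"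
    using key_polynomials[of "n + 1" A] assms(5) False by auto
  then show ?thesis
    using polys_iff[OF gp(1)[of k]] gp(2)[of k] assms(5) False by auto
qed

lemma last_key_polynomial:
  assumes "g (n + 1) \<in> polys" "k \<le> n + 1"
  shows "g k \<in> polys"
proof (rule all_key_polynomials[of 1 "gp (n + 1)"])
  show "gp (n + 1) \<in> xcoeffs"
    using polys_iff[OF gp(1)[of "n + 1"]] gp(2)[of "n + 1"] assms by simp
  show "monic_of (gp (n + 1)) (1 * yd (n + 1))"
    using monic_of_gp[of "n + 1"] by simp
  show "le (poly (gp (n + 1)) Y) (int 1 * \<omega> (n + 1))"
    using gp(2)[of "n + 1"] by (simp add: \<omega>_def)
qed (use assms in auto)

end

section \<open>The total degree\<close>

lemma total_degree_Max: "total_degree f = Max ((\<lambda>z. fst z + snd z) ` supp f)"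
proof -
  have "{i + j | i j. coeff (coeff f j) i \<noteq> 0} = (\<lambda>z. fst z + snd z) ` supp f"
    by (force simp: supp_def)
  then show ?thesis by (simp add: total_degree_def)
qed

lemma total_degree_ge: "coeff (coeff f j) i \<noteq> 0 \<Longrightarrow> i + j \<le> total_degree f"
  unfolding total_degree_Max
  by (rule Max_ge) (auto intro!: finite_imageI[OF finite_supp] image_eqI[of _ _ "(i, j)"] simp: mem_supp)

lemma total_degree_attained:
  assumes "f \<noteq> 0"
  obtains i j where "coeff (coeff f j) i \<noteq> 0" "i + j = total_degree f"
proof -
  have "total_degree f \<in> (\<lambda>z. fst z + snd z) ` supp f"
    unfolding total_degree_Max using assms by (intro Max_in) (auto simp: supp_empty)
  then obtain z where "z \<in> supp f" "total_degree f = fst z + snd z" by auto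
  then show ?thesis using that[of "snd z" "fst z"] by (simp add: mem_supp)
qed

text \<open>The substitution of Y for x and XY for y: the exponent of the outer variable becomes the
  total degree, so that additivity of \<open>total_degree\<close> reduces to that of
  \<open>degree\<close>.\<close>

definition homog :: "poly2 \<Rightarrow> poly2" where
  "homog = relabel (\<lambda>z. (snd z, fst z + snd z))"

lemma homog_mult: "homog (f * h) = homog f * homog h"
proof -
  have "to_fract (homog f) = ev2 Y (X * Y) f" for f
    unfolding homog_def ev2_XY[symmetric] ev2_relabel ev2_supp[of Y "X * Y" f]
    by (intro sum.cong refl) (simp add: power_add power_mult_distrib mult_ac)
  then have "to_fract (homog (f * h)) = to_fract (homog f * homog h)"
    by (simp add: ev2.hom_mult)
  then show ?thesis by (simp only: to_fract_eq_iff)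
qed

lemma degree_homog:
  assumes "f \<noteq> 0"
  shows "degree (homog f) = total_degree f"
proof (rule antisym)
  show "degree (homog f) \<le> total_degree f"
  proof (rule degree_le, intro allI impI)
    fix e assume "total_degree f < e"
    show "coeff (homog f) e = 0"
    proof (rule poly_eqI, rule ccontr)
      fix k assume "coeff (coeff (homog f) e) k \<noteq> coeff 0 k"
      then have "coeff (coeff (homog f) e) k \<noteq> 0" by simp
      then obtain z where "z \<in> supp f" "(snd z, fst z + snd z) = (k, e)"
        unfolding homog_def by (rule relabel_nonzero)
      then show False
        using total_degree_ge[of f "snd z" "fst z"] \<open>total_degree f < e\<close> by (simp add: mem_supp)
    qed
  qed
  obtain i j where ij: "coeff (coeff f j) i \<noteq> 0" "i + j = total_degree f"
    using total_degree_attained[OF assms] .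
  have inj: "inj_on (\<lambda>z. (snd z, fst z + snd z)) (supp f)"
    by (rule inj_onI) (auto simp: prod_eq_iff)
  have "coeff (coeff (homog f) (i + j)) j = coeff (coeff f j) i"
    unfolding homog_def using ij(1) by (subst relabel_inj[OF inj, of "(i, j)"]) (auto simp: supp_def)
  then show "total_degree f \<le> degree (homog f)"
    using ij by (intro le_degree) auto
qed

lemma total_degree_mult:
  assumes "f \<noteq> 0" "h \<noteq> 0"
  shows "total_degree (f * h) = total_degree f + total_degree h"
proof -
  have "homog f \<noteq> 0" if nz: "f \<noteq> 0" for f
  proof
    assume 0: "homog f = 0"
    obtain i j where ij: "coeff (coeff f j) i \<noteq> 0" "i + j = total_degree f"
      using total_degree_attained[OF nz] by blast
    have inj: "inj_on (\<lambda>z. (snd z, fst z + snd z)) (supp f)"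
      by (rule inj_onI) (auto simp: prod_eq_iff)
    have "coeff (coeff (homog f) (i + j)) j = coeff (coeff f j) i"
      unfolding homog_def using ij(1) by (subst relabel_inj[OF inj, of "(i, j)"]) (auto simp: supp_def)
    then show False using ij 0 by simp
  qed
  then have "degree (homog f * homog h) = degree (homog f) + degree (homog h)"
    using assms by (intro degree_mult_eq)
  then show ?thesis
    using assms by (simp add: degree_homog flip: homog_mult)
qed

lemma degree_le_total_degree:
  assumes "f \<noteq> 0"
  shows "degree f \<le> total_degree f"
proof -
  have "coeff f (degree f) \<noteq> 0" using assms by simp
  then obtain i where "coeff (coeff f (degree f)) i \<noteq> 0" by (metis leading_coeff_0_iff)
  from total_degree_ge[OF this] show ?thesis by simp
qed

lemma nonconstant_polys_iff: "f \<in> nonconstant_polys \<longleftrightarrow> f \<noteq> 0 \<and> 0 < total_degree f"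
proof
  assume f: "f \<in> nonconstant_polys"
  have "f \<noteq> 0"
  proof
    assume "f = 0"
    then have "f = [:[:0:]:]" by simp
    then show False using f by (auto simp: nonconstant_polys_def)
  qed
  moreover have "total_degree f \<noteq> 0"
  proof
    assume 0: "total_degree f = 0"
    have "f = [:[:coeff (coeff f 0) 0:]:]"
    proof (rule poly_eqI, rule poly_eqI)
      fix j i
      show "coeff (coeff f j) i = coeff (coeff [:[:coeff (coeff f 0) 0:]:] j) i"
        using total_degree_ge[of f j i] 0 by (auto simp: coeff_pCons split: nat.splits)
    qed
    then show False using f unfolding nonconstant_polys_def by blast
  qed
  ultimately show "f \<noteq> 0 \<and> 0 < total_degree f" by simp
next
  assume f: "f \<noteq> 0 \<and> 0 < total_degree f"
  show "f \<in> nonconstant_polys"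
  proof (rule ccontr)
    assume "f \<notin> nonconstant_polys"
    then obtain c where c: "f = [:[:c:]:]" by (auto simp: nonconstant_polys_def)
    obtain i j where "coeff (coeff f j) i \<noteq> 0" "i + j = total_degree f"
      using total_degree_attained f by blast
    then show False using f c by (auto simp: coeff_pCons split: nat.splits)
  qed
qed

section \<open>The slopes of two coprime polynomials\<close>

lemma sum_lessThan_split:
  fixes h :: "nat \<Rightarrow> 'a::comm_monoid_add"
  shows "(\<Sum>r<k + l. h r) = (\<Sum>r<k. h r) + (\<Sum>r<l. h (k + r))"
  by (induction l) (simp_all add: add.assoc)

lemma coeff_mult_sum:
  fixes F G :: "'a::comm_semiring_1 poly"
  assumes "\<And>l. k \<le> l \<Longrightarrow> coeff G l = 0"
  shows "(\<Sum>l<k. coeff (monom 1 l * F) i * coeff G l) = coeff (G * F) i"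
proof -
  have "(\<Sum>l<k. coeff (monom 1 l * F) i * coeff G l) = (\<Sum>l\<in>{..<k} \<inter> {..i}. coeff F (i - l) * coeff G l)"
    by (subst sum.inter_restrict) (auto simp: coeff_monom_mult intro!: sum.cong)
  also have "\<dots> = (\<Sum>l\<le>i. coeff F (i - l) * coeff G l)"
  proof (intro sum.mono_neutral_left ballI)
    fix l assume "l \<in> {..i} - {..<k} \<inter> {..i}"
    then have "k \<le> l" by auto
    then show "coeff F (i - l) * coeff G l = 0" using assms by simp
  qed auto
  also have "\<dots> = coeff (G * F) i"
    unfolding coeff_mult by (intro sum.cong refl mult.commute)
  finally show ?thesis .
qed

lemma det_unit_upper_triangular:
  fixes A :: "ratfun mat"
  assumes A: "A \<in> carrier_mat k k" and "\<And>i j. i < k \<Longrightarrow> j < i \<Longrightarrow> A $$ (i, j) = 0" "\<And>i. i < k \<Longrightarrow> A $$ (i, i) = 1"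
  shows "det A = 1"
proof -
  have "upper_triangular A"
    using assms by (auto simp: upper_triangular_def)
  then have "det A = prod_list (diag_mat A)"
    using A by (rule det_upper_triangular)
  also have "\<dots> = (\<Prod>i = 0..<k. A $$ (i, i))"
    using A by (simp add: prod_list_diag_prod)
  also have "\<dots> = 1"
    using assms by (intro prod.neutral) auto
  finally show ?thesis .
qed

context key_data
begin

lemma le_prod:
  assumes "\<And>i. i \<in> A \<Longrightarrow> le (f i) (v i)" "finite A"
  shows "le (prod f A) (sum v A)"
  using assms(2,1) le_cst[of 1] by (induction A rule: finite_induct) (auto intro: le_mult)

text \<open>In the Leibniz expansion the bounds along every permutation add up to the same
  number.\<close>

lemma det_le:
  assumes C: "C \<in> carrier_mat N N" and le: "\<And>i r. i < N \<Longrightarrow> r < N \<Longrightarrow> le (C $$ (i, r)) (v r - v' i)"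
  shows "le (det C) ((\<Sum>r<N. v r) - (\<Sum>i<N. v' i))"
proof -
  have "le (signof p * (\<Prod>i = 0..<N. C $$ (i, p i))) ((\<Sum>r<N. v r) - (\<Sum>i<N. v' i))"
    if p: "p permutes {0..<N}" for p
  proof -
    have pN: "p i < N" if "i < N" for i
      using permutes_in_image[OF p, of i] that by simp
    have "le (\<Prod>i = 0..<N. C $$ (i, p i)) (\<Sum>i = 0..<N. v (p i) - v' i)"
      using le pN by (intro le_prod) auto
    also have "(\<Sum>i = 0..<N. v (p i) - v' i) = (\<Sum>r = 0..<N. v r) - (\<Sum>i = 0..<N. v' i)"
      using sum.permute[OF p, of v] by (simp add: sum_subtractf o_def)
    finally have "le (\<Prod>i = 0..<N. C $$ (i, p i)) ((\<Sum>r<N. v r) - (\<Sum>i<N. v' i))"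
      by (simp add: atLeast0LessThan)
    then show ?thesis
      by (cases rule: sign_cases[of p]) auto
  qed
  then show ?thesis
    unfolding det_def'[OF C] by (intro le_sum) auto
qed

text \<open>The columns of S are the multiples of f and f' by powers of y. Replacing the powers of y
  by the \<open>mp k\<close>, both in the multipliers and in the basis for the rows, leaves the
  determinant unchanged. It is a nonzero polynomial in x, hence of nonnegative value, while the
  entries in the new basis are bounded by \<open>expansion_value\<close>.\<close>

lemma sylvester_bound:
  fixes f f' :: poly2
  assumes nz: "f \<noteq> 0" "f' \<noteq> 0"
    and inj: "\<And>A B. A * f + B * f' = 0 \<Longrightarrow> A = 0 \<or> degree A < degree f' \<Longrightarrow> B = 0 \<or> degree B < degree f \<Longrightarrow>
      A = 0 \<and> B = 0"
  defines "M \<equiv> degree f" and "M' \<equiv> degree f'"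
  shows "0 \<le> int M' * \<delta> (to_fract f) + int M * \<delta> (to_fract f') +
    ((\<Sum>k<M'. w k) + (\<Sum>k<M. w k) - (\<Sum>k<M + M'. w k))"
proof -
  define N where "N = M + M'"
  define P where "P r = (if r < M' then monom 1 r * f else monom 1 (r - M') * f')" for r
  have degP: "coeff (P r) i = 0" if "r < N" "N \<le> i" for r i
    using that by (auto simp: P_def coeff_monom_mult N_def M_def M'_def intro!: coeff_eq_0)
  define S where "S = mat N N (\<lambda>(i, r). coeff (P r) i)"
  have S: "S \<in> carrier_mat N N" by (simp add: S_def)
  have "det S \<noteq> 0"
  proof
    assume "det S = 0"
    then obtain v where v: "v \<in> carrier_vec N" "v \<noteq> 0\<^sub>v N" "S *\<^sub>v v = 0\<^sub>v N"
      using det_0_iff_vec_prod_zero[OF S] by auto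
    define c where "c r = vec_index v r" for r
    have sum0: "(\<Sum>r<N. smult (c r) (P r)) = 0"
    proof (rule poly_eqI)
      fix i
      show "coeff (\<Sum>r<N. smult (c r) (P r)) i = coeff 0 i"
      proof (cases "i < N")
        case True
        have "vec_index (S *\<^sub>v v) i = (\<Sum>r = 0..<N. coeff (P r) i * c r)"
          using True v(1) by (simp add: S_def scalar_prod_def c_def)
        then have "(\<Sum>r = 0..<N. coeff (P r) i * c r) = 0"
          using v(3) True by simp
        then show ?thesis
          by (simp add: coeff_sum atLeast0LessThan mult.commute)
      next
        case False
        then show ?thesis by (simp add: coeff_sum degP)
      qed
    qed
    define A where "A = (\<Sum>r<M'. monom (c r) r)"
    define B where "B = (\<Sum>r<M. monom (c (M' + r)) r)"
    have cA: "coeff A r = (if r < M' then c r else 0)" for r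
      by (simp add: A_def coeff_sum coeff_monom)
    have cB: "coeff B r = (if r < M then c (M' + r) else 0)" for r
      by (simp add: B_def coeff_sum coeff_monom)
    have "(\<Sum>r<N. smult (c r) (P r)) = (\<Sum>r<M'. smult (c r) (P r)) + (\<Sum>r<M. smult (c (M' + r)) (P (M' + r)))"
      unfolding N_def add.commute[of M M'] by (rule sum_lessThan_split)
    also have "(\<Sum>r<M. smult (c (M' + r)) (P (M' + r))) = B * f'"
      unfolding B_def sum_distrib_right by (intro sum.cong refl) (simp add: P_def smult_monom flip: mult_smult_left)
    also have "(\<Sum>r<M'. smult (c r) (P r)) = A * f"
      unfolding A_def sum_distrib_right by (intro sum.cong refl) (simp add: P_def smult_monom flip: mult_smult_left)
    finally have "A * f + B * f' = 0" using sum0 by simp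
    moreover have "A = 0 \<or> degree A < degree f'"
      using cA[of "degree A"] by (auto simp: M'_def split: if_splits)
    moreover have "B = 0 \<or> degree B < degree f"
      using cB[of "degree B"] by (auto simp: M_def split: if_splits)
    ultimately have AB: "A = 0" "B = 0" using inj by blast+
    have "c r = 0" if "r < N" for r
    proof (cases "r < M'")
      case True
      then show ?thesis using cA[of r] AB by simp
    next
      case False
      then obtain l where "r = M' + l" by (metis le_Suc_ex not_less)
      then show ?thesis using cB[of l] AB that by (simp add: N_def)
    qed
    then have "v = 0\<^sub>v N"
      using v(1) by (intro eq_vecI) (auto simp: c_def)
    with v(2) show False by simp
  qed
  define S' where "S' = map_mat (evx X) S"
  have S': "S' \<in> carrier_mat N N" using S by (simp add: S'_def)
  have detS': "det S' = evx X (det S)" unfolding S'_def by (rule evx.hom_det)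
  define F where "F = map_poly (evx X) f"
  define F' where "F' = map_poly (evx X) f'"
  have F: "F \<in> laurent_coeffs" "poly F Y = to_fract f" "F' \<in> laurent_coeffs" "poly F' Y = to_fract f'"
    unfolding F_def F'_def by (auto simp: poly_map_evx_X)
  define Q where "Q r = (if r < M' then mp r * F else mp (r - M') * F')" for r
  define v where "v r = (if r < M' then w r + \<delta> (to_fract f) else w (r - M') + \<delta> (to_fract f'))" for r
  have Q: "Q r \<in> laurent_coeffs" "\<delta> (poly (Q r) Y) = v r" for r
    using F mp nz by (auto simp: Q_def v_def mult delta_m)
  have degQ: "coeff (Q r) i = 0" if "r < N" "N \<le> i" for r i
  proof -
    have "degree (mp r * F) \<le> r + M" "degree (mp (r - M') * F') \<le> (r - M') + M'"
      using degree_mult_le[of "mp r" F] degree_mult_le[of "mp (r - M')" F'] mp(3)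
      by (simp_all add: F_def F'_def M_def M'_def)
    then show ?thesis
      using that by (auto simp: Q_def N_def intro!: coeff_eq_0)
  qed
  have "\<forall>r. r < N \<longrightarrow> (\<exists>a. Q r = (\<Sum>i<N. smult (a i) (mp i)) \<and> (\<forall>i. a i \<in> laurent_x))"
    using laurent_expansion Q(1) degQ by blast
  then have "\<forall>r. \<exists>a. r < N \<longrightarrow> Q r = (\<Sum>i<N. smult (a i) (mp i)) \<and> (\<forall>i. a i \<in> laurent_x)"
    by blast
  from choice[OF this] obtain a where
    a: "\<And>r. r < N \<Longrightarrow> Q r = (\<Sum>i<N. smult (a r i) (mp i))" "\<And>r i. r < N \<Longrightarrow> a r i \<in> laurent_x"
    by blast
  define C where "C = mat N N (\<lambda>(i, r). a r i)"
  have C: "C \<in> carrier_mat N N" by (simp add: C_def)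
  have leC: "le (C $$ (i, r)) (v r - w i)" if "i < N" "r < N" for i r
  proof (cases "a r i = 0")
    case False
    have "poly (Q r) Y = (\<Sum>i<N. a r i * m i)"
      by (subst a(1)[OF that(2)]) (simp add: poly_sum mp)
    then have "\<delta> (a r i) + w i \<le> v r"
      using expansion_value(2)[of N "a r" i] a(2)[OF that(2)] that(1) False Q(2)[of r] by simp
    then show ?thesis using that by (simp add: C_def le_def)
  qed (use that in \<open>simp add: C_def\<close>)
  \<comment> \<open>T writes the \<open>mp k\<close> in powers of y, and T' does the same for the
    multipliers in two diagonal blocks; both are unit upper triangular.\<close>
  define T where "T = mat N N (\<lambda>(i, k). coeff (mp k) i)"
  define T' where "T' = mat N N (\<lambda>(l, r). if r < M' then (if l < M' then coeff (mp r) l else 0)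
      else (if M' \<le> l then coeff (mp (r - M')) (l - M') else 0))"
  have T: "T \<in> carrier_mat N N" "T' \<in> carrier_mat N N" by (simp_all add: T_def T'_def)
  have detT: "det T = 1" by (rule det_unit_upper_triangular[OF T(1)]) (auto simp: T_def)
  have detT': "det T' = 1" by (rule det_unit_upper_triangular[OF T(2)]) (auto simp: T'_def)
  have TC: "(T * C) $$ (i, r) = coeff (Q r) i" if "i < N" "r < N" for i r
  proof -
    have "(T * C) $$ (i, r) = (\<Sum>k = 0..<N. coeff (mp k) i * a r k)"
      using that by (simp add: T_def C_def scalar_prod_def)
    also have "\<dots> = coeff (Q r) i"
      by (subst a(1)[OF that(2)]) (simp add: coeff_sum atLeast0LessThan mult.commute)
    finally show ?thesis .
  qed
  have ST: "(S' * T') $$ (i, r) = coeff (Q r) i" if "i < N" "r < N" for i r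
  proof -
    have "(S' * T') $$ (i, r) = (\<Sum>l = 0..<N. evx X (coeff (P l) i) * T' $$ (l, r))"
      using that by (simp add: S'_def S_def T'_def scalar_prod_def)
    also have "\<dots> = coeff (Q r) i"
    proof (cases "r < M'")
      case True
      have "(\<Sum>l = 0..<N. evx X (coeff (P l) i) * T' $$ (l, r)) = (\<Sum>l<M'. evx X (coeff (monom 1 l * f) i) * coeff (mp r) l)"
        using that True by (intro sum.mono_neutral_cong_right) (auto simp: T'_def P_def N_def)
      also have "\<dots> = (\<Sum>l<M'. coeff (monom 1 l * F) i * coeff (mp r) l)"
        by (intro sum.cong refl) (simp add: coeff_monom_mult F_def)
      also have "\<dots> = coeff (mp r * F) i"
        by (rule coeff_mult_sum) (use True in simp)
      finally show ?thesis using True by (simp add: Q_def)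
    next
      case False
      define r' where "r' = r - M'"
      have r': "r' < M" using that False by (simp add: r'_def N_def)
      have "(\<Sum>l = 0..<N. evx X (coeff (P l) i) * T' $$ (l, r)) =
          (\<Sum>l<M. evx X (coeff (P (M' + l)) i) * T' $$ (M' + l, r))"
        unfolding atLeast0LessThan N_def add.commute[of M M'] sum_lessThan_split
        using that False by (simp add: T'_def N_def)
      also have "\<dots> = (\<Sum>l<M. coeff (monom 1 l * F') i * coeff (mp r') l)"
        using that False by (intro sum.cong refl) (auto simp: T'_def P_def N_def r'_def coeff_monom_mult F'_def)
      also have "\<dots> = coeff (mp r' * F') i"
        by (rule coeff_mult_sum) (use r' in simp)
      finally show ?thesis using False by (simp add: Q_def r'_def)
    qed
    finally show ?thesis .
  qed
  \<comment> \<open>Both products list the coefficients of the polynomials \<open>Q r\<close> in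
    powers of y.\<close>
  have "T * C = S' * T'"
    using T C S' TC ST by (intro eq_matI) auto
  then have "det T * det C = det S' * det T'"
    by (metis det_mult T C S')
  then have "det C = evx X (det S)" by (simp add: detT detT' detS')
  moreover have "le (det C) ((\<Sum>r<N. v r) - (\<Sum>i<N. w i))"
    by (rule det_le[OF C]) (rule leC)
  ultimately have "le (evx X (det S)) ((\<Sum>r<N. v r) - (\<Sum>i<N. w i))" by simp
  then have "\<delta> (evx X (det S)) \<le> (\<Sum>r<N. v r) - (\<Sum>i<N. w i)"
    by (rule leD) (use \<open>det S \<noteq> 0\<close> in simp)
  moreover have "0 \<le> \<delta> (evx X (det S))"
    by (rule xpoly_nonneg) (use \<open>det S \<noteq> 0\<close> in \<open>auto simp: xpoly_def\<close>)
  moreover have "(\<Sum>r<N. v r) = int M' * \<delta> (to_fract f) + int M * \<delta> (to_fract f') + ((\<Sum>k<M'. w k) + (\<Sum>k<M. w k))"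
  proof -
    have "(\<Sum>r<N. v r) = (\<Sum>r<M'. v r) + (\<Sum>r<M. v (M' + r))"
      unfolding N_def add.commute[of M M'] by (rule sum_lessThan_split)
    then show ?thesis by (simp add: v_def sum.distrib)
  qed
  ultimately show ?thesis by (simp add: N_def)
qed

text \<open>For \<open>f ^ a\<close> and \<open>f' ^ a\<close> the bound of
  \<open>sylvester_bound\<close> becomes \<open>a * a * E\<close> plus a term linear in a, which
  stems from the bounded excess of the weights over \<tau>. A negative E would violate it for large
  a.\<close>

lemma coprime_slopes:
  fixes f f' :: poly2
  assumes cop: "coprime f f'" and nz: "f \<noteq> 0" "f' \<noteq> 0"
  shows "\<tau> * real (degree f) * real (degree f') \<le>
    real (degree f') * of_int (\<delta> (to_fract f)) + real (degree f) * of_int (\<delta> (to_fract f'))"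
proof (rule ccontr)
  define M where "M = degree f"
  define M' where "M' = degree f'"
  define E where "E = real M' * of_int (\<delta> (to_fract f)) + real M * of_int (\<delta> (to_fract f')) - \<tau> * real M * real M'"
  obtain C where C: "C \<ge> 0" "\<And>k. of_int (w k) \<le> \<tau> * real k + C"
    by (rule w_le) (rule that)
  assume "\<not> ?thesis"
  then have E: "E < 0" by (simp add: E_def M_def M'_def)
  have gauss: "(\<Sum>k<N. \<tau> * real k) = \<tau> * (real N * (real N - 1) / 2)" for N
  proof (induction N)
    case (Suc N)
    have "(\<Sum>k<Suc N. \<tau> * real k) = \<tau> * (real N * (real N - 1) / 2) + \<tau> * real N"
      using Suc by simp
    also have "\<dots> = \<tau> * (real N * (real N - 1) / 2 + real N)"
      by (simp only: distrib_left)
    also have "real N * (real N - 1) / 2 + real N = real (Suc N) * (real (Suc N) - 1) / 2"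
      by (simp add: field_simps)
    finally show ?case .
  qed simp
  have sum_le: "real_of_int (\<Sum>k<N. w k) \<le> \<tau> * (real N * (real N - 1) / 2) + real N * C" for N
  proof -
    have "real_of_int (\<Sum>k<N. w k) \<le> (\<Sum>k<N. \<tau> * real k + C)"
      unfolding of_int_sum using C(2) by (intro sum_mono)
    also have "\<dots> = \<tau> * (real N * (real N - 1) / 2) + real N * C"
      by (simp add: sum.distrib gauss)
    finally show ?thesis .
  qed
  have sum_ge: "\<tau> * (real N * (real N - 1) / 2) \<le> real_of_int (\<Sum>k<N. w k)" for N
  proof -
    have "\<tau> * (real N * (real N - 1) / 2) = (\<Sum>k<N. \<tau> * real k)"
      by (simp add: gauss)
    also have "\<dots> \<le> real_of_int (\<Sum>k<N. w k)"
      unfolding of_int_sum using w_ge by (intro sum_mono)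
    finally show ?thesis .
  qed
  have main: "0 \<le> real a * real a * E + real a * (real (M + M') * C)" for a
  proof -
    have cop': "coprime (f ^ a) (f' ^ a)" using cop by simp
    have nz': "f ^ a \<noteq> 0" "f' ^ a \<noteq> 0" using nz by simp_all
    have inj: "A = 0 \<and> B = 0" if "A * f ^ a + B * f' ^ a = 0" "B = 0 \<or> degree B < degree (f ^ a)" for A B
    proof -
      have "f ^ a dvd B * f' ^ a"
        using that(1) by (metis add_eq_0_iff dvd_minus_iff dvd_triv_right)
      then have "f ^ a dvd B"
        using cop' by (simp add: coprime_dvd_mult_left_iff)
      then have "B = 0"
        using that(2) by (metis dvd_imp_degree_le not_less)
      then show ?thesis using that(1) nz(1) by simp
    qed
    have deg: "degree (f ^ a) = a * M" "degree (f' ^ a) = a * M'"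
      using nz by (simp_all add: degree_power_eq M_def M'_def)
    have del: "\<delta> (to_fract (f ^ a)) = int a * \<delta> (to_fract f)" "\<delta> (to_fract (f' ^ a)) = int a * \<delta> (to_fract f')"
      using nz by (simp_all add: to_fract_power power)
    have "0 \<le> int (a * M') * (int a * \<delta> (to_fract f)) + int (a * M) * (int a * \<delta> (to_fract f')) +
        ((\<Sum>k<a * M'. w k) + (\<Sum>k<a * M. w k) - (\<Sum>k<a * M + a * M'. w k))"
      using sylvester_bound[OF nz' inj] unfolding deg del by blast
    then have "0 \<le> real_of_int (int (a * M') * (int a * \<delta> (to_fract f)) + int (a * M) * (int a * \<delta> (to_fract f')) +
        ((\<Sum>k<a * M'. w k) + (\<Sum>k<a * M. w k) - (\<Sum>k<a * M + a * M'. w k)))"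
      by (simp only: of_int_0_le_iff)
    also have "\<dots> = real (a * M') * (real a * of_int (\<delta> (to_fract f))) + real (a * M) * (real a * of_int (\<delta> (to_fract f'))) +
        (real_of_int (\<Sum>k<a * M'. w k) + real_of_int (\<Sum>k<a * M. w k) - real_of_int (\<Sum>k<a * M + a * M'. w k))"
      by simp
    also have "\<dots> \<le> real (a * M') * (real a * of_int (\<delta> (to_fract f))) + real (a * M) * (real a * of_int (\<delta> (to_fract f'))) +
        ((\<tau> * (real (a * M') * (real (a * M') - 1) / 2) + real (a * M') * C) +
         (\<tau> * (real (a * M) * (real (a * M) - 1) / 2) + real (a * M) * C) -
         \<tau> * (real (a * M + a * M') * (real (a * M + a * M') - 1) / 2))"
      by (intro add_left_mono diff_mono add_mono sum_le sum_ge)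
    \<comment> \<open>The three triangular sums combine to \<open>- \<tau> * M * M'\<close> times
      \<open>a * a\<close>; their linear parts cancel because the degrees add up.\<close>
    also have "\<dots> = real a * real a * E + real a * (real (M + M') * C)"
      by (simp add: E_def field_simps)
    finally show ?thesis .
  qed
  define a where "a = nat \<lceil>real (M + M') * C / (- E)\<rceil> + 1"
  have "real (M + M') * C / (- E) < real a" unfolding a_def by linarith
  then have "real (M + M') * C < real a * (- E)"
    by (rule iffD1[OF pos_divide_less_eq, rotated]) (use E in simp)
  then have "real a * (real (M + M') * C) < real a * (real a * (- E))"
    by (intro mult_strict_left_mono) (simp_all add: a_def)
  then show False using main[of a] by (simp add: algebra_simps)
qed

end

section \<open>The center\<close>

context local_bounds
begin

text \<open>A denominator with nonzero constant term has value 0, since its other terms have value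
  at most -1.\<close>

lemma local_ring_nonpos:
  assumes "local_coords pt = (u, v)" "f \<in> local_ring pt" "f \<noteq> 0"
  shows "\<delta> f \<le> 0"
proof -
  obtain F G where f: "f = ev2 u v F / ev2 u v G" and G: "coeff (coeff G 0) 0 \<noteq> 0"
    using assms(1,2) by (auto simp: local_ring_def subst2_eq_ev2)
  have F: "le (ev2 u v F) 0"
    using high_order[of 0 F] by simp
  define G' where "G' = G - [:[:coeff (coeff G 0) 0:]:]"
  have "le (ev2 u v G') (- int 1)"
  proof (rule high_order)
    fix i j :: nat assume "i + j < 1"
    then show "coeff (coeff G' j) i = 0" by (simp add: G'_def)
  qed
  moreover have "ev2 u v G' = ev2 u v G - cst (coeff (coeff G 0) 0)"
    by (simp add: G'_def ev2.hom_minus)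
  ultimately have "ev2 u v G \<noteq> 0" "\<delta> (ev2 u v G) = 0"
    using dominant[of "cst (coeff (coeff G 0) 0)" "ev2 u v G" "- 1"] G by simp_all
  then show ?thesis
    using F assms(3) f by (auto simp: divide le_def)
qed

lemma center_eq:
  assumes "local_coords pt = (u, v)"
    and "\<And>pt'. pt' \<noteq> pt \<Longrightarrow> \<exists>f\<in>local_ring pt'. f \<noteq> 0 \<and> 0 < \<delta> f"
  shows "center (\<lambda>h. - \<delta> h) = {pt}"
proof (intro equalityI subsetI)
  fix pt' assume c: "pt' \<in> center (\<lambda>h. - \<delta> h)"
  have "pt' = pt"
  proof (rule ccontr)
    assume "pt' \<noteq> pt"
    then obtain f where "f \<in> local_ring pt'" "f \<noteq> 0" "0 < \<delta> f" using assms(2) by blast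
    then show False using c by (auto simp: center_def)
  qed
  then show "pt' \<in> {pt}" by simp
next
  fix pt' assume "pt' \<in> {pt}"
  then show "pt' \<in> center (\<lambda>h. - \<delta> h)"
    using local_ring_nonpos[OF assms(1)] by (auto simp: center_def)
qed

end

lemma local_ringI:
  assumes "local_coords pt = (s, t)" "coeff (coeff G 0) 0 \<noteq> 0" "f = ev2 s t F / ev2 s t G"
  shows "f \<in> local_ring pt"
  unfolding local_ring_def subst2_eq_ev2 using assms by auto

context semidegree
begin

lemma finite_point_not_center: "\<exists>f\<in>local_ring (Finite_Point a b). f \<noteq> 0 \<and> 0 < \<delta> f"
proof -
  have "X - cst a \<in> local_ring (Finite_Point a b)"
    by (rule local_ringI[of _ "X - cst a" "Y - cst b" 1 _ "[:[:0, 1:]:]"]) simp_all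
  moreover have "le ((X - cst a) - X) 0"
    using le_cst[of "- a"] by (simp add: cst.hom_uminus)
  then have "X - cst a \<noteq> 0" "\<delta> (X - cst a) = \<delta> X"
    using dominant[of X "X - cst a" 0] X_pos by simp_all
  ultimately show ?thesis using X_pos by (intro bexI[of _ "X - cst a"]) auto
qed

end

section \<open>Semidegrees with center on the horizontal chart\<close>

context key_data
begin

lemma last_power: "m (b * yd (n + 1)) = g (n + 1) ^ b" "w (b * yd (n + 1)) = int b * \<omega> (n + 1)"
proof -
  let ?c = "\<lambda>l. if l = n + 1 then b else 0"
  have std: "std ?c" using alpha_pos by (auto simp: std_def Suc_le_eq)
  have dg: "dg ?c = b * yd (n + 1)" by (rule dg_single) auto
  have "mono ?c = g (n + 1) ^ b" by (rule mono_single) auto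
  then show "m (b * yd (n + 1)) = g (n + 1) ^ b"
    using standard_mono[OF std] unfolding dg by simp
  have "wt ?c = int b * \<omega> (n + 1)" by (rule wt_single) auto
  then show "w (b * yd (n + 1)) = int b * \<omega> (n + 1)"
    using standard_wt[OF std] unfolding dg by simp
qed

lemma monic_polynomial_imp_key_polynomials:
  assumes "1 \<le> b" "coeff f (b * yd (n + 1)) = [:c0:]" "c0 \<noteq> 0" "\<And>i. b * yd (n + 1) < i \<Longrightarrow> coeff f i = 0"
    and "\<delta> (to_fract f) = int b * \<omega> (n + 1)" "k \<le> n + 1"
  shows "g k \<in> polys"
proof (rule all_key_polynomials[of b "smult (cst (1 / c0)) (map_poly (evx X) f)"])
  show "smult (cst (1 / c0)) (map_poly (evx X) f) \<in> xcoeffs"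
    by (intro xcoeffs_smult xpoly_cst xcoeffs_map)
  show "monic_of (smult (cst (1 / c0)) (map_poly (evx X) f)) (b * yd (n + 1))"
    using assms(2-4) by (simp add: monic_of_def flip: cst.hom_mult)
  show "le (poly (smult (cst (1 / c0)) (map_poly (evx X) f)) Y) (int b * \<omega> (n + 1))"
    using assms(5) by (simp add: poly_map_evx_X le_cst_mult le_def[of "to_fract f"])
qed (use assms in auto)

lemma tau_less_omega_1: "1 \<le> n \<Longrightarrow> \<tau> < of_int (\<omega> 1)"
  using tau_less[of 1] by simp

lemma tau_le_omega_1: "\<tau> \<le> of_int (\<omega> 1)"
  using tau_le[of 1] by simp

lemma poly_last_degree:
  assumes "to_fract f = g (n + 1)"
  shows "f \<noteq> 0" "degree f = yd (n + 1)"
proof -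
  show "f \<noteq> 0" using g_nonzero[of "n + 1"] assms by auto
  have "map_poly (evx X) f = gp (n + 1)"
    using gp[of "n + 1"] assms by (intro laurent_coeffs_eqI) (auto simp: poly_map_evx_X)
  then show "degree f = yd (n + 1)"
    using gp(3)[of "n + 1"] degree_map_evx_X[of f] by simp
qed

lemma yd_last_pos: "0 < yd (n + 1)" by (rule yd_pos) simp

text \<open>Since \<tau> is nonnegative, every discarded term has value at most
  \<open>\<tau> * M * yd (n + 1) + C\<close>, with the C of \<open>w_le\<close>. C is chosen before
  M, so its share of the slope tends to 0 as M grows.\<close>

lemma approximating_value:
  assumes "0 \<le> \<omega> (n + 1)"
  shows "\<exists>C\<ge>0. \<forall>M f a. to_fract f = g (n + 1) ^ M - (\<Sum>k<M * yd (n + 1). a k * m k) \<and>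
    (\<forall>k. le (a k) (- 1)) \<and> f \<noteq> 0 \<longrightarrow> of_int (\<delta> (to_fract f)) \<le> real M * of_int (\<omega> (n + 1)) + C"
proof -
  obtain C where C: "C \<ge> 0" "\<And>k. of_int (w k) \<le> \<tau> * real k + C"
    by (rule w_le) (rule that)
  have tau: "0 \<le> \<tau>" using assms by (simp add: \<tau>_def)
  have "of_int (\<delta> (to_fract f)) \<le> real M * of_int (\<omega> (n + 1)) + C"
    if f: "to_fract f = g (n + 1) ^ M - (\<Sum>k<M * yd (n + 1). a k * m k)" and a: "\<And>k. le (a k) (- 1)" and nz: "f \<noteq> 0"
    for M f a
  proof -
    define B where "B = \<lfloor>real M * of_int (\<omega> (n + 1)) + C\<rfloor>"
    have B1: "z \<le> B" if "of_int z \<le> real M * of_int (\<omega> (n + 1)) + C" for z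
      using that unfolding B_def by (rule iffD2[OF le_floor_iff])
    have B2: "of_int B \<le> real M * of_int (\<omega> (n + 1)) + C"
      unfolding B_def by (rule of_int_floor_le)
    have "int M * \<omega> (n + 1) \<le> B"
      using C(1) by (intro B1) simp
    have "w k \<le> B" if "k < M * yd (n + 1)" for k
    proof -
      have "of_int (w k) \<le> \<tau> * real k + C" by (rule C(2))
      also have "\<tau> * real k \<le> \<tau> * real (M * yd (n + 1))"
        using tau that by (intro mult_left_mono) (simp_all only: of_nat_le_iff less_imp_le)
      also have "\<dots> = real M * (\<tau> * real (yd (n + 1)))" by simp
      also have "\<dots> = real M * of_int (\<omega> (n + 1))" by (simp only: tau_yd)
      finally show ?thesis by (intro B1) simp
    qed
    then have "le (a k * m k) B" if "k < M * yd (n + 1)" for k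
      using le_mult[OF a[of k], of "m k" "w k"] that delta_m[of k]
      by (force intro: le_mono simp: le_def[of "m k"])
    moreover have "le (g (n + 1) ^ M) B"
      using le_power[of "g (n + 1)" "\<omega> (n + 1)" M] \<open>int M * \<omega> (n + 1) \<le> B\<close>
      by (auto intro: le_mono simp: \<omega>_def)
    ultimately have "le (to_fract f) B"
      unfolding f by (intro le_diff le_sum) auto
    then have "\<delta> (to_fract f) \<le> B"
      by (rule leD) (use nz in simp)
    then show ?thesis using B2 by linarith
  qed
  with C(1) show ?thesis by blast
qed

end

text \<open>The case of a center [0:1:c]. By \<open>nuX\<close> the shift c is such that the
  standard monomials restrict to powers of v; \<open>nondegree\<close> excludes the multiples of
  deg.\<close>

locale horizontal = key_subst +
  assumes p1: "p = 1" and q1: "q = 1" and nuX: "nu k = monom 1 k"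
    and nondegree: "1 \<le> n \<or> \<omega> 1 < \<omega> 0"
begin

lemma r_eq: "r = \<omega> 0" using rp p1 by simp

lemma omega_1_le: "\<omega> 1 \<le> \<omega> 0" using rq r_eq q1 by simp

lemma tau_less_omega_0: "\<tau> < of_int (\<omega> 0)"
proof (cases "1 \<le> n")
  case True
  then have "\<tau> < of_int (\<omega> 1)" by (rule tau_less_omega_1)
  then show ?thesis using omega_1_le by linarith
next
  case False
  then have "\<omega> 1 < \<omega> 0" using nondegree by simp
  then show ?thesis using tau_le_omega_1 by linarith
qed

definition u :: ratfun where "u = inverse X"
definition v :: ratfun where "v = Y * inverse X - cst c"

lemma Psi_uv: "\<Psi> (ev2 u v F) = to_fract F"
  unfolding u_def v_def by (rule Psi_local_coords[OF p1 q1])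

lemma lower_bound:
  assumes "low_order F k"
  shows "ev2 u v F \<noteq> 0" "w k - int k * \<omega> 0 \<le> \<delta> (ev2 u v F)"
  using lower_bound_horizontal[OF p1 q1 nuX assms] by (simp_all add: u_def v_def)

lemma delta_u: "\<delta> u = - \<omega> 0" "u \<noteq> 0"
  by (simp_all add: u_def inverse omega_0)

text \<open>Divided by a power of X, the last key form is a polynomial in u and v whose restriction
  is a pure power of v; it is the one that attains the local bound.\<close>

lemma last_key_uv:
  obtains G where "g (n + 1) = X ^ yd (n + 1) * ev2 u v G" "at0 G = monom 1 (yd (n + 1))"
proof -
  obtain G where G: "\<Psi> (m (yd (n + 1))) = X powi (- (int q * int (yd (n + 1)))) * to_fract G"
      "at0 G = nu (yd (n + 1))"
    using mono_subst_poly by blast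
  have m: "m (yd (n + 1)) = g (n + 1)" using last_power(1)[of 1] by simp
  have "\<Psi> (X ^ yd (n + 1)) = X powi (- int (yd (n + 1)))"
    using Psi_X_powi[of "int (yd (n + 1))"] by (simp add: p1[THEN arg_cong[of _ _ int]])
  then have "\<Psi> (X ^ yd (n + 1) * ev2 u v G) = \<Psi> (g (n + 1))"
    using G(1) unfolding m by (simp add: Psi.hom_mult Psi_uv q1[THEN arg_cong[of _ _ int]])
  then have "g (n + 1) = X ^ yd (n + 1) * ev2 u v G"
    by (simp only: Psi.eq_iff)
  moreover have "at0 G = monom 1 (yd (n + 1))" using G(2) by (simp only: nuX)
  ultimately show ?thesis by (rule that)
qed

text \<open>At u = 0 only the form of top degree D survives: F(0, v) is P(v + c), where P is that
  form at x = 1. Its order at 0 is at most its degree, hence at most D.\<close>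

lemma chart:
  fixes f :: poly2
  assumes "f \<noteq> 0"
  obtains F k where "ev2 u v F = u ^ total_degree f * to_fract f" "low_order F k" "k \<le> total_degree f"
    "coeff (coeff F (total_degree f)) 0 = coeff (coeff f (total_degree f)) 0"
proof -
  define D where "D = total_degree f"
  have D: "fst z + snd z \<le> D" if "z \<in> supp f" for z
    using that total_degree_ge[of f "snd z" "fst z"] by (simp add: mem_supp D_def)
  define F where "F = (\<Sum>z\<in>supp f. smult (monom (cf f z) (D - (fst z + snd z))) ([:[:c:], 1:] ^ snd z))"
  have "v + cst c = Y * u" by (simp add: u_def v_def)
  have "ev2 u v F = (\<Sum>z\<in>supp f. cst (cf f z) * u ^ (D - (fst z + snd z)) * (Y * u) ^ snd z)"
    unfolding F_def ev2.hom_sum using \<open>v + cst c = Y * u\<close>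
    by (intro sum.cong refl) (simp add: ev2.hom_power add.commute)
  also have "\<dots> = (\<Sum>z\<in>supp f. u ^ D * (cst (cf f z) * X ^ fst z * Y ^ snd z))"
  proof (intro sum.cong refl)
    fix z assume z: "z \<in> supp f"
    have "u ^ D = u ^ (D - (fst z + snd z)) * u ^ fst z * u ^ snd z"
      using D[OF z] by (simp flip: power_add)
    moreover have "u ^ fst z * X ^ fst z = 1"
      by (simp add: u_def flip: power_mult_distrib)
    ultimately show "cst (cf f z) * u ^ (D - (fst z + snd z)) * (Y * u) ^ snd z =
        u ^ D * (cst (cf f z) * X ^ fst z * Y ^ snd z)"
      by (simp add: power_mult_distrib mult_ac)
  qed
  also have "\<dots> = u ^ D * to_fract f"
    by (simp add: ev2_supp sum_distrib_left flip: ev2_XY)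
  finally have ev: "ev2 u v F = u ^ D * to_fract f" .
  define P where "P = (\<Sum>z\<in>supp f. if fst z + snd z = D then monom (cf f z) (snd z) else 0)"
  have coeffP: "coeff P j = (if j \<le> D then coeff (coeff f j) (D - j) else 0)" for j
  proof -
    have "coeff P j = (\<Sum>z\<in>supp f. if z = (D - j, j) \<and> j \<le> D then cf f z else 0)"
      unfolding P_def coeff_sum
    proof (intro sum.cong refl)
      fix z show "coeff (if fst z + snd z = D then monom (cf f z) (snd z) else 0) j = (if z = (D - j, j) \<and> j \<le> D then cf f z else 0)"
        by (cases z) (auto simp: coeff_monom)
    qed
    also have "\<dots> = (if (D - j, j) \<in> supp f \<and> j \<le> D then coeff (coeff f j) (D - j) else 0)"
      by (cases "j \<le> D") (simp_all add: sum.delta)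
    also have "\<dots> = (if j \<le> D then coeff (coeff f j) (D - j) else 0)"
      by (simp add: mem_supp)
    finally show ?thesis .
  qed
  have "degree P \<le> D" by (rule degree_le) (simp add: coeffP)
  have "P \<noteq> 0"
  proof
    assume "P = 0"
    obtain i j where ij: "coeff (coeff f j) i \<noteq> 0" "i + j = total_degree f"
      using total_degree_attained[OF assms] .
    then have "coeff P j \<noteq> 0" unfolding coeffP D_def by (simp flip: ij(2))
    with \<open>P = 0\<close> show False by simp
  qed
  have at0: "at0 F = pcompose P [:c, 1:]"
  proof -
    have "at0 F = (\<Sum>z\<in>supp f. if fst z + snd z = D then smult (cf f z) ([:c, 1:] ^ snd z) else 0)"
      unfolding F_def at0.hom_sum
    proof (intro sum.cong refl)
      fix z assume "z \<in> supp f"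
      then show "at0 (smult (monom (cf f z) (D - (fst z + snd z))) ([:[:c:], 1:] ^ snd z)) =
          (if fst z + snd z = D then smult (cf f z) ([:c, 1:] ^ snd z) else 0)"
        using D[of z] by (auto simp: at0.hom_power coeff_monom)
    qed
    also have "\<dots> = pcompose P [:c, 1:]"
      unfolding P_def pcompose_sum
      by (intro sum.cong refl) (simp add: monom_altdef pcompose_smult pcompose_hom.hom_power pcompose_pCons)
    finally show ?thesis .
  qed
  have "at0 F \<noteq> 0"
    unfolding at0 using \<open>P \<noteq> 0\<close> by (simp add: pcompose_eq_0_iff)
  then have ex: "\<exists>k. coeff (at0 F) k \<noteq> 0"
    using leading_coeff_0_iff by blast
  define k where "k = (LEAST k. coeff (at0 F) k \<noteq> 0)"
  have k: "coeff (at0 F) k \<noteq> 0"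
    unfolding k_def using ex by (rule LeastI_ex)
  have "coeff (at0 F) j = 0" if "j < k" for j
    using that not_less_Least unfolding k_def by blast
  then have low: "low_order F k" using k by (simp add: low_order_def)
  have "k \<le> degree (at0 F)" using k by (rule le_degree)
  also have "\<dots> = degree P" unfolding at0 by (simp add: degree_pcompose)
  also have "\<dots> \<le> D" by fact
  finally have "k \<le> D" .
  have "coeff (at0 F) D = coeff P D"
  proof (cases "degree P = D")
    case True
    have "lead_coeff (pcompose P [:c, 1:]) = lead_coeff P"
      by (subst lead_coeff_comp) simp_all
    then show ?thesis
      unfolding at0 using True by (simp add: degree_pcompose)
  next
    case False
    then have "degree P < D" using \<open>degree P \<le> D\<close> by simp
    then show ?thesis
      unfolding at0 by (simp add: coeff_eq_0 degree_pcompose)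
  qed
  then have "coeff (coeff F D) 0 = coeff (coeff f D) 0" by (simp add: coeffP)
  then show ?thesis using that ev low \<open>k \<le> D\<close> unfolding D_def by blast
qed

lemma chart_value:
  assumes "f \<noteq> 0" "ev2 u v F = u ^ total_degree f * to_fract f"
  shows "\<delta> (to_fract f) = int (total_degree f) * \<omega> 0 + \<delta> (ev2 u v F)"
  using assms by (simp add: mult power delta_u)

text \<open>If k is the order of F(0, v) in the chart, then \<delta> f is at least
  \<open>D * \<omega> 0 - k * (\<omega> 0 - \<tau>)\<close> for the total degree D, and k is at most
  D.\<close>

lemma degree_bound:
  assumes "f \<noteq> 0"
  shows "\<tau> * real (total_degree f) \<le> of_int (\<delta> (to_fract f))"
proof -
  obtain F k where F: "ev2 u v F = u ^ total_degree f * to_fract f" "low_order F k" "k \<le> total_degree f"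
    using chart[OF assms] .
  have "\<tau> * real k - real k * of_int (\<omega> 0) \<le> real_of_int (w k - int k * \<omega> 0)"
    using w_ge[of k] by simp
  also have "\<dots> \<le> of_int (\<delta> (ev2 u v F))"
    using lower_bound(2)[OF F(2)] by (simp only: of_int_le_iff)
  finally have "\<tau> * real k - real k * of_int (\<omega> 0) \<le> of_int (\<delta> (ev2 u v F))" .
  moreover have "real k * (of_int (\<omega> 0) - \<tau>) \<le> real (total_degree f) * (of_int (\<omega> 0) - \<tau>)"
    using F(3) tau_less_omega_0 by (intro mult_right_mono) auto
  ultimately show ?thesis
    unfolding chart_value[OF assms F(1)] by (simp add: algebra_simps)
qed

text \<open>Equality forces k' = D and \<open>w D = \<tau> * D\<close>. The first makes the top form
  a constant times the D-th power of y - c x, so f is monic in y up to a constant; the second makes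
  D a multiple of \<open>yd (n + 1)\<close>.\<close>

lemma degree_bound_eq:
  assumes f: "f \<noteq> 0" "0 < total_degree f" and eq: "of_int (\<delta> (to_fract f)) = \<tau> * real (total_degree f)" and "k \<le> n + 1"
  shows "g k \<in> polys"
proof -
  define D where "D = total_degree f"
  obtain F k' where F: "ev2 u v F = u ^ D * to_fract f" "low_order F k'" "k' \<le> D"
    "coeff (coeff F D) 0 = coeff (coeff f D) 0"
    using chart[OF f(1)] unfolding D_def .
  have val: "\<delta> (to_fract f) = int D * \<omega> 0 + \<delta> (ev2 u v F)"
    using chart_value[OF f(1)] F(1) by (simp add: D_def)
  have low: "real_of_int (w k' - int k' * \<omega> 0) \<le> of_int (\<delta> (ev2 u v F))"
    using lower_bound(2)[OF F(2)] by (simp only: of_int_le_iff)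
  have eqD: "of_int (\<delta> (ev2 u v F)) = real D * (\<tau> - of_int (\<omega> 0))"
    using eq unfolding val D_def by (simp add: algebra_simps)
  have "real k' * (\<tau> - of_int (\<omega> 0)) \<le> real D * (\<tau> - of_int (\<omega> 0))"
    using low w_ge[of k'] unfolding eqD by (simp add: algebra_simps)
  then have "real D \<le> real k'"
    using tau_less_omega_0 by (simp add: mult_le_cancel_right)
  then have "k' = D" using F(3) by simp
  then have "of_int (w D) = \<tau> * real D"
    using low w_ge[of D] unfolding eqD by (simp add: algebra_simps)
  then have "yd (n + 1) dvd D" by (rule w_eq)
  then obtain b where b: "D = b * yd (n + 1)" by (metis dvd_def mult.commute)
  define c0 where "c0 = coeff (coeff f D) 0"
  have "c0 \<noteq> 0" using F(2,4) \<open>k' = D\<close> by (simp add: low_order_def c0_def)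
  have "coeff f D = [:c0:]"
  proof (rule poly_eqI)
    fix i show "coeff (coeff f D) i = coeff [:c0:] i"
      using total_degree_ge[of f D i] by (cases i) (auto simp: c0_def D_def)
  qed
  moreover have "coeff f i = 0" if "D < i" for i
  proof (rule ccontr)
    assume "coeff f i \<noteq> 0"
    then obtain l where "coeff (coeff f i) l \<noteq> 0" by (metis leading_coeff_0_iff)
    from total_degree_ge[OF this] show False using that by (simp add: D_def)
  qed
  moreover have "\<delta> (to_fract f) = int b * \<omega> (n + 1)"
  proof -
    have "real_of_int (\<delta> (to_fract f)) = real b * (\<tau> * real (yd (n + 1)))"
      using eq unfolding D_def[symmetric] b by simp
    also have "\<dots> = real b * of_int (\<omega> (n + 1))" by (simp only: tau_yd)
    also have "\<dots> = real_of_int (int b * \<omega> (n + 1))" by simp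
    finally show ?thesis by (simp only: of_int_eq_iff)
  qed
  moreover have "1 \<le> b" using f(2) b D_def by (cases b) auto
  ultimately show ?thesis
    using monic_polynomial_imp_key_polynomials[of b f c0] \<open>c0 \<noteq> 0\<close> assms(4) unfolding b by blast
qed

text \<open>If the total degree exceeded the degree in y, then u would divide the chart polynomial
  of f, whose restriction is nonzero.\<close>

lemma last_key_total_degree:
  assumes f: "to_fract f = g (n + 1)"
  shows "f \<noteq> 0" "total_degree f = yd (n + 1)"
proof -
  note nz = poly_last_degree[OF f]
  show "f \<noteq> 0" by fact
  define D where "D = total_degree f"
  have "yd (n + 1) \<le> D" using degree_le_total_degree[OF nz(1)] nz(2) by (simp add: D_def)
  moreover have "D \<le> yd (n + 1)"
  proof (rule ccontr)
    assume less: "\<not> D \<le> yd (n + 1)"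
    obtain G where G: "g (n + 1) = X ^ yd (n + 1) * ev2 u v G" by (rule last_key_uv)
    obtain F k where F: "ev2 u v F = u ^ D * to_fract f" "low_order F k"
      using chart[OF nz(1)] unfolding D_def .
    have "u ^ D = u ^ (D - yd (n + 1)) * u ^ yd (n + 1)" using less by (simp flip: power_add)
    moreover have "u ^ yd (n + 1) * X ^ yd (n + 1) = 1" by (simp add: u_def flip: power_mult_distrib)
    ultimately have "ev2 u v F = ev2 u v (smult (monom 1 (D - yd (n + 1))) G)"
      unfolding F(1) f G by (simp add: mult_ac)
    then have "\<Psi> (ev2 u v F) = \<Psi> (ev2 u v (smult (monom 1 (D - yd (n + 1))) G))" by (rule arg_cong)
    then have "to_fract F = to_fract (smult (monom 1 (D - yd (n + 1))) G)"
      unfolding Psi_uv .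
    then have "F = smult (monom 1 (D - yd (n + 1))) G" by simp
    then have "at0 F = 0" using less by (simp add: coeff_monom)
    then have "coeff (at0 F) k = 0" by simp
    then show False using F(2) by (simp add: low_order_def)
  qed
  ultimately show "total_degree f = yd (n + 1)" by (simp add: D_def)
qed

lemma approximation:
  assumes "0 \<le> \<omega> (n + 1)" "0 < \<epsilon>"
  shows "\<exists>f. f \<noteq> 0 \<and> 0 < total_degree f \<and> of_int (\<delta> (to_fract f)) \<le> (\<tau> + \<epsilon>) * real (total_degree f)"
proof -
  obtain C where C: "C \<ge> 0" "\<forall>M f a. to_fract f = g (n + 1) ^ M - (\<Sum>k<M * yd (n + 1). a k * m k) \<and>
    (\<forall>k. le (a k) (- 1)) \<and> f \<noteq> 0 \<longrightarrow> of_int (\<delta> (to_fract f)) \<le> real M * of_int (\<omega> (n + 1)) + C"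
    using approximating_value[OF assms(1)] by blast
  \<comment> \<open>Large enough that the constant error C is at most \<open>\<epsilon> * M\<close>,
    while the total degree is at least M.\<close>
  define M where "M = nat \<lceil>C / \<epsilon>\<rceil> + 1"
  have "C / \<epsilon> \<le> real M" unfolding M_def by linarith
  then have M: "C \<le> \<epsilon> * real M" "0 < M"
    using assms(2) by (simp_all add: field_simps M_def)
  obtain f a where f: "to_fract f = g (n + 1) ^ M - (\<Sum>k<M * yd (n + 1). a k * m k)"
    "\<And>k. a k \<in> laurent_x" "\<And>k. le (a k) (- 1)" "coeff f (M * yd (n + 1)) = 1"
    "\<And>i. M * yd (n + 1) < i \<Longrightarrow> coeff f i = 0"
    by (rule approximating_polynomial) (rule that)
  have nz: "f \<noteq> 0" using f(4) by auto
  have "M * yd (n + 1) \<le> degree f" using f(4) by (intro le_degree) simp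
  also have "\<dots> \<le> total_degree f" by (rule degree_le_total_degree[OF nz])
  finally have deg: "M * yd (n + 1) \<le> total_degree f" .
  have "of_int (\<delta> (to_fract f)) \<le> real M * of_int (\<omega> (n + 1)) + C" using C(2) f(1,3) nz by blast
  also have "\<dots> \<le> real M * (\<tau> * real (yd (n + 1))) + \<epsilon> * real M" using M by (simp only: tau_yd)
  also have "\<dots> \<le> real M * (\<tau> * real (yd (n + 1))) + \<epsilon> * (real M * real (yd (n + 1)))"
  proof (intro add_left_mono mult_left_mono)
    have "real M * 1 \<le> real M * real (yd (n + 1))"
      using yd_last_pos by (intro mult_left_mono) linarith+
    then show "real M \<le> real M * real (yd (n + 1))" by simp
  qed (use assms(2) in simp)
  also have "\<dots> = (\<tau> + \<epsilon>) * real (M * yd (n + 1))" by (simp add: algebra_simps)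
  also have "\<dots> \<le> (\<tau> + \<epsilon>) * real (total_degree f)"
  proof (rule mult_left_mono)
    show "real (M * yd (n + 1)) \<le> real (total_degree f)" using deg by (simp only: of_nat_le_iff)
    show "0 \<le> \<tau> + \<epsilon>" using assms by (simp add: \<tau>_def)
  qed
  finally show ?thesis
    using nz deg M(2) yd_last_pos by (intro exI[of _ f]) (auto intro: less_le_trans[OF _ deg])
qed

text \<open>For negative \<tau>, replacing the degree in y by the larger total degree weakens the
  bound, so a slope of at least half of \<tau> remains and the other half is the gap.\<close>

lemma irreducible_bound:
  assumes "\<tau> < 0"
  shows "\<exists>\<epsilon>>0. \<forall>f. f \<noteq> 0 \<and> (\<tau> / 2) * real (degree f) \<le> of_int (\<delta> (to_fract f)) \<longrightarrow>
    (\<tau> + \<epsilon>) * real (total_degree f) \<le> of_int (\<delta> (to_fract f))"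
proof (intro exI[of _ "- \<tau> / 2"] conjI allI impI)
  show "0 < - \<tau> / 2" using assms by simp
  fix f assume f: "f \<noteq> 0 \<and> (\<tau> / 2) * real (degree f) \<le> of_int (\<delta> (to_fract f))"
  have "(\<tau> / 2) * real (total_degree f) \<le> (\<tau> / 2) * real (degree f)"
    using degree_le_total_degree[of f] f assms by (intro mult_left_mono_neg) auto
  then show "(\<tau> + - \<tau> / 2) * real (total_degree f) \<le> of_int (\<delta> (to_fract f))"
    using f by simp
qed

text \<open>The local constant is \<open>\<tau> - \<omega> 0\<close>: in order k the standard
  monomial contributes at least \<open>\<tau> * k\<close>, and the division by \<open>X ^ k\<close>
  takes away \<open>k * \<omega> 0\<close>.\<close>

lemma skewness_horizontal:
  assumes v: "\<delta> v < 0" and cc: "\<omega> 1 = \<omega> 0 \<longrightarrow> c \<noteq> 0"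
  shows "skewness \<delta> = ereal (\<tau> / of_int (\<omega> 0))" "dmax \<delta> = \<omega> 0"
proof -
  have o1: "\<omega> 1 = \<delta> Y" by (simp add: \<omega>_def g_1[simplified])
  show d: "dmax \<delta> = \<omega> 0"
    using omega_1_le o1 by (simp add: dmax_def omega_0)
  have o0: "0 < \<omega> 0" using X_pos by (simp add: omega_0)
  have "low_order [:0, 1:] 1" by (simp add: low_order_def)
  from lower_bound(1)[OF this] have v0: "v \<noteq> 0" by simp
  obtain G where G: "g (n + 1) = X ^ yd (n + 1) * ev2 u v G" "at0 G = monom 1 (yd (n + 1))"
    by (rule last_key_uv) (rule that)
  have coeffG: "coeff (coeff G j) 0 = (if j = yd (n + 1) then 1 else 0)" for j
    using arg_cong[OF G(2), of "\<lambda>P. coeff P j"] by (simp add: coeff_monom)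
  have lowG: "low_order G (yd (n + 1))" by (simp add: low_order_def coeffG)
  interpret local_bounds \<delta> u v "\<tau> - of_int (\<omega> 0)"
  proof
    show "u \<noteq> 0" "\<delta> u < 0" using delta_u o0 by simp_all
    show "v \<noteq> 0" "\<delta> v < 0" by fact+
    show "ev2 u v F \<noteq> 0" if "low_order F k" for F k by (rule lower_bound(1)[OF that])
    show "real k * (\<tau> - of_int (\<omega> 0)) \<le> of_int (\<delta> (ev2 u v F))" if "low_order F k" for F k
    proof -
      have "real k * (\<tau> - of_int (\<omega> 0)) \<le> real_of_int (w k - int k * \<omega> 0)"
        using w_ge[of k] by (simp add: algebra_simps)
      also have "\<dots> \<le> of_int (\<delta> (ev2 u v F))"
        using lower_bound(2)[OF that] by (simp only: of_int_le_iff)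
      finally show ?thesis .
    qed
    have "\<omega> (n + 1) = int (yd (n + 1)) * \<omega> 0 + \<delta> (ev2 u v G)"
      unfolding \<omega>_def[of "n + 1"] G(1) using lower_bound(1)[OF lowG] by (simp add: mult power omega_0)
    then have "real_of_int (\<omega> (n + 1)) = real_of_int (int (yd (n + 1)) * \<omega> 0 + \<delta> (ev2 u v G))" by (rule arg_cong)
    then have "of_int (\<delta> (ev2 u v G)) = real (yd (n + 1)) * (\<tau> - of_int (\<omega> 0))"
      using tau_yd by (simp add: algebra_simps)
    then show "\<exists>F k. 1 \<le> k \<and> low_order F k \<and> of_int (\<delta> (ev2 u v F)) \<le> real k * (\<tau> - of_int (\<omega> 0))"
      using lowG yd_last_pos by (intro exI[of _ G] exI[of _ "yd (n + 1)"]) auto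
  qed
  have lc: "local_coords (Infinite_Point c) = (u, v)"
    by (simp add: u_def v_def divide_inverse)
  have "center (\<lambda>h. - \<delta> h) = {Infinite_Point c}"
  proof (rule center_eq[OF lc])
    fix pt assume pt: "pt \<noteq> Infinite_Point c"
    show "\<exists>f\<in>local_ring pt. f \<noteq> 0 \<and> 0 < \<delta> f"
    proof (cases pt)
      case (Finite_Point a b)
      then show ?thesis using finite_point_not_center by simp
    next
      case (Infinite_Point c')
      \<comment> \<open>At another point [0:1:c'] the function v differs from the vanishing
        coordinate by a nonzero constant, so it is a unit there.\<close>
      have "1 / v \<in> local_ring pt"
        unfolding Infinite_Point
        by (rule local_ringI[of _ "1 / X" "Y / X - cst c'" "[:[:c' - c:], 1:]" _ 1])
          (use pt Infinite_Point in \<open>simp_all add: v_def divide_inverse cst.hom_minus\<close>)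
      then show ?thesis using v0 v by (intro bexI[of _ "1 / v"]) (auto simp: divide)
    next
      case Vertical_Point
      show ?thesis
      proof (cases "\<omega> 1 = \<omega> 0")
        case False
        have "X / Y \<in> local_ring pt"
          unfolding Vertical_Point by (rule local_ringI[of _ "1 / Y" "X / Y" 1 _ "[:0, 1:]"]) simp_all
        then show ?thesis
          using False omega_1_le o1 by (intro bexI[of _ "X / Y"]) (auto simp: divide omega_0)
      next
        case True
        then have "c \<noteq> 0" using cc by simp
        \<comment> \<open>A unit at [0:0:1], since X/Y vanishes there; up to a factor of value 0 it
          is v, so its inverse has positive value.\<close>
        define h where "h = X / Y - cst (1 / c)"
        have "cst c * cst (1 / c) = 1" using \<open>c \<noteq> 0\<close> by (simp flip: cst.hom_mult)
        then have h: "h = cst (- 1 / c) * (X / Y) * v"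
          by (simp add: h_def v_def field_simps cst.hom_uminus)
        have "h \<noteq> 0" using \<open>c \<noteq> 0\<close> v0 by (simp add: h)
        moreover have "\<delta> h = \<delta> v"
          using \<open>c \<noteq> 0\<close> v0 True o1 by (simp add: h mult divide omega_0)
        moreover have "1 / h \<in> local_ring pt"
          unfolding Vertical_Point
          by (rule local_ringI[of _ "1 / Y" "X / Y" "[:[:- 1 / c:], 1:]" _ 1])
            (use \<open>c \<noteq> 0\<close> in \<open>simp_all add: h_def cst.hom_uminus\<close>)
        ultimately show ?thesis using v by (intro bexI[of _ "1 / h"]) (auto simp: divide)
      qed
    qed
  qed
  \<comment> \<open>\<open>X * v\<close> is the linear polynomial y - c x, but its value is smaller
    than that of X.\<close>
  moreover have "\<not> is_degree \<delta>"
  proof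
    assume deg: "is_degree \<delta>"
    have td: "total_degree f = 1" if "f = [:[:0, 1:]:] \<or> f = [:[:a:], 1:] \<or> f = [:[:0, a:], 1:]" for f a
    proof (rule antisym)
      have nz: "f \<noteq> 0" using that by auto
      obtain i j where "coeff (coeff f j) i \<noteq> 0" "i + j = total_degree f"
        using total_degree_attained[OF nz] .
      then show "total_degree f \<le> 1"
        using that by (auto simp: coeff_pCons split: nat.splits if_splits)
      show "1 \<le> total_degree f"
        using that total_degree_ge[of f 0 1] total_degree_ge[of f 1 0] by auto
    qed
    have one: "\<delta> (to_fract f) = 1" if "f = [:[:0, 1:]:] \<or> f = [:[:a:], 1:] \<or> f = [:[:0, a:], 1:]" for f a
    proof -
      have "f \<noteq> 0" using that by auto
      then show ?thesis using deg td[OF that] unfolding is_degree_def by simp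
    qed
    have "\<delta> X = 1" using one[of "[:[:0, 1:]:]"] by (simp add: X_def)
    moreover have "\<delta> (to_fract [:[:0, - c:], 1:]) = 1" using one by blast
    moreover have "to_fract [:[:0, - c:], 1:] = X * v"
    proof -
      have "to_fract [:[:0, - c:], 1:] = Y - cst c * X"
        unfolding ev2_XY[symmetric] by (simp add: cst.hom_uminus)
      also have "\<dots> = Y * (X * inverse X) - cst c * X" by simp
      also have "\<dots> = X * v" unfolding v_def by (simp only: right_diff_distrib mult_ac)
      finally show ?thesis .
    qed
    ultimately show False using v v0 by (simp add: mult)
  qed
  ultimately show "skewness \<delta> = ereal (\<tau> / of_int (\<omega> 0))"
    using skewness_value[OF _ _ lc] o0 d by (simp add: diff_divide_distrib)
qed

end

section \<open>Semidegrees with center at the vertical point\<close>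

text \<open>The case \<open>\<delta> X < \<delta> Y\<close>, with center [0:0:1]. Here the
  substitution is the weighted grading and not a change to local coordinates, so estimates come from
  the top weighted form.\<close>

locale vertical = key_subst +
  assumes c_0: "c = 0" and r_1: "r = 1" and q_eq: "int q = \<omega> 1" and omega_lt: "\<omega> 0 < \<omega> 1"
begin

lemma p_eq: "int p = \<omega> 0" using rp r_1 by simp

lemma omega_0_pos: "0 < \<omega> 0" using X_pos by (simp add: omega_0)
lemma omega_1_pos: "0 < \<omega> 1" using omega_0_pos omega_lt by simp
lemma omega_1: "\<omega> 1 = \<delta> Y" by (simp add: \<omega>_def g_1[simplified])

text \<open>The analogue of \<tau> for the total degree: for n at least 1, a polynomial last key
  form has total degree \<open>yd (n + 1) * \<omega> 1 / \<omega> 0\<close>, coming from a pure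
  power of x of the same weight as its leading power of y.\<close>

definition \<sigma> :: real where "\<sigma> = \<tau> * of_int (\<omega> 0) / of_int (\<omega> 1)"

lemma sigma_tau: "\<sigma> * of_int (\<omega> 1) = \<tau> * of_int (\<omega> 0)"
  using omega_1_pos by (simp add: \<sigma>_def)

lemma sigma_le: "\<sigma> \<le> of_int (\<omega> 0)"
proof -
  have "\<tau> * of_int (\<omega> 0) \<le> of_int (\<omega> 1) * of_int (\<omega> 0)"
    using tau_le_omega_1 omega_0_pos by (intro mult_right_mono) auto
  then show ?thesis using omega_1_pos by (simp add: \<sigma>_def field_simps)
qed

lemma sigma_less: "1 \<le> n \<Longrightarrow> \<sigma> < of_int (\<omega> 0)"
proof -
  assume "1 \<le> n"
  then have "\<tau> * of_int (\<omega> 0) < of_int (\<omega> 1) * of_int (\<omega> 0)"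
    using tau_less_omega_1 omega_0_pos by (intro mult_strict_right_mono) auto
  then show ?thesis using omega_1_pos by (simp add: \<sigma>_def field_simps)
qed

definition u :: ratfun where "u = inverse Y"
definition v :: ratfun where "v = X * inverse Y"

lemma uv: "u \<noteq> 0" "v \<noteq> 0" "\<delta> u = - \<omega> 1" "\<delta> v = \<omega> 0 - \<omega> 1"
proof -
  show "u \<noteq> 0" "v \<noteq> 0" by (simp_all add: u_def v_def)
  show "\<delta> u = - \<omega> 1" unfolding u_def omega_1 by (rule inverse) simp
  have "\<delta> v = \<delta> X + \<delta> (inverse Y)" unfolding v_def by (rule mult) simp_all
  also have "\<delta> (inverse Y) = - \<omega> 1" unfolding omega_1 by (rule inverse) simp
  finally show "\<delta> v = \<omega> 0 - \<omega> 1" unfolding omega_0 by simp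
qed

text \<open>\<open>\<omega> 1 - \<tau>\<close> and \<open>\<omega> 0 - \<sigma>\<close> are in the
  ratio of \<omega> 1 to \<omega> 0, so a comparison of weights carries over to the losses.\<close>

lemma excess_bound:
  assumes "real e * of_int (\<omega> 1) \<le> real i * of_int (\<omega> 0)"
  shows "real e * (of_int (\<omega> 1) - \<tau>) \<le> real i * (of_int (\<omega> 0) - \<sigma>)"
proof -
  have "real e * of_int (\<omega> 1) * (of_int (\<omega> 1) - \<tau>) \<le> real i * of_int (\<omega> 0) * (of_int (\<omega> 1) - \<tau>)"
    using assms tau_le_omega_1 by (intro mult_right_mono) auto
  also have "\<dots> = real i * (of_int (\<omega> 0) - \<sigma>) * of_int (\<omega> 1)"
    using sigma_tau by (simp add: algebra_simps)
  finally have "real e * (of_int (\<omega> 1) - \<tau>) * of_int (\<omega> 1) \<le> real i * (of_int (\<omega> 0) - \<sigma>) * of_int (\<omega> 1)"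
    by (simp add: mult_ac)
  then show ?thesis
    using omega_1_pos by (simp add: mult_le_cancel_right)
qed

text \<open>The term of index k0 loses at most \<open>e * (\<omega> 1 - \<tau>)\<close> against the
  top weight. The factor \<open>\<kappa>\<close> to degree e fits above \<open>y ^ j\<close> in the
  top form, so \<open>e * \<omega> 1 \<le> i * \<omega> 0\<close>, and the loss is at most
  \<open>i * (\<omega> 0 - \<sigma>)\<close>. For n = 0 nothing is lost.\<close>

lemma vertical_bound:
  fixes f :: poly2
  assumes f: "f \<noteq> 0"
  obtains i j where "coeff (coeff f j) i \<noteq> 0"
    "\<And>k l. coeff (coeff f l) k \<noteq> 0 \<Longrightarrow> \<omega> 0 * int k + \<omega> 1 * int l \<le> \<omega> 0 * int i + \<omega> 1 * int j"
    "real j * of_int (\<omega> 1) + real i * \<sigma> \<le> of_int (\<delta> (to_fract f))"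
proof (cases "1 \<le> n")
  case True
  obtain W i j e k0 kx i' where *:
    "\<And>i j. coeff (coeff f j) i \<noteq> 0 \<Longrightarrow> \<omega> 0 * int i + \<omega> 1 * int j \<le> W"
    "coeff (coeff f j) i \<noteq> 0" "\<omega> 0 * int i + \<omega> 1 * int j = W"
    "coeff (coeff f kx) i' \<noteq> 0" "\<omega> 0 * int i' + \<omega> 1 * int kx = W"
    "e \<le> k0" "k0 \<le> kx" "j + e \<le> kx"
    "W - \<omega> 1 * int k0 + w k0 \<le> \<delta> (to_fract f)"
    "real_of_int (w k0) \<ge> real (k0 - e) * of_int (\<omega> 1) + \<tau> * real e"
    by (rule vertical_data[OF c_0 r_1 q_eq True f]) (rule that)
  have "int e * \<omega> 1 \<le> int i * \<omega> 0"
  proof -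
    have "0 \<le> \<omega> 0 * int i'" using omega_0_pos by simp
    moreover have "\<omega> 1 * int (j + e) \<le> \<omega> 1 * int kx"
      using *(8) omega_1_pos by (intro mult_left_mono) auto
    ultimately show ?thesis using *(3,5) by (simp add: algebra_simps)
  qed
  then have "real_of_int (int e * \<omega> 1) \<le> real_of_int (int i * \<omega> 0)" by (simp only: of_int_le_iff)
  then have "real e * (of_int (\<omega> 1) - \<tau>) \<le> real i * (of_int (\<omega> 0) - \<sigma>)"
    by (intro excess_bound) simp
  moreover have "of_int W - of_int (\<omega> 1) * real k0 + of_int (w k0) \<le> real_of_int (\<delta> (to_fract f))"
    using *(9) by (metis (mono_tags, lifting) of_int_add of_int_diff of_int_le_iff of_int_mult of_int_of_nat_eq)
  moreover have "real_of_int W = of_int (\<omega> 0) * real i + of_int (\<omega> 1) * real j"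
    using *(3) by (simp flip: of_int_eq_iff[where 'a = real])
  moreover have "real (k0 - e) = real k0 - real e" using *(6) by (simp add: of_nat_diff)
  ultimately have "real j * of_int (\<omega> 1) + real i * \<sigma> \<le> of_int (\<delta> (to_fract f))"
    using *(10) by (simp add: algebra_simps)
  then show ?thesis using that *(1,2,3) by blast
next
  case False
  then have n0: "n = 0" by simp
  have "to_fract f \<noteq> 0" using f by simp
  then obtain W T a G where G: "X powi W * \<Psi> (to_fract f) = to_fract G" "at0 G = (\<Sum>k\<in>T. smult (a k) (nu k))"
    "finite T" "T \<noteq> {}" "\<And>k. k \<in> T \<Longrightarrow> a k \<noteq> 0"
    "\<And>k. k \<in> T \<Longrightarrow> r * (W - int q * int k) + w k \<le> \<delta> (to_fract f)"
    "\<And>k. k \<in> T \<Longrightarrow> int p dvd W - int q * int k"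
    by (rule leading_form[OF to_fract_laurent]) (rule that)
  have "at0 G \<noteq> 0" using nu_sum(2)[of T a] G by simp
  then obtain j where "coeff (at0 G) j \<noteq> 0" using leading_coeff_0_iff by blast
  then obtain i where i: "coeff (coeff f j) i \<noteq> 0" "int p * int i + int q * int j = W"
    using weight_support(3)[OF c_0 G(1)] by blast
  have wk: "w k = int k * \<omega> 1" for k
  proof -
    have "yd (n + 1) = 1" "\<omega> (n + 1) = \<omega> 1" using n0 yd_1 by simp_all
    then show ?thesis using last_power(2)[of k] by simp
  qed
  obtain k where "k \<in> T" using G(4) by blast
  then have "W \<le> \<delta> (to_fract f)" using G(6)[of k] r_1 q_eq by (simp add: wk mult.commute)
  have "yd (n + 1) = 1" "\<omega> (n + 1) = \<omega> 1" using n0 yd_1 by simp_all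
  then have "\<tau> = of_int (\<omega> 1)" unfolding \<tau>_def by simp
  then have "\<sigma> = of_int (\<omega> 0)" using omega_1_pos by (simp add: \<sigma>_def)
  moreover have "real_of_int W = of_int (\<omega> 0) * real i + of_int (\<omega> 1) * real j"
    using i(2) by (metis of_int_add of_int_mult of_int_of_nat_eq p_eq q_eq)
  ultimately have "real j * of_int (\<omega> 1) + real i * \<sigma> \<le> of_int (\<delta> (to_fract f))"
    using \<open>W \<le> \<delta> (to_fract f)\<close> by (simp add: mult.commute flip: of_int_le_iff[where 'a = real])
  moreover have "\<omega> 0 * int k + \<omega> 1 * int l \<le> \<omega> 0 * int i + \<omega> 1 * int j" if "coeff (coeff f l) k \<noteq> 0" for k l
    using weight_support(1)[OF c_0 G(1) that] i(2) by (simp add: p_eq q_eq)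
  ultimately show ?thesis using that i(1) by blast
qed

lemma weight_ge_degree: "\<omega> 0 * (int i + int j) \<le> \<omega> 0 * int i + \<omega> 1 * int j"
  using omega_lt by (simp add: distrib_left mult_right_mono)

lemma degree_weight:
  assumes "f \<noteq> 0" "\<And>k l. coeff (coeff f l) k \<noteq> 0 \<Longrightarrow> \<omega> 0 * int k + \<omega> 1 * int l \<le> W"
  shows "\<omega> 0 * int (total_degree f) \<le> W"
proof -
  obtain k l where "coeff (coeff f l) k \<noteq> 0" "k + l = total_degree f"
    using total_degree_attained[OF assms(1)] .
  then show ?thesis using assms(2)[of l k] weight_ge_degree[of k l] by (simp flip: of_nat_add)
qed

text \<open>The top weight is at least \<open>\<omega> 0 * D\<close> for the total degree D, so
  \<open>y ^ j\<close> carries at least \<open>\<omega> 0 * (D - i)\<close>; and \<sigma> is at most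
  \<omega> 0.\<close>

lemma degree_bound:
  assumes f: "f \<noteq> 0"
  shows "\<sigma> * real (total_degree f) \<le> of_int (\<delta> (to_fract f))"
proof -
  obtain i j where ij: "coeff (coeff f j) i \<noteq> 0"
    "\<And>k l. coeff (coeff f l) k \<noteq> 0 \<Longrightarrow> \<omega> 0 * int k + \<omega> 1 * int l \<le> \<omega> 0 * int i + \<omega> 1 * int j"
    "real j * of_int (\<omega> 1) + real i * \<sigma> \<le> of_int (\<delta> (to_fract f))"
    by (rule vertical_bound[OF f]) (rule that)
  define D where "D = total_degree f"
  have "\<omega> 0 * int D \<le> \<omega> 0 * int i + \<omega> 1 * int j"
    unfolding D_def by (rule degree_weight[OF f ij(2)])
  then have "real_of_int (\<omega> 0 * int D) \<le> real_of_int (\<omega> 0 * int i + \<omega> 1 * int j)" by (simp only: of_int_le_iff)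
  then have "of_int (\<omega> 0) * (real D - real i) \<le> real j * of_int (\<omega> 1)" by (simp add: algebra_simps)
  moreover have "\<sigma> * (real D - real i) \<le> of_int (\<omega> 0) * (real D - real i)"
    using sigma_le total_degree_ge[OF ij(1)] by (intro mult_right_mono) (simp_all add: D_def)
  ultimately show ?thesis using ij(3) by (simp add: D_def algebra_simps)
qed

text \<open>All estimates become equalities: i = D and j = 0, then k0 = kx = e, i' = 0 and
  \<open>w e = \<tau> * e\<close>. So f is, up to a constant, monic in y of degree e, a multiple of
  \<open>yd (n + 1)\<close>.\<close>

lemma degree_bound_eq:
  assumes n: "1 \<le> n" and f: "f \<noteq> 0" "0 < total_degree f"
    and eq: "of_int (\<delta> (to_fract f)) = \<sigma> * real (total_degree f)" and k: "k \<le> n + 1"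
  shows "g k \<in> polys"
proof -
  define D where "D = total_degree f"
  obtain W i j e k0 kx i' where *:
    "\<And>i j. coeff (coeff f j) i \<noteq> 0 \<Longrightarrow> \<omega> 0 * int i + \<omega> 1 * int j \<le> W"
    "coeff (coeff f j) i \<noteq> 0" "\<omega> 0 * int i + \<omega> 1 * int j = W"
    "coeff (coeff f kx) i' \<noteq> 0" "\<omega> 0 * int i' + \<omega> 1 * int kx = W"
    "e \<le> k0" "k0 \<le> kx" "j + e \<le> kx"
    "W - \<omega> 1 * int k0 + w k0 \<le> \<delta> (to_fract f)"
    "real_of_int (w k0) \<ge> real (k0 - e) * of_int (\<omega> 1) + \<tau> * real e"
    by (rule vertical_data[OF c_0 r_1 q_eq n f(1)]) (rule that)
  have eR: "real (k0 - e) = real k0 - real e" using *(6) by (simp add: of_nat_diff)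
  have WR: "real_of_int W = of_int (\<omega> 0) * real i + of_int (\<omega> 1) * real j"
    using *(3) by (simp flip: of_int_eq_iff[where 'a = real])
  have WR': "real_of_int W = of_int (\<omega> 0) * real i' + of_int (\<omega> 1) * real kx"
    using *(5) by (simp flip: of_int_eq_iff[where 'a = real])
  have val: "of_int W - of_int (\<omega> 1) * real k0 + of_int (w k0) \<le> \<sigma> * real D"
    using *(9) unfolding D_def eq[symmetric]
    by (metis (mono_tags, lifting) of_int_add of_int_diff of_int_le_iff of_int_mult of_int_of_nat_eq)
  have o0: "0 < real_of_int (\<omega> 0)" and o1: "0 < real_of_int (\<omega> 1)" using omega_0_pos omega_1_pos by simp_all
  have "\<omega> 0 * int D \<le> W" unfolding D_def by (rule degree_weight[OF f(1) *(1)])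
  then have WD: "of_int (\<omega> 0) * real D \<le> of_int W"
    by (metis of_int_le_iff of_int_mult of_int_of_nat_eq)
  have iD: "real i + real j \<le> real D" using total_degree_ge[OF *(2)] by (simp add: D_def flip: of_nat_add)
  have "of_int (\<omega> 1) * (real j + real e) \<le> of_int (\<omega> 1) * real kx"
    using *(8) o1 by (intro mult_left_mono) (simp_all flip: of_nat_add)
  also have "\<dots> \<le> of_int W" using WR' o0 by simp
  finally have eW: "of_int (\<omega> 1) * real e \<le> of_int (\<omega> 0) * real i" using WR by (simp add: algebra_simps)
  have ex: "real e * (of_int (\<omega> 1) - \<tau>) \<le> real i * (of_int (\<omega> 0) - \<sigma>)"
    by (rule excess_bound) (use eW in \<open>simp add: mult.commute\<close>)
  have 1: "of_int W - real e * (of_int (\<omega> 1) - \<tau>) \<le> \<sigma> * real D"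
    using val *(10) unfolding eR by (simp add: algebra_simps)
  have s: "0 < of_int (\<omega> 0) - \<sigma>" using sigma_less[OF n] by simp
  have "(of_int (\<omega> 0) - \<sigma>) * real D \<le> (of_int (\<omega> 0) - \<sigma>) * real i"
    using 1 ex WD by (simp add: algebra_simps)
  then have "real D \<le> real i" using s by (simp add: mult_le_cancel_left)
  then have "i = D" "j = 0" using iD by linarith+
  have W: "real_of_int W = of_int (\<omega> 0) * real D" using WR \<open>i = D\<close> \<open>j = 0\<close> by simp
  have t: "0 < of_int (\<omega> 1) - \<tau>" using tau_less_omega_1[OF n] by simp
  have "real i * (of_int (\<omega> 0) - \<sigma>) \<le> real e * (of_int (\<omega> 1) - \<tau>)"
    using 1 W \<open>i = D\<close> by (simp add: algebra_simps)
  then have "real i * (of_int (\<omega> 0) - \<sigma>) * of_int (\<omega> 1) \<le> real e * (of_int (\<omega> 1) - \<tau>) * of_int (\<omega> 1)"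
    using o1 by (intro mult_right_mono) auto
  also have "real i * (of_int (\<omega> 0) - \<sigma>) * of_int (\<omega> 1) = real i * of_int (\<omega> 0) * (of_int (\<omega> 1) - \<tau>)"
    using sigma_tau by (simp add: algebra_simps)
  finally have "(real i * of_int (\<omega> 0)) * (of_int (\<omega> 1) - \<tau>) \<le> (real e * of_int (\<omega> 1)) * (of_int (\<omega> 1) - \<tau>)"
    by (simp add: mult_ac)
  then have "real i * of_int (\<omega> 0) \<le> real e * of_int (\<omega> 1)"
    using t by (simp add: mult_le_cancel_right)
  then have We: "real_of_int W = real e * of_int (\<omega> 1)"
    using eW W \<open>i = D\<close> by (simp add: mult.commute)
  have "of_int (\<omega> 1) * real kx \<le> real e * of_int (\<omega> 1)"
  proof -
    have "0 \<le> of_int (\<omega> 0) * real i'" using o0 by simp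
    then show ?thesis using WR' We by linarith
  qed
  then have "real kx \<le> real e" using o1 by (simp add: mult.commute)
  then have keq: "k0 = e" "kx = e" using *(6,7) by linarith+
  have "of_int (\<omega> 0) * real i' = 0" using WR' We keq by (simp add: mult.commute)
  then have "i' = 0" using o0 by simp
  have "of_int (w e) \<le> \<tau> * real e"
  proof -
    have "of_int (w e) \<le> \<sigma> * real D" using val We keq by (simp add: mult.commute)
    moreover have "\<sigma> * real D * of_int (\<omega> 1) = \<tau> * real e * of_int (\<omega> 1)"
    proof -
      have "\<sigma> * real D * of_int (\<omega> 1) = \<tau> * (of_int (\<omega> 0) * real D)" using sigma_tau by (simp add: mult_ac)
      also have "of_int (\<omega> 0) * real D = real e * of_int (\<omega> 1)" using We W by linarith
      finally show ?thesis by (simp only: mult.assoc)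
    qed
    then have "\<sigma> * real D = \<tau> * real e" using o1 by simp
    ultimately show ?thesis by simp
  qed
  then have we: "of_int (w e) = \<tau> * real e" using w_ge[of e] by simp
  then have "yd (n + 1) dvd e" by (rule w_eq)
  then obtain b where b: "e = b * yd (n + 1)" by (metis dvd_def mult.commute)
  have "0 < D" using f(2) by (simp add: D_def)
  then have "0 < real e * of_int (\<omega> 1)" using We W o0 by (metis mult_pos_pos of_nat_0_less_iff)
  then have "e \<noteq> 0" by (intro notI) simp
  then have "1 \<le> b" using b by (cases b) auto
  define c0 where "c0 = coeff (coeff f e) 0"
  have "c0 \<noteq> 0" using *(4) keq \<open>i' = 0\<close> by (simp add: c0_def)
  have We': "W = int e * \<omega> 1" using We by (metis of_int_eq_iff of_int_mult of_int_of_nat_eq)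
  \<comment> \<open>\<open>y ^ e\<close> already has the maximal weight W, so its proper multiples
    and higher powers of y cannot occur.\<close>
  have fe: "coeff (coeff f l) k = 0" if "e < l \<or> e = l \<and> 0 < k" for k l
  proof (rule ccontr)
    assume nz: "coeff (coeff f l) k \<noteq> 0"
    then have le: "\<omega> 0 * int k + \<omega> 1 * int l \<le> int e * \<omega> 1" using *(1) We' by blast
    have "e < l \<longrightarrow> \<omega> 1 * int e < \<omega> 1 * int l" using omega_1_pos by simp
    moreover have "0 < k \<longrightarrow> 0 < \<omega> 0 * int k" "0 \<le> \<omega> 0 * int k" using omega_0_pos by simp_all
    ultimately show False using that le by (auto simp: mult.commute)
  qed
  have "coeff f e = [:c0:]"
  proof (rule poly_eqI)
    fix l show "coeff (coeff f e) l = coeff [:c0:] l"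
      using fe[of e l] by (cases l) (auto simp: c0_def)
  qed
  moreover have "coeff f l = 0" if "e < l" for l
    using fe[of l] that by (intro poly_eqI) simp
  moreover have "\<delta> (to_fract f) = int b * \<omega> (n + 1)"
  proof -
    have "\<sigma> * real D * of_int (\<omega> 1) = \<tau> * (of_int (\<omega> 0) * real D)" using sigma_tau by (simp add: mult_ac)
    also have "of_int (\<omega> 0) * real D = real e * of_int (\<omega> 1)" using We W by linarith
    finally have "\<sigma> * real D * of_int (\<omega> 1) = \<tau> * real e * of_int (\<omega> 1)" by (simp only: mult.assoc)
    then have "\<sigma> * real D = \<tau> * real e" using o1 by simp
    then have "real_of_int (\<delta> (to_fract f)) = real b * (\<tau> * real (yd (n + 1)))"
      using eq unfolding D_def[symmetric] b by simp
    also have "\<dots> = real b * of_int (\<omega> (n + 1))" by (simp only: tau_yd)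
    also have "\<dots> = real_of_int (int b * \<omega> (n + 1))" by simp
    finally show ?thesis by (simp only: of_int_eq_iff)
  qed
  ultimately show ?thesis
    using monic_polynomial_imp_key_polynomials[of b f c0] \<open>c0 \<noteq> 0\<close> \<open>1 \<le> b\<close> k unfolding b by blast
qed

text \<open>Here \<open>\<omega> 1 = r * q\<close>, so the tail of the first recursion survives and
  the constant term is \<open>- \<theta> 1\<close>.\<close>

lemma kappa_0:
  assumes "1 \<le> n"
  shows "poly \<kappa> 0 \<noteq> 0"
proof -
  have "\<alpha> 1 > 0" using alpha_pos[of 1] assms by simp
  have "ex 1 = 0" using ex_1[OF assms] r_1 q_eq by simp
  then have "poly \<kappa> 0 = c ^ \<alpha> 1 - \<theta> 1" by (simp add: \<kappa>_def)
  also have "c ^ \<alpha> 1 = 0" using c_0 \<open>\<alpha> 1 > 0\<close> by simp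
  finally show ?thesis using theta_nonzero[of 1] assms by simp
qed

lemma gam_last: "1 \<le> n \<Longrightarrow> gam (n + 1) = \<kappa> ^ (yd (n + 1) div \<alpha> 1)"
  unfolding gam_def by simp

text \<open>The top weighted form restricts to a power of \<open>\<kappa>\<close> with nonzero
  constant term, so it contains a pure power of x. As x has the smaller weight, no other monomial
  has larger total degree.\<close>

lemma last_key_total_degree:
  assumes n: "1 \<le> n" and f: "to_fract f = g (n + 1)"
  shows "f \<noteq> 0" "\<omega> 0 * int (total_degree f) = \<omega> 1 * int (yd (n + 1))"
proof -
  show nz: "f \<noteq> 0" by (rule poly_last_degree(1)[OF f])
  define W where "W = int q * int (yd (n + 1))"
  obtain G where G: "\<Psi> (g (n + 1)) = X powi (- W) * to_fract G" "at0 G = gam (n + 1)"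
    using key_subst_poly[of "n + 1"] unfolding W_def by auto
  have G': "X powi W * \<Psi> (to_fract f) = to_fract G"
    unfolding f G(1) by (simp add: power_int_minus)
  note ws = weight_support[OF c_0 G']
  have "\<omega> 0 * int (total_degree f) \<le> W"
    by (rule degree_weight[OF nz]) (use ws(1) in \<open>simp add: p_eq q_eq\<close>)
  moreover have "coeff (at0 G) 0 \<noteq> 0"
    unfolding G(2) gam_last[OF n] using kappa_0[OF n] by (simp flip: poly_0_coeff_0)
  then obtain i where i: "coeff (coeff f 0) i \<noteq> 0" "int p * int i + int q * int 0 = W"
    using ws(3) by blast
  have "\<omega> 0 * int i \<le> \<omega> 0 * int (total_degree f)"
    using total_degree_ge[OF i(1)] omega_0_pos by (intro mult_left_mono) auto
  ultimately show "\<omega> 0 * int (total_degree f) = \<omega> 1 * int (yd (n + 1))"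
    using i(2) by (simp add: W_def p_eq q_eq)
qed

text \<open>The discarded terms have coefficients of negative value, hence negative exponents of x,
  and lie strictly below the top weight. So the top form is that of \<open>g (n + 1) ^ M\<close>,
  and its pure power of x makes the total degree large enough for the slope to approach
  \<sigma>.\<close>

lemma approximation:
  assumes n: "1 \<le> n" and "0 \<le> \<omega> (n + 1)" "0 < \<epsilon>"
  shows "\<exists>f. f \<noteq> 0 \<and> 0 < total_degree f \<and> of_int (\<delta> (to_fract f)) \<le> (\<sigma> + \<epsilon>) * real (total_degree f)"
proof -
  obtain C where C: "C \<ge> 0" "\<forall>M f a. to_fract f = g (n + 1) ^ M - (\<Sum>k<M * yd (n + 1). a k * m k) \<and>
    (\<forall>k. le (a k) (- 1)) \<and> f \<noteq> 0 \<longrightarrow> of_int (\<delta> (to_fract f)) \<le> real M * of_int (\<omega> (n + 1)) + C"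
    using approximating_value[OF assms(2)] by blast
  define M where "M = nat \<lceil>C / \<epsilon>\<rceil> + 1"
  have "C / \<epsilon> \<le> real M" unfolding M_def by linarith
  then have M: "C \<le> \<epsilon> * real M" "0 < M"
    using assms(3) by (simp_all add: field_simps M_def)
  define E where "E = M * yd (n + 1)"
  obtain f a where f: "to_fract f = g (n + 1) ^ M - (\<Sum>k<E. a k * m k)"
    "\<And>k. a k \<in> laurent_x" "\<And>k. le (a k) (- 1)" "coeff f E = 1"
    "\<And>i. E < i \<Longrightarrow> coeff f i = 0"
    by (rule approximating_polynomial[of M, folded E_def]) (rule that)
  have nz: "f \<noteq> 0" using f(4) by auto
  define W where "W = int q * int E"
  obtain G where G: "\<Psi> (g (n + 1)) = X powi (- (int q * int (yd (n + 1)))) * to_fract G" "at0 G = gam (n + 1)"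
    using key_subst_poly[of "n + 1"] by auto
  have term_ex: "\<exists>H. X powi W * \<Psi> (a k * m k) = to_fract H \<and> at0 H = 0" if k: "k < E" for k
  proof (cases "a k = 0")
    case True
    then show ?thesis by (intro exI[of _ 0]) simp
  next
    case False
    obtain i A where A: "\<delta> (a k) = i * \<omega> 0" "\<Psi> (a k) = X powi (- (int p * i)) * to_fract [:A:]"
      using laurent_x_subst[OF f(2) False] by blast
    have "i * \<omega> 0 < 0" using leD[OF f(3) False] A(1) by simp
    then have "i < 0" using omega_0_pos by (simp add: mult_less_0_iff)
    obtain N where N: "\<Psi> (m k) = X powi (- (int q * int k)) * to_fract N"
      using mono_subst_poly by blast
    define l where "l = W - int p * i - int q * int k"
    have "int q * int k \<le> W" unfolding W_def using k by (intro mult_left_mono) auto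
    moreover have "0 < - (int p * i)" using \<open>i < 0\<close> p_pos by (simp add: mult_pos_neg)
    ultimately have l: "0 < l" by (simp add: l_def)
    have "X powi W * \<Psi> (a k * m k) =
        (X powi W * X powi (- (int p * i)) * X powi (- (int q * int k))) * (to_fract [:A:] * to_fract N)"
      by (simp add: Psi.hom_mult A N mult_ac)
    also have "X powi W * X powi (- (int p * i)) * X powi (- (int q * int k)) = X ^ nat l"
    proof -
      have "X powi W * X powi (- (int p * i)) * X powi (- (int q * int k)) = X powi l"
        by (simp add: l_def diff_conv_add_uminus flip: power_int_add del: add_uminus_conv_diff)
      then show ?thesis using l by (simp add: power_int_def)
    qed
    finally have "X powi W * \<Psi> (a k * m k) = to_fract (smult (monom 1 (nat l)) ([:A:] * N))"
      by (simp only: to_fract_X_power to_fract_mult)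
    moreover have "at0 (smult (monom 1 (nat l)) ([:A:] * N)) = 0"
      unfolding at0_smult using l by (simp add: coeff_monom)
    ultimately show ?thesis by blast
  qed
  then have "\<forall>k\<in>{..<E}. \<exists>H. X powi W * \<Psi> (a k * m k) = to_fract H \<and> at0 H = 0" by blast
  from bchoice[OF this] obtain H where H: "\<forall>k\<in>{..<E}. X powi W * \<Psi> (a k * m k) = to_fract (H k) \<and> at0 (H k) = 0" ..
  have gM: "X powi W * \<Psi> (g (n + 1) ^ M) = to_fract (G ^ M)"
  proof -
    have "\<Psi> (g (n + 1) ^ M) = X powi (- W) * to_fract G ^ M"
      by (simp add: Psi.hom_power G(1)[simplified] power_mult_distrib X_powi_power W_def E_def mult_ac)
    then show ?thesis by (simp add: to_fract_power power_int_minus)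
  qed
  have "X powi W * \<Psi> (to_fract f) = to_fract (G ^ M) - (\<Sum>k<E. X powi W * \<Psi> (a k * m k))"
    unfolding f(1) by (simp only: Psi.hom_minus Psi.hom_sum right_diff_distrib gM sum_distrib_left)
  also have "\<dots> = to_fract (G ^ M - (\<Sum>k<E. H k))"
    using H by simp
  finally have F: "X powi W * \<Psi> (to_fract f) = to_fract (G ^ M - (\<Sum>k<E. H k))" .
  have "at0 (G ^ M - (\<Sum>k<E. H k)) = gam (n + 1) ^ M"
    using H by (simp add: at0.hom_minus at0.hom_sum at0.hom_power G(2)[simplified])
  then have "coeff (at0 (G ^ M - (\<Sum>k<E. H k))) 0 \<noteq> 0"
    unfolding gam_last[OF n] using kappa_0[OF n] by (simp flip: poly_0_coeff_0)
  then obtain i where i: "coeff (coeff f 0) i \<noteq> 0" "int p * int i + int q * int 0 = W"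
    using weight_support(3)[OF c_0 F] by blast
  define D where "D = total_degree f"
  have iD: "i \<le> D" using total_degree_ge[OF i(1)] by (simp add: D_def)
  have "\<omega> 0 * int i = \<omega> 1 * int E" using i(2) by (simp add: W_def p_eq q_eq)
  then have iE: "of_int (\<omega> 0) * real i = of_int (\<omega> 1) * real E"
    by (metis of_int_mult of_int_of_nat_eq)
  have tau: "0 \<le> \<tau>" using assms(2) by (simp add: \<tau>_def)
  then have sig: "0 \<le> \<sigma>" using omega_0_pos omega_1_pos by (simp add: \<sigma>_def)
  have "\<sigma> * real i * of_int (\<omega> 1) = \<tau> * (of_int (\<omega> 0) * real i)" using sigma_tau by (simp add: mult_ac)
  also have "\<dots> = \<tau> * real E * of_int (\<omega> 1)" unfolding iE by (simp add: mult_ac)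
  finally have sE: "\<sigma> * real i = \<tau> * real E" using omega_1_pos by simp
  have Ei: "real E \<le> real i"
  proof -
    have "of_int (\<omega> 1) * real E \<le> of_int (\<omega> 1) * real i"
      unfolding iE[symmetric] using omega_lt by (intro mult_right_mono) auto
    then show ?thesis using omega_1_pos by simp
  qed
  have ME: "real M \<le> real E"
  proof -
    have "real M * 1 \<le> real M * real (yd (n + 1))"
      using yd_last_pos by (intro mult_left_mono) linarith+
    then show ?thesis by (simp add: E_def)
  qed
  have "of_int (\<delta> (to_fract f)) \<le> real M * of_int (\<omega> (n + 1)) + C"
    using C(2) f(1,3) nz unfolding E_def by blast
  also have "real M * of_int (\<omega> (n + 1)) = real M * (\<tau> * real (yd (n + 1)))" by (simp only: tau_yd)
  also have "\<dots> = \<sigma> * real i" unfolding sE E_def by simp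
  also have "\<sigma> * real i + C \<le> \<sigma> * real i + \<epsilon> * real i"
  proof -
    have "\<epsilon> * real M \<le> \<epsilon> * real i" using ME Ei assms(3) by (intro mult_left_mono) linarith+
    then show ?thesis using M(1) by linarith
  qed
  also have "\<dots> = (\<sigma> + \<epsilon>) * real i" by (simp add: algebra_simps)
  also have "\<dots> \<le> (\<sigma> + \<epsilon>) * real D" using iD sig assms(3) by (intro mult_left_mono) auto
  finally have "of_int (\<delta> (to_fract f)) \<le> (\<sigma> + \<epsilon>) * real D" .
  moreover have "0 < D" using ME Ei iD M(2) by linarith
  ultimately show ?thesis using nz unfolding D_def by blast
qed

text \<open>Two bounds are available: half of \<tau> per degree in y, and
  \<open>vertical_bound\<close>. A convex combination removes the contribution of j and leaves
  \<open>\<sigma> * (1 - \<mu> / 2) * i\<close>, which improves \<sigma> by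
  \<open>- \<sigma> * \<mu> / 2\<close>.\<close>

lemma irreducible_bound:
  assumes "\<tau> < 0"
  shows "\<exists>\<epsilon>>0. \<forall>f. f \<noteq> 0 \<and> (\<tau> / 2) * real (degree f) \<le> of_int (\<delta> (to_fract f)) \<longrightarrow>
    (\<sigma> + \<epsilon>) * real (total_degree f) \<le> of_int (\<delta> (to_fract f))"
proof -
  define o0 where "o0 = real_of_int (\<omega> 0)"
  define o1 where "o1 = real_of_int (\<omega> 1)"
  have o: "0 < o0" "0 < o1" using omega_0_pos omega_1_pos by (simp_all add: o0_def o1_def)
  have sig: "\<sigma> < 0" using assms o by (simp add: \<sigma>_def o0_def o1_def divide_neg_pos mult_neg_pos)
  \<comment> \<open>The solution of \<open>\<mu> * (\<tau> / 2) + (1 - \<mu>) * o1 = 0\<close>, so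
    that the coefficient of j vanishes.\<close>
  define \<mu> where "\<mu> = o1 / (o1 - \<tau> / 2)"
  have mu: "0 < \<mu>" "\<mu> < 1" using o assms by (simp_all add: \<mu>_def)
  have mu0: "\<mu> * (\<tau> / 2) + (1 - \<mu>) * o1 = 0"
    using o assms by (simp add: \<mu>_def field_simps)
  show ?thesis
  proof (intro exI[of _ "- \<sigma> * \<mu> / 2"] conjI allI impI)
    show "0 < - \<sigma> * \<mu> / 2" using sig mu by (simp add: mult_neg_pos)
    fix f assume f: "f \<noteq> 0 \<and> (\<tau> / 2) * real (degree f) \<le> of_int (\<delta> (to_fract f))"
    obtain i j where ij: "coeff (coeff f j) i \<noteq> 0"
      "\<And>k l. coeff (coeff f l) k \<noteq> 0 \<Longrightarrow> \<omega> 0 * int k + \<omega> 1 * int l \<le> \<omega> 0 * int i + \<omega> 1 * int j"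
      "real j * of_int (\<omega> 1) + real i * \<sigma> \<le> of_int (\<delta> (to_fract f))"
      by (rule vertical_bound[OF f[THEN conjunct1]]) (rule that)
    define d where "d = real_of_int (\<delta> (to_fract f))"
    have "lead_coeff f \<noteq> 0" using f by simp
    then obtain k where "coeff (coeff f (degree f)) k \<noteq> 0" by (metis leading_coeff_0_iff)
    then have "\<omega> 0 * int k + \<omega> 1 * int (degree f) \<le> \<omega> 0 * int i + \<omega> 1 * int j" by (rule ij(2))
    moreover have "0 \<le> \<omega> 0 * int k" using omega_0_pos by simp
    ultimately have "\<omega> 1 * int (degree f) \<le> \<omega> 0 * int i + \<omega> 1 * int j" by simp
    then have "real_of_int (\<omega> 1 * int (degree f)) \<le> real_of_int (\<omega> 0 * int i + \<omega> 1 * int j)" by (simp only: of_int_le_iff)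
    then have deg: "o1 * real (degree f) \<le> o0 * real i + o1 * real j" by (simp add: o0_def o1_def)
    have "(\<tau> / 2) * (o0 * real i + o1 * real j) \<le> (\<tau> / 2) * (o1 * real (degree f))"
      using deg assms by (intro mult_left_mono_neg) auto
    also have "\<dots> = o1 * ((\<tau> / 2) * real (degree f))" by simp
    also have "\<dots> \<le> o1 * d" using f o unfolding d_def by (intro mult_left_mono) simp_all
    finally have "o1 * ((\<sigma> / 2) * real i + (\<tau> / 2) * real j) \<le> o1 * d"
      using sigma_tau by (simp add: o0_def o1_def algebra_simps)
    then have 1: "(\<sigma> / 2) * real i + (\<tau> / 2) * real j \<le> d" using o by simp
    have 2: "real j * o1 + real i * \<sigma> \<le> d" using ij(3) by (simp add: d_def o1_def)
    have "\<mu> * ((\<sigma> / 2) * real i + (\<tau> / 2) * real j) + (1 - \<mu>) * (real j * o1 + real i * \<sigma>) \<le> \<mu> * d + (1 - \<mu>) * d"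
      using 1 2 mu by (intro add_mono mult_left_mono) auto
    also have "\<mu> * d + (1 - \<mu>) * d = d" by (simp add: algebra_simps)
    also have "\<mu> * ((\<sigma> / 2) * real i + (\<tau> / 2) * real j) + (1 - \<mu>) * (real j * o1 + real i * \<sigma>) =
        (\<mu> * (\<tau> / 2) + (1 - \<mu>) * o1) * real j + \<sigma> * (1 - \<mu> / 2) * real i"
      by (simp add: algebra_simps)
    finally have "\<sigma> * (1 - \<mu> / 2) * real i \<le> d" unfolding mu0 by simp
    moreover have "\<sigma> * (1 - \<mu> / 2) * real (total_degree f) \<le> \<sigma> * (1 - \<mu> / 2) * real i"
      using total_degree_ge[OF ij(1)] sig mu
      by (intro mult_left_mono_neg) (auto simp: mult_nonpos_nonneg)
    ultimately show "(\<sigma> + - \<sigma> * \<mu> / 2) * real (total_degree f) \<le> of_int (\<delta> (to_fract f))"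
      by (simp add: d_def algebra_simps)
  qed
qed

end

lemma total_degree_coordinate:
  assumes "f = [:[:0, 1:]:] \<or> f = [:0, 1:]"
  shows "total_degree f = 1"
proof (rule antisym)
  have nz: "f \<noteq> 0" using assms by auto
  obtain i j where "coeff (coeff f j) i \<noteq> 0" "i + j = total_degree f"
    using total_degree_attained[OF nz] .
  then show "total_degree f \<le> 1"
    using assms by (auto simp: coeff_pCons split: nat.splits if_splits)
  show "1 \<le> total_degree f"
    using assms total_degree_ge[of f 0 1] total_degree_ge[of f 1 0] by auto
qed

section \<open>Weierstrass division by the last key form at the vertical point\<close>

context vertical
begin

definition lmon :: "int \<times> int \<Rightarrow> ratfun" where "lmon x = X powi fst x * Y powi snd x"

definition wgt :: "int \<times> int \<Rightarrow> int" where "wgt x = \<omega> 0 * fst x + \<omega> 1 * snd x"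

lemma lmon_nonzero [simp]: "lmon x \<noteq> 0" by (simp add: lmon_def)

lemma lmon_mult: "lmon (i, j) * lmon (i', j') = lmon (i + i', j + j')"
  by (simp add: lmon_def power_int_add mult_ac)

lemma delta_lmon: "\<delta> (lmon x) = wgt x"
  unfolding lmon_def wgt_def by (subst mult) (simp_all add: powi omega_0 omega_1[simplified] mult.commute)

lemma wgt_add: "wgt (i + i', j + j') = wgt (i, j) + wgt (i', j')"
  by (simp add: wgt_def algebra_simps)

text \<open>Weierstrass division by the last key form: the part \<open>b\<close> of the remainder turns into a
  polynomial multiple of \<open>u\<close> in the local coordinates after multiplication with \<open>u ^ D\<close>.\<close>

definition division :: "int \<Rightarrow> nat \<Rightarrow> ratfun \<Rightarrow> bool" where
  "division N D h \<longleftrightarrow> (\<exists>a b e \<Phi>. h = a * g (n + 1) + b + e \<and> le a 0 \<and>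
     ev2 u v \<Phi> = u ^ D * b \<and> at0 \<Phi> = 0 \<and> le e (- N))"

lemma divisionI:
  "h = a * g (n + 1) + b + e \<Longrightarrow> le a 0 \<Longrightarrow> ev2 u v \<Phi> = u ^ D * b \<Longrightarrow> at0 \<Phi> = 0 \<Longrightarrow> le e (- N) \<Longrightarrow>
    division N D h"
  unfolding division_def by blast

lemma division_add:
  assumes "division N D h" "division N D h'"
  shows "division N D (h + h')"
proof -
  obtain a b e \<Phi> where 1: "h = a * g (n + 1) + b + e" "le a 0" "ev2 u v \<Phi> = u ^ D * b" "at0 \<Phi> = 0" "le e (- N)"
    using assms(1) unfolding division_def by blast
  obtain a' b' e' \<Phi>' where 2: "h' = a' * g (n + 1) + b' + e'" "le a' 0" "ev2 u v \<Phi>' = u ^ D * b'"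
    "at0 \<Phi>' = 0" "le e' (- N)"
    using assms(2) unfolding division_def by blast
  show ?thesis
  proof (rule divisionI)
    show "h + h' = (a + a') * g (n + 1) + (b + b') + (e + e')"
      unfolding 1(1) 2(1) by (simp only: distrib_right ac_simps)
    show "le (a + a') 0" "le (e + e') (- N)" using 1 2 by (simp_all add: le_add)
    show "ev2 u v (\<Phi> + \<Phi>') = u ^ D * (b + b')" using 1(3) 2(3) by (simp add: ev2.hom_add distrib_left)
    show "at0 (\<Phi> + \<Phi>') = 0" using 1(4) 2(4) by (simp add: at0.hom_add)
  qed
qed

lemma division_cst_mult:
  assumes "division N D h"
  shows "division N D (cst c' * h)"
proof -
  obtain a b e \<Phi> where 1: "h = a * g (n + 1) + b + e" "le a 0" "ev2 u v \<Phi> = u ^ D * b" "at0 \<Phi> = 0" "le e (- N)"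
    using assms unfolding division_def by blast
  show ?thesis
  proof (rule divisionI)
    show "cst c' * h = (cst c' * a) * g (n + 1) + cst c' * b + cst c' * e"
      unfolding 1(1) by (simp only: distrib_left mult.assoc)
    show "le (cst c' * a) 0" "le (cst c' * e) (- N)" using 1 by (simp_all add: le_cst_mult)
    show "ev2 u v (smult [:c':] \<Phi>) = u ^ D * (cst c' * b)" using 1(3) by (simp add: mult_ac)
    show "at0 (smult [:c':] \<Phi>) = 0" using 1(4) by (simp del: at0_smult add: at0_smult)
  qed
qed

lemma division_0: "division N D 0"
  by (rule divisionI[of _ 0 0 0 0]) simp_all

lemma division_sum: "(\<And>x. x \<in> A \<Longrightarrow> division N D (f x)) \<Longrightarrow> division N D (sum f A)"
  by (induction A rule: infinite_finite_induct) (simp_all add: division_0 division_add)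

lemma division_multiple: "le a 0 \<Longrightarrow> division N D (a * g (n + 1))"
  by (rule divisionI[of _ a 0 0 0]) simp_all

lemma division_small: "le e (- N) \<Longrightarrow> division N D e"
  by (rule divisionI[of _ 0 0 e 0]) simp_all

text \<open>Multiplication by \<open>u ^ D\<close> gives \<open>u ^ k * v ^ i\<close> with k = D - i
  - j. The bounds on i and on the weight make k positive, so the result is a polynomial divisible by
  u.\<close>

lemma division_region:
  assumes "0 \<le> i" "i < int D" "wgt (i, j) \<le> int D * \<omega> 0"
  shows "division N D (lmon (i, j))"
proof -
  have ij: "i + j < int D"
  proof (cases "j \<le> 0")
    case True
    then show ?thesis using assms(2) by simp
  next
    case False
    then have "\<omega> 0 * j < \<omega> 1 * j" using omega_lt by (intro mult_strict_right_mono) auto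
    then have "\<omega> 0 * (i + j) < \<omega> 0 * int D" using assms(3) by (simp add: wgt_def algebra_simps)
    then show ?thesis using omega_0_pos by (simp add: mult_less_cancel_left)
  qed
  define k where "k = nat (int D - i - j)"
  have k: "int k = int D - i - j" "0 < k" using ij by (simp_all add: k_def)
  show ?thesis
  proof (rule divisionI)
    show "lmon (i, j) = 0 * g (n + 1) + lmon (i, j) + 0" by simp
    have up: "u ^ m = Y powi (- int m)" for m by (simp add: u_def power_int_minus power_inverse)
    have "v ^ nat i = X powi i * Y powi (- i)"
      using assms(1) by (simp add: v_def power_mult_distrib power_int_def power_inverse)
    moreover have "- int k + - i = - int D + j" using k(1) by simp
    then have "Y powi (- int k) * Y powi (- i) = Y powi (- int D) * Y powi j"
      by (simp only: power_int_add[symmetric] Y_nonzero simp_thms)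
    ultimately show "ev2 u v (monom (monom 1 k) (nat i)) = u ^ D * lmon (i, j)"
      unfolding lmon_def by (simp add: up mult_ac del: power_int_minus)
    show "at0 (monom (monom 1 k) (nat i)) = 0"
      using k(2) by (intro poly_eqI) (simp add: coeff_monom)
  qed auto
qed

text \<open>Under the weighted substitution \<open>g 2 ^ kk\<close> and \<open>g (n + 1)\<close>
  have the same restriction \<open>\<kappa> ^ kk\<close>, so their difference has only monomials of
  smaller weight. B is the exponent \<open>b0 1\<close> of x in the first recursion, positive
  because both weights are.\<close>

lemma first_key_power_expansion:
  assumes n: "1 \<le> n"
  obtains B kk S A c' where "0 < B" "0 < kk" "yd (n + 1) = \<alpha> 1 * kk" "int B * \<omega> 0 = int (\<alpha> 1) * \<omega> 1"
    "g (n + 1) = (Y ^ \<alpha> 1 - cst (\<theta> 1) * X ^ B) ^ kk - (\<Sum>z\<in>S. cst (c' z) * lmon (A z))"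
    "\<And>z::nat \<times> nat. z \<in> S \<Longrightarrow> wgt (A z) < int (B * kk) * \<omega> 0"
proof -
  define B where "B = nat (b0 1)"
  define kk where "kk = yd (n + 1) div \<alpha> 1"
  have a1: "0 < \<alpha> 1" using alpha_pos[of 1] n by simp
  have yd2: "yd 2 = \<alpha> 1" using yd_Suc[of 1] by (simp add: numeral_2_eq_2)
  have "yd 2 dvd yd (n + 1)" using n by (intro yd_dvd) auto
  then have yk: "yd (n + 1) = \<alpha> 1 * kk" unfolding yd2 kk_def by simp
  have kk: "0 < kk" using yk yd_last_pos by (cases kk) auto
  have eq: "int (\<alpha> 1) * \<omega> 1 = b0 1 * \<omega> 0"
    using key_eq[of 1] n by (simp add: \<omega>_def g_0)
  have "0 < b0 1 * \<omega> 0" unfolding eq[symmetric] using a1 omega_1_pos by simp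
  then have "0 < b0 1" using omega_0_pos by (simp add: zero_less_mult_iff)
  then have B: "0 < B" "b0 1 = int B" by (simp_all add: B_def)
  have g2: "g 2 = Y ^ \<alpha> 1 - cst (\<theta> 1) * X ^ B"
    using key_rec[of 1] n g_1 unfolding B(2) by (simp add: numeral_2_eq_2)
  define z where "z = g 2 ^ kk - g (n + 1)"
  have "z = poly (gp 2 ^ kk - gp (n + 1)) Y" using gp(2)[of 2] gp(2)[of "n + 1"] n by (simp add: z_def)
  moreover have "gp 2 ^ kk - gp (n + 1) \<in> laurent_coeffs" using gp(1)[of 2] gp(1)[of "n + 1"] n by auto
  ultimately have "z \<in> laurent_polys" unfolding laurent_polys_iff by blast
  then obtain K f where f: "X ^ K * z = to_fract f" unfolding laurent_polys_def polys_def by auto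
  obtain G1 where G1: "\<Psi> (g (n + 1)) = X powi (- (int q * int (yd (n + 1)))) * to_fract G1" "at0 G1 = gam (n + 1)"
    using key_subst_poly[of "n + 1"] by auto
  obtain G2 where G2: "\<Psi> (g 2) = X powi (- (int q * int (yd 2))) * to_fract G2" "at0 G2 = gam 2"
    using key_subst_poly[of 2] n by auto
  have gam2: "gam 2 = \<kappa>" unfolding gam_def yd2 using a1 by simp
  define W where "W = int q * int (yd (n + 1))"
  have P2: "\<Psi> (g 2 ^ kk) = X powi (- W) * to_fract (G2 ^ kk)"
  proof -
    have "\<Psi> (g 2 ^ kk) = (X powi (- (int q * int (yd 2)))) ^ kk * to_fract G2 ^ kk"
      unfolding Psi.hom_power G2(1) by (rule power_mult_distrib)
    also have "(X powi (- (int q * int (yd 2)))) ^ kk = X powi (- W)"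
      unfolding X_powi_power W_def yk yd2 by (simp add: mult.assoc)
    finally show ?thesis by (simp only: to_fract_power)
  qed
  have Pz: "\<Psi> z = X powi (- W) * to_fract (G2 ^ kk - G1)"
    unfolding z_def Psi.hom_minus P2 G1(1) W_def[symmetric] to_fract_diff by (rule right_diff_distrib[symmetric])
  have "\<Psi> (to_fract f) = X powi (- (int p * int K)) * \<Psi> z"
    unfolding f[symmetric] Psi.hom_mult using Psi_X_powi[of "int K"] by (simp add: power_int_of_nat)
  also have "\<dots> = X powi (- (W + int p * int K)) * to_fract (G2 ^ kk - G1)"
    unfolding Pz by (simp add: mult.assoc[symmetric] power_int_add[symmetric] add.commute)
  finally have Pf: "X powi (W + int p * int K) * \<Psi> (to_fract f) = to_fract (G2 ^ kk - G1)"
    by (simp add: mult.assoc[symmetric] power_int_add[symmetric])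
  have at: "at0 (G2 ^ kk - G1) = 0"
    unfolding at0.hom_minus at0.hom_power G2(2) G1(2) gam2 gam_last[OF n] kk_def by simp
  have wf: "int p * int i + int q * int j < W + int p * int K" if "coeff (coeff f j) i \<noteq> 0" for i j
    using weight_support(1,2)[OF c_0 Pf that] that at by (cases "int p * int i + int q * int j = W + int p * int K") auto
  define A where "A z = (int (fst z) - int K, int (snd z))" for z :: "nat \<times> nat"
  have WD: "W = int (B * kk) * \<omega> 0"
    unfolding W_def yk q_eq using eq B(2) by (simp add: mult_ac)
  have "X ^ K * z = (\<Sum>z\<in>supp f. cst (cf f z) * X ^ fst z * Y ^ snd z)"
    unfolding f ev2_XY[symmetric] by (rule ev2_supp)
  also have "\<dots> = (\<Sum>z\<in>supp f. X ^ K * (cst (cf f z) * lmon (A z)))"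
    by (intro sum.cong refl) (simp add: lmon_def A_def power_int_diff)
  also have "\<dots> = X ^ K * (\<Sum>z\<in>supp f. cst (cf f z) * lmon (A z))" by (rule sum_distrib_left[symmetric])
  finally have z: "z = (\<Sum>z\<in>supp f. cst (cf f z) * lmon (A z))" by simp
  show ?thesis
  proof (rule that)
    show "0 < B" "0 < kk" "yd (n + 1) = \<alpha> 1 * kk" by fact+
    show "int B * \<omega> 0 = int (\<alpha> 1) * \<omega> 1" using eq B(2) by simp
    show "g (n + 1) = (Y ^ \<alpha> 1 - cst (\<theta> 1) * X ^ B) ^ kk - (\<Sum>z\<in>supp f. cst (cf f z) * lmon (A z))"
      unfolding g2[symmetric] z[symmetric] z_def by simp
    show "wgt (A z) < int (B * kk) * \<omega> 0" if "z \<in> supp f" for z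
      using wf[of "snd z" "fst z"] that unfolding WD mem_supp p_eq q_eq wgt_def A_def
      by (simp add: algebra_simps)
  qed
qed

text \<open>The extreme terms of top weight in \<open>g (n + 1)\<close> are
  \<open>Y ^ (\<alpha> 1 * kk)\<close> and, up to a constant, \<open>X ^ (B * kk)\<close>. A
  negative exponent of x is removed with the first as pivot, an exponent that is too large with the
  second. Other top terms move it into or towards the admissible range; the remaining ones lower the
  weight until it is at most -N.\<close>

lemma division_lmon:
  assumes n: "1 \<le> n" and B: "0 < B" "0 < kk" "int B * \<omega> 0 = int (\<alpha> 1) * \<omega> 1"
    and gn: "g (n + 1) = (Y ^ \<alpha> 1 - cst (\<theta> 1) * X ^ B) ^ kk - (\<Sum>z\<in>S. cst (c' z) * lmon (A z))"
    and A: "\<And>z::nat \<times> nat. z \<in> S \<Longrightarrow> wgt (A z) < int (B * kk) * \<omega> 0"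
    and "wgt x \<le> int (B * kk) * \<omega> 0"
  shows "division N (B * kk) (lmon x)"
  using assms(7)
\<comment> \<open>Weight first; at equal weight, negative exponents of x must grow, too large ones
  must shrink, and admissible ones count 0.\<close>
proof (induction x rule: wf_induct_rule[OF wf_measures[of "[\<lambda>x. nat (wgt x + N),
    \<lambda>x. if fst x < 0 then nat (- fst x) else if fst x < int (B * kk) then 0 else nat (fst x)]"]])
  case (1 x)
  obtain i j where x: "x = (i, j)" by fastforce
  define D where "D = B * kk"
  have D: "0 < D" using B by (simp add: D_def)
  have IH: "division N D (lmon (i', j'))"
    if "wgt (i', j') < wgt (i, j) \<or> wgt (i', j') = wgt (i, j) \<and>
      (0 \<le> i' \<and> i' < int D \<and> (i < 0 \<or> int D \<le> i) \<or> i < i' \<and> i' < 0 \<or> int D \<le> i' \<and> i' < i)"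
      "0 < wgt (i, j) + N" for i' j'
    unfolding D_def
  proof (rule 1(1))
    show "wgt (i', j') \<le> int (B * kk) * \<omega> 0" using that(1) 1(2) unfolding x by linarith
    show "((i', j'), x) \<in> measures [\<lambda>x. nat (wgt x + N),
      \<lambda>x. if fst x < 0 then nat (- fst x) else if fst x < int (B * kk) then 0 else nat (fst x)]"
      using that(1)
    proof (elim disjE conjE)
      assume "wgt (i', j') < wgt (i, j)"
      then show ?thesis using that(2) by (simp add: x)
    qed (use D in \<open>simp_all add: x D_def[symmetric]\<close>)
  qed
  define cc where "cc l = of_nat (kk choose l) * (- \<theta> 1) ^ l" for l
  have cc: "cc l \<noteq> 0" if "l \<le> kk" for l
    using that theta_nonzero[of 1] n by (simp add: cc_def)
  have gk: "g (n + 1) = (\<Sum>l\<le>kk. cst (cc l) * lmon (int (B * l), int (\<alpha> 1 * (kk - l)))) - (\<Sum>z\<in>S. cst (c' z) * lmon (A z))"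
  proof -
    have "(Y ^ \<alpha> 1 - cst (\<theta> 1) * X ^ B) ^ kk = (cst (- \<theta> 1) * X ^ B + Y ^ \<alpha> 1) ^ kk"
      by (simp add: cst.hom_uminus)
    also have "\<dots> = (\<Sum>l\<le>kk. of_nat (kk choose l) * (cst (- \<theta> 1) * X ^ B) ^ l * (Y ^ \<alpha> 1) ^ (kk - l))"
      by (rule binomial_ring)
    also have "\<dots> = (\<Sum>l\<le>kk. cst (cc l) * lmon (int (B * l), int (\<alpha> 1 * (kk - l))))"
    proof (intro sum.cong refl)
      fix l
      have c: "cst (of_nat m) = of_nat m" for m by (induction m) (simp_all add: cst.hom_add)
      show "of_nat (kk choose l) * (cst (- \<theta> 1) * X ^ B) ^ l * (Y ^ \<alpha> 1) ^ (kk - l) =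
          cst (cc l) * lmon (int (B * l), int (\<alpha> 1 * (kk - l)))"
        unfolding lmon_def cc_def fst_conv snd_conv power_int_of_nat
        by (simp only: cst.hom_mult cst.hom_power c power_mult_distrib power_mult mult_ac)
    qed
    finally show ?thesis unfolding gn by (simp only:)
  qed
  \<comment> \<open>The monomial is matched with the l0-th top term of a multiple
    \<open>lmon (i0, j0) * g (n + 1)\<close>, and the equation is solved for it.\<close>
  have pivot: "division N D (lmon (i, j))"
    if l0: "l0 \<le> kk" and N: "0 < wgt (i, j) + N"
      and other: "\<And>l. l \<le> kk \<Longrightarrow> l \<noteq> l0 \<Longrightarrow> (0 \<le> i - int (B * l0) + int (B * l) \<and> i - int (B * l0) + int (B * l) < int D
        \<and> (i < 0 \<or> int D \<le> i) \<or> i < i - int (B * l0) + int (B * l) \<and> i - int (B * l0) + int (B * l) < 0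
        \<or> int D \<le> i - int (B * l0) + int (B * l) \<and> i - int (B * l0) + int (B * l) < i)" for l0
  proof -
    define i0 where "i0 = i - int (B * l0)"
    define j0 where "j0 = j - int (\<alpha> 1 * (kk - l0))"
    have wl: "wgt (int (B * l), int (\<alpha> 1 * (kk - l))) = int D * \<omega> 0" if "l \<le> kk" for l
    proof -
      have "wgt (int (B * l), int (\<alpha> 1 * (kk - l))) = int l * (int B * \<omega> 0) + int (kk - l) * (int (\<alpha> 1) * \<omega> 1)"
        by (simp add: wgt_def mult_ac)
      also have "\<dots> = (int l + int (kk - l)) * (int B * \<omega> 0)" unfolding B(3) by (simp only: distrib_right)
      also have "int l + int (kk - l) = int kk" using that by simp
      finally show ?thesis by (simp add: D_def mult_ac)
    qed
    have ij: "i = i0 + int (B * l0)" "j = j0 + int (\<alpha> 1 * (kk - l0))" by (simp_all add: i0_def j0_def)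
    have w0: "wgt (i0, j0) + int D * \<omega> 0 = wgt (i, j)"
      unfolding ij wgt_add wl[OF l0] ..
    have w0': "wgt (i0, j0) \<le> 0" using w0 1(2) by (simp add: x D_def)
    define T where "T l = cst (cc l) * lmon (i0 + int (B * l), j0 + int (\<alpha> 1 * (kk - l)))" for l
    have "lmon (i0, j0) * g (n + 1) = (\<Sum>l\<le>kk. T l) - (\<Sum>z\<in>S. cst (c' z) * (lmon (i0, j0) * lmon (A z)))"
      unfolding gk right_diff_distrib sum_distrib_left T_def lmon_mult[symmetric]
      by (simp only: mult.left_commute)
    also have "(\<Sum>l\<le>kk. T l) = T l0 + (\<Sum>l\<in>{..kk} - {l0}. T l)" using l0 by (intro sum.remove) auto
    finally have "T l0 = lmon (i0, j0) * g (n + 1) +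
        ((\<Sum>z\<in>S. cst (c' z) * (lmon (i0, j0) * lmon (A z))) + cst (- 1) * (\<Sum>l\<in>{..kk} - {l0}. T l))"
      by (simp add: cst.hom_uminus)
    moreover have "division N D (lmon (i0, j0) * g (n + 1))"
      by (rule division_multiple) (use w0' in \<open>simp add: le_def delta_lmon\<close>)
    moreover have "division N D (\<Sum>z\<in>S. cst (c' z) * (lmon (i0, j0) * lmon (A z)))"
    proof (intro division_sum division_cst_mult)
      fix z assume z: "z \<in> S"
      obtain i1 j1 where z1: "A z = (i1, j1)" by fastforce
      have "wgt (i0 + i1, j0 + j1) < wgt (i, j)" using A[OF z] w0 unfolding wgt_add z1 D_def by simp
      then show "division N D (lmon (i0, j0) * lmon (A z))"
        unfolding z1 lmon_mult using N by (intro IH) simp_all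
    qed
    moreover have "division N D (\<Sum>l\<in>{..kk} - {l0}. T l)"
      unfolding T_def
    proof (intro division_sum division_cst_mult IH)
      fix l assume l: "l \<in> {..kk} - {l0}"
      have "wgt (i0 + int (B * l), j0 + int (\<alpha> 1 * (kk - l))) = wgt (i, j)"
        unfolding wgt_add using wl[of l] l w0 by simp
      then show "wgt (i0 + int (B * l), j0 + int (\<alpha> 1 * (kk - l))) < wgt (i, j) \<or>
        wgt (i0 + int (B * l), j0 + int (\<alpha> 1 * (kk - l))) = wgt (i, j) \<and>
        (0 \<le> i0 + int (B * l) \<and> i0 + int (B * l) < int D \<and> (i < 0 \<or> int D \<le> i) \<or>
          i < i0 + int (B * l) \<and> i0 + int (B * l) < 0 \<or> int D \<le> i0 + int (B * l) \<and> i0 + int (B * l) < i)"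
        using other[of l] l unfolding i0_def by blast
    qed (rule N)
    ultimately have "division N D (T l0)" by (simp only: division_add division_cst_mult)
    then have "division N D (cst (1 / cc l0) * T l0)" by (rule division_cst_mult)
    also have "cst (1 / cc l0) * T l0 = lmon (i, j)"
      unfolding T_def ij[symmetric] using cc[OF l0] by (simp flip: mult.assoc cst.hom_mult)
    finally show ?thesis .
  qed
  have Bl: "int (B * l) < int D" if "l < kk" for l using that B unfolding D_def by simp
  have "division N D (lmon (i, j))"
  proof (cases "0 < wgt (i, j) + N")
    case False
    then show ?thesis by (intro division_small) (simp add: le_def delta_lmon)
  next
    case N: True
    consider "i < 0" | "0 \<le> i" "i < int D" | "int D \<le> i" by linarith
    then show ?thesis
    proof cases
      case 1
      show ?thesis
      proof (rule pivot[of 0])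
        fix l assume l: "l \<le> kk" "l \<noteq> 0"
        have "0 < int (B * l)" using l B by simp
        moreover have "int (B * l) \<le> int D" using l B unfolding D_def by simp
        ultimately show "0 \<le> i - int (B * 0) + int (B * l) \<and> i - int (B * 0) + int (B * l) < int D
          \<and> (i < 0 \<or> int D \<le> i) \<or> i < i - int (B * 0) + int (B * l) \<and> i - int (B * 0) + int (B * l) < 0
          \<or> int D \<le> i - int (B * 0) + int (B * l) \<and> i - int (B * 0) + int (B * l) < i"
          using 1 unfolding mult_0_right of_nat_0 by linarith
      qed (use N in simp_all)
    next
      case 2
      then show ?thesis using 1(2) unfolding x by (intro division_region) (simp_all add: D_def)
    next
      case 3
      show ?thesis
      proof (rule pivot[of kk])
        fix l assume l: "l \<le> kk" "l \<noteq> kk"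
        then have "int (B * l) < int D" by (intro Bl) simp
        then show "0 \<le> i - int (B * kk) + int (B * l) \<and> i - int (B * kk) + int (B * l) < int D
          \<and> (i < 0 \<or> int D \<le> i) \<or> i < i - int (B * kk) + int (B * l) \<and> i - int (B * kk) + int (B * l) < 0
          \<or> int D \<le> i - int (B * kk) + int (B * l) \<and> i - int (B * kk) + int (B * l) < i"
          using 3 unfolding D_def by linarith
      qed (use N in simp_all)
    qed
  qed
  then show ?case unfolding x D_def .
qed

text \<open>With \<open>D * \<omega> 0 = yd (n + 1) * \<omega> 1\<close>, divide
  \<open>X ^ D\<close> by the last key form and drop b. Times \<open>u ^ D\<close>, the rest is a
  polynomial in u and v with restriction \<open>v ^ D\<close>, of value at most that of
  \<open>u ^ D * g (n + 1)\<close>. For n = 0 the polynomial v suffices.\<close>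

lemma sigma_attained:
  "\<exists>F k. 1 \<le> k \<and> low_order F k \<and> of_int (\<delta> (ev2 u v F)) \<le> real k * (\<sigma> - of_int (\<omega> 1))"
  if nonzero: "\<And>F k. low_order F k \<Longrightarrow> ev2 u v F \<noteq> 0"
proof (cases "1 \<le> n")
  case True
  obtain B kk S A c' where *: "0 < B" "0 < kk" "yd (n + 1) = \<alpha> 1 * kk" "int B * \<omega> 0 = int (\<alpha> 1) * \<omega> 1"
    "g (n + 1) = (Y ^ \<alpha> 1 - cst (\<theta> 1) * X ^ B) ^ kk - (\<Sum>z\<in>S. cst (c' z) * lmon (A z))"
    "\<And>z::nat \<times> nat. z \<in> S \<Longrightarrow> wgt (A z) < int (B * kk) * \<omega> 0"
    by (rule first_key_power_expansion[OF True]) (rule that)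
  define D where "D = B * kk"
  \<comment> \<open>This precision makes the value of the error term at most that of the last key
    form.\<close>
  have "division (- \<omega> (n + 1)) D (lmon (int D, 0))"
    unfolding D_def by (rule division_lmon[OF True *(1,2,4,5,6)]) (simp_all add: wgt_def)
  then obtain a b e \<Phi> where d: "X ^ D = a * g (n + 1) + b + e" "le a 0" "ev2 u v \<Phi> = u ^ D * b" "at0 \<Phi> = 0"
    "le e (\<omega> (n + 1))"
    unfolding division_def by (auto simp: lmon_def)
  define F where "F = monom 1 D - \<Phi>"
  have "at0 F = monom 1 D" unfolding F_def at0.hom_minus d(4) by (intro poly_eqI) (simp add: coeff_monom)
  then have "coeff (coeff F j) 0 = (if j = D then 1 else 0)" for j
    using coeff_at0[of F j] by (auto simp: coeff_monom)
  then have low: "low_order F D" by (simp add: low_order_def)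
  have "ev2 u v F = v ^ D - u ^ D * b" by (simp add: F_def ev2.hom_minus d(3))
  also have "v ^ D = u ^ D * X ^ D" by (simp add: u_def v_def power_mult_distrib mult.commute)
  finally have F: "ev2 u v F = u ^ D * (a * g (n + 1) + e)" unfolding d(1) by (simp add: algebra_simps)
  have "le (a * g (n + 1)) (0 + \<omega> (n + 1))" by (rule le_mult[OF d(2)]) (simp add: \<omega>_def)
  then have "le (a * g (n + 1) + e) (\<omega> (n + 1))" using d(5) by (simp add: le_add)
  then have "le (ev2 u v F) (int D * (- \<omega> 1) + \<omega> (n + 1))"
    unfolding F by (intro le_mult le_power) (simp_all add: le_def uv)
  then have "\<delta> (ev2 u v F) \<le> int D * (- \<omega> 1) + \<omega> (n + 1)" using leD nonzero[OF low] by blast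
  then have "real_of_int (\<delta> (ev2 u v F)) \<le> real_of_int (int D * (- \<omega> 1) + \<omega> (n + 1))" by (simp only: of_int_le_iff)
  also have "\<dots> = real D * (- of_int (\<omega> 1)) + of_int (\<omega> (n + 1))" by simp
  also have "of_int (\<omega> (n + 1)) = real D * \<sigma>"
  proof -
    have "int D * \<omega> 0 = int (yd (n + 1)) * \<omega> 1" using *(4) unfolding D_def *(3) by (simp add: mult_ac)
    then have "real_of_int (int D * \<omega> 0) = real_of_int (int (yd (n + 1)) * \<omega> 1)" by (rule arg_cong)
    then have e: "real D * of_int (\<omega> 0) = real (yd (n + 1)) * of_int (\<omega> 1)" by simp
    have "real D * \<sigma> * of_int (\<omega> 1) = \<tau> * (real D * of_int (\<omega> 0))"
      unfolding mult.assoc sigma_tau by (simp add: mult_ac)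
    also have "\<dots> = of_int (\<omega> (n + 1)) * of_int (\<omega> 1)" unfolding e tau_yd[symmetric] by (simp add: mult_ac)
    finally show ?thesis using omega_1_pos by simp
  qed
  finally have "of_int (\<delta> (ev2 u v F)) \<le> real D * (\<sigma> - of_int (\<omega> 1))" by (simp add: algebra_simps)
  moreover have "1 \<le> D" using *(1,2) by (simp add: D_def Suc_le_eq)
  ultimately show ?thesis using low by blast
next
  case False
  then have "n = 0" by simp
  then have "yd (n + 1) = 1" "\<omega> (n + 1) = \<omega> 1" using yd_1 by simp_all
  then have "\<tau> = of_int (\<omega> 1)" unfolding \<tau>_def by simp
  then have "\<sigma> = of_int (\<omega> 0)" using omega_1_pos by (simp add: \<sigma>_def)
  then have "of_int (\<delta> (ev2 u v [:0, 1:])) \<le> real 1 * (\<sigma> - of_int (\<omega> 1))"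
    using uv(4) by simp
  moreover have "low_order [:0, 1:] 1" by (simp add: low_order_def)
  ultimately show ?thesis by blast
qed

text \<open>Multiplied by a power of Y, F(u, v) becomes a polynomial f in x and y, in which
  \<open>v ^ k\<close> turns into \<open>X ^ k * Y ^ (l - k)\<close>. The weight of this monomial is
  at most the top weight, from which \<open>vertical_bound\<close> bounds \<delta> f.\<close>

lemma lower_bound:
  assumes "low_order F k"
  shows "ev2 u v F \<noteq> 0" "real k * (\<sigma> - of_int (\<omega> 1)) \<le> of_int (\<delta> (ev2 u v F))"
proof -
  have k: "(0, k) \<in> supp F" using assms by (simp add: low_order_def supp_def)
  define l where "l = Max ((\<lambda>z. fst z + snd z) ` supp F)"
  have l: "fst z + snd z \<le> l" if "z \<in> supp F" for z
    unfolding l_def using that by (intro Max_ge) auto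
  define \<phi> where "\<phi> z = (snd z, l - fst z - snd z)" for z :: "nat \<times> nat"
  have inj: "inj_on \<phi> (supp F)"
  proof (rule inj_onI)
    fix z z' assume z: "z \<in> supp F" "z' \<in> supp F" "\<phi> z = \<phi> z'"
    then show "z = z'" using l[OF z(1)] l[OF z(2)] by (auto simp: \<phi>_def prod_eq_iff)
  qed
  define f where "f = relabel \<phi> F"
  have kl: "k \<le> l" using l[OF k] by simp
  have fk: "coeff (coeff f (l - k)) k \<noteq> 0"
    unfolding f_def using relabel_inj[OF inj k, of k "l - k"] k by (simp add: \<phi>_def mem_supp)
  then have f0: "f \<noteq> 0" by auto
  have "to_fract f = (\<Sum>z\<in>supp F. cst (cf F z) * X ^ fst (\<phi> z) * Y ^ snd (\<phi> z))"
    unfolding f_def ev2_XY[symmetric] by (rule ev2_relabel)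
  also have "\<dots> = (\<Sum>z\<in>supp F. Y ^ l * (cst (cf F z) * u ^ fst z * v ^ snd z))"
  proof (intro sum.cong refl)
    fix z assume "z \<in> supp F"
    then have "l = (l - fst z - snd z) + fst z + snd z" using l by fastforce
    then have "Y ^ l = Y ^ (l - fst z - snd z) * Y ^ fst z * Y ^ snd z" by (metis power_add)
    then show "cst (cf F z) * X ^ fst (\<phi> z) * Y ^ snd (\<phi> z) = Y ^ l * (cst (cf F z) * u ^ fst z * v ^ snd z)"
      by (simp add: \<phi>_def u_def v_def power_mult_distrib power_inverse field_simps)
  qed
  also have "\<dots> = Y ^ l * ev2 u v F" unfolding ev2_supp by (rule sum_distrib_left[symmetric])
  finally have f: "to_fract f = Y ^ l * ev2 u v F" .
  show nz: "ev2 u v F \<noteq> 0" using f f0 by auto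
  have df: "\<delta> (to_fract f) = int l * \<omega> 1 + \<delta> (ev2 u v F)"
    unfolding f using nz by (simp add: mult power omega_1[simplified])
  obtain i j where ij: "coeff (coeff f j) i \<noteq> 0"
    "\<And>k l. coeff (coeff f l) k \<noteq> 0 \<Longrightarrow> \<omega> 0 * int k + \<omega> 1 * int l \<le> \<omega> 0 * int i + \<omega> 1 * int j"
    "real j * of_int (\<omega> 1) + real i * \<sigma> \<le> of_int (\<delta> (to_fract f))"
    by (rule vertical_bound[OF f0]) (rule that)
  obtain z where z: "z \<in> supp F" "\<phi> z = (i, j)"
    using ij(1) unfolding f_def by (rule relabel_nonzero)
  have "i + j \<le> l" using z(2) l[OF z(1)] by (auto simp: \<phi>_def)
  define a where "a = real l - real i - real j"
  have a: "0 \<le> a" "real j = real l - real i - a" using \<open>i + j \<le> l\<close> by (simp_all add: a_def)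
  have "real_of_int (\<omega> 0 * int k + \<omega> 1 * int (l - k)) \<le> real_of_int (\<omega> 0 * int i + \<omega> 1 * int j)"
    using ij(2)[OF fk] by (simp only: of_int_le_iff)
  then have w: "of_int (\<omega> 0) * real k + of_int (\<omega> 1) * (real l - real k) \<le> of_int (\<omega> 0) * real i + of_int (\<omega> 1) * real j"
    using kl by (simp add: of_nat_diff)
  then have w': "a * of_int (\<omega> 1) \<le> (real k - real i) * (of_int (\<omega> 1) - of_int (\<omega> 0))"
    unfolding a(2) by (simp add: algebra_simps)
  have "0 \<le> a * of_int (\<omega> 1)" using a omega_1_pos by simp
  then have "0 \<le> (real k - real i) * (of_int (\<omega> 1) - of_int (\<omega> 0))" using w' by linarith
  then have ki: "0 \<le> real k - real i" using omega_lt by (simp add: zero_le_mult_iff)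
  have "(real k - real i) * (of_int (\<omega> 1) - of_int (\<omega> 0)) \<le> (real k - real i) * (of_int (\<omega> 1) - \<sigma>)"
    using ki sigma_le by (intro mult_left_mono) auto
  then have "0 \<le> (real k - real i) * (of_int (\<omega> 1) - \<sigma>) - a * of_int (\<omega> 1)" using w' by linarith
  also have "\<dots> = real j * of_int (\<omega> 1) + real i * \<sigma> - real l * of_int (\<omega> 1) - real k * (\<sigma> - of_int (\<omega> 1))"
    unfolding a(2) by (simp add: algebra_simps)
  also have "\<dots> \<le> of_int (\<delta> (ev2 u v F)) - real k * (\<sigma> - of_int (\<omega> 1))"
    using ij(3) unfolding df by simp
  finally show "real k * (\<sigma> - of_int (\<omega> 1)) \<le> of_int (\<delta> (ev2 u v F))" by simp
qed

lemma skewness_vertical: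
  "skewness \<delta> = ereal (\<sigma> / of_int (\<omega> 1))" "dmax \<delta> = \<omega> 1"
proof -
  show d: "dmax \<delta> = \<omega> 1"
    using omega_lt omega_1 by (simp add: dmax_def omega_0)
  interpret local_bounds \<delta> u v "\<sigma> - of_int (\<omega> 1)"
  proof
    show "u \<noteq> 0" "\<delta> u < 0" "v \<noteq> 0" "\<delta> v < 0" using uv omega_1_pos omega_lt by simp_all
    show "ev2 u v F \<noteq> 0" "real k * (\<sigma> - of_int (\<omega> 1)) \<le> of_int (\<delta> (ev2 u v F))" if "low_order F k" for F k
      using lower_bound[OF that] .
    show "\<exists>F k. 1 \<le> k \<and> low_order F k \<and> of_int (\<delta> (ev2 u v F)) \<le> real k * (\<sigma> - of_int (\<omega> 1))"
      by (rule sigma_attained) (rule lower_bound(1))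
  qed
  have lc: "local_coords Vertical_Point = (u, v)"
    by (simp add: u_def v_def divide_inverse)
  have "center (\<lambda>h. - \<delta> h) = {Vertical_Point}"
  proof (rule center_eq[OF lc])
    fix pt assume pt: "pt \<noteq> Vertical_Point"
    show "\<exists>f\<in>local_ring pt. f \<noteq> 0 \<and> 0 < \<delta> f"
    proof (cases pt)
      case (Finite_Point a b)
      then show ?thesis using finite_point_not_center by simp
    next
      case (Infinite_Point c')
      define h where "h = Y / X - cst c'"
      have YX: "\<delta> (Y / X) = \<omega> 1 - \<omega> 0" by (simp add: divide omega_0 omega_1[simplified])
      have "le (h - Y / X) 0" by (simp add: h_def)
      then have "h \<noteq> 0" "\<delta> h = \<omega> 1 - \<omega> 0"
        using dominant[of "Y / X" h 0] YX omega_lt by simp_all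
      moreover have "h \<in> local_ring pt"
        unfolding Infinite_Point
        by (rule local_ringI[of _ "1 / X" "Y / X - cst c'" 1 _ "[:0, 1:]"]) (simp_all add: h_def)
      ultimately show ?thesis using omega_lt by (intro bexI[of _ h]) auto
    next
      case Vertical_Point
      then show ?thesis using pt by simp
    qed
  qed
  moreover have "\<not> is_degree \<delta>"
  proof
    assume deg: "is_degree \<delta>"
    have "\<delta> X = 1" unfolding X_def using deg total_degree_coordinate unfolding is_degree_def by simp
    moreover have "\<delta> Y = 1" unfolding Y_def using deg total_degree_coordinate unfolding is_degree_def by simp
    ultimately show False using omega_lt omega_1 omega_0 by simp
  qed
  ultimately show "skewness \<delta> = ereal (\<sigma> / of_int (\<omega> 1))"
    using skewness_value[OF _ _ lc] omega_1_pos d by (simp add: diff_divide_distrib)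
qed

end

section \<open>The criterion\<close>

abbreviation skewness_criterion :: "(ratfun \<Rightarrow> int) \<Rightarrow> nat \<Rightarrow> (nat \<Rightarrow> ratfun) \<Rightarrow> bool" where
  "skewness_criterion \<delta> n g \<equiv>
    (skewness_is_inf \<delta> \<longleftrightarrow>
        \<delta> (g (n + 1)) \<ge> 0 \<or> (\<delta> (g (n + 1)) < 0 \<and> (\<forall>k\<le>n+1. g k \<in> polys))) \<and>
     (skewness_is_inf \<delta> \<longleftrightarrow>
        \<delta> (g (n + 1)) \<ge> 0 \<or> (\<delta> (g (n + 1)) < 0 \<and> g (n + 1) \<in> polys)) \<and>
     (skewness_is_min \<delta> \<longleftrightarrow> g (n + 1) \<in> polys) \<and>
     (g (n + 1) \<in> polys \<longleftrightarrow> (\<forall>k\<le>n+1. g k \<in> polys)) \<and>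
     (skewness_is_min \<delta> \<longrightarrow>
        (if n = 0 \<and> \<delta> X < \<delta> Y then inf_attained_at \<delta> (g 0)
         else inf_attained_at \<delta> (g (n + 1))))"

lemma total_degree_1: "total_degree 1 = 0"
  using total_degree_mult[of 1 1] by simp

context key_data
begin

text \<open>By coprime_slopes, at most one irreducible polynomial up to associates has a value below
  half the slope of the last key form; every other one satisfies the hypothesis \<open>irr\<close>.\<close>

lemma uniform_gap:
  fixes s :: real
  assumes tau: "\<tau> < 0"
    and bound: "\<And>f. f \<noteq> 0 \<Longrightarrow> s * real (total_degree f) \<le> of_int (\<delta> (to_fract f))"
    and strict: "\<And>f. f \<noteq> 0 \<Longrightarrow> 0 < total_degree f \<Longrightarrow> of_int (\<delta> (to_fract f)) \<noteq> s * real (total_degree f)"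
    and irr: "\<exists>\<epsilon>>0. \<forall>f. f \<noteq> 0 \<and> (\<tau> / 2) * real (degree f) \<le> of_int (\<delta> (to_fract f)) \<longrightarrow>
      (s + \<epsilon>) * real (total_degree f) \<le> of_int (\<delta> (to_fract f))"
  shows "\<exists>\<epsilon>>0. \<forall>f. f \<noteq> 0 \<longrightarrow> (s + \<epsilon>) * real (total_degree f) \<le> of_int (\<delta> (to_fract f))"
proof -
  obtain \<epsilon>1 where e1: "\<epsilon>1 > 0" "\<forall>f. f \<noteq> 0 \<and> (\<tau> / 2) * real (degree f) \<le> of_int (\<delta> (to_fract f)) \<longrightarrow>
      (s + \<epsilon>1) * real (total_degree f) \<le> of_int (\<delta> (to_fract f))"
    using irr by blast
  define bad where "bad f \<longleftrightarrow> of_int (\<delta> (to_fract f)) < (\<tau> / 2) * real (degree f)" for f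
  have bad_degree: "0 < degree f" if "f \<noteq> 0" "bad f" for f
  proof (rule ccontr)
    assume "\<not> 0 < degree f"
    then obtain a where a: "f = [:a:]" by (metis degree_eq_zeroE neq0_conv)
    then have "a \<noteq> 0" using that(1) by simp
    then have "0 \<le> \<delta> (to_fract f)"
      unfolding a evx_X[symmetric] using evx_X_value[of a] X_pos by simp
    then show False using that(2) \<open>\<not> 0 < degree f\<close> by (simp add: bad_def)
  qed
  have nonneg: "0 \<le> \<delta> (to_fract f)" if "f \<noteq> 0" "total_degree f = 0" for f
    using bound[OF that(1)] that(2) by simp
  have dvd: "f dvd f'" if f: "prime_elem f" "prime_elem f'" "bad f" "bad f'" for f f'
  proof (rule ccontr)
    assume "\<not> f dvd f'"
    with f(1) have "coprime f f'" by (rule prime_elem_imp_coprime)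
    moreover have nz: "f \<noteq> 0" "f' \<noteq> 0" using f by auto
    ultimately have "\<tau> * real (degree f) * real (degree f') \<le>
      real (degree f') * of_int (\<delta> (to_fract f)) + real (degree f) * of_int (\<delta> (to_fract f'))"
      by (rule coprime_slopes)
    moreover have "real (degree f') * of_int (\<delta> (to_fract f)) < real (degree f') * ((\<tau> / 2) * real (degree f))"
      using bad_degree[OF nz(2) f(4)] f(3) by (intro mult_strict_left_mono) (simp_all add: bad_def)
    moreover have "real (degree f) * of_int (\<delta> (to_fract f')) < real (degree f) * ((\<tau> / 2) * real (degree f'))"
      using bad_degree[OF nz(1) f(3)] f(4) by (intro mult_strict_left_mono) (simp_all add: bad_def)
    ultimately show False by (simp add: algebra_simps)
  qed
  obtain \<epsilon> where e: "\<epsilon> > 0"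
    "\<And>f. prime_elem f \<Longrightarrow> (s + \<epsilon>) * real (total_degree f) \<le> of_int (\<delta> (to_fract f))"
  proof (cases "\<exists>f0. prime_elem f0 \<and> bad f0")
    case False
    show ?thesis
    proof (rule that[OF e1(1)])
      fix f :: poly2 assume "prime_elem f"
      then have "f \<noteq> 0" "\<not> bad f" using False by auto
      then show "(s + \<epsilon>1) * real (total_degree f) \<le> of_int (\<delta> (to_fract f))"
        using e1(2) unfolding bad_def by simp
    qed
  next
    case True
    then obtain f0 where f0: "prime_elem f0" "bad f0" by blast
    then have nz: "f0 \<noteq> 0" by auto
    have t0: "0 < total_degree f0"
      using bad_degree[OF nz f0(2)] degree_le_total_degree[OF nz] by simp
    \<comment> \<open>The gap of the exceptional prime itself, positive by
      \<open>strict\<close>.\<close>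
    define \<epsilon>0 where "\<epsilon>0 = (of_int (\<delta> (to_fract f0)) - s * real (total_degree f0)) / real (total_degree f0)"
    have e0: "0 < \<epsilon>0" using bound[OF nz] strict[OF nz t0] t0 by (simp add: \<epsilon>0_def)
    have e0': "(s + \<epsilon>0) * real (total_degree f0) = of_int (\<delta> (to_fract f0))"
      using t0 by (simp add: \<epsilon>0_def field_simps)
    show ?thesis
    proof (rule that[of "min \<epsilon>0 \<epsilon>1"])
      show "0 < min \<epsilon>0 \<epsilon>1" using e0 e1(1) by simp
      fix f :: poly2 assume f: "prime_elem f"
      then have fnz: "f \<noteq> 0" by auto
      show "(s + min \<epsilon>0 \<epsilon>1) * real (total_degree f) \<le> of_int (\<delta> (to_fract f))"
      proof (cases "bad f")
        case False
        have "(s + min \<epsilon>0 \<epsilon>1) * real (total_degree f) \<le> (s + \<epsilon>1) * real (total_degree f)"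
          by (intro mult_right_mono) auto
        also have "\<dots> \<le> of_int (\<delta> (to_fract f))" using e1(2) fnz False unfolding bad_def by simp
        finally show ?thesis .
      next
        case True
        obtain k where k1: "f = f0 * k" using dvd[OF f0(1) f f0(2) True] by (rule dvdE)
        obtain k' where k2: "f0 = f * k'" using dvd[OF f f0(1) True f0(2)] by (rule dvdE)
        note k = k1 k2
        have knz: "k \<noteq> 0" "k' \<noteq> 0" using k nz fnz by auto
        have td: "total_degree f = total_degree f0 + total_degree k" "total_degree f0 = total_degree f + total_degree k'"
          using total_degree_mult[OF nz knz(1)] total_degree_mult[OF fnz knz(2)]
          unfolding k1[symmetric] k2[symmetric] .
        have "\<delta> (to_fract f) = \<delta> (to_fract f0) + \<delta> (to_fract k)"
          using mult[of "to_fract f0" "to_fract k"] nz knz unfolding to_fract_mult[symmetric] k1[symmetric] by simp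
        moreover have "\<delta> (to_fract f0) = \<delta> (to_fract f) + \<delta> (to_fract k')"
          using mult[of "to_fract f" "to_fract k'"] fnz knz unfolding to_fract_mult[symmetric] k2[symmetric] by simp
        \<comment> \<open>Since f and f0 divide each other, the cofactors have total degree 0 and
          nonnegative value; so f and f0 have the same value and degree.\<close>
        moreover have "0 \<le> \<delta> (to_fract k)" "0 \<le> \<delta> (to_fract k')"
          using nonneg knz td by simp_all
        ultimately have "\<delta> (to_fract f) = \<delta> (to_fract f0)" by linarith
        moreover have "total_degree f = total_degree f0" using td by simp
        moreover have "(s + min \<epsilon>0 \<epsilon>1) * real (total_degree f0) \<le> (s + \<epsilon>0) * real (total_degree f0)"
          by (intro mult_right_mono) auto
        ultimately show ?thesis using e0' by simp
      qed
    qed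
  qed
  \<comment> \<open>Value and total degree are both additive, so the gap passes from primes to all
    products; units have nonnegative value.\<close>
  have "f \<noteq> 0 \<longrightarrow> (s + \<epsilon>) * real (total_degree f) \<le> of_int (\<delta> (to_fract f))" for f :: poly2
  proof (induction f rule: prime_divisors_induct)
    case (unit x)
    show ?case
    proof
      assume nz: "x \<noteq> 0"
      obtain y where y: "1 = x * y" using unit by (rule dvdE)
      then have "y \<noteq> 0" by auto
      then have "total_degree x = 0"
        using total_degree_mult[OF nz \<open>y \<noteq> 0\<close>] unfolding y[symmetric] total_degree_1 by simp
      then show "(s + \<epsilon>) * real (total_degree x) \<le> of_int (\<delta> (to_fract x))"
        using nonneg[OF nz] by simp
    qed
  next
    case (factor p x)
    show ?case
    proof
      assume "p * x \<noteq> 0"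
      then have nz: "p \<noteq> 0" "x \<noteq> 0" by auto
      have "\<delta> (to_fract (p * x)) = \<delta> (to_fract p) + \<delta> (to_fract x)"
        unfolding to_fract_mult using nz by (intro mult) simp_all
      then show "(s + \<epsilon>) * real (total_degree (p * x)) \<le> of_int (\<delta> (to_fract (p * x)))"
        unfolding total_degree_mult[OF nz] using e(2)[OF prime_imp_prime_elem[OF factor(1)]] factor(2) nz
        by (simp add: distrib_left)
    qed
  qed simp
  then show ?thesis using e(1) by blast
qed

text \<open>The deduction common to all positions of the center: s is \<tau> for a center [0:1:c],
  \<sigma> at [0:0:1] and 1 for deg. In \<open>approx\<close> the last key form may be assumed not
  to be a polynomial, as the bound is attained otherwise; at the vertical point this excludes n =
  0.\<close>

lemma criterion:
  fixes s :: real
  assumes d: "0 < dmax \<delta>" "skewness \<delta> = ereal (s / of_int (dmax \<delta>))"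
    and bound: "\<And>f. f \<noteq> 0 \<Longrightarrow> s * real (total_degree f) \<le> of_int (\<delta> (to_fract f))"
    and equality: "\<And>f k. f \<noteq> 0 \<Longrightarrow> 0 < total_degree f \<Longrightarrow>
      of_int (\<delta> (to_fract f)) = s * real (total_degree f) \<Longrightarrow> k \<le> n + 1 \<Longrightarrow> g k \<in> polys"
    and approx: "\<And>\<epsilon>. 0 \<le> \<omega> (n + 1) \<Longrightarrow> g (n + 1) \<notin> polys \<Longrightarrow> 0 < \<epsilon> \<Longrightarrow>
      \<exists>f. f \<noteq> 0 \<and> 0 < total_degree f \<and> of_int (\<delta> (to_fract f)) \<le> (s + \<epsilon>) * real (total_degree f)"
    and irr: "\<tau> < 0 \<Longrightarrow> \<exists>\<epsilon>>0. \<forall>f. f \<noteq> 0 \<and> (\<tau> / 2) * real (degree f) \<le> of_int (\<delta> (to_fract f)) \<longrightarrow>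
      (s + \<epsilon>) * real (total_degree f) \<le> of_int (\<delta> (to_fract f))"
    and last: "\<And>f. to_fract f = g (n + 1) \<Longrightarrow> \<not> (n = 0 \<and> \<delta> X < \<delta> Y) \<Longrightarrow>
      f \<noteq> 0 \<and> 0 < total_degree f \<and> of_int (\<delta> (to_fract f)) = s * real (total_degree f)"
    and first: "n = 0 \<Longrightarrow> \<delta> X < \<delta> Y \<Longrightarrow> s = of_int (\<delta> X)"
  shows "skewness_criterion \<delta> n g"
proof -
  define D where "D = real_of_int (dmax \<delta>)"
  define I where "I = (INF f\<in>nonconstant_polys. slope \<delta> f)"
  have D: "0 < D" using d(1) by (simp add: D_def)
  have slope: "slope \<delta> f = ereal (of_int (\<delta> (to_fract f)) / real (total_degree f) / D)" for f
    unfolding slope_def D_def by (simp add: mult.commute)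
  have slope_le: "slope \<delta> f \<le> ereal (x / D) \<longleftrightarrow> of_int (\<delta> (to_fract f)) \<le> x * real (total_degree f)"
    and slope_ge: "ereal (x / D) \<le> slope \<delta> f \<longleftrightarrow> x * real (total_degree f) \<le> of_int (\<delta> (to_fract f))"
    if "f \<in> nonconstant_polys" for f x
    using that D unfolding slope nonconstant_polys_iff by (simp_all add: divide_le_cancel field_simps)
  have lower: "ereal (s / D) \<le> I"
    unfolding I_def by (intro INF_greatest) (simp add: slope_ge bound nonconstant_polys_iff)
  have upper: "I \<le> slope \<delta> f" if "f \<in> nonconstant_polys" for f
    unfolding I_def using that by (rule INF_lower)
  have is_inf: "skewness_is_inf \<delta> \<longleftrightarrow> I = ereal (s / D)"
    unfolding skewness_is_inf_def I_def D_def d(2) by auto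
  have attains: "inf_attained_at \<delta> (to_fract f)" "I = ereal (s / D)"
    if "f \<noteq> 0" "0 < total_degree f" "of_int (\<delta> (to_fract f)) = s * real (total_degree f)" for f
  proof -
    have f: "f \<in> nonconstant_polys" using that by (simp add: nonconstant_polys_iff)
    have "slope \<delta> f \<le> ereal (s / D)" unfolding slope_le[OF f] using that(3) by simp
    then show "I = ereal (s / D)" using lower upper[OF f] by (intro antisym) auto
    then have "slope \<delta> f = I"
      using \<open>slope \<delta> f \<le> ereal (s / D)\<close> upper[OF f] by (intro antisym) auto
    then show "inf_attained_at \<delta> (to_fract f)" using f unfolding inf_attained_at_def I_def by blast
  qed
  have at_last: "(if n = 0 \<and> \<delta> X < \<delta> Y then inf_attained_at \<delta> (g 0) else inf_attained_at \<delta> (g (n + 1))) \<and>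
      I = ereal (s / D)" if poly: "g (n + 1) \<in> polys"
  proof (cases "n = 0 \<and> \<delta> X < \<delta> Y")
    case True
    have "total_degree [:[:0, 1:]:] = 1" by (rule total_degree_coordinate) simp
    then have "inf_attained_at \<delta> (to_fract [:[:0, 1:]:])" "I = ereal (s / D)"
      using attains[of "[:[:0, 1:]:]"] first True by (simp_all flip: X_def)
    then show ?thesis using True by (simp add: g_0 X_def)
  next
    case False
    obtain f where f: "to_fract f = g (n + 1)" using poly by (auto simp: polys_def)
    have c: "f \<noteq> 0" "0 < total_degree f" "of_int (\<delta> (to_fract f)) = s * real (total_degree f)"
      using last[OF f False] by simp_all
    show ?thesis using attains[OF c] unfolding if_not_P[OF False] f by (rule conjI)
  qed
  have attained: "g k \<in> polys" if inf: "I = ereal (s / D)" "inf_attained_at \<delta> h" and k: "k \<le> n + 1" for h k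
  proof -
    obtain f where f: "f \<in> nonconstant_polys" "slope \<delta> f = I"
      using inf(2) unfolding inf_attained_at_def I_def by blast
    have nz: "f \<noteq> 0" "0 < total_degree f" using f(1) by (simp_all add: nonconstant_polys_iff)
    have "of_int (\<delta> (to_fract f)) \<le> s * real (total_degree f)"
      using slope_le[OF f(1), of s] f(2) inf(1) by simp
    then show ?thesis using bound[OF nz(1)] by (intro equality[OF nz _ k]) simp
  qed
  have all: "g (n + 1) \<in> polys \<longleftrightarrow> (\<forall>k\<le>n+1. g k \<in> polys)"
    using last_key_polynomial by blast
  have min: "skewness_is_min \<delta> \<longleftrightarrow> g (n + 1) \<in> polys"
  proof
    assume "skewness_is_min \<delta>"
    then obtain h where "I = ereal (s / D)" "inf_attained_at \<delta> h"
      unfolding skewness_is_min_def is_inf by blast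
    then show "g (n + 1) \<in> polys" by (rule attained) simp
  next
    assume "g (n + 1) \<in> polys"
    from at_last[OF this] show "skewness_is_min \<delta>"
      unfolding skewness_is_min_def is_inf by (auto split: if_splits)
  qed
  have inf: "skewness_is_inf \<delta> \<longleftrightarrow> \<delta> (g (n + 1)) \<ge> 0 \<or> g (n + 1) \<in> polys"
  proof
    assume "\<delta> (g (n + 1)) \<ge> 0 \<or> g (n + 1) \<in> polys"
    moreover have "I = ereal (s / D)" if pos: "0 \<le> \<delta> (g (n + 1))" and np: "g (n + 1) \<notin> polys"
    proof (rule antisym[OF _ lower], rule ereal_le_epsilon2)
      fix e :: real assume "0 < e"
      then have "0 < e * D" using D by simp
      then obtain f where f: "f \<noteq> 0" "0 < total_degree f"
        "of_int (\<delta> (to_fract f)) \<le> (s + e * D) * real (total_degree f)"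
        using approx[of "e * D"] pos np by (auto simp: \<omega>_def)
      have fn: "f \<in> nonconstant_polys" using f by (simp add: nonconstant_polys_iff)
      have "I \<le> slope \<delta> f" by (rule upper[OF fn])
      also have "\<dots> \<le> ereal ((s + e * D) / D)" unfolding slope_le[OF fn] by (rule f(3))
      also have "(s + e * D) / D = s / D + e" using D by (simp add: add_divide_distrib)
      finally show "I \<le> ereal (s / D) + ereal e" by simp
    qed
    ultimately show "skewness_is_inf \<delta>" using at_last is_inf by blast
  next
    assume "skewness_is_inf \<delta>"
    then have I: "I = ereal (s / D)" by (simp only: is_inf)
    show "\<delta> (g (n + 1)) \<ge> 0 \<or> g (n + 1) \<in> polys"
    proof (rule ccontr)
      assume "\<not> (\<delta> (g (n + 1)) \<ge> 0 \<or> g (n + 1) \<in> polys)"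
      then have neg: "\<omega> (n + 1) < 0" and np: "g (n + 1) \<notin> polys" by (auto simp: \<omega>_def)
      have tau: "\<tau> < 0" unfolding \<tau>_def using neg yd_last_pos by (intro divide_neg_pos) simp_all
      have "of_int (\<delta> (to_fract f)) \<noteq> s * real (total_degree f)" if "f \<noteq> 0" "0 < total_degree f" for f
        using equality[OF that, of "n + 1"] np by blast
      then obtain \<epsilon> where e: "\<epsilon> > 0"
        "\<forall>f. f \<noteq> 0 \<longrightarrow> (s + \<epsilon>) * real (total_degree f) \<le> of_int (\<delta> (to_fract f))"
        using uniform_gap[OF tau bound _ irr[OF tau]] by blast
      have "ereal ((s + \<epsilon>) / D) \<le> I"
        unfolding I_def using e(2) by (intro INF_greatest) (simp add: slope_ge nonconstant_polys_iff)
      then have "(s + \<epsilon>) / D \<le> s / D" unfolding I by simp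
      then show False using D e(1) by (simp add: divide_le_cancel)
    qed
  qed
  show ?thesis
  proof (intro conjI impI)
    show "skewness_is_inf \<delta> \<longleftrightarrow> \<delta> (g (n + 1)) \<ge> 0 \<or> (\<delta> (g (n + 1)) < 0 \<and> (\<forall>k\<le>n+1. g k \<in> polys))"
      unfolding inf all by (auto simp: not_le[symmetric])
    show "skewness_is_inf \<delta> \<longleftrightarrow> \<delta> (g (n + 1)) \<ge> 0 \<or> (\<delta> (g (n + 1)) < 0 \<and> g (n + 1) \<in> polys)"
      unfolding inf by (auto simp: not_le[symmetric])
    show "skewness_is_min \<delta> \<longleftrightarrow> g (n + 1) \<in> polys" by (rule min)
    show "g (n + 1) \<in> polys \<longleftrightarrow> (\<forall>k\<le>n+1. g k \<in> polys)" by (rule all)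
    assume "skewness_is_min \<delta>"
    then have "g (n + 1) \<in> polys" by (simp only: min)
    from conjunct1[OF at_last[OF this]]
    show "if n = 0 \<and> \<delta> X < \<delta> Y then inf_attained_at \<delta> (g 0) else inf_attained_at \<delta> (g (n + 1))" .
  qed
qed

lemma omega_1_Y: "\<omega> 1 = \<delta> Y" by (simp add: \<omega>_def g_1[simplified])

end

lemma (in horizontal) horizontal_criterion:
  assumes "\<delta> v < 0" and "\<omega> 1 = \<omega> 0 \<longrightarrow> c \<noteq> 0"
  shows "skewness_criterion \<delta> n g"
proof (rule criterion[of \<tau>])
  have o0: "0 < \<omega> 0" using X_pos by (simp add: omega_0)
  show "0 < dmax \<delta>" using skewness_horizontal(2)[OF assms] o0 by simp
  show "skewness \<delta> = ereal (\<tau> / of_int (dmax \<delta>))" unfolding skewness_horizontal[OF assms] ..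
  show "\<tau> * real (total_degree f) \<le> of_int (\<delta> (to_fract f))" if "f \<noteq> 0" for f using that by (rule degree_bound)
  show "g k \<in> polys" if "f \<noteq> 0" "0 < total_degree f" "of_int (\<delta> (to_fract f)) = \<tau> * real (total_degree f)"
    "k \<le> n + 1" for f k using that by (rule degree_bound_eq)
  show "\<exists>f. f \<noteq> 0 \<and> 0 < total_degree f \<and> of_int (\<delta> (to_fract f)) \<le> (\<tau> + \<epsilon>) * real (total_degree f)"
    if "0 \<le> \<omega> (n + 1)" "0 < \<epsilon>" for \<epsilon> using that by (rule approximation)
  show "\<exists>\<epsilon>>0. \<forall>f. f \<noteq> 0 \<and> (\<tau> / 2) * real (degree f) \<le> of_int (\<delta> (to_fract f)) \<longrightarrow>
      (\<tau> + \<epsilon>) * real (total_degree f) \<le> of_int (\<delta> (to_fract f))" if "\<tau> < 0" using that by (rule irreducible_bound)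
  show "f \<noteq> 0 \<and> 0 < total_degree f \<and> of_int (\<delta> (to_fract f)) = \<tau> * real (total_degree f)"
    if f: "to_fract f = g (n + 1)" for f
    unfolding last_key_total_degree(2)[OF f] f using last_key_total_degree(1)[OF f] yd_last_pos tau_yd
    by (simp add: \<omega>_def)
  show "\<tau> = of_int (\<delta> X)" if "\<delta> X < \<delta> Y"
    using that omega_1_le unfolding omega_1_Y omega_0 by simp
qed

lemma (in vertical) vertical_criterion: "skewness_criterion \<delta> n g"
proof (rule criterion[of \<sigma>])
  show "0 < dmax \<delta>" using skewness_vertical(2) omega_1_pos by simp
  show "skewness \<delta> = ereal (\<sigma> / of_int (dmax \<delta>))" unfolding skewness_vertical ..
  show "\<sigma> * real (total_degree f) \<le> of_int (\<delta> (to_fract f))" if "f \<noteq> 0" for f using that by (rule degree_bound)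
  have XY: "\<delta> X < \<delta> Y" using omega_lt unfolding omega_1_Y omega_0 .
  have g0_poly: "g 0 \<in> polys" by (simp add: g_0 polys_def X_def)
  have g1_poly: "g 1 \<in> polys" by (simp only: g_1 polys_def Y_def) simp
  show "g k \<in> polys" if "f \<noteq> 0" "0 < total_degree f" "of_int (\<delta> (to_fract f)) = \<sigma> * real (total_degree f)"
    "k \<le> n + 1" for f k
  proof (cases "1 \<le> n")
    case True
    then show ?thesis using that by (rule degree_bound_eq)
  next
    case False
    then have "k = 0 \<or> k = 1" using that(4) by linarith
    then show ?thesis using g0_poly g1_poly by blast
  qed
  show "\<exists>f. f \<noteq> 0 \<and> 0 < total_degree f \<and> of_int (\<delta> (to_fract f)) \<le> (\<sigma> + \<epsilon>) * real (total_degree f)"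
    if "0 \<le> \<omega> (n + 1)" "g (n + 1) \<notin> polys" "0 < \<epsilon>" for \<epsilon>
  proof (rule approximation)
    show "1 \<le> n"
    proof (rule ccontr)
      assume "\<not> 1 \<le> n"
      then have "n + 1 = 1" by simp
      then show False using that(2) g1_poly by metis
    qed
  qed fact+
  show "\<exists>\<epsilon>>0. \<forall>f. f \<noteq> 0 \<and> (\<tau> / 2) * real (degree f) \<le> of_int (\<delta> (to_fract f)) \<longrightarrow>
      (\<sigma> + \<epsilon>) * real (total_degree f) \<le> of_int (\<delta> (to_fract f))" if "\<tau> < 0" using that by (rule irreducible_bound)
  show "f \<noteq> 0 \<and> 0 < total_degree f \<and> of_int (\<delta> (to_fract f)) = \<sigma> * real (total_degree f)"
    if f: "to_fract f = g (n + 1)" and "\<not> (n = 0 \<and> \<delta> X < \<delta> Y)" for f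
  proof -
    have n: "1 \<le> n" using that(2) XY by simp
    note td = last_key_total_degree[OF n f]
    have "0 < \<omega> 1 * int (yd (n + 1))" using omega_1_pos yd_last_pos by (intro mult_pos_pos) (simp_all only: of_nat_0_less_iff)
    then have "0 < \<omega> 0 * int (total_degree f)" using td(2) by simp
    then have pos: "0 < total_degree f" using omega_0_pos by (simp add: zero_less_mult_iff)
    have "real_of_int (\<omega> 0 * int (total_degree f)) = real_of_int (\<omega> 1 * int (yd (n + 1)))"
      unfolding td(2) ..
    then have e: "of_int (\<omega> 0) * real (total_degree f) = of_int (\<omega> 1) * real (yd (n + 1))" by simp
    have "\<sigma> * real (total_degree f) * of_int (\<omega> 1) = \<tau> * (of_int (\<omega> 0) * real (total_degree f))"
      using sigma_tau by (simp add: mult_ac)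
    also have "\<dots> = of_int (\<omega> (n + 1)) * of_int (\<omega> 1)" unfolding e tau_yd[symmetric] by (simp add: mult_ac)
    finally have "\<sigma> * real (total_degree f) = of_int (\<omega> (n + 1))" using omega_1_pos by simp
    then show ?thesis using td(1) pos unfolding f by (simp add: \<omega>_def)
  qed
  show "\<sigma> = of_int (\<delta> X)" if "n = 0"
  proof -
    have "yd (n + 1) = 1" "\<omega> (n + 1) = \<omega> 1" using that yd_1 by simp_all
    then have "\<tau> = of_int (\<omega> 1)" unfolding \<tau>_def by simp
    then show ?thesis using omega_1_pos by (simp add: \<sigma>_def omega_0)
  qed
qed

section \<open>The degree\<close>

text \<open>A uniformizer t has order 1 and is a quotient of polynomials. Orders are given for
  polynomials only, each with a uniformizer of its own, so all of them are first expressed through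
  one t up to units.\<close>

lemma divisorial_value_one:
  assumes "divisorial_valuation \<nu>"
  obtains a b :: poly2 where "a \<noteq> 0" "b \<noteq> 0" "\<nu> (to_fract a) - \<nu> (to_fract b) = 1"
proof -
  obtain A P where A: "normal_affine_model A" "height_one_prime A P"
    and order: "\<And>f::poly2. f \<noteq> 0 \<Longrightarrow> has_vanishing_order A P (to_fract f) (\<nu> (to_fract f))"
    using assms unfolding divisorial_valuation_def by blast
  obtain S where S: "A = generated_algebra S" using A(1) unfolding normal_affine_model_def by blast
  have A_1: "1 \<in> A" unfolding S using generated_algebra.const[of 1 S] by simp
  have A_mult: "x * y \<in> A" if "x \<in> A" "y \<in> A" for x y using that unfolding S by (rule generated_algebra.mult)
  have prime: "prime_ideal_of A P" and P_0: "P \<noteq> {0}"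
    using A(2) unfolding height_one_prime_def by - (elim conjE, assumption)+
  have P: "P \<subseteq> A" "0 \<in> P" "1 \<notin> P" "\<forall>a\<in>A. \<forall>b\<in>A. a * b \<in> P \<longrightarrow> a \<in> P \<or> b \<in> P"
    using prime unfolding prime_ideal_of_def by - (elim conjE, assumption)+
  define R where "R = localization_at A P"
  define I where "I = {a / s | a s. a \<in> P \<and> s \<in> A - P}"
  have R_mult: "x * y \<in> R" if xy: "x \<in> R" "y \<in> R" for x y
  proof -
    obtain a s a' s' where *: "x = a / s" "a \<in> A" "s \<in> A - P" "y = a' / s'" "a' \<in> A" "s' \<in> A - P"
      using xy unfolding R_def localization_at_def by blast
    then have "s * s' \<in> A - P" using P(4) A_mult by blast
    moreover have "x * y = (a * a') / (s * s')" using * by simp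
    ultimately show ?thesis
      unfolding R_def localization_at_def using A_mult[OF *(2,5)] by blast
  qed
  have R_1: "1 \<in> R"
    unfolding R_def localization_at_def using A_1 P(3) by (auto intro!: exI[of _ 1])
  have I_R: "I \<subseteq> R" unfolding I_def R_def localization_at_def using P(1) by blast
  have I_1: "1 \<notin> I"
  proof
    assume "1 \<in> I"
    then obtain a s where as: "1 = a / s" "a \<in> P" "s \<in> A - P" unfolding I_def by blast
    then have "s \<noteq> 0" using P(2) by auto
    then show False using as by simp
  qed
  have unif: "uniformizer_at A P t \<longleftrightarrow> I = {t * h | h. h \<in> R}" for t
    unfolding uniformizer_at_def I_def R_def ..
  define U where "U x \<longleftrightarrow> x \<noteq> 0 \<and> x \<in> R \<and> inverse x \<in> R" for x
  have U_mult: "U (x * y)" if "U x" "U y" for x y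
    using that R_mult unfolding U_def by (simp add: mult.commute)
  have U_inverse: "U (inverse x)" if "U x" for x using that unfolding U_def by simp
  have U_power: "U (x ^ k)" if "U x" for x k
    by (induction k) (simp_all add: U_mult that, simp add: U_def R_1)
  have U_powi: "U (x powi k)" if "U x" for x k
    using that by (simp add: power_int_def U_power U_inverse del: inverse_eq_divide flip: power_inverse)
  have t_I: "t \<in> I" if "uniformizer_at A P t" for t
    using that R_1 unfolding unif by (auto intro!: exI[of _ 1])
  have t_0: "t \<noteq> 0" if t: "uniformizer_at A P t" for t
  proof -
    obtain a where a: "a \<in> P" "a \<noteq> 0" using P(2) P_0 by blast
    then have "a / 1 \<in> I" unfolding I_def using A_1 P(3) by blast
    then obtain h where "a = t * h" using t unfolding unif by auto
    then show ?thesis using a by auto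
  qed
  have t_unit: "\<exists>w. U w \<and> t' = t * w" if t: "uniformizer_at A P t" "uniformizer_at A P t'" for t t'
  proof -
    obtain h where h: "h \<in> R" "t' = t * h" using t_I[OF t(2)] t(1) unfolding unif by blast
    obtain h' where h': "h' \<in> R" "t = t' * h'" using t_I[OF t(1)] t(2) unfolding unif by blast
    have "t * (h * h') = t * 1" using h h' by (metis mult.assoc mult.right_neutral)
    then have "h * h' = 1" using mult_left_cancel[OF t_0[OF t(1)], of "h * h'" 1] by blast
    then have "h \<noteq> 0" "inverse h = h'" using inverse_unique by auto
    then have "U h" using h h' unfolding U_def by simp
    then show ?thesis using h by blast
  qed
  obtain t where t: "uniformizer_at A P t" using order[OF one_neq_zero] unfolding has_vanishing_order_def by blast
  have t_R: "t \<in> R" using t_I[OF t] I_R by blast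
  \<comment> \<open>If a positive power of t were a unit of the local ring, then 1 would lie in its
    maximal ideal I.\<close>
  have no_unit: "\<not> U (t ^ Suc k)" for k
  proof
    assume u: "U (t ^ Suc k)"
    have "t ^ k \<in> R" by (induction k) (simp_all add: R_1 R_mult t_R)
    then have "t ^ k * inverse (t ^ Suc k) \<in> R" using u R_mult unfolding U_def by blast
    then have "t * (t ^ k * inverse (t ^ Suc k)) \<in> I" using t unfolding unif by blast
    moreover have "t * (t ^ k * inverse (t ^ Suc k)) = 1"
      unfolding mult.assoc[symmetric] power_Suc[symmetric] by (rule right_inverse) (simp add: t_0[OF t])
    ultimately show False using I_1 by simp
  qed
  have no_unit_powi: "k = 0" if u: "U (t powi k)" for k
  proof (rule ccontr)
    assume k: "k \<noteq> 0"
    have "U (t ^ nat \<bar>k\<bar>)"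
    proof (cases "0 \<le> k")
      case True
      then show ?thesis using u by (simp add: power_int_def)
    next
      case False
      then show ?thesis using U_inverse[OF u] by (simp add: power_int_def power_inverse)
    qed
    moreover obtain l where "nat \<bar>k\<bar> = Suc l" using k by (cases "nat \<bar>k\<bar>") auto
    ultimately show False using no_unit by metis
  qed
  have val: "\<exists>w. U w \<and> to_fract f = t powi \<nu> (to_fract f) * w" if f: "f \<noteq> 0" for f :: poly2
  proof -
    obtain t' w where w: "uniformizer_at A P t'" "U w" "to_fract f = t' powi \<nu> (to_fract f) * w"
      using order[OF f] unfolding has_vanishing_order_def U_def R_def by blast
    obtain w' where w': "U w'" "t' = t * w'" using t_unit[OF t w(1)] by blast
    have "to_fract f = t powi \<nu> (to_fract f) * (w' powi \<nu> (to_fract f) * w)"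
      using w(3) unfolding w'(2) power_int_mult_distrib by (simp only: mult.assoc)
    then show ?thesis using U_mult[OF U_powi[OF w'(1)] w(2)] by blast
  qed
  obtain a b where ab: "b \<noteq> 0" "t = to_fract a / to_fract b" by (rule ratfun_cases)
  then have a0: "a \<noteq> 0" using t_0[OF t] by auto
  define i where "i = \<nu> (to_fract a)"
  define j where "j = \<nu> (to_fract b)"
  obtain w where w: "U w" "to_fract a = t powi i * w" using val[OF a0] unfolding i_def by blast
  obtain w' where w': "U w'" "to_fract b = t powi j * w'" using val[OF ab(1)] unfolding j_def by blast
  have "t * to_fract b = to_fract a" using ab by simp
  then have "t * t powi j * w' = t powi i * w" unfolding w w' by (simp only: mult.assoc)
  then have "t powi (i - j - 1) = w' * inverse w"
    using t_0[OF t] w(1) w'(1) unfolding U_def by (simp add: power_int_diff power_int_add field_simps)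
  then have "U (t powi (i - j - 1))" using U_mult[OF w'(1) U_inverse[OF w(1)]] by simp
  then have "i - j = 1" using no_unit_powi by fastforce
  then show ?thesis using that[OF a0 ab(1)] by (simp add: i_def j_def)
qed

context key_data
begin

text \<open>For n = 0 the standard monomials are the powers of y, so a monomial of maximal total
  degree bounds \<delta> f from below without cancellation.\<close>

lemma weighted_total_degree:
  assumes n: "n = 0" and eq: "\<delta> Y = \<delta> X" and f: "f \<noteq> 0"
  shows "\<delta> (to_fract f) = int (total_degree f) * \<delta> X"
proof (rule antisym)
  have "le (to_fract f) (int (total_degree f) * \<delta> X)"
    unfolding ev2_XY[symmetric] ev2_supp
  proof (rule le_sum)
    fix z assume z: "z \<in> supp f"
    have "fst z + snd z \<le> total_degree f" using z by (intro total_degree_ge) (simp add: mem_supp)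
    then have "(int (fst z) + int (snd z)) * \<delta> X \<le> int (total_degree f) * \<delta> X"
      using X_pos by (intro mult_right_mono) auto
    moreover have "le (cst (cf f z) * (X ^ fst z * Y ^ snd z)) (int (fst z) * \<delta> X + int (snd z) * \<delta> X)"
      using eq by (intro le_cst_mult le_mult le_power) (simp_all add: le_def)
    ultimately show "le (cst (cf f z) * X ^ fst z * Y ^ snd z) (int (total_degree f) * \<delta> X)"
      by (auto simp: mult.assoc distrib_right intro: le_mono)
  qed
  then show "\<delta> (to_fract f) \<le> int (total_degree f) * \<delta> X" using leD f by simp
next
  have yd: "yd (n + 1) = 1" "\<omega> (n + 1) = \<delta> X" "g (n + 1) = Y"
    using n yd_1 omega_1_Y eq g_1 by simp_all
  have m: "m k = Y ^ k" "w k = int k * \<delta> X" for k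
    by (rule last_power[of k, unfolded yd mult_1_right])+
  have sum: "to_fract f = (\<Sum>k<Suc (degree f). evx X (coeff f k) * m k)"
    unfolding ev2_XY[symmetric] ev2_altdef m lessThan_Suc_atMost ..
  obtain i j where ij: "coeff (coeff f j) i \<noteq> 0" "i + j = total_degree f"
    using total_degree_attained[OF f] .
  have cj: "coeff f j \<noteq> 0" using ij(1) by auto
  then have j: "j < Suc (degree f)" by (simp add: le_degree less_Suc_eq_le)
  have ex: "evx X (coeff f j) \<noteq> 0" using cj by (simp add: evx_X)
  have "\<delta> (evx X (coeff f j)) + w j \<le> \<delta> (to_fract f)"
    unfolding sum by (rule expansion_value(2)[of "Suc (degree f)" "\<lambda>k. evx X (coeff f k)" j, OF _ j ex]) simp
  moreover have "int i * \<delta> X \<le> int (degree (coeff f j)) * \<delta> X"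
    using le_degree[OF ij(1)] X_pos by (intro mult_right_mono) auto
  ultimately show "int (total_degree f) * \<delta> X \<le> \<delta> (to_fract f)"
    unfolding evx_X_value[OF cj] m ij(2)[symmetric] by (simp add: distrib_right)
qed

text \<open>\<delta> is \<open>\<delta> X\<close> times deg on polynomials, and two of its values
  differ by 1; hence \<open>\<delta> X = 1\<close>, and the skewness is 1 by definition.\<close>

lemma degree_criterion:
  assumes n: "n = 0" and eq: "\<delta> Y = \<delta> X" and div: "divisorial_valuation (\<lambda>h. - \<delta> h)"
  shows "skewness_criterion \<delta> n g"
proof -
  note td = weighted_total_degree[OF n eq]
  obtain a b where "a \<noteq> 0" "b \<noteq> 0" "- \<delta> (to_fract a) - - \<delta> (to_fract b) = 1"
    using divisorial_value_one[OF div] .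
  then have "1 = (int (total_degree b) - int (total_degree a)) * \<delta> X"
    by (simp add: td left_diff_distrib)
  then have "\<delta> X dvd 1" by (metis dvd_triv_right)
  then have X1: "\<delta> X = 1" using X_pos by simp
  have deg: "\<delta> (to_fract f) = int (total_degree f)" if "f \<noteq> 0" for f using td[OF that] X1 by simp
  have gn: "g (n + 1) = Y" using n g_1 by simp
  have d: "dmax \<delta> = 1" using X1 eq by (simp add: dmax_def)
  have polys: "g k \<in> polys" if "k \<le> n + 1" for k
  proof -
    have "k = 0 \<or> k = n + 1" using that n by linarith
    then show ?thesis using g_0 gn by (auto simp: polys_def X_def Y_def)
  qed
  show ?thesis
  proof (rule criterion[of 1])
    show "0 < dmax \<delta>" using d by simp
    have "is_degree \<delta>" unfolding is_degree_def using deg by blast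
    then show "skewness \<delta> = ereal (1 / of_int (dmax \<delta>))" unfolding skewness_def d by (simp add: one_ereal_def)
    show "1 * real (total_degree f) \<le> of_int (\<delta> (to_fract f))" if "f \<noteq> 0" for f using deg[OF that] by simp
    show "g k \<in> polys" if "k \<le> n + 1" for k using that by (rule polys)
    show "\<exists>f. f \<noteq> 0 \<and> 0 < total_degree f \<and> of_int (\<delta> (to_fract f)) \<le> (1 + \<epsilon>) * real (total_degree f)"
      if "g (n + 1) \<notin> polys" for \<epsilon> using that polys by blast
    show "\<exists>\<epsilon>>0. \<forall>f. f \<noteq> 0 \<and> (\<tau> / 2) * real (degree f) \<le> of_int (\<delta> (to_fract f)) \<longrightarrow>
      (1 + \<epsilon>) * real (total_degree f) \<le> of_int (\<delta> (to_fract f))" if "\<tau> < 0"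
    proof -
      have "yd (n + 1) = 1" "\<omega> (n + 1) = 1" using n yd_1 X1 eq omega_1_Y by simp_all
      then have "\<tau> = 1" unfolding \<tau>_def by simp
      then show ?thesis using that by simp
    qed
    show "f \<noteq> 0 \<and> 0 < total_degree f \<and> of_int (\<delta> (to_fract f)) = 1 * real (total_degree f)"
      if "to_fract f = g (n + 1)" for f
    proof -
      have "f = [:0, 1:]" using that unfolding gn Y_def by simp
      then show ?thesis using deg[of f] total_degree_coordinate[of f] by simp
    qed
  qed (use eq in simp)
qed

end

section \<open>Key forms\<close>

lemma key_forms_key_data:
  assumes "semidegree \<delta>" and kf: "key_forms \<delta> n g"
  obtains \<alpha> b0 \<beta> \<theta> where "key_data \<delta> n g \<alpha> b0 \<beta> \<theta>" "1 \<le> n \<Longrightarrow> \<delta> Y = \<delta> X \<Longrightarrow> \<alpha> 1 = 1"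
proof -
  interpret semidegree \<delta> by fact
  define \<omega> where "\<omega> j = \<delta> (g j)" for j
  define \<alpha> where "\<alpha> = key_alpha \<omega>"
  have g: "g 0 = X" "g 1 = Y" using kf unfolding key_forms_def Let_def by blast+
  obtain \<beta> :: "nat \<Rightarrow> nat \<Rightarrow> int" and \<theta> where b: "\<forall>j\<in>{1..n}. \<omega> (j + 1) < int (\<alpha> j) * \<omega> j \<and>
          int (\<alpha> j) * \<omega> j = (\<Sum>i<j. \<beta> j i * \<omega> i) \<and>
          (\<forall>i. 1 \<le> i \<and> i < j \<longrightarrow> 0 \<le> \<beta> j i \<and> \<beta> j i < int (\<alpha> i)) \<and>
          \<theta> j \<noteq> 0 \<and>
          g (j + 1) = g j ^ \<alpha> j - cst (\<theta> j) * (\<Prod>i<j. g i powi \<beta> j i)"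
    using kf unfolding key_forms_def Let_def \<alpha>_def \<omega>_def by blast
  have repr: "\<exists>G\<in>mixed_laurent n. eval_at g n G = h \<and> weighted_degree (\<lambda>j. \<delta> (g j)) n G = \<delta> h"
    if "h \<in> laurent_polys" "h \<noteq> 0" for h
    using kf that unfolding key_forms_def Let_def by blast
  have split: "{..<j} = insert 0 {1..<j}" if "1 \<le> j" for j :: nat using that by auto
  have alpha: "1 \<le> \<alpha> j" if "1 \<le> j" for j
  proof -
    \<comment> \<open>The multiple by the positive integer \<omega> 0 always lies in the group
      generated by \<omega> 0, so the least exponent exists and is positive.\<close>
    have "int (nat (\<omega> 0)) * \<omega> j = (\<Sum>i<j. (if i = 0 then \<omega> j else 0) * \<omega> i)"
      unfolding split[OF that] using X_pos by (simp add: \<omega>_def g(1))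
    then have "\<exists>a. a > 0 \<and> (\<exists>m::nat \<Rightarrow> int. int a * \<omega> j = (\<Sum>i<j. m i * \<omega> i))"
      using X_pos by (intro exI[of _ "nat (\<omega> 0)"] conjI exI[of _ "\<lambda>i. if i = 0 then \<omega> j else 0"])
        (simp_all add: \<omega>_def g(1))
    from LeastI_ex[OF this] show ?thesis unfolding \<alpha>_def key_alpha_def by simp
  qed
  have alpha_1: "\<alpha> 1 = 1" if "\<delta> Y = \<delta> X"
  proof -
    have "\<alpha> 1 \<le> 1"
      unfolding \<alpha>_def key_alpha_def
      by (rule Least_le) (use that in \<open>auto intro!: exI[of _ "\<lambda>_. 1"] simp: \<omega>_def g(1) g(2)[simplified]\<close>)
    then show ?thesis using alpha[of 1] by simp
  qed
  have "key_data \<delta> n g \<alpha> (\<lambda>j. \<beta> j 0) (\<lambda>j i. nat (\<beta> j i)) \<theta>"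
  proof
    show "g 0 = X" "g 1 = Y" by fact+
    show "1 \<le> \<alpha> j" if "1 \<le> j" for j by (rule alpha[OF that])
    fix j
    show "nat (\<beta> j i) < \<alpha> i" if "j \<le> n" "1 \<le> i" "i < j" for i
      using bspec[OF b, of j] that by (auto simp: nat_less_iff)
    assume j: "1 \<le> j" "j \<le> n"
    then have "j \<in> {1..n}" by simp
    note bj = bspec[OF b this]
    show "\<delta> (g (j + 1)) < int (\<alpha> j) * \<delta> (g j)" using bj unfolding \<omega>_def by blast
    show "\<theta> j \<noteq> 0" using bj by blast
    have nn: "0 \<le> \<beta> j i" if "i \<in> {1..<j}" for i using bj that by simp
    have "int (\<alpha> j) * \<delta> (g j) = (\<Sum>i<j. \<beta> j i * \<delta> (g i))" using bj unfolding \<omega>_def by blast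
    also have "\<dots> = \<beta> j 0 * \<delta> X + (\<Sum>i=1..<j. \<beta> j i * \<delta> (g i))"
      unfolding split[OF j(1)] by (subst sum.insert) (simp_all add: g(1))
    also have "(\<Sum>i=1..<j. \<beta> j i * \<delta> (g i)) = (\<Sum>i=1..<j. int (nat (\<beta> j i)) * \<delta> (g i))"
      using nn by (intro sum.cong refl) simp
    finally show "int (\<alpha> j) * \<delta> (g j) = \<beta> j 0 * \<delta> X + (\<Sum>i=1..<j. int (nat (\<beta> j i)) * \<delta> (g i))" .
    have "(\<Prod>i<j. g i powi \<beta> j i) = X powi \<beta> j 0 * (\<Prod>i=1..<j. g i powi \<beta> j i)"
      unfolding split[OF j(1)] by (subst prod.insert) (simp_all add: g(1))
    also have "(\<Prod>i=1..<j. g i powi \<beta> j i) = (\<Prod>i=1..<j. g i ^ nat (\<beta> j i))"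
      using nn by (intro prod.cong refl) (simp add: power_int_def)
    finally show "g (j + 1) = g j ^ \<alpha> j - cst (\<theta> j) * X powi \<beta> j 0 * (\<Prod>i=1..<j. g i ^ nat (\<beta> j i))"
      using bj by (simp only: mult.assoc)
  qed (rule repr)
  then show ?thesis using that alpha_1 by blast
qed

text \<open>If \<open>\<omega> 1 < r * q\<close>, the tail of the first recursion disappears at X =
  0, and c = 0 gives pure powers. Otherwise \<open>\<alpha> 1 = 1\<close>, and the shift by
  \<open>\<theta> 1\<close> cancels the constant tail in \<open>\<kappa>\<close>.\<close>

lemma (in key_subst) nu_eq_monom:
  assumes "if \<omega> 1 < r * int q then c = 0 else 1 \<le> n \<and> \<alpha> 1 = 1 \<and> c = \<theta> 1"
  shows "nu k = monom 1 k"
proof -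
  have X: "[:0, 1:] ^ k = (monom 1 k :: complex poly)" for k by (simp add: monom_altdef)
  show ?thesis
  proof (cases "\<omega> 1 < r * int q")
    case True
    then have c: "c = 0" using assms by simp
    show ?thesis
    proof (cases "n = 0")
      case True
      then show ?thesis unfolding nu_def by (simp add: c X)
    next
      case False
      then have n: "1 \<le> n" by simp
      have "0 < int (\<alpha> 1) * (r * int q - \<omega> 1)" using True alpha_pos[of 1] n by simp
      then have "0 < r * ex 1" by (simp only: ex_1[OF n])
      then have "ex 1 \<noteq> 0" by auto
      then have kappa: "\<kappa> = [:0, 1:] ^ \<alpha> 1" unfolding \<kappa>_def by (simp only: c if_False diff_zero)
      have "nu k = [:0, 1:] ^ (k mod \<alpha> 1 + \<alpha> 1 * (k div \<alpha> 1))"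
        unfolding nu_def kappa unfolding c power_add power_mult if_not_P[OF False] ..
      then show ?thesis by (simp add: X)
    qed
  next
    case False
    then have *: "1 \<le> n" "\<alpha> 1 = 1" "c = \<theta> 1" using assms by simp_all
    have "r * ex 1 = 0" using ex_1[OF *(1)] False rq by simp
    then have "ex 1 = 0" using r_pos by simp
    then have kappa: "\<kappa> = [:0, 1:]" unfolding \<kappa>_def unfolding *(2,3) by simp
    have "n \<noteq> 0" using *(1) by simp
    then have "nu k = [:0, 1:] ^ k" unfolding nu_def kappa unfolding *(2) by simp
    then show ?thesis by (simp only: X)
  qed
qed

text \<open>Comparing \<open>\<delta> X\<close> with \<open>\<delta> Y\<close> locates the center:
  [0:1:0] if x dominates, [0:0:1] if y does. If they are equal, the first recursion either exists
  and singles out the slope \<open>\<theta> 1\<close>, or is absent and \<delta> is deg.\<close>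

lemma (in key_data) key_criterion:
  assumes div: "divisorial_valuation (\<lambda>h. - \<delta> h)" and a1: "1 \<le> n \<Longrightarrow> \<delta> Y = \<delta> X \<Longrightarrow> \<alpha> 1 = 1"
  shows "skewness_criterion \<delta> n g"
proof -
  have o0: "\<omega> 0 = \<delta> X" and o1: "\<omega> 1 = \<delta> Y" by (rule omega_0, rule omega_1_Y)
  consider (less) "\<delta> Y < \<delta> X" | (eq) "\<delta> Y = \<delta> X" "1 \<le> n" | (deg) "\<delta> Y = \<delta> X" "n = 0" | (greater) "\<delta> X < \<delta> Y"
    by linarith
  then show ?thesis
  proof cases
    case less
    interpret key_subst \<delta> n g \<alpha> b0 \<beta> \<theta> 1 1 "\<delta> X" 0
      by unfold_locales (use less o0 o1 X_pos in simp_all)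
    interpret horizontal \<delta> n g \<alpha> b0 \<beta> \<theta> 1 1 "\<delta> X" 0
      by unfold_locales (rule refl, rule nu_eq_monom, use less o0 o1 in simp_all)
    show ?thesis
    proof (rule horizontal_criterion)
      show "\<delta> v < 0" unfolding v_def using less by (simp add: mult inverse)
    qed (use less o0 o1 in simp)
  next
    case eq
    have a: "\<alpha> 1 = 1" by (rule a1) fact+
    interpret key_subst \<delta> n g \<alpha> b0 \<beta> \<theta> 1 1 "\<delta> X" "\<theta> 1"
      by unfold_locales (use eq o0 o1 X_pos in simp_all)
    interpret horizontal \<delta> n g \<alpha> b0 \<beta> \<theta> 1 1 "\<delta> X" "\<theta> 1"
      by unfold_locales (rule refl, rule nu_eq_monom, use eq o0 o1 a in simp_all)
    show ?thesis
    proof (rule horizontal_criterion)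
      show "\<omega> 1 = \<omega> 0 \<longrightarrow> \<theta> 1 \<noteq> 0" using theta_nonzero[of 1] eq by simp
      \<comment> \<open>The first recursion reads \<open>g 2 = Y - \<theta> 1 * X\<close> up to the
        embedding of constants, so v is g 2 / X, and (P1) puts the value of \<open>g 2\<close> below
        that of x.\<close>
      have "\<delta> X = b0 1 * \<delta> X" using key_eq[of 1] eq a g_1 by simp
      then have b: "b0 1 = 1" using X_pos by simp
      have g2: "g 2 = Y - cst (\<theta> 1) * X"
        using key_rec[of 1] eq(2) unfolding a b g_1 by (simp add: numeral_2_eq_2)
      have v: "v = g 2 * inverse X"
        unfolding g2 v_def by (simp add: left_diff_distrib)
      have "g 2 \<noteq> 0" by (rule g_nonzero) (use eq(2) in simp)
      moreover have "\<delta> (g 2) < \<delta> X" using key_less[of 1] eq unfolding a g_1 by (simp add: numeral_2_eq_2)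
      ultimately show "\<delta> v < 0" unfolding v by (simp add: mult inverse)
    qed
  next
    case deg
    then show ?thesis using div by (intro degree_criterion)
  next
    case greater
    interpret vertical \<delta> n g \<alpha> b0 \<beta> \<theta> "nat (\<delta> X)" "nat (\<delta> Y)" 1 0
      by unfold_locales (use greater o0 o1 X_pos in simp_all)
    show ?thesis by (rule vertical_criterion)
  qed
qed

theorem theorem1p7:
  fixes \<delta> :: "ratfun \<Rightarrow> int" and g :: "nat \<Rightarrow> ratfun" and n :: nat
  assumes "divisorial_semidegree_on_polys \<delta>"
    and "\<delta> X > 0"
    and "key_forms \<delta> n g"
  shows
    "(skewness_is_inf \<delta> \<longleftrightarrow>
        \<delta> (g (n + 1)) \<ge> 0 \<or> (\<delta> (g (n + 1)) < 0 \<and> (\<forall>k\<le>n+1. g k \<in> polys))) \<and>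
     (skewness_is_inf \<delta> \<longleftrightarrow>
        \<delta> (g (n + 1)) \<ge> 0 \<or> (\<delta> (g (n + 1)) < 0 \<and> g (n + 1) \<in> polys)) \<and>
     (skewness_is_min \<delta> \<longleftrightarrow> g (n + 1) \<in> polys) \<and>
     (g (n + 1) \<in> polys \<longleftrightarrow> (\<forall>k\<le>n+1. g k \<in> polys)) \<and>
     (skewness_is_min \<delta> \<longrightarrow>
        (if n = 0 \<and> \<delta> X < \<delta> Y then inf_attained_at \<delta> (g 0)
         else inf_attained_at \<delta> (g (n + 1))))"
proof -
  have div: "divisorial_valuation (\<lambda>h. - \<delta> h)"
    using assms(1) unfolding divisorial_semidegree_on_polys_def by blast
  then have val: "discrete_valuation (\<lambda>h. - \<delta> h)" unfolding divisorial_valuation_def by blast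
  have semi: "semidegree \<delta>"
  proof
    fix f h :: ratfun assume nz: "f \<noteq> 0" "h \<noteq> 0"
    then have "- \<delta> (f * h) = - \<delta> f + - \<delta> h" using val unfolding discrete_valuation_def by blast
    then show "\<delta> (f * h) = \<delta> f + \<delta> h" by simp
    assume "f + h \<noteq> 0"
    then have "min (- \<delta> f) (- \<delta> h) \<le> - \<delta> (f + h)" using val nz unfolding discrete_valuation_def by blast
    then show "\<delta> (f + h) \<le> max (\<delta> f) (\<delta> h)" by linarith
  qed fact
  obtain \<alpha> b0 \<beta> \<theta> where kd: "key_data \<delta> n g \<alpha> b0 \<beta> \<theta>" and a1: "1 \<le> n \<Longrightarrow> \<delta> Y = \<delta> X \<Longrightarrow> \<alpha> 1 = 1"
    by (rule key_forms_key_data[OF semi assms(3)]) (rule that)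
  interpret key_data \<delta> n g \<alpha> b0 \<beta> \<theta> by (rule kd)
  show ?thesis by (rule key_criterion[OF div a1])
qed

end
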